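(* Let $\Omega\subseteq\mathbb{R}^n$ be open and bounded with Lipschitz boundary, let $1<p\le1+\frac1n$, $p'=\frac p{p-1}$. Let $\mathcal{E}_{\mathrm{Per}}:L^p(\Omega)\to\mathbb{R}$ be locally Lipschitz continuous and even, and assume there is a constant $C_{\mathrm{Per}}>0$ such that for all $v\in L^p(\Omega)$ one has $|\mathcal{E}_{\mathrm{Per}}(v)|\le C_{\mathrm{Per}}\|v\|_p^p$ and $\|v^*\|_{p'}\le p\,C_{\mathrm{Per}}\|v\|_p^{p-1}$ for all $v^*\in\partial\mathcal{E}_{\mathrm{Per}}(v)$. For $\alpha>0$ with $\alpha^{n-(n-1)p}<C_{\mathrm{Per}}^{-1}C_{\mathrm{BV}}^{-(p-1)n}$ and $k\in\mathbb{N}$, $k\ge1$, let $$c_{k,\alpha}:=\inf_{S\in\mathscr{S}^\alpha_k}\sup_{v\in S}\big(\mathcal{E}_{TV}(v)+\mathcal{E}_{\mathrm{Per}}(v)\big),$$ $$\mathscr{S}^\alpha_k:=\{S\subseteq L^p(\Omega)\text{ compact, symmetric}\;;\;\|v\|_1=\alpha\text{ for all }v\in S,\ \operatorname{gen}_{L^p}S\ge k\},$$ let $u_{k,\alpha}$ be an eigenfunction of the perturbed problem with parameter $\alpha$ with critical value $c_{k,\alpha}$, and let $\lambda_{k,\alpha}$ be an eigenvalue corresponding to $u_{k,\alpha}$. Let $$\lambda_{k,1}:=\inf_{S}\sup_{v\in S}\mathcal{E}_{TV}(v),$$ where the infimum is over all compact symmetric $S\subseteq L^1(\Omega)$ with $\|v\|_1=1$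 for all $v\in S$ and $\operatorname{gen}_{L^1}S\ge k$. Then $$\lim_{\alpha\to0}\frac{c_{k,\alpha}}{\alpha}=\lim_{\alpha\to0}\lambda_{k,\alpha}=\lambda_{k,1}\qquad\text{for all }k\ge1,$$ and hence each $\lambda_{k,1}$ is a bifurcation value of the perturbed problem.
   Context: If $n=1$, $\frac{n}{n-1}$ is read as $\infty$. $C_{\mathrm{BV}}$ is the optimal constant in $\|v\|_{\frac{n}{n-1}}\le C_{\mathrm{BV}}\|Dv\|_1$ for all $v\in W^{1,1}_0(\Omega)$. $\mathcal{E}_{TV}(v)=\int_\Omega d|Dv|+\int_{\partial\Omega}|v|\,d\mathcal{H}^{n-1}$ (boundary trace) for $v\in BV(\Omega)$ and $\mathcal{E}_{TV}(v)=\infty$ for $v\notin BV(\Omega)$ (used on both $L^p(\Omega)$ and $L^1(\Omega)$). $\partial\mathcal{E}_{\mathrm{Per}}(v)$ is Clarke's generalized gradient, a subset of $L^p(\Omega)^*=L^{p'}(\Omega)$. Weak slope. For a metric space $(M,d)$ and continuous $F:M\to\mathbb{R}$, $|dF|(u)\in[0,\infty]$ is the supremum of all $\sigma\in[0,\infty)$ for which there are $\delta>0$ and a continuous $\eta:B_\delta(u)\times[0,\delta]\to M$ ($B_\delta(u)$ the open ball in $M$) with $d(\eta(v,t),v)\le t$ and $F(\eta(v,t))\le F(v)-\sigma t$ for all $(v,t)\in B_\delta(u)\times[0,\delta]$. For lower semicontinuous $F:M\to\mathbb{R}\cup\{\infty\}$ let $\operatorname{epi}(F)=\{(v,t)\in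 M\times\mathbb{R}: F(v)\le t\}$ with metric $\sqrt{d(v_1,v_2)^2+(t_1-t_2)^2}$, let $\mathscr{G}_F:\operatorname{epi}(F)\to\mathbb{R}$, $\mathscr{G}_F(v,t)=t$ (continuous), and for $F(u)<\infty$ set $|dF|(u)=\frac{|d\mathscr{G}_F|(u,F(u))}{\sqrt{1-|d\mathscr{G}_F|(u,F(u))^2}}$ if $|d\mathscr{G}_F|(u,F(u))<1$ and $|dF|(u)=\infty$ if $|d\mathscr{G}_F|(u,F(u))=1$. A point $u$ with $F(u)<\infty$ is critical if $|dF|(u)=0$; then $F(u)$ is its critical value. An eigenfunction of the perturbed problem with parameter $\alpha>0$ is a critical point $u$ of $\mathcal{E}_{TV}+\mathcal{E}_{\mathrm{Per}}+I_{\{\|\cdot\|_1=\alpha\}}$ on the metric space $L^p(\Omega)$ ($I_A$ is $0$ on $A$, $\infty$ off $A$). A number $\lambda\in\mathbb{R}$ is an eigenvalue corresponding to $u$ if there are $s\in L^\infty(\Omega)$ with $s(x)\in\operatorname{Sgn}(u(x))$ a.e., $z\in L^\infty(\Omega,\mathbb{R}^n)$ with $\operatorname{div}z\in L^{p'}(\Omega)$, $\|z\|_\infty=1$, $\mathcal{E}_{TV}(u)=-\int_\Omega u\operatorname{div}z\,dx$, and $u^*\in\partial\mathcal{E}_{\mathrm{Per}}(u)$ such that $-\operatorname{div}z+u^*=\lambda s$ on $\Omega$. Under the present hypotheses eigenfunctions $u_{k,\alpha}$ with critical value $c_{k,\alpha}$ and corresponding eigenvalues exist. Here $\operatorname{Sgn}(t)=\{1\}$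 for $t>0$, $[-1,1]$ for $t=0$, $\{-1\}$ for $t<0$; $\operatorname{div}$ is distributional and $\|z\|_\infty=\operatorname{ess\,sup}|z(x)|$. Genus: for symmetric $S\subseteq X\setminus\{0\}$ in a Banach space $X$, $\operatorname{gen}_XS$ is the least integer $k$ such that an odd continuous map $S\to\mathbb{R}^k\setminus\{0\}$ exists, and $\infty$ if there is none. The numbers $\lambda_{k,1}$ are the minimax eigenvalues of the unperturbed $1$-Laplace operator. That $\lambda$ is a bifurcation value means that $(\lambda,0)$ is a limit in $\mathbb{R}\times L^p(\Omega)$ of pairs $(\lambda_j,u_j)$ with $u_j\ne0$ an eigenfunction of the perturbed problem (with parameter $\|u_j\|_1$) and $\lambda_j$ a corresponding eigenvalue. *)

theory Defs
  imports "HOL-Analysis.Analysis" "HOL-Probability.Essential_Supremum"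
begin

section \<open>Lebesgue spaces\<close>

text \<open>
  Lebesgue measurable functions modulo almost everywhere equality. The space \<open>L\<^sup>q(\<Omega>)\<close> is
  realised inside this vector space as the set of classes that vanish almost everywhere outside
  \<open>\<Omega>\<close>, i.e. functions on \<open>\<Omega>\<close> are extended by zero. This puts all the spaces \<open>L\<^sup>q(\<Omega>)\<close> into one type.
\<close>

definition ae_eq :: "('a::euclidean_space \<Rightarrow> real) \<Rightarrow> ('a \<Rightarrow> real) \<Rightarrow> bool" where
  "ae_eq f g \<longleftrightarrow> f \<in> borel_measurable lebesgue \<and> g \<in> borel_measurable lebesgue \<and>
     (AE x in lebesgue. f x = g x)"

quotient_type (overloaded) 'a L0 = "'a::euclidean_space \<Rightarrow> real" / partial: ae_eq
proof (rule part_equivpI)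
  show "\<exists>f. ae_eq f (f :: 'a \<Rightarrow> real)"
    by (rule exI[of _ "\<lambda>_. 0"]) (simp add: ae_eq_def)
  show "symp (ae_eq :: ('a \<Rightarrow> real) \<Rightarrow> _)"
    by (rule sympI) (auto simp: ae_eq_def)
  show "transp (ae_eq :: ('a \<Rightarrow> real) \<Rightarrow> _)"
    by (rule transpI) (auto simp: ae_eq_def)
qed

instantiation L0 :: (euclidean_space) real_vector
begin

lift_definition zero_L0 :: "'a L0" is "\<lambda>_. 0"
  by (simp add: ae_eq_def)

lift_definition plus_L0 :: "'a L0 \<Rightarrow> 'a L0 \<Rightarrow> 'a L0" is "\<lambda>f g x. f x + g x"
  by (auto simp: ae_eq_def elim: eventually_elim2)

lift_definition minus_L0 :: "'a L0 \<Rightarrow> 'a L0 \<Rightarrow> 'a L0" is "\<lambda>f g x. f x - g x"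
  by (auto simp: ae_eq_def elim: eventually_elim2)

lift_definition uminus_L0 :: "'a L0 \<Rightarrow> 'a L0" is "\<lambda>f x. - f x"
  by (auto simp: ae_eq_def)

lift_definition scaleR_L0 :: "real \<Rightarrow> 'a L0 \<Rightarrow> 'a L0" is "\<lambda>c f x. c * f x"
  by (auto simp: ae_eq_def)

instance
  by standard (transfer, auto simp: ae_eq_def algebra_simps)+

end

definition ess_norm :: "'a::euclidean_space L0 \<Rightarrow> ereal" where
  "ess_norm v = esssup lebesgue (\<lambda>x. ereal \<bar>rep_L0 v x\<bar>)"

definition Lp :: "'a::euclidean_space set \<Rightarrow> ereal \<Rightarrow> 'a L0 set" where
  "Lp \<Omega> q = {v. (AE x in lebesgue. x \<notin> \<Omega> \<longrightarrow> rep_L0 v x = 0) \<and>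
     (if q = \<infinity> then ess_norm v < \<infinity>
      else integrable lebesgue (\<lambda>x. \<bar>rep_L0 v x\<bar> powr real_of_ereal q))}"

definition Lnorm :: "ereal \<Rightarrow> 'a::euclidean_space L0 \<Rightarrow> real" where
  "Lnorm q v =
     (if q = \<infinity> then real_of_ereal (ess_norm v)
      else (\<integral>x. \<bar>rep_L0 v x\<bar> powr real_of_ereal q \<partial>lebesgue) powr (1 / real_of_ereal q))"

definition Ldist :: "ereal \<Rightarrow> 'a::euclidean_space L0 \<Rightarrow> 'a L0 \<Rightarrow> real" where
  "Ldist q v w = Lnorm q (v - w)"

abbreviation Ltop :: "'a::euclidean_space set \<Rightarrow> ereal \<Rightarrow> 'a L0 topology" where
  "Ltop \<Omega> q \<equiv> Metric_space.mtopology (Lp \<Omega> q) (Ldist q)"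

definition pairing :: "'a::euclidean_space L0 \<Rightarrow> 'a L0 \<Rightarrow> real" where
  "pairing w v = (\<integral>x. rep_L0 w x * rep_L0 v x \<partial>lebesgue)"


section \<open>Test functions, distributional divergence and Sobolev functions\<close>

definition partial :: "'a::euclidean_space \<Rightarrow> ('a \<Rightarrow> real) \<Rightarrow> 'a \<Rightarrow> real" where
  "partial b f x = frechet_derivative f (at x) b"

definition grad :: "('a::euclidean_space \<Rightarrow> real) \<Rightarrow> 'a \<Rightarrow> 'a" where
  "grad f x = (\<Sum>b\<in>Basis. partial b f x *\<^sub>R b)"

definition divergence :: "('a::euclidean_space \<Rightarrow> 'a) \<Rightarrow> 'a \<Rightarrow> real" where
  "divergence \<phi> x = (\<Sum>b\<in>Basis. partial b (\<lambda>y. \<phi> y \<bullet> b) x)"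

fun C_k :: "nat \<Rightarrow> ('a::euclidean_space \<Rightarrow> real) \<Rightarrow> bool" where
  "C_k 0 f \<longleftrightarrow> continuous_on UNIV f"
| "C_k (Suc k) f \<longleftrightarrow> (\<forall>x. f differentiable (at x)) \<and> (\<forall>b\<in>Basis. C_k k (partial b f))"

definition test_functions :: "'a::euclidean_space set \<Rightarrow> ('a \<Rightarrow> real) set" where
  "test_functions \<Omega> = {\<phi>. (\<forall>k. C_k k \<phi>) \<and> compact (closure {x. \<phi> x \<noteq> 0}) \<and>
     closure {x. \<phi> x \<noteq> 0} \<subseteq> \<Omega>}"

definition test_fields :: "'a::euclidean_space set \<Rightarrow> ('a \<Rightarrow> 'a) set" where
  "test_fields \<Omega> = {\<phi>. \<forall>b\<in>Basis. (\<lambda>x. \<phi> x \<bullet> b) \<in> test_functions \<Omega>}"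

definition weak_divergence ::
  "'a::euclidean_space set \<Rightarrow> ('a \<Rightarrow> 'a) \<Rightarrow> 'a L0 \<Rightarrow> bool" where
  "weak_divergence \<Omega> z w \<longleftrightarrow> (\<forall>\<phi>\<in>test_functions \<Omega>.
     (\<integral>x. z x \<bullet> grad \<phi> x \<partial>lebesgue_on \<Omega>) = - (\<integral>x. rep_L0 w x * \<phi> x \<partial>lebesgue_on \<Omega>))"

definition weak_gradient ::
  "'a::euclidean_space set \<Rightarrow> 'a L0 \<Rightarrow> ('a \<Rightarrow> 'a) \<Rightarrow> bool" where
  "weak_gradient \<Omega> v g \<longleftrightarrow> (\<forall>\<phi>\<in>test_functions \<Omega>. \<forall>b\<in>Basis.
     (\<integral>x. rep_L0 v x * partial b \<phi> x \<partial>lebesgue_on \<Omega>) = - (\<integral>x. (g x \<bullet> b) * \<phi> x \<partial>lebesgue_on \<Omega>))"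

text \<open>
  \<open>v \<in> W\<^sub>0\<^sup>1\<^sup>,\<^sup>1(\<Omega>)\<close> with weak gradient \<open>g\<close>: the closure of the test functions in
  \<open>W\<^sup>1\<^sup>,\<^sup>1(\<Omega>)\<close>.
\<close>

definition W0_11 :: "'a::euclidean_space set \<Rightarrow> 'a L0 \<Rightarrow> ('a \<Rightarrow> 'a) \<Rightarrow> bool" where
  "W0_11 \<Omega> v g \<longleftrightarrow> v \<in> Lp \<Omega> 1 \<and> integrable (lebesgue_on \<Omega>) g \<and> weak_gradient \<Omega> v g \<and>
     (\<exists>\<phi>. (\<forall>j::nat. \<phi> j \<in> test_functions \<Omega>) \<and>
       ((\<lambda>j. \<integral>x. \<bar>\<phi> j x - rep_L0 v x\<bar> \<partial>lebesgue_on \<Omega>) \<longlonglongrightarrow> 0) \<and>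
       ((\<lambda>j. \<integral>x. norm (grad (\<phi> j) x - g x) \<partial>lebesgue_on \<Omega>) \<longlonglongrightarrow> 0))"

definition sobolev_exponent :: "nat \<Rightarrow> ereal" where
  "sobolev_exponent n = (if n = 1 then \<infinity> else ereal (real n / (real n - 1)))"

text \<open>The optimal constant in \<open>\<parallel>v\<parallel>\<^bsub>n/(n-1)\<^esub> \<le> C \<parallel>Dv\<parallel>\<^sub>1\<close> on \<open>W\<^sub>0\<^sup>1\<^sup>,\<^sup>1(\<Omega>)\<close>.\<close>

definition C_BV :: "'a::euclidean_space set \<Rightarrow> real" where
  "C_BV \<Omega> = Inf {C. 0 \<le> C \<and> (\<forall>v g. W0_11 \<Omega> v g \<longrightarrow>
     v \<in> Lp \<Omega> (sobolev_exponent DIM('a)) \<and>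
     Lnorm (sobolev_exponent DIM('a)) v \<le> C * (\<integral>x. norm (g x) \<partial>lebesgue_on \<Omega>))}"


section \<open>Lipschitz boundary, Hausdorff measure, BV functions\<close>

text \<open>Locally, after a rotation taking the last coordinate direction to \<open>e\<close>, the set \<open>\<Omega>\<close> is the
  strict epigraph of a Lipschitz function of the remaining coordinates.\<close>

definition lipschitz_boundary :: "'a::euclidean_space set \<Rightarrow> bool" where
  "lipschitz_boundary \<Omega> \<longleftrightarrow> (\<forall>x\<in>frontier \<Omega>. \<exists>r>0. \<exists>e L \<gamma>. norm e = 1 \<and>
     L-lipschitz_on {y. y \<bullet> e = 0} \<gamma> \<and>
     \<Omega> \<inter> ball x r = {y \<in> ball x r. \<gamma> (y - (y \<bullet> e) *\<^sub>R e) < y \<bullet> e})"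

text \<open>In dimension \<open>k = 0\<close> every nonempty set of a covering counts \<open>0 ^ 0 = 1\<close>; the empty set
  must always count \<open>0\<close>.\<close>

definition hausdorff_pre ::
  "nat \<Rightarrow> real \<Rightarrow> 'a::metric_space set \<Rightarrow> ennreal" where
  "hausdorff_pre k \<delta> A =
     (INF C \<in> {C :: nat \<Rightarrow> 'a set. A \<subseteq> (\<Union>i. C i) \<and> (\<forall>i. bounded (C i) \<and> diameter (C i) \<le> \<delta>)}.
       \<Sum>i. if C i = {} then 0
            else ennreal (unit_ball_vol (real k) * (diameter (C i) / 2) ^ k))"

text \<open>The Hausdorff outer measure is countably additive on the Borel sets, so \<^const>\<open>measure_of\<close>
  does yield its restriction to them.\<close>

definition hausdorff_measure :: "nat \<Rightarrow> 'a::metric_space measure" where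
  "hausdorff_measure k =
     measure_of UNIV (sets borel) (\<lambda>A. SUP \<delta>\<in>{0<..}. hausdorff_pre k \<delta> A)"

text \<open>\<open>|Dv|(\<Omega>)\<close> by duality; the fields \<open>\<phi>\<close> and \<open>-\<phi>\<close> are both admissible, so the sign of the
  integration by parts is immaterial.\<close>

definition total_variation :: "'a::euclidean_space set \<Rightarrow> 'a L0 \<Rightarrow> ereal" where
  "total_variation \<Omega> v = (SUP \<phi> \<in> {\<phi> \<in> test_fields \<Omega>. \<forall>x. norm (\<phi> x) \<le> 1}.
     ereal (\<integral>x. rep_L0 v x * divergence \<phi> x \<partial>lebesgue_on \<Omega>))"

definition BV :: "'a::euclidean_space set \<Rightarrow> 'a L0 set" where
  "BV \<Omega> = {v \<in> Lp \<Omega> 1. total_variation \<Omega> v < \<infinity>}"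

text \<open>The trace of a BV function at a boundary point, as the one-sided approximate limit; on a
  Lipschitz domain it exists almost everywhere on the boundary for the \<open>(n-1)\<close>-dimensional
  Hausdorff measure.\<close>

definition boundary_trace :: "'a::euclidean_space set \<Rightarrow> 'a L0 \<Rightarrow> 'a \<Rightarrow> real" where
  "boundary_trace \<Omega> v x = (THE t.
     ((\<lambda>r. (\<integral>y. \<bar>rep_L0 v y - t\<bar> \<partial>lebesgue_on (\<Omega> \<inter> ball x r)) / r ^ DIM('a)) \<longlongrightarrow> 0) (at_right 0))"

definition E_TV :: "'a::euclidean_space set \<Rightarrow> 'a L0 \<Rightarrow> ereal" where
  "E_TV \<Omega> v =
     (if v \<in> BV \<Omega> then
        total_variation \<Omega> v +
        enn2ereal (\<integral>\<^sup>+x\<in>frontier \<Omega>. ennreal \<bar>boundary_trace \<Omega> v x\<bar>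
                     \<partial>hausdorff_measure (DIM('a) - 1))
      else \<infinity>)"


section \<open>Nonsmooth analysis\<close>

definition weak_slope_cont ::
  "'b set \<Rightarrow> ('b \<Rightarrow> 'b \<Rightarrow> real) \<Rightarrow> ('b \<Rightarrow> real) \<Rightarrow> 'b \<Rightarrow> ereal" where
  "weak_slope_cont M d F u = Sup {ereal \<sigma> | \<sigma>. 0 \<le> \<sigma> \<and> (\<exists>\<delta>>0. \<exists>\<eta>.
     continuous_map
       (subtopology (prod_topology (Metric_space.mtopology M d) euclideanreal)
          (Metric_space.mball M d u \<delta> \<times> {0..\<delta>}))
       (Metric_space.mtopology M d) \<eta> \<and>
     (\<forall>v\<in>Metric_space.mball M d u \<delta>. \<forall>t\<in>{0..\<delta>}.
        d (\<eta> (v, t)) v \<le> t \<and> F (\<eta> (v, t)) \<le> F v - \<sigma> * t))}"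

definition epigraph_on :: "'b set \<Rightarrow> ('b \<Rightarrow> ereal) \<Rightarrow> ('b \<times> real) set" where
  "epigraph_on M F = {(v, t). v \<in> M \<and> F v \<le> ereal t}"

definition weak_slope ::
  "'b set \<Rightarrow> ('b \<Rightarrow> 'b \<Rightarrow> real) \<Rightarrow> ('b \<Rightarrow> ereal) \<Rightarrow> 'b \<Rightarrow> ereal" where
  "weak_slope M d F u =
     (let s = weak_slope_cont (epigraph_on M F) (prod_dist d dist) snd (u, real_of_ereal (F u))
      in if s < 1 then ereal (real_of_ereal s / sqrt (1 - (real_of_ereal s)\<^sup>2)) else \<infinity>)"

definition critical_point ::
  "'b set \<Rightarrow> ('b \<Rightarrow> 'b \<Rightarrow> real) \<Rightarrow> ('b \<Rightarrow> ereal) \<Rightarrow> 'b \<Rightarrow> bool" where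
  "critical_point M d F u \<longleftrightarrow> u \<in> M \<and> F u < \<infinity> \<and> weak_slope M d F u = 0"

definition locally_lipschitz_Lp ::
  "'a::euclidean_space set \<Rightarrow> ereal \<Rightarrow> ('a L0 \<Rightarrow> real) \<Rightarrow> bool" where
  "locally_lipschitz_Lp \<Omega> q E \<longleftrightarrow> (\<forall>v\<in>Lp \<Omega> q. \<exists>\<epsilon>>0. \<exists>L.
     \<forall>x\<in>Metric_space.mball (Lp \<Omega> q) (Ldist q) v \<epsilon>.
     \<forall>y\<in>Metric_space.mball (Lp \<Omega> q) (Ldist q) v \<epsilon>. \<bar>E x - E y\<bar> \<le> L * Ldist q x y)"

text \<open>Clarke's generalized directional derivative and generalized gradient on \<open>L\<^sup>p(\<Omega>)\<close>, with the
  dual space identified with \<open>L\<^sup>p\<^sup>'(\<Omega>)\<close>.\<close>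

definition clarke_derivative ::
  "'a::euclidean_space set \<Rightarrow> real \<Rightarrow> ('a L0 \<Rightarrow> real) \<Rightarrow> 'a L0 \<Rightarrow> 'a L0 \<Rightarrow> ereal" where
  "clarke_derivative \<Omega> p E v h =
     Limsup (nhdsin (Ltop \<Omega> (ereal p)) v \<times>\<^sub>F at_right 0)
       (\<lambda>(y, t). ereal ((E (y + t *\<^sub>R h) - E y) / t))"

definition clarke_gradient ::
  "'a::euclidean_space set \<Rightarrow> real \<Rightarrow> ('a L0 \<Rightarrow> real) \<Rightarrow> 'a L0 \<Rightarrow> 'a L0 set" where
  "clarke_gradient \<Omega> p E v = {w \<in> Lp \<Omega> (ereal (p / (p - 1))).
     \<forall>h\<in>Lp \<Omega> (ereal p). ereal (pairing w h) \<le> clarke_derivative \<Omega> p E v h}"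


section \<open>Genus and minimax values\<close>

text \<open>For \<open>k = 0\<close> the target \<open>\<real>\<^sup>0 \<setminus> {0}\<close> is empty, so exactly the empty set has genus \<open>0\<close>.\<close>

definition genus :: "'a::euclidean_space L0 topology \<Rightarrow> 'a L0 set \<Rightarrow> enat" where
  "genus X S = Inf {enat k | k. \<exists>f. continuous_map (subtopology X S) (Euclidean_space k) f \<and>
     (\<forall>v\<in>S. f v \<noteq> (\<lambda>_. 0)) \<and> (\<forall>v\<in>S. f (- v) = (\<lambda>i. - f v i))}"

definition minimax_sets ::
  "'a::euclidean_space set \<Rightarrow> ereal \<Rightarrow> real \<Rightarrow> nat \<Rightarrow> 'a L0 set set" where
  "minimax_sets \<Omega> q \<alpha> k = {S. S \<subseteq> Lp \<Omega> q \<and> compactin (Ltop \<Omega> q) S \<and> (\<forall>v\<in>S. - v \<in> S) \<and>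
     (\<forall>v\<in>S. Lnorm 1 v = \<alpha>) \<and> enat k \<le> genus (Ltop \<Omega> q) S}"

definition c_minimax ::
  "'a::euclidean_space set \<Rightarrow> real \<Rightarrow> ('a L0 \<Rightarrow> real) \<Rightarrow> nat \<Rightarrow> real \<Rightarrow> ereal" where
  "c_minimax \<Omega> p E k \<alpha> =
     (INF S \<in> minimax_sets \<Omega> (ereal p) \<alpha> k. SUP v\<in>S. E_TV \<Omega> v + ereal (E v))"

definition lambda1 :: "'a::euclidean_space set \<Rightarrow> nat \<Rightarrow> ereal" where
  "lambda1 \<Omega> k = (INF S \<in> minimax_sets \<Omega> 1 1 k. SUP v\<in>S. E_TV \<Omega> v)"


section \<open>The perturbed eigenvalue problem\<close>

definition Sgn :: "real \<Rightarrow> real set" where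
  "Sgn t = (if t > 0 then {1} else if t = 0 then {-1..1} else {-1})"

definition perturbed_functional ::
  "'a::euclidean_space set \<Rightarrow> ('a L0 \<Rightarrow> real) \<Rightarrow> real \<Rightarrow> 'a L0 \<Rightarrow> ereal" where
  "perturbed_functional \<Omega> E \<alpha> v =
     E_TV \<Omega> v + ereal (E v) + (if Lnorm 1 v = \<alpha> then 0 else \<infinity>)"

definition eigenfunction ::
  "'a::euclidean_space set \<Rightarrow> real \<Rightarrow> ('a L0 \<Rightarrow> real) \<Rightarrow> real \<Rightarrow> 'a L0 \<Rightarrow> bool" where
  "eigenfunction \<Omega> p E \<alpha> u \<longleftrightarrow> \<alpha> > 0 \<and>
     critical_point (Lp \<Omega> (ereal p)) (Ldist (ereal p)) (perturbed_functional \<Omega> E \<alpha>) u"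

text \<open>Here \<open>w = div z\<close> and \<open>us\<close> is the element \<open>u\<^sup>*\<close> of the generalized gradient.\<close>

definition eigenvalue ::
  "'a::euclidean_space set \<Rightarrow> real \<Rightarrow> ('a L0 \<Rightarrow> real) \<Rightarrow> 'a L0 \<Rightarrow> real \<Rightarrow> bool" where
  "eigenvalue \<Omega> p E u \<mu> \<longleftrightarrow> (\<exists>s z w us.
     s \<in> Lp \<Omega> \<infinity> \<and> (AE x in lebesgue_on \<Omega>. rep_L0 s x \<in> Sgn (rep_L0 u x)) \<and>
     z \<in> borel_measurable (lebesgue_on \<Omega>) \<and>
     esssup (lebesgue_on \<Omega>) (\<lambda>x. ereal (norm (z x))) = 1 \<and>
     w \<in> Lp \<Omega> (ereal (p / (p - 1))) \<and> weak_divergence \<Omega> z w \<and>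
     E_TV \<Omega> u = ereal (- pairing u w) \<and>
     us \<in> clarke_gradient \<Omega> p E u \<and>
     - w + us = \<mu> *\<^sub>R s)"

definition bifurcation_value ::
  "'a::euclidean_space set \<Rightarrow> real \<Rightarrow> ('a L0 \<Rightarrow> real) \<Rightarrow> real \<Rightarrow> bool" where
  "bifurcation_value \<Omega> p E \<mu> \<longleftrightarrow> (\<exists>l u.
     (\<forall>j::nat. u j \<noteq> 0 \<and> eigenfunction \<Omega> p E (Lnorm 1 (u j)) (u j) \<and>
        eigenvalue \<Omega> p E (u j) (l j)) \<and>
     l \<longlonglongrightarrow> \<mu> \<and> (\<lambda>j. Lnorm (ereal p) (u j)) \<longlonglongrightarrow> 0)"

end

theory Submission
  imports Defs "HOL-Homology.Simplices" "HOL-Real_Asymp.Real_Asymp"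
begin

text \<open>
  Normalising \<open>\<parallel>v\<parallel>\<^sub>1 = 1\<close>, the Sobolev embedding of \<open>BV\<close> gives \<open>\<parallel>v\<parallel>\<^sub>p\<^sup>p \<le> C (|Dv|(\<Omega>) + 1)\<close>; here the bound
  \<open>p \<le> 1 + 1/n\<close> is needed. Scaling shows that on \<open>\<parallel>v\<parallel>\<^sub>1 = \<alpha>\<close> the perturbation is at most
  \<open>\<kappa>(\<alpha>) (\<E>(v) + \<alpha>)\<close>, where \<open>\<E>\<close> is the total variation energy and \<open>\<kappa>(\<alpha>)\<close> is a multiple of
  \<open>\<alpha>\<close> to the power \<open>p - 1\<close>. The scaling \<open>v \<mapsto> \<alpha> v\<close> is odd and, on sets of bounded energy,
  continuous from \<open>L\<^sup>1\<close> to \<open>L\<^sup>p\<close> and back, so it exchanges the minimax sets of the two problems, and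
  \<open>\<alpha> ((1 - \<kappa>) \<lambda> - \<kappa>) \<le> c \<le> \<alpha> ((1 + \<kappa>) \<lambda> + \<kappa>)\<close>. Pairing the eigenvalue equation with the
  eigenfunction bounds the distance of \<open>\<alpha>\<close> times an eigenvalue to \<open>c\<close> by a multiple of
  \<open>\<parallel>u\<parallel>\<^sub>p\<^sup>p\<close>, which is \<open>o(\<alpha>)\<close>. That \<open>\<lambda>\<close> is finite follows from Borsuk--Ulam on the span of \<open>k\<close> bumps with
  disjoint supports.

  The embedding rests on the estimate \<open>\<integral>|v(x + h) - v(x)| dx \<le> C |h| (\<parallel>v\<parallel>\<^sub>1 + |Dv|(\<Omega>))\<close> for the extension
  of \<open>v\<close> by zero: one translates into the domain along the interior cones, so that no extension or trace
  theorem is required. The trace enters only through the homogeneity of \<open>\<E>\<close>, for which it has to exist at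
  almost every boundary point.
\<close>

section \<open>The Borsuk--Ulam theorem on the cross-polytope\<close>

text \<open>Everything metric is drawn from translations. \<open>lost E h\<close>, the volume that
  leaves \<open>E\<close> under translation by \<open>h\<close>, stands in for the perimeter, and
  integrating it over superlevel sets stands in for the coarea formula, of which only one inequality
  is used. The trace is the delicate point, since \<open>boundary_trace\<close> is a description and
  says something only where a limit exists. Where it fails, \<open>f\<close> oscillates on small
  balls, and this is paid for by variation along columns running from these balls into the domain.
  The columns stay close to the frontier, off a compact set carrying almost all variation, and can
  be chosen disjoint; so the exceptional points have arbitrarily small content of dimension
  \<open>n - 1\<close>. Borsuk--Ulam comes from Ky Fan's labelling lemma, counted modulo 2 on
  subdivided chains. The sum-norm sphere serves twice: its hemispheres are simplicial cones, and
  disjoint bumps of integral 1 map it isometrically into the unit sphere of the target. The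
  threshold for \<alpha> contains a power of \<open>C_BV \<Omega>\<close>. It admits all small
  \<alpha> only because this infimum is positive, which takes a Sobolev inequality and a bump of its
  own.\<close>

primrec alternating :: "bool \<Rightarrow> bool list \<Rightarrow> bool" where
  "alternating b [] \<longleftrightarrow> True"
| "alternating b (x # xs) \<longleftrightarrow> x = b \<and> alternating (\<not> b) xs"

definition remove_nth :: "nat \<Rightarrow> 'b list \<Rightarrow> 'b list" where
  "remove_nth k xs = take k xs @ drop (Suc k) xs"

lemma remove_nth_simps [simp]:
  "remove_nth 0 (x # xs) = xs"
  "remove_nth (Suc k) (x # xs) = x # remove_nth k xs"
  by (simp_all add: remove_nth_def)

lemma map_remove_nth: "map f (remove_nth k xs) = remove_nth k (map f xs)"
  by (simp add: remove_nth_def take_map drop_map)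

lemma mset_remove_nth: "k < length xs \<Longrightarrow> mset (remove_nth k xs) = mset xs - {#xs ! k#}"
proof (induction xs arbitrary: k)
  case (Cons x xs)
  show ?case
  proof (cases k)
    case (Suc m)
    then have m: "m < length xs" using Cons.prems by simp
    then have "xs ! m \<in># mset xs" by simp
    then show ?thesis using Cons.IH[OF m] Suc by (simp add: insert_DiffM)
  qed simp
qed simp

lemma set_remove_nth: "set (remove_nth k xs) \<subseteq> set xs"
  by (auto simp: remove_nth_def dest: in_set_takeD in_set_dropD)

lemma sorted_remove_nth: "sorted xs \<Longrightarrow> sorted (remove_nth k xs)"
  using sorted_append[of "take k xs" "drop k xs"] set_drop_subset_set_drop[of k "Suc k" xs]
  by (auto simp: remove_nth_def sorted_append sorted_wrt_drop)

text \<open>The parity behind Fan's formula, for a single simplex. If the list begins with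
  \<open>b\<close>, every deletion but the first keeps this head and falls under the induction
  hypothesis for the tail and \<open>\<not> b\<close>. Otherwise only the deletion of the head can
  give a list alternating from \<open>b\<close>. In both cases the terms cancel modulo 2.\<close>

lemma alternating_count:
  assumes "s \<noteq> []"
  shows "even ((\<Sum>k<length s. of_bool (alternating b (remove_nth k s))) +
               of_bool (alternating b s) + of_bool (alternating (\<not> b) s) :: int)"
  using assms
proof (induction s arbitrary: b)
  case (Cons x xs)
  show ?case
  proof (cases "xs = []")
    case False
    have "even ((\<Sum>k<length xs. of_bool (alternating (\<not> b) (remove_nth k xs))) +
               of_bool (alternating (\<not> b) xs) + of_bool (alternating b xs) :: int)"
      using Cons.IH[OF False, of "\<not> b"] by simp
    moreover have "(\<Sum>k<length (x # xs). of_bool (alternating b (remove_nth k (x # xs)))) =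
        (of_bool (alternating b xs) :: int) +
        (if x = b then (\<Sum>k<length xs. of_bool (alternating (\<not> b) (remove_nth k xs))) else 0)"
      unfolding length_Cons by (subst sum.lessThan_Suc_shift) simp
    ultimately show ?thesis
      by (auto simp del: sum_of_bool_eq length_Cons)
  qed auto
qed simp

text \<open>The label sets allowed on one simplex in Fan's lemma: zero is absent and there is no
  complementary edge, so that labels are separated by their absolute values.\<close>

definition compatible :: "int set \<Rightarrow> bool" where
  "compatible A \<longleftrightarrow> 0 \<notin> A \<and> (\<forall>x\<in>A. - x \<notin> A)"

lemma compatible_inj: "compatible A \<Longrightarrow> inj_on abs A"
  by (auto simp: compatible_def inj_on_def abs_eq_iff)

lemma compatible_subset: "compatible A \<Longrightarrow> B \<subseteq> A \<Longrightarrow> compatible B"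
  by (auto simp: compatible_def)

lemma compatible_uminus: "compatible (uminus ` A) \<longleftrightarrow> compatible A"
  by (auto simp: compatible_def image_iff)

text \<open>Ky Fan's count: a simplex counts if its labels, ordered by absolute value, alternate in sign and
  begin with a positive one.\<close>

definition fan_sign :: "int list \<Rightarrow> bool" where
  "fan_sign L \<longleftrightarrow> alternating True (map (\<lambda>x. 0 < x) (sort_key abs L))"

lemma alternating_Not: "alternating b (map Not s) \<longleftrightarrow> alternating (\<not> b) s"
  by (induction s arbitrary: b) auto

text \<open>Negation keeps the order by absolute value and flips every sign; injectivity of the
  absolute value makes the sorted list unique.\<close>

lemma fan_sign_uminus:
  assumes "compatible (set L)"
  shows "fan_sign (map uminus L) \<longleftrightarrow> alternating False (map (\<lambda>x. 0 < x) (sort_key abs L))"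
proof -
  have "sort_key abs (map uminus L) = map uminus (sort_key abs L)"
  proof (rule sort_key_inj_key_eq)
    show "mset (map uminus L) = mset (map uminus (sort_key abs L))"
      by simp
    show "inj_on abs (set (map uminus L))"
      using assms compatible_inj compatible_uminus by (metis set_map)
    show "sorted (map abs (map uminus (sort_key abs L)))"
      by (simp add: comp_def)
  qed
  moreover have "map (\<lambda>x. 0 < x) (map uminus (sort_key abs L)) = map Not (map (\<lambda>x. 0 < x) (sort_key abs L))"
    using assms by (auto simp: compatible_def) (metis linorder_cases)
  ultimately show ?thesis
    unfolding fan_sign_def by (metis alternating_Not)
qed

lemma sort_key_abs_eqI:
  "mset L = mset S \<Longrightarrow> compatible (set L) \<Longrightarrow> sorted (map abs S) \<Longrightarrow> sort_key abs L = S"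
  by (rule sort_key_inj_key_eq) (auto intro: compatible_inj)

text \<open>Deleting an entry from a sorted list leaves it sorted, so the claim is
  \<open>alternating_count\<close> for the sign pattern of the sorted labels.\<close>

lemma fan_sign_boundary:
  assumes "compatible (set L)" "L \<noteq> []"
  shows "even ((\<Sum>k<length L. of_bool (fan_sign (remove_nth k L))) +
               of_bool (fan_sign L) + of_bool (fan_sign (map uminus L)) :: int)"
proof -
  define S where "S = sort_key abs L"
  \<comment> \<open>\<open>h\<close> turns \<open>fan_sign\<close> into a function of the multiset
    of labels; deletions from \<open>L\<close> may then be counted as deletions from the sorted list
    \<open>S\<close>.\<close>
  define h where "h M = (of_bool (fan_sign (SOME l. mset l = M)) :: int)" for M
  have h: "h (mset l) = of_bool (fan_sign l)" if "compatible (set l)" for l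
  proof -
    define l' where "l' = (SOME l'. mset l' = mset l)"
    have *: "mset l' = mset l" unfolding l'_def by (rule someI) simp
    have "sort_key abs l' = sort_key abs l"
    proof (rule sort_key_abs_eqI)
      show "compatible (set l')" using * that by (metis set_mset_mset)
    qed (auto simp: *)
    then show ?thesis by (simp add: h_def fan_sign_def flip: l'_def)
  qed
  have S: "mset S = mset L" "set S = set L" "sorted (map abs S)" "length S = length L"
    by (simp_all add: S_def)
  have cnt: "(\<Sum>k<length l. of_bool (fan_sign (remove_nth k l))) = (\<Sum>x\<in>#mset l. h (mset l - {#x#}))"
    if "compatible (set l)" for l
  proof -
    have "(\<Sum>k<length l. of_bool (fan_sign (remove_nth k l))) = (\<Sum>k<length l. h (mset l - {#l ! k#}))"
    proof (intro sum.cong refl)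
      fix k assume "k \<in> {..<length l}"
      then show "of_bool (fan_sign (remove_nth k l)) = h (mset l - {#l ! k#})"
        using h[OF compatible_subset[OF that set_remove_nth, of k]] mset_remove_nth[of k l] by simp
    qed
    also have "\<dots> = sum_list (map (\<lambda>x. h (mset l - {#x#})) l)"
      by (simp add: sum_list_sum_nth atLeast0LessThan)
    also have "\<dots> = (\<Sum>x\<in>#mset l. h (mset l - {#x#}))"
      by (simp flip: sum_mset_sum_list)
    finally show ?thesis .
  qed
  have "(\<Sum>k<length L. of_bool (fan_sign (remove_nth k L)) :: int) =
        (\<Sum>k<length S. of_bool (fan_sign (remove_nth k S)))"
    using cnt[of L] cnt[of S] assms(1) S by simp
  also have "\<dots> = (\<Sum>k<length S. of_bool (alternating True (remove_nth k (map (\<lambda>x. 0 < x) S))))"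
  proof (intro sum.cong refl)
    fix k
    have "sort_key abs (remove_nth k S) = remove_nth k S"
    proof (rule sort_key_abs_eqI)
      show "compatible (set (remove_nth k S))"
        using assms(1) S(2) set_remove_nth compatible_subset by metis
      show "sorted (map abs (remove_nth k S))"
        using S(3) sorted_remove_nth by (metis map_remove_nth)
    qed simp
    then show "of_bool (fan_sign (remove_nth k S)) =
       (of_bool (alternating True (remove_nth k (map (\<lambda>x. 0 < x) S))) :: int)"
      by (simp add: fan_sign_def map_remove_nth)
  qed
  finally have "(\<Sum>k<length L. of_bool (fan_sign (remove_nth k L)) :: int) =
    (\<Sum>k<length S. of_bool (alternating True (remove_nth k (map (\<lambda>x. 0 < x) S))))" .
  moreover have "fan_sign L \<longleftrightarrow> alternating True (map (\<lambda>x. 0 < x) S)"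
    by (simp add: fan_sign_def S_def)
  moreover have "fan_sign (map uminus L) \<longleftrightarrow> alternating False (map (\<lambda>x. 0 < x) S)"
    using assms(1) by (simp add: fan_sign_uminus S_def)
  moreover have "map (\<lambda>x. 0 < x) S \<noteq> []"
    using assms(2) S(4) by auto
  ultimately show ?thesis
    using alternating_count[of "map (\<lambda>x. 0 < x) S" True] by (simp del: sum_of_bool_eq)
qed

text \<open>Neighbours have opposite signs, so equal absolute values would make them opposite
  labels, which compatibility forbids.\<close>

lemma alternating_sorted_distinct:
  assumes "alternating b (map (\<lambda>x. 0 < x) S)" "sorted (map abs S)" "compatible (set S)"
  shows "distinct (map abs S)"
proof -
  have "successively (<) (map abs S)"
    using assms
  proof (induction S arbitrary: b rule: induct_list012)
    case (3 x y zs)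
    have "\<bar>x\<bar> \<noteq> \<bar>y\<bar>"
      using 3(3,5) by (auto simp: compatible_def abs_eq_iff)
    moreover have "successively (<) (map abs (y # zs))"
      by (rule "3.IH"(2)[of "\<not> b"]) (use 3(3-5) in \<open>auto simp: compatible_def\<close>)
    ultimately show ?case using 3(4) by auto
  qed auto
  then have "sorted_wrt (<) (map abs S)"
    by (simp add: successively_conv_sorted_wrt)
  then show ?thesis
    using strict_sorted_iff by blast
qed

text \<open>Here the number of available labels bounds the dimension: a counted simplex uses each
  absolute value at most once.\<close>

lemma fan_sign_length:
  assumes "fan_sign L" "compatible (set L)" "abs ` set L \<subseteq> {1..int j}"
  shows "length L \<le> j"
proof -
  have "distinct (map abs (sort_key abs L))"
    using assms by (intro alternating_sorted_distinct[of True]) (auto simp: fan_sign_def)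
  then have "distinct (map abs L)"
    by (metis distinct_map distinct_sort set_sort)
  then have "length L = card (abs ` set L)"
    by (metis distinct_card length_map set_map)
  also have "\<dots> \<le> card {1..int j}"
    using assms(3) by (intro card_mono) auto
  finally show ?thesis by simp
qed

section \<open>Label counts on singular chains\<close>

definition unit_vec :: "nat \<Rightarrow> nat \<Rightarrow> real" where
  "unit_vec j = (\<lambda>i. if i = j then 1 else 0)"

lemma unit_vec_in_simplex: "j \<le> p \<Longrightarrow> unit_vec j \<in> standard_simplex p"
  unfolding unit_vec_def by simp

definition vertex_labels :: "('b \<Rightarrow> int) \<Rightarrow> nat \<Rightarrow> ((nat \<Rightarrow> real) \<Rightarrow> 'b) \<Rightarrow> int list" where
  "vertex_labels lab p \<sigma> = map (\<lambda>j. lab (\<sigma> (unit_vec j))) [0..<Suc p]"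

lemma singular_face_unit_vec:
  assumes "k \<le> Suc p" "j \<le> p"
  shows "singular_face (Suc p) k \<sigma> (unit_vec j) = \<sigma> (unit_vec (if j < k then j else Suc j))"
proof -
  have "simplical_face k (unit_vec j) = unit_vec (if j < k then j else Suc j)"
    by (auto simp: simplical_face_def unit_vec_def fun_eq_iff)
  then show ?thesis
    using unit_vec_in_simplex[OF assms(2)] by (simp add: singular_face_def)
qed

lemma vertex_labels_face:
  assumes "k \<le> Suc p"
  shows "vertex_labels lab p (singular_face (Suc p) k \<sigma>) = remove_nth k (vertex_labels lab (Suc p) \<sigma>)"
proof (rule nth_equalityI)
  show "length (vertex_labels lab p (singular_face (Suc p) k \<sigma>)) =
        length (remove_nth k (vertex_labels lab (Suc p) \<sigma>))"
    using assms by (simp add: vertex_labels_def remove_nth_def)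
  fix i assume "i < length (vertex_labels lab p (singular_face (Suc p) k \<sigma>))"
  then have i: "i \<le> p" by (simp add: vertex_labels_def)
  show "vertex_labels lab p (singular_face (Suc p) k \<sigma>) ! i =
        remove_nth k (vertex_labels lab (Suc p) \<sigma>) ! i"
    using i assms
    by (simp add: vertex_labels_def remove_nth_def nth_append singular_face_unit_vec
        del: upt_Suc)
qed

text \<open>Written as an extension into the free abelian group on one generator, whose single
  coefficient is the count; additivity on chains is then inherited.\<close>

definition fan_count :: "('b \<Rightarrow> int) \<Rightarrow> nat \<Rightarrow> 'b chain \<Rightarrow> int" where
  "fan_count lab p c = Poly_Mapping.lookup
     (frag_extend (\<lambda>\<sigma>. frag_cmul (of_bool (fan_sign (vertex_labels lab p \<sigma>))) (frag_of ())) c) ()"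

lemma fan_count_simps [simp]:
  "fan_count lab p 0 = 0"
  "fan_count lab p (c - d) = fan_count lab p c - fan_count lab p d"
  "fan_count lab p (c + d) = fan_count lab p c + fan_count lab p d"
  "fan_count lab p (frag_cmul a c) = a * fan_count lab p c"
  "fan_count lab p (frag_of \<sigma>) = of_bool (fan_sign (vertex_labels lab p \<sigma>))"
  by (simp_all add: fan_count_def frag_extend_diff frag_extend_add frag_extend_cmul lookup_minus lookup_add)

lemma fan_count_sum: "finite I \<Longrightarrow> fan_count lab p (sum f I) = (\<Sum>i\<in>I. fan_count lab p (f i))"
  by (induction I rule: finite_induct) auto

lemma vertex_labels_simplex_map:
  assumes "\<And>x. x \<in> \<sigma> ` standard_simplex p \<Longrightarrow> lab (a x) = - lab x"
  shows "vertex_labels lab p (simplex_map p a \<sigma>) = map uminus (vertex_labels lab p \<sigma>)"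
  using assms unit_vec_in_simplex
  by (auto simp: vertex_labels_def simplex_map_def simp del: upt_Suc)

text \<open>The signs of the boundary operator disappear modulo 2, so
  \<open>fan_sign_boundary\<close> can be summed over the simplices of the chain.\<close>

lemma fan_count_boundary:
  assumes "Poly_Mapping.keys c \<subseteq> {\<sigma>. compatible (set (vertex_labels lab (Suc p) \<sigma>)) \<and>
      (\<forall>x \<in> \<sigma> ` standard_simplex (Suc p). lab (a x) = - lab x)}"
  shows "even (fan_count lab p (chain_boundary (Suc p) c) + fan_count lab (Suc p) c +
               fan_count lab (Suc p) (chain_map (Suc p) a c))"
  using assms
proof (induction rule: frag_induction)
  case (one \<sigma>)
  define L where "L = vertex_labels lab (Suc p) \<sigma>"
  have L: "length L = Suc (Suc p)" "L \<noteq> []"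
    by (auto simp: L_def vertex_labels_def)
  have "even ((\<Sum>k<length L. of_bool (fan_sign (remove_nth k L))) +
               of_bool (fan_sign L) + of_bool (fan_sign (map uminus L)) :: int)"
    by (rule fan_sign_boundary) (use one L in \<open>auto simp: L_def\<close>)
  moreover have "fan_count lab p (chain_boundary (Suc p) (frag_of \<sigma>)) =
      (\<Sum>k<length L. (-1)^k * of_bool (fan_sign (remove_nth k L)))"
    unfolding chain_boundary_of L(1) lessThan_Suc_atMost
    by (simp add: fan_count_sum del: sum.atMost_Suc sum_of_bool_mult_eq sum_mult_of_bool_eq)
      (intro sum.cong, auto simp: vertex_labels_face L_def)
  moreover have "even ((\<Sum>k<length L. (-1)^k * of_bool (fan_sign (remove_nth k L))) -
      (\<Sum>k<length L. of_bool (fan_sign (remove_nth k L)) :: int))"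
    unfolding sum_subtractf[symmetric] by (rule dvd_sum) (auto simp: minus_one_power_iff)
  moreover have "vertex_labels lab (Suc p) (simplex_map (Suc p) a \<sigma>) = map uminus L"
    unfolding L_def by (rule vertex_labels_simplex_map) (use one in blast)
  ultimately show ?case
    by (simp add: L_def[symmetric] del: sum_of_bool_eq)
next
  case (diff c d)
  then show ?case
    by (simp add: chain_boundary_diff chain_map_diff) presburger
qed simp

section \<open>Antipodal chains on the sum-norm sphere\<close>

definition cross_sphere :: "nat \<Rightarrow> (nat \<Rightarrow> real) set" where
  "cross_sphere n = {x. (\<forall>i>n. x i = 0) \<and> (\<Sum>i\<le>n. \<bar>x i\<bar>) = 1}"

abbreviation antipode :: "(nat \<Rightarrow> real) \<Rightarrow> nat \<Rightarrow> real" where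
  "antipode x \<equiv> \<lambda>i. - x i"

lemma antipode_cross_sphere [simp]: "antipode x \<in> cross_sphere n \<longleftrightarrow> x \<in> cross_sphere n"
  by (simp add: cross_sphere_def)

lemma cross_sphere_Suc_mono: "cross_sphere n \<subseteq> cross_sphere (Suc n)"
  by (auto simp: cross_sphere_def)

lemma cross_sphere_mono: "m \<le> n \<Longrightarrow> cross_sphere m \<subseteq> cross_sphere n"
  by (rule lift_Suc_mono_le[of cross_sphere]) (rule cross_sphere_Suc_mono)

lemma simplicial_chain_mono: "simplicial_chain p S c \<Longrightarrow> S \<subseteq> T \<Longrightarrow> simplicial_chain p T c"
  by (fastforce simp: simplicial_chain_def simplicial_simplex)

lemma simplicial_chain_antipode:
  assumes "simplicial_chain p S c" "\<And>x. x \<in> S \<Longrightarrow> antipode x \<in> S"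
  shows "simplicial_chain p S (chain_map p antipode c)"
  using assms(1) unfolding simplicial_chain_def[of p S c]
proof (induction rule: frag_induction)
  case (one f)
  then obtain l where l: "f = oriented_simplex p l" and f: "f ` standard_simplex p \<subseteq> S"
    by (auto simp: simplicial_simplex)
  have "simplex_map p antipode f = oriented_simplex p (\<lambda>j. antipode (l j))"
    by (auto simp: l simplex_map_def oriented_simplex_def sum_negf)
  moreover have "simplex_map p antipode f ` standard_simplex p \<subseteq> S"
    using f assms(2) by (auto simp: simplex_map_def)
  ultimately show ?case
    by (auto simp: simplicial_simplex)
qed (auto simp: chain_map_diff simplicial_chain_diff)

lemma chain_map_antipode_antipode:
  "singular_chain p (subtopology (powertop_real UNIV) S) c \<Longrightarrow>
     chain_map p antipode (chain_map p antipode c) = c"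
  using chain_map_compose[of p antipode antipode]
    chain_map_id_gen[of p "subtopology (powertop_real UNIV) S" c "antipode \<circ> antipode"]
  by (simp add: fun_eq_iff)

text \<open>The upper hemisphere of dimension \<open>i + 1\<close> is the cone over the sphere of dimension \<open>i\<close>, which is
  the lower-dimensional hemisphere together with its antipodal image.\<close>

primrec hemisphere_chain :: "nat \<Rightarrow> (nat \<Rightarrow> real) chain" where
  "hemisphere_chain 0 = frag_of (oriented_simplex 0 (\<lambda>_. unit_vec 0))"
| "hemisphere_chain (Suc i) = simplicial_cone i (unit_vec (Suc i))
     (hemisphere_chain i - frag_cmul ((-1) ^ i) (chain_map i antipode (hemisphere_chain i)))"

lemma unit_vec_cross_sphere: "j \<le> n \<Longrightarrow> unit_vec j \<in> cross_sphere n"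
  by (simp add: cross_sphere_def unit_vec_def if_distrib[of abs] cong: if_cong)

text \<open>On the segment from the pole \<open>unit_vec (Suc n)\<close> to a point of the lower
  sphere the sum norm is \<open>(1 - u) + u = 1\<close>, so the straight cone stays on the
  sphere.\<close>

lemma simplicial_chain_hemisphere:
  "simplicial_chain n (cross_sphere n) (hemisphere_chain n)"
proof (induction n)
  case 0
  have "oriented_simplex 0 (\<lambda>_. unit_vec 0) ` standard_simplex 0 \<subseteq> cross_sphere 0"
    using unit_vec_cross_sphere[of 0 0]
    by (auto simp: oriented_simplex_def standard_simplex_0)
  then show ?case by (auto simp: simplicial_simplex)
next
  case (Suc n)
  show ?case unfolding hemisphere_chain.simps
  proof (rule simplicial_chain_simplicial_cone)
    show "simplicial_chain n (cross_sphere n)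
      (hemisphere_chain n - frag_cmul ((-1) ^ n) (chain_map n antipode (hemisphere_chain n)))"
      by (intro simplicial_chain_diff simplicial_chain_cmul simplicial_chain_antipode Suc) simp
  next
    fix x :: "nat \<Rightarrow> real" and u :: real
    assume u: "0 \<le> u" "u \<le> 1" and x: "x \<in> cross_sphere n"
    have "(\<Sum>i\<le>n. \<bar>(1 - u) * unit_vec (Suc n) i + u * x i\<bar>) = (\<Sum>i\<le>n. u * \<bar>x i\<bar>)"
      using u by (intro sum.cong) (auto simp: unit_vec_def abs_mult)
    also have "\<dots> = u"
      using x by (simp add: cross_sphere_def flip: sum_distrib_left)
    finally show "(\<lambda>i. (1 - u) * unit_vec (Suc n) i + u * x i) \<in> cross_sphere (Suc n)"
      using x u by (auto simp: cross_sphere_def unit_vec_def)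
  qed
qed

lemma chain_boundary_hemisphere:
  "chain_boundary (Suc n) (hemisphere_chain (Suc n)) =
     hemisphere_chain n - frag_cmul ((-1) ^ n) (chain_map n antipode (hemisphere_chain n))"
proof (induction n)
  case 0
  have "simplicial_chain 0 (cross_sphere 0)
      (hemisphere_chain 0 - chain_map 0 antipode (hemisphere_chain 0))"
    using simplicial_chain_hemisphere[of 0]
    by (intro simplicial_chain_diff simplicial_chain_antipode) auto
  \<comment> \<open>In dimension 0 the boundary of a cone carries an additional multiple of its
    apex; it cancels between the two antipodal points.\<close>
  from chain_boundary_simplicial_cone[OF this, of "unit_vec 1"] show ?case
    by (simp add: frag_extend_diff)
next
  case (Suc n)
  let ?h = "hemisphere_chain (Suc n)" and ?s = "(-1) ^ Suc n :: int"
  let ?z = "?h - frag_cmul ?s (chain_map (Suc n) antipode ?h)"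
  have h: "simplicial_chain (Suc n) (cross_sphere (Suc n)) ?h"
    by (rule simplicial_chain_hemisphere)
  note h' = simplicial_imp_singular_chain[OF h]
  have hn: "chain_map n antipode (chain_map n antipode (hemisphere_chain n)) = hemisphere_chain n"
    using simplicial_imp_singular_chain[OF simplicial_chain_hemisphere[of n]]
    by (rule chain_map_antipode_antipode)
  \<comment> \<open>The base of the cone is a cycle: by the induction hypothesis the two boundaries
    agree up to the sign \<open>?s\<close>, because applying the antipode twice gives the identity.
    A cone over a cycle has that cycle as its boundary.\<close>
  have "chain_boundary (Suc n) ?z =
     chain_boundary (Suc n) ?h - frag_cmul ?s (chain_map n antipode (chain_boundary (Suc n) ?h))"
    using chain_boundary_chain_map[OF h', of antipode]
    by (simp add: chain_boundary_diff chain_boundary_cmul)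
  also have "\<dots> = 0"
    unfolding Suc.IH chain_map_diff chain_map_cmul hn
    by (cases "even n") simp_all
  finally have "chain_boundary (Suc n) ?z = 0" .
  moreover have "simplicial_chain (Suc n) (cross_sphere (Suc n)) ?z"
    by (intro simplicial_chain_diff simplicial_chain_cmul simplicial_chain_antipode h) simp
  ultimately show ?case
    using chain_boundary_simplicial_cone[of "Suc n" "cross_sphere (Suc n)" ?z "unit_vec (Suc (Suc n))"]
    unfolding hemisphere_chain.simps(2)[of "Suc n"]
    by (simp add: simplicial_cone_def del: hemisphere_chain.simps)
qed

lemma singular_subdivision_0_chain:
  "singular_chain 0 X c \<Longrightarrow> singular_subdivision 0 c = c"
  unfolding singular_chain_def
proof (induction rule: frag_induction)
  case (one f)
  then show ?case
    using singular_simplex_chain_map_id[of 0 X f] by (simp add: singular_subdivision_def)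
qed (auto simp: singular_subdivision_diff)

text \<open>Subdivision makes every simplex fit into a member of the cover, hence carry compatible
  labels, and it commutes with the boundary and with the antipode. Passing from a hemisphere to its
  boundary shows that, in each dimension, the simplices alternating from either sign are odd in
  number. A counted simplex of dimension \<open>n\<close> has \<open>n + 1\<close> vertices and at
  most \<open>j\<close> labels.\<close>

theorem Fan_labelling:
  fixes lab :: "(nat \<Rightarrow> real) \<Rightarrow> int" and n j :: nat
  defines "X \<equiv> subtopology (powertop_real UNIV) (cross_sphere n)"
  assumes cover: "\<And>V. V \<in> \<C> \<Longrightarrow> openin X V" "cross_sphere n \<subseteq> \<Union>\<C>"
    and comp: "\<And>V. V \<in> \<C> \<Longrightarrow> compatible (lab ` V)"
    and odd: "\<And>x. x \<in> cross_sphere n \<Longrightarrow> lab (antipode x) = - lab x"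
    and le: "\<And>x. x \<in> cross_sphere n \<Longrightarrow> \<bar>lab x\<bar> \<in> {1..int j}"
  shows "Suc n \<le> j"
proof -
  have sc: "singular_chain i X (hemisphere_chain i)" if "i \<le> n" for i
    unfolding X_def
    using simplicial_imp_singular_chain[OF simplicial_chain_mono[OF simplicial_chain_hemisphere cross_sphere_mono[OF that]]] .
  have tX: "topspace X = cross_sphere n"
    by (simp add: X_def)
  have "\<exists>N. \<forall>m\<ge>N. \<forall>f\<in>Poly_Mapping.keys ((singular_subdivision i ^^ m) (hemisphere_chain i)).
          \<exists>V\<in>\<C>. f \<in> standard_simplex i \<rightarrow> V" if i: "i \<le> n" for i
  proof -
    obtain N where "\<And>m f. \<lbrakk>N \<le> m; f \<in> Poly_Mapping.keys ((singular_subdivision i ^^ m) (hemisphere_chain i))\<rbrakk>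
                      \<Longrightarrow> \<exists>V \<in> \<C>. f \<in> standard_simplex i \<rightarrow> V"
      using sufficient_iterated_singular_subdivision_exists[of \<C> X i "hemisphere_chain i"] cover sc[OF i] tX
      by metis
    then show ?thesis by blast
  qed
  then obtain N where N: "\<And>i m f. i \<le> n \<Longrightarrow> N i \<le> m \<Longrightarrow>
       f \<in> Poly_Mapping.keys ((singular_subdivision i ^^ m) (hemisphere_chain i)) \<Longrightarrow>
       \<exists>V\<in>\<C>. f \<in> standard_simplex i \<rightarrow> V"
    by metis
  \<comment> \<open>One number of subdivisions for all dimensions, since the boundary of
    \<open>d (Suc i)\<close> has to be expressed by \<open>d i\<close>.\<close>
  define M where "M = Max (N ` {..n})"
  have M: "N i \<le> M" if "i \<le> n" for i
    using that by (auto simp: M_def)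
  define d where "d i = (singular_subdivision i ^^ M) (hemisphere_chain i)" for i
  have scs: "singular_chain i X ((singular_subdivision i ^^ m) c)" if "singular_chain i X c" for i m c
    by (induction m) (auto simp: that intro: singular_chain_singular_subdivision)
  have scd: "singular_chain i X (d i)" if "i \<le> n" for i
    unfolding d_def by (rule scs) (rule sc[OF that])
  have bd_sub: "chain_boundary (Suc i) ((singular_subdivision (Suc i) ^^ m) c) =
      (singular_subdivision i ^^ m) (chain_boundary (Suc i) c)" if "singular_chain (Suc i) X c" for i m c
  proof (induction m)
    case (Suc m)
    then show ?case
      using chain_boundary_singular_subdivision[OF scs[OF that, of m]] by simp
  qed simp
  have nat_sub: "(singular_subdivision i ^^ m) (chain_map i antipode c) =
      chain_map i antipode ((singular_subdivision i ^^ m) c)" if "singular_chain i X c" for i m c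
  proof (induction m)
    case (Suc m)
    then show ?case
      using naturality_singular_subdivision[OF scs[OF that, of m], of antipode] by simp
  qed simp
  have bd: "chain_boundary (Suc i) (d (Suc i)) = d i - frag_cmul ((-1) ^ i) (chain_map i antipode (d i))"
    if "Suc i \<le> n" for i
  proof -
    have cm: "(singular_subdivision i ^^ m) (frag_cmul ((-1) ^ i) c) = frag_cmul ((-1) ^ i) ((singular_subdivision i ^^ m) c)"
      for m and c :: "(nat \<Rightarrow> real) chain"
      by (induction m) (simp_all add: singular_subdivision_def frag_extend_cmul)
    show ?thesis
      using sc[OF that] sc[of i] that
      by (simp add: d_def bd_sub chain_boundary_hemisphere singular_subdivision_power_diff cm nat_sub
          del: hemisphere_chain.simps)
  qed
  have small: "Poly_Mapping.keys (d i) \<subseteq> {\<sigma>. compatible (set (vertex_labels lab i \<sigma>)) \<and>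
      (\<forall>x \<in> \<sigma> ` standard_simplex i. x \<in> cross_sphere n)}" if "i \<le> n" for i
  proof safe
    fix \<sigma> assume \<sigma>: "\<sigma> \<in> Poly_Mapping.keys (d i)"
    obtain V where V: "V \<in> \<C>" "\<sigma> \<in> standard_simplex i \<rightarrow> V"
      using N[OF \<open>i \<le> n\<close> M[OF \<open>i \<le> n\<close>]] \<sigma> by (auto simp: d_def)
    have "set (vertex_labels lab i \<sigma>) \<subseteq> lab ` V"
      using V(2) unit_vec_in_simplex by (auto simp: vertex_labels_def simp del: upt_Suc)
    then show "compatible (set (vertex_labels lab i \<sigma>))"
      using comp[OF V(1)] compatible_subset by blast
    fix x assume "x \<in> standard_simplex i"
    then show "\<sigma> x \<in> cross_sphere n"
      using V cover(1) tX openin_subset by fastforce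
  qed
  \<comment> \<open>Modulo 2 the boundary of \<open>d (Suc i)\<close> counts what \<open>d i\<close>
    and its antipodal image count together, so the parity moves up by one dimension. It starts at a
    single pair of points, exactly one of which has a positive label.\<close>
  have par: "odd (fan_count lab i (d i) + fan_count lab i (chain_map i antipode (d i)))" if "i \<le> n" for i
    using that
  proof (induction i)
    case 0
    have "d 0 = hemisphere_chain 0"
    proof -
      have "(singular_subdivision 0 ^^ m) (hemisphere_chain 0) = hemisphere_chain 0" for m
        using singular_subdivision_0_chain[OF sc[OF 0]] by (induction m) auto
      then show ?thesis by (simp add: d_def)
    qed
    moreover have "oriented_simplex 0 (\<lambda>_. unit_vec 0) (unit_vec 0) = unit_vec 0"
      by (auto simp: oriented_simplex_def unit_vec_in_simplex) (simp add: unit_vec_def)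
    ultimately show ?case
      using odd[of "unit_vec 0"] le[of "unit_vec 0"] unit_vec_cross_sphere[of 0 n]
      by (auto simp: vertex_labels_def fan_sign_def simplex_map_def unit_vec_in_simplex)
  next
    case (Suc i)
    have "even (fan_count lab i (chain_boundary (Suc i) (d (Suc i))) + fan_count lab (Suc i) (d (Suc i)) +
               fan_count lab (Suc i) (chain_map (Suc i) antipode (d (Suc i))))"
      by (rule fan_count_boundary) (use small[OF Suc.prems] odd in blast)
    moreover have "odd (fan_count lab i (chain_boundary (Suc i) (d (Suc i))))"
      using Suc unfolding bd[OF Suc.prems] by (cases "even i") auto
    ultimately show ?case by (simp add: add.assoc)
  qed
  \<comment> \<open>Without such a simplex both counts in \<open>par\<close> would vanish, although
    their sum is odd.\<close>
  have "\<exists>\<sigma>\<in>Poly_Mapping.keys (d n). fan_sign (vertex_labels lab n \<sigma>) \<or> fan_sign (map uminus (vertex_labels lab n \<sigma>))"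
  proof (rule ccontr)
    assume neg: "\<not> ?thesis"
    have "Poly_Mapping.keys c \<subseteq> Poly_Mapping.keys (d n) \<Longrightarrow>
       fan_count lab n c = 0 \<and> fan_count lab n (chain_map n antipode c) = 0" for c
    proof (induction rule: frag_induction)
      case (one \<sigma>)
      moreover have "vertex_labels lab n (simplex_map n antipode \<sigma>) = map uminus (vertex_labels lab n \<sigma>)"
        using small[of n] one odd by (intro vertex_labels_simplex_map) blast
      ultimately show ?case using neg by auto
    qed (auto simp: chain_map_diff)
    with par[of n] show False by auto
  qed
  then obtain \<sigma> where \<sigma>: "\<sigma> \<in> Poly_Mapping.keys (d n)"
    and f: "fan_sign (vertex_labels lab n \<sigma>) \<or> fan_sign (map uminus (vertex_labels lab n \<sigma>))" by blast
  have c: "compatible (set (vertex_labels lab n \<sigma>))"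
    using small[of n] \<sigma> by auto
  have l: "abs ` set (vertex_labels lab n \<sigma>) \<subseteq> {1..int j}"
    using small[of n] \<sigma> le unit_vec_in_simplex[of _ n]
    by (fastforce simp: vertex_labels_def simp del: upt_Suc)
  have len: "length (vertex_labels lab n \<sigma>) = Suc n"
    by (simp add: vertex_labels_def)
  show ?thesis
    using f
  proof
    assume "fan_sign (vertex_labels lab n \<sigma>)"
    from fan_sign_length[OF this c l] show ?thesis by (simp add: len)
  next
    assume f: "fan_sign (map uminus (vertex_labels lab n \<sigma>))"
    have "compatible (set (map uminus (vertex_labels lab n \<sigma>)))"
      using c by (simp add: compatible_uminus)
    from fan_sign_length[OF f this] l show ?thesis by (simp add: len image_image)
  qed
qed

text \<open>After normalisation in the sum norm some coordinate of \<open>f\<close> is at least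
  \<open>1 / j\<close> in absolute value; the label is the index of the first such coordinate,
  shifted by 1 to avoid zero, with its sign. On \<open>V x\<close> each coordinate stays within
  \<open>1 / j\<close> of its value at \<open>x\<close>, hence cannot be \<open>\<ge> 1 / j\<close>
  at one point and \<open>\<le> - 1 / j\<close> at another. So opposite labels do not meet in one
  \<open>V x\<close>.\<close>

theorem Borsuk_Ulam_cross_sphere:
  fixes f :: "(nat \<Rightarrow> real) \<Rightarrow> nat \<Rightarrow> real" and n j :: nat
  defines "X \<equiv> subtopology (powertop_real UNIV) (cross_sphere n)"
  assumes cont: "\<And>i. i < j \<Longrightarrow> continuous_map X euclideanreal (\<lambda>x. f x i)"
    and odd: "\<And>x i. x \<in> cross_sphere n \<Longrightarrow> i < j \<Longrightarrow> f (antipode x) i = - f x i"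
    and nz: "\<And>x. x \<in> cross_sphere n \<Longrightarrow> \<exists>i<j. f x i \<noteq> 0"
  shows "Suc n \<le> j"
proof -
  define T where "T x = (\<Sum>i<j. \<bar>f x i\<bar>)" for x
  have T: "T x > 0" if x: "x \<in> cross_sphere n" for x
    using nz[OF x] unfolding T_def by (auto intro!: sum_pos2)
  have Todd: "T (antipode x) = T x" if "x \<in> cross_sphere n" for x
    using odd[OF that] by (simp add: T_def)
  have tX: "topspace X = cross_sphere n"
    by (simp add: X_def)
  have j: "j > 0"
    using nz[OF unit_vec_cross_sphere[of 0 n]] by auto
  have big: "\<exists>i<j. 1 / j \<le> \<bar>f x i / T x\<bar>" if x: "x \<in> cross_sphere n" for x
  proof (rule ccontr)
    assume "\<not> ?thesis"
    then have "\<bar>f x i / T x\<bar> < 1 / j" if "i < j" for i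
      using that by force
    then have "(\<Sum>i<j. \<bar>f x i / T x\<bar>) < (\<Sum>i<j. 1 / j)"
      using j by (intro sum_strict_mono) auto
    then show False
      using T[OF x] j by (simp add: T_def abs_divide flip: sum_divide_distrib)
  qed
  define I where "I x = (LEAST i. i < j \<and> 1 / j \<le> \<bar>f x i / T x\<bar>)" for x
  have I: "I x < j" "1 / j \<le> \<bar>f x (I x) / T x\<bar>" if "x \<in> cross_sphere n" for x
    using LeastI_ex[OF big[OF that]] by (auto simp: I_def)
  have Iodd: "I (antipode x) = I x" if "x \<in> cross_sphere n" for x
    unfolding I_def Todd[OF that] using odd[OF that] by (auto intro!: arg_cong[where f=Least])
  define lab where "lab x = int (Suc (I x)) * (if f x (I x) > 0 then 1 else -1)" for x
  define V where "V x = {y \<in> topspace X. \<forall>i<j. f y i / T y \<in> ball (f x i / T x) (1 / j)}" for x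
  have contq: "continuous_map X euclideanreal (\<lambda>x. f x i / T x)" if "i < j" for i
    unfolding T_def
    by (intro continuous_map_real_divide continuous_map_sum continuous_map_real_abs cont that)
       (use T in \<open>auto simp: tX T_def less_le\<close>)
  show ?thesis
  proof (rule Fan_labelling[where \<C>="V ` cross_sphere n" and lab=lab])
    fix U assume "U \<in> V ` cross_sphere n"
    then obtain x where U: "U = V x" "x \<in> cross_sphere n" by auto
    have "openin X (topspace X \<inter> (\<Inter>i\<in>{..<j}. {y \<in> topspace X. f y i / T y \<in> ball (f x i / T x) (1 / j)}))"
    proof -
      have "openin X {y \<in> topspace X. f y i / T y \<in> ball (f x i / T x) (1 / j)}" if "i < j" for i
        using openin_continuous_map_preimage[OF contq[OF that], of "ball (f x i / T x) (1 / j)"] by simp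
      then show ?thesis
        using j by (intro openin_Int openin_topspace openin_INT2) auto
    qed
    moreover have "U = topspace X \<inter> (\<Inter>i\<in>{..<j}. {y \<in> topspace X. f y i / T y \<in> ball (f x i / T x) (1 / j)})"
      by (auto simp: U V_def)
    ultimately show "openin (subtopology (powertop_real UNIV) (cross_sphere n)) U"
      by (simp add: X_def)
    show "compatible (lab ` U)"
      unfolding compatible_def
    proof (intro conjI ballI notI)
      assume "0 \<in> lab ` U" then show False by (auto simp: lab_def split: if_splits)
    next
      fix l assume "l \<in> lab ` U" "- l \<in> lab ` U"
      then obtain y z where yz: "y \<in> U" "z \<in> U" "lab z = - lab y" by auto
      then have ys: "y \<in> cross_sphere n" "z \<in> cross_sphere n" by (auto simp: U V_def tX)
      have "\<bar>lab z\<bar> = \<bar>lab y\<bar>" using yz by simp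
      then have Ieq: "I z = I y" by (auto simp: lab_def abs_mult split: if_splits)
      with yz(3) have sg: "(f z (I y) > 0) \<noteq> (f y (I y) > 0)"
        by (auto simp: lab_def split: if_splits)
      have "\<bar>f y (I y) / T y - f x (I y) / T x\<bar> < 1 / j" "\<bar>f z (I y) / T z - f x (I y) / T x\<bar> < 1 / j"
        using yz(1,2) I(1)[OF ys(1)] by (auto simp: U V_def dist_real_def abs_minus_commute)
      moreover have "1 / j \<le> \<bar>f y (I y) / T y\<bar>" "1 / j \<le> \<bar>f z (I y) / T z\<bar>"
        using I(2)[OF ys(1)] I(2)[OF ys(2)] Ieq by auto
      moreover have "(f z (I y) / T z > 0) = (f z (I y) > 0)" "(f y (I y) / T y > 0) = (f y (I y) > 0)"
        using T ys by (simp_all add: zero_less_divide_iff) (metis less_asym)+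
      ultimately show False
        using sg by linarith
    qed
  next
    show "cross_sphere n \<subseteq> \<Union> (V ` cross_sphere n)"
      using j by (auto simp: V_def tX)
  next
    fix x assume x: "x \<in> cross_sphere n"
    have "f x (I x) \<noteq> 0" using I(2)[OF x] j by auto
    then show "lab (antipode x) = - lab x"
      using Iodd[OF x] odd[OF x I(1)[OF x]] by (auto simp: lab_def)
    show "\<bar>lab x\<bar> \<in> {1..int j}"
      using I(1)[OF x] by (auto simp: lab_def abs_mult)
  qed
qed

section \<open>Smooth functions with compact support\<close>

lemma partial_eqI: "(f has_derivative D) (at x) \<Longrightarrow> partial b f x = D b"
  unfolding partial_def by (metis frechet_derivative_at)

lemma has_derivative_grad:
  assumes "f differentiable (at x)"
  shows "(f has_derivative (\<lambda>h. grad f x \<bullet> h)) (at x)"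
proof -
  define D where "D = frechet_derivative f (at x)"
  have D: "(f has_derivative D) (at x)"
    using assms frechet_derivative_works D_def by blast
  have "D h = grad f x \<bullet> h" for h
  proof -
    have "D h = D (\<Sum>b\<in>Basis. (h \<bullet> b) *\<^sub>R b)" by (simp add: euclidean_representation)
    also have "\<dots> = (\<Sum>b\<in>Basis. (h \<bullet> b) * D b)"
      using has_derivative_linear[OF D] by (simp add: linear_sum linear_cmul)
    also have "\<dots> = grad f x \<bullet> h"
      by (simp add: grad_def partial_def D_def inner_sum_left inner_commute[of h] mult.commute)
    finally show ?thesis .
  qed
  then have "D = (\<lambda>h. grad f x \<bullet> h)" by blast
  with D show ?thesis by metis
qed

text \<open>For \<open>m = 0\<close> the usual smooth function that is flat at 0; the powers of
  \<open>1 / t\<close> make the family closed under differentiation.\<close>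

definition flat_exp :: "nat \<Rightarrow> real \<Rightarrow> real" where
  "flat_exp m t = (if t > 0 then (1 / t) ^ m * exp (- 1 / t) else 0)"

lemma flat_exp_tendsto_0: "(flat_exp m \<longlongrightarrow> 0) (at 0)"
proof -
  have "((\<lambda>t. (1 / t) ^ m * exp (- 1 / t)) \<longlongrightarrow> 0) (at_right (0::real))"
  proof -
    have "((\<lambda>x. x ^ m / exp x) \<longlongrightarrow> 0) (at_top :: real filter)"
      by (rule tendsto_power_div_exp_0)
    from filterlim_compose[OF this filterlim_inverse_at_top_right]
    show ?thesis by (simp add: exp_minus field_simps)
  qed
  then have "(flat_exp m \<longlongrightarrow> 0) (at_right 0)"
    by (rule Lim_transform_eventually)
       (auto simp: flat_exp_def eventually_at_right_less intro!: eventually_at_rightI[of 0 1])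
  moreover have "(flat_exp m \<longlongrightarrow> 0) (at_left 0)"
    by (rule tendsto_eventually) (auto simp: flat_exp_def intro!: eventually_at_leftI[of "-1" 0])
  ultimately show ?thesis
    by (simp add: filterlim_split_at)
qed

lemma DERIV_flat_exp:
  "(flat_exp m has_real_derivative flat_exp (m + 2) t - real m * flat_exp (m + 1) t) (at t)"
proof -
  consider "t > 0" | "t = 0" | "t < 0" by linarith
  then show ?thesis
  proof cases
    case 1
    have "((\<lambda>t. (1 / t) ^ m * exp (- 1 / t)) has_real_derivative
       flat_exp (m + 2) t - real m * flat_exp (m + 1) t) (at t)"
    proof -
      have d: "((\<lambda>t. 1 / t) has_real_derivative - ((1 / t) * (1 / t))) (at t)"
        using 1 by (auto intro!: derivative_eq_intros)
      have "((\<lambda>t. (1 / t) ^ m) has_real_derivative - (real m * (1 / t) ^ (m + 1))) (at t)"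
        using DERIV_power[OF d, of m] by (cases m) (simp_all add: algebra_simps)
      moreover have "((\<lambda>t. exp (- (1 / t))) has_real_derivative exp (- (1 / t)) * (1 / t * (1 / t))) (at t)"
        using DERIV_fun_exp[OF DERIV_minus[OF d]] by simp
      ultimately have "((\<lambda>t. (1 / t) ^ m * exp (- (1 / t))) has_real_derivative
         - (real m * (1 / t) ^ (m + 1)) * exp (- (1 / t)) + exp (- (1 / t)) * (1 / t * (1 / t)) * (1 / t) ^ m) (at t)"
        by (rule DERIV_mult)
      then show ?thesis using 1 by (simp add: flat_exp_def algebra_simps)
    qed
    moreover have "\<forall>\<^sub>F x in nhds t. (1 / x) ^ m * exp (- 1 / x) = flat_exp m x"
      using 1 eventually_nhds_in_open[of "{0<..}" t] by (auto elim!: eventually_mono simp: flat_exp_def)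
    ultimately show ?thesis
      by (subst DERIV_cong_ev[OF refl _ refl, symmetric])
  next
    case 2
    \<comment> \<open>At 0 the difference quotient is itself a member of the family, so its limit is
      already known.\<close>
    have "(\<lambda>h. flat_exp m h / h) = flat_exp (m + 1)"
      by (auto simp: flat_exp_def fun_eq_iff)
    then show ?thesis
      using flat_exp_tendsto_0[of "m + 1"] 2 by (simp add: DERIV_def) (simp add: flat_exp_def)
  next
    case 3
    have "\<forall>\<^sub>F x in nhds t. 0 = flat_exp m x"
      using 3 eventually_nhds_in_open[of "{..<0}" t] by (auto elim!: eventually_mono simp: flat_exp_def)
    moreover have "((\<lambda>_. 0) has_real_derivative 0) (at t)" by simp
    ultimately have "(flat_exp m has_real_derivative 0) (at t)"
      by (subst DERIV_cong_ev[OF refl _ refl, symmetric, where f="\<lambda>_. 0"])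
    then show ?thesis
      using 3 by (simp add: flat_exp_def)
  qed
qed

text \<open>A syntactic algebra closed under partial derivatives. Smoothness of all orders follows
  by one induction, and the algebra contains both the polynomials and the bumps needed for
  approximation.\<close>

inductive smooth_alg :: "('a::euclidean_space \<Rightarrow> real) \<Rightarrow> bool" where
  const: "smooth_alg (\<lambda>x. c)"
| inner: "smooth_alg (\<lambda>x. x \<bullet> b)"
| bump: "smooth_alg (\<lambda>x. flat_exp m (r - (x - a) \<bullet> (x - a)))"
| add: "smooth_alg f \<Longrightarrow> smooth_alg g \<Longrightarrow> smooth_alg (\<lambda>x. f x + g x)"
| mult: "smooth_alg f \<Longrightarrow> smooth_alg g \<Longrightarrow> smooth_alg (\<lambda>x. f x * g x)"

lemma smooth_alg_sum: "(\<And>i. i \<in> I \<Longrightarrow> smooth_alg (f i)) \<Longrightarrow> smooth_alg (\<lambda>x. \<Sum>i\<in>I. f i x)"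
  by (induction I rule: infinite_finite_induct) (auto intro: smooth_alg.intros)

lemma smooth_alg_derivative:
  assumes "smooth_alg f"
  shows "\<exists>D. (\<forall>x. (f has_derivative D x) (at x)) \<and> (\<forall>b. smooth_alg (\<lambda>x. D x b))"
  using assms
proof induction
  case (const c)
  then show ?case by (intro exI[of _ "\<lambda>_ _. 0"]) (auto intro: smooth_alg.intros)
next
  case (inner b)
  then show ?case by (intro exI[of _ "\<lambda>_ h. h \<bullet> b"]) (auto intro: smooth_alg.intros derivative_intros)
next
  case (bump m r a)
  let ?q = "\<lambda>x::'a. r - (x - a) \<bullet> (x - a)"
  let ?D = "\<lambda>x h. (- 2 * ((x - a) \<bullet> h)) * (flat_exp (m + 2) (?q x) - real m * flat_exp (m + 1) (?q x))"
  have "((\<lambda>x. flat_exp m (?q x)) has_derivative ?D x) (at x)" for x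
  proof -
    have "(?q has_derivative (\<lambda>h. - 2 * ((x - a) \<bullet> h))) (at x)"
      by (auto intro!: derivative_eq_intros simp: inner_commute)
    from DERIV_compose_FDERIV[OF DERIV_flat_exp this, of m]
    show ?thesis by (simp add: mult.commute)
  qed
  moreover have "smooth_alg (\<lambda>x. ?D x b)" for b
  proof -
    have "smooth_alg (\<lambda>x. ((-2) * (x \<bullet> b) + 2 * (a \<bullet> b)) *
        (flat_exp (m + 2) (?q x) + (- real m) * flat_exp (m + 1) (?q x)))"
      by (intro smooth_alg.intros)
    then show ?thesis by (simp add: inner_diff_left algebra_simps)
  qed
  ultimately have "(\<forall>x. ((\<lambda>x. flat_exp m (?q x)) has_derivative ?D x) (at x)) \<and>
      (\<forall>b. smooth_alg (\<lambda>x. ?D x b))"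
    by blast
  then show ?case by (rule exI[where x="?D"])
next
  case (add f g)
  then obtain D E where "\<forall>x. (f has_derivative D x) (at x)" "\<forall>b. smooth_alg (\<lambda>x. D x b)"
    "\<forall>x. (g has_derivative E x) (at x)" "\<forall>b. smooth_alg (\<lambda>x. E x b)" by blast
  then show ?case
    by (intro exI[of _ "\<lambda>x h. D x h + E x h"]) (auto intro: smooth_alg.intros derivative_intros)
next
  case (mult f g)
  then obtain D E where "\<forall>x. (f has_derivative D x) (at x)" "\<forall>b. smooth_alg (\<lambda>x. D x b)"
    "\<forall>x. (g has_derivative E x) (at x)" "\<forall>b. smooth_alg (\<lambda>x. E x b)" by blast
  then show ?case using mult.hyps
    by (intro exI[of _ "\<lambda>x h. f x * E x h + D x h * g x"]) (auto intro!: smooth_alg.intros derivative_intros)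
qed

lemma smooth_alg_differentiable: "smooth_alg f \<Longrightarrow> f differentiable (at x)"
  using smooth_alg_derivative differentiable_def by blast

lemma smooth_alg_continuous: "smooth_alg f \<Longrightarrow> continuous_on UNIV f"
  by (meson differentiable_imp_continuous_within smooth_alg_differentiable continuous_at_imp_continuous_on)

lemma smooth_alg_partial: "smooth_alg f \<Longrightarrow> smooth_alg (partial b f)"
proof -
  assume "smooth_alg f"
  then obtain D where D: "\<forall>x. (f has_derivative D x) (at x)" "\<forall>b. smooth_alg (\<lambda>x. D x b)"
    using smooth_alg_derivative by blast
  then have "partial b f = (\<lambda>x. D x b)" by (auto intro!: partial_eqI)
  with D show ?thesis by simp
qed

lemma smooth_alg_C_k: "smooth_alg f \<Longrightarrow> C_k k f"
  by (induction k arbitrary: f)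
     (auto intro: smooth_alg_continuous smooth_alg_differentiable smooth_alg_partial)

lemma smooth_alg_polynomial:
  "real_polynomial_function p \<Longrightarrow> smooth_alg (p :: 'a::euclidean_space \<Rightarrow> real)"
proof (induction rule: real_polynomial_function.induct)
  case (linear f)
  then interpret bounded_linear f .
  have "f = (\<lambda>x. \<Sum>b\<in>Basis. f b * (x \<bullet> b))"
  proof
    fix x
    have "f x = f (\<Sum>b\<in>Basis. (x \<bullet> b) *\<^sub>R b)" by (simp add: euclidean_representation)
    then show "f x = (\<Sum>b\<in>Basis. f b * (x \<bullet> b))" by (simp add: sum scaleR mult.commute)
  qed
  moreover have "smooth_alg (\<lambda>x. \<Sum>b\<in>Basis. f b * (x \<bullet> b))"
    by (intro smooth_alg_sum smooth_alg.intros)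
  ultimately show ?case by simp
qed (auto intro: smooth_alg.intros)

section \<open>Functions of class \<open>C_k\<close> and test functions\<close>

lemma C_k_affine:
  assumes "C_k k f"
  shows "C_k k (\<lambda>x. f (x - a) * c)"
  using assms
proof (induction k arbitrary: f c)
  case 0
  then have "continuous_on UNIV (f \<circ> (\<lambda>x. x - a))"
    by (intro continuous_on_compose continuous_intros) (auto intro: continuous_on_subset)
  then show ?case by (auto intro!: continuous_intros simp: o_def)
next
  case (Suc k)
  have D: "((\<lambda>x. f (x - a) * c) has_derivative (\<lambda>h. (grad f (x - a) \<bullet> h) * c)) (at x)" for x
  proof -
    have "((\<lambda>x. x - a) has_derivative (\<lambda>h. h)) (at x)" by (auto intro!: derivative_eq_intros)
    moreover have "(f has_derivative (\<lambda>h. grad f (x - a) \<bullet> h)) (at (x - a))"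
      using Suc.prems by (intro has_derivative_grad) auto
    ultimately have "((\<lambda>x. f (x - a)) has_derivative (\<lambda>h. grad f (x - a) \<bullet> h)) (at x)"
      by (rule has_derivative_compose)
    then show ?thesis by (auto intro!: derivative_eq_intros)
  qed
  have "partial b (\<lambda>x. f (x - a) * c) = (\<lambda>x. partial b f (x - a) * c)" for b
  proof
    fix x
    have "partial b f (x - a) = grad f (x - a) \<bullet> b"
      using Suc.prems by (intro partial_eqI has_derivative_grad) auto
    with partial_eqI[OF D] show "partial b (\<lambda>x. f (x - a) * c) x = partial b f (x - a) * c" by simp
  qed
  moreover have "(\<lambda>x. f (x - a) * c) differentiable (at x)" for x
    using D differentiable_def by blast
  ultimately show ?case using Suc by simp
qed

lemma C_k_add:
  assumes "C_k k f" "C_k k g"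
  shows "C_k k (\<lambda>x. f x + g x)"
  using assms
proof (induction k arbitrary: f g)
  case 0
  then show ?case by (auto intro!: continuous_intros)
next
  case (Suc k)
  have D: "((\<lambda>x. f x + g x) has_derivative (\<lambda>h. grad f x \<bullet> h + grad g x \<bullet> h)) (at x)" for x
    using Suc.prems by (intro has_derivative_add has_derivative_grad) auto
  have "partial b (\<lambda>x. f x + g x) = (\<lambda>x. partial b f x + partial b g x)" for b
  proof
    fix x
    have "partial b f x = grad f x \<bullet> b" "partial b g x = grad g x \<bullet> b"
      using Suc.prems by (auto intro!: partial_eqI has_derivative_grad)
    with partial_eqI[OF D] show "partial b (\<lambda>x. f x + g x) x = partial b f x + partial b g x" by simp
  qed
  moreover have "(\<lambda>x. f x + g x) differentiable (at x)" for x
    using D differentiable_def by blast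
  ultimately show ?case using Suc by simp
qed

lemma test_functionsD:
  assumes "\<phi> \<in> test_functions U"
  shows "C_k k \<phi>" "\<phi> differentiable (at x)" "continuous_on UNIV \<phi>" "continuous_on UNIV (partial b \<phi>)"
    "compact (closure {x. \<phi> x \<noteq> 0})" "closure {x. \<phi> x \<noteq> 0} \<subseteq> U" "x \<notin> U \<Longrightarrow> \<phi> x = 0"
    "x \<notin> closure {x. \<phi> x \<noteq> 0} \<Longrightarrow> \<phi> x = 0"
proof -
  have C: "C_k k \<phi>" for k using assms by (simp add: test_functions_def)
  show "C_k k \<phi>" by (rule C)
  show d: "\<phi> differentiable (at x)" for x using C[of "Suc 0"] by simp
  show "continuous_on UNIV \<phi>" using C[of 0] by simp
  show "compact (closure {x. \<phi> x \<noteq> 0})" "closure {x. \<phi> x \<noteq> 0} \<subseteq> U"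
    using assms by (auto simp: test_functions_def)
  then show "x \<notin> U \<Longrightarrow> \<phi> x = 0"  "x \<notin> closure {x. \<phi> x \<noteq> 0} \<Longrightarrow> \<phi> x = 0"
    using closure_subset[of "{x. \<phi> x \<noteq> 0}"] by auto
  show "continuous_on UNIV (partial b \<phi>)"
  proof -
    have "continuous_on UNIV (partial c \<phi>)" if "c \<in> Basis" for c
      using C[of "Suc 0"] that by simp
    then have "continuous_on UNIV (grad \<phi>)"
      unfolding grad_def by (intro continuous_intros) auto
    moreover have "partial b \<phi> = (\<lambda>x. grad \<phi> x \<bullet> b)"
      by (intro ext partial_eqI has_derivative_grad d)
    ultimately show ?thesis by (auto intro!: continuous_intros)
  qed
qed

lemma test_functions_cmult:
  assumes "\<phi> \<in> test_functions U"
  shows "(\<lambda>x. \<phi> x * c) \<in> test_functions U"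
proof -
  have "{x. \<phi> x * c \<noteq> 0} \<subseteq> {x. \<phi> x \<noteq> 0}" by auto
  then have "closure {x. \<phi> x * c \<noteq> 0} \<subseteq> closure {x. \<phi> x \<noteq> 0}" by (rule closure_mono)
  moreover from this have "compact (closure {x. \<phi> x * c \<noteq> 0})"
    by (metis test_functionsD(5)[OF assms] bounded_subset compact_eq_bounded_closed closed_closure)
  moreover have "C_k k (\<lambda>x. \<phi> x * c)" for k
    using C_k_affine[OF test_functionsD(1)[OF assms], of k 0 c] by simp
  ultimately show ?thesis
    using test_functionsD(6)[OF assms] by (auto simp: test_functions_def)
qed

lemma test_functionsI:
  assumes "smooth_alg \<phi>" "compact K" "K \<subseteq> U" "\<And>x. x \<notin> K \<Longrightarrow> \<phi> x = 0"
  shows "\<phi> \<in> test_functions U"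
proof -
  have "closure {x. \<phi> x \<noteq> 0} \<subseteq> K"
    by (rule closure_minimal) (use assms compact_imp_closed in auto)
  moreover from this have "compact (closure {x. \<phi> x \<noteq> 0})"
    by (meson assms(2) bounded_subset compact_eq_bounded_closed closed_closure)
  ultimately show ?thesis
    using assms smooth_alg_C_k by (auto simp: test_functions_def)
qed

text \<open>In place of mollification: \<open>\<sigma>\<close> is a finite sum of bumps, positive on
  \<open>K\<close> and supported in a compact \<open>L\<close>. The quotient of \<open>f\<close> by
  \<open>\<sigma>\<close> is continuous, so Stone--Weierstrass approximates it on \<open>L\<close>
  by a polynomial, and multiplying back by \<open>\<sigma>\<close> gives a test function.\<close>

lemma test_functions_dense:
  fixes f :: "'a::euclidean_space \<Rightarrow> real"
  assumes U: "open U" and K: "compact K" "K \<subseteq> U" and f: "continuous_on UNIV f" "\<And>x. x \<notin> K \<Longrightarrow> f x = 0"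
    and "e > 0"
  obtains \<psi> where "\<psi> \<in> test_functions U" "\<And>x. \<bar>\<psi> x - f x\<bar> \<le> e"
proof -
  have "\<exists>r>0. cball a r \<subseteq> U" if "a \<in> K" for a
    using U K(2) that unfolding open_contains_cball by auto
  then obtain r where r: "\<And>a. a \<in> K \<Longrightarrow> r a > 0 \<and> cball a (r a) \<subseteq> U" by metis
  obtain A where A: "A \<subseteq> K" "finite A" "K \<subseteq> (\<Union>a\<in>A. ball a (r a))"
  proof (rule compactE_image[OF K(1), of K "\<lambda>a. ball a (r a)"])
    show "K \<subseteq> (\<Union>a\<in>K. ball a (r a))" using r by fastforce
  qed auto
  define \<sigma> where "\<sigma> x = (\<Sum>a\<in>A. flat_exp 0 ((r a)\<^sup>2 - (x - a) \<bullet> (x - a)))" for x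
  define L where "L = (\<Union>a\<in>A. cball a (r a))"
  have s: "smooth_alg \<sigma>" unfolding \<sigma>_def by (intro smooth_alg_sum smooth_alg.bump)
  have LK: "compact L" "L \<subseteq> U" using A r by (auto simp: L_def intro!: compact_UN)
  have tm: "flat_exp 0 ((r a)\<^sup>2 - (x - a) \<bullet> (x - a)) \<ge> 0"
     "x \<in> ball a (r a) \<Longrightarrow> flat_exp 0 ((r a)\<^sup>2 - (x - a) \<bullet> (x - a)) > 0"
     "a \<in> K \<Longrightarrow> x \<notin> cball a (r a) \<Longrightarrow> flat_exp 0 ((r a)\<^sup>2 - (x - a) \<bullet> (x - a)) = 0" for a x
  proof -
    show "flat_exp 0 ((r a)\<^sup>2 - (x - a) \<bullet> (x - a)) \<ge> 0" by (simp add: flat_exp_def)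
    show "flat_exp 0 ((r a)\<^sup>2 - (x - a) \<bullet> (x - a)) > 0" if "x \<in> ball a (r a)"
    proof -
      have "(norm (x - a))\<^sup>2 < (r a)\<^sup>2"
        using that by (intro power_strict_mono) (auto simp: dist_norm norm_minus_commute)
      then show ?thesis by (simp add: flat_exp_def power2_norm_eq_inner)
    qed
    show "flat_exp 0 ((r a)\<^sup>2 - (x - a) \<bullet> (x - a)) = 0" if "a \<in> K" "x \<notin> cball a (r a)"
    proof -
      have "(r a)\<^sup>2 < (norm (x - a))\<^sup>2"
        using that r[of a] by (intro power_strict_mono) (auto simp: dist_norm norm_minus_commute)
      then show ?thesis by (simp add: flat_exp_def power2_norm_eq_inner)
    qed
  qed
  have s0: "\<sigma> x \<ge> 0" for x unfolding \<sigma>_def by (intro sum_nonneg tm)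
  have spos: "\<sigma> x > 0" if x: "x \<in> K" for x
  proof -
    obtain a where "a \<in> A" "x \<in> ball a (r a)" using A x by auto
    then show ?thesis unfolding \<sigma>_def using A tm by (intro sum_pos2[of A a]) auto
  qed
  have soff: "\<sigma> x = 0" if "x \<notin> L" for x
    unfolding \<sigma>_def using that A tm(3) by (intro sum.neutral) (auto simp: L_def)
  define h where "h x = (if \<sigma> x > 0 then f x / \<sigma> x else 0)" for x
  have cs: "continuous_on UNIV \<sigma>" by (rule smooth_alg_continuous[OF s])
  have ch: "continuous_on UNIV h"
  proof -
    have "open {x. \<sigma> x > 0}" using open_Collect_less[OF _ cs] by (simp add: continuous_on_const)
    moreover have "open (- K)" using K(1) compact_imp_closed by blast
    moreover have "continuous_on {x. \<sigma> x > 0} h"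
    proof (rule continuous_on_eq)
      show "continuous_on {x. \<sigma> x > 0} (\<lambda>x. f x / \<sigma> x)"
        by (intro continuous_intros continuous_on_subset[OF f(1)] continuous_on_subset[OF cs]) auto
    qed (simp add: h_def)
    moreover have "continuous_on (- K) h"
    proof (rule continuous_on_eq)
      show "continuous_on (- K) (\<lambda>x. 0 :: real)" by simp
    qed (auto simp: h_def f(2))
    ultimately have "continuous_on ({x. \<sigma> x > 0} \<union> - K) h"
      by (rule continuous_on_open_Un)
    moreover have "{x. \<sigma> x > 0} \<union> - K = UNIV" using spos by auto
    ultimately show ?thesis by simp
  qed
  have fh: "f x = \<sigma> x * h x" for x
    using s0[of x] spos[of x] f(2)[of x] by (cases "x \<in> K") (auto simp: h_def)
  obtain B where B: "B > 0" "\<And>x. x \<in> L \<Longrightarrow> \<sigma> x \<le> B"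
  proof -
    have "bounded (\<sigma> ` L)"
      by (intro compact_imp_bounded compact_continuous_image LK continuous_on_subset[OF cs]) auto
    then obtain B where B: "B > 0" "\<forall>y\<in>\<sigma> ` L. norm y \<le> B" unfolding bounded_pos by auto
    show ?thesis
    proof (rule that[OF B(1)])
      fix x assume "x \<in> L"
      then have "norm (\<sigma> x) \<le> B" using B(2) by simp
      then show "\<sigma> x \<le> B" by simp
    qed
  qed
  have "continuous_on L h" "e / B > 0"
    using continuous_on_subset[OF ch] \<open>e > 0\<close> B(1) by auto
  then obtain p where p: "real_polynomial_function p" "\<And>x. x \<in> L \<Longrightarrow> \<bar>h x - p x\<bar> < e / B"
    using Stone_Weierstrass_real_polynomial_function[OF LK(1), of h "e / B"] by metis
  show ?thesis
  proof
    show "(\<lambda>x. \<sigma> x * p x) \<in> test_functions U"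
      by (rule test_functionsI[OF _ LK]) (use s p smooth_alg_polynomial soff in \<open>auto intro: smooth_alg.mult\<close>)
    fix x
    show "\<bar>\<sigma> x * p x - f x\<bar> \<le> e"
    proof (cases "x \<in> L")
      case True
      have "\<bar>\<sigma> x * p x - f x\<bar> = \<sigma> x * \<bar>h x - p x\<bar>"
        using s0[of x] by (simp add: fh abs_mult flip: right_diff_distrib) (simp add: abs_minus_commute)
      also have "\<dots> \<le> B * (e / B)"
        using p(2)[OF True] B(2)[OF True] s0[of x] B(1) \<open>e > 0\<close> by (intro mult_mono) auto
      finally show ?thesis using B(1) by simp
    next
      case False
      then show ?thesis using \<open>e > 0\<close> by (simp add: soff fh)
    qed
  qed
qed

text \<open>The optimal weight would be the sign of \<open>g\<close> on \<open>U\<close>. It is an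
  almost everywhere limit of continuous functions, which are truncated, cut off near the boundary
  and replaced by test functions; dominated convergence then gives the integral.\<close>

lemma integral_abs_eq_SUP_test_functions:
  fixes g :: "'a::euclidean_space \<Rightarrow> real"
  assumes g: "integrable lborel g" and U: "open U" "bounded U" and "e > 0"
  obtains \<psi> where "\<psi> \<in> test_functions U" "\<And>x. \<bar>\<psi> x\<bar> \<le> 1"
    "(LBINT x. indicator U x * \<bar>g x\<bar>) \<le> (LBINT x. \<psi> x * g x) + e"
proof -
  have gm[measurable]: "g \<in> borel_measurable borel" using g by auto
  have Um[measurable]: "U \<in> sets borel" using U by auto
  define s where "s x = indicator U x * sgn (g x)" for x
  have sm[measurable]: "s \<in> borel_measurable borel"
    unfolding s_def by measurable
  have "s \<in> borel_measurable lborel" by simp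
  then have "s \<in> borel_measurable lebesgue" by (rule measurable_completion)
  then have "s measurable_on UNIV"
    by (intro lebesgue_measurable_imp_measurable_on) auto
  then obtain N where "negligible N" "\<exists>k. (\<forall>n. continuous_on UNIV (k n)) \<and>
      (\<forall>x. x \<notin> N \<longrightarrow> (\<lambda>n. k n x) \<longlonglongrightarrow> (if x \<in> UNIV then s x else 0))"
    unfolding measurable_on_def by (elim exE conjE) blast
  then obtain k where "negligible N" "\<forall>n. continuous_on UNIV (k n)"
     "\<forall>x. x \<notin> N \<longrightarrow> (\<lambda>n. k n x) \<longlonglongrightarrow> (if x \<in> UNIV then s x else 0)"
    by blast
  then have N: "negligible N" and k: "\<And>n. continuous_on UNIV (k n)"
     and lim: "\<And>x. x \<notin> N \<Longrightarrow> (\<lambda>n. k n x) \<longlonglongrightarrow> s x"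
    by simp_all
  \<comment> \<open>Zero within distance \<open>1 / n\<close> of the complement and one beyond
    \<open>2 / n\<close>, so the supports are compact in \<open>U\<close> and the cut-off tends to 1
    on \<open>U\<close>.\<close>
  define cut where "cut n x = max 0 (min 1 (real n * infdist x (- U) - 1))" for n x
  define c where "c n x = cut n x * max (- 1) (min 1 (k n x))" for n x
  have chi: "0 \<le> cut n x" "cut n x \<le> 1" for n x by (auto simp: cut_def)
  have Une: "- U \<noteq> {}"
  proof
    assume "- U = {}"
    then have "U = UNIV" by auto
    then show False using U(2) not_bounded_UNIV by metis
  qed
  have ex: "\<exists>\<psi>. \<psi> \<in> test_functions U \<and> (\<forall>x. \<bar>\<psi> x - c n x\<bar> \<le> 1 / (real n + 1))" for n
  proof -
    define K where "K = {x. infdist x (- U) * real n \<ge> 1}"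
    have KU: "K \<subseteq> U"
    proof
      fix x assume "x \<in> K"
      then have "infdist x (- U) \<noteq> 0" by (auto simp: K_def)
      then show "x \<in> U" using infdist_zero[of x "- U"] by blast
    qed
    have "closed K" unfolding K_def by (intro closed_Collect_le continuous_intros)
    then have "compact K" using bounded_subset[OF U(2) KU] by (simp add: compact_eq_bounded_closed)
    moreover have "continuous_on UNIV (c n)"
      unfolding c_def cut_def by (intro continuous_intros k)
    moreover have "c n x = 0" if "x \<notin> K" for x
      using that by (auto simp: c_def cut_def K_def mult.commute)
    moreover have "0 < 1 / (real n + 1)" by simp
    ultimately obtain \<phi> where "\<phi> \<in> test_functions U" "\<forall>x. \<bar>\<phi> x - c n x\<bar> \<le> 1 / (real n + 1)"
      by (rule_tac test_functions_dense[OF U(1) \<open>compact K\<close> KU, of "c n" "1 / (real n + 1)"]) auto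
    then show ?thesis by blast
  qed
  then have "\<exists>\<psi>. \<forall>n. \<psi> n \<in> test_functions U \<and> (\<forall>x. \<bar>\<psi> n x - c n x\<bar> \<le> 1 / (real n + 1))"
    by (intro choice allI)
  then obtain \<psi> where \<psi>: "\<And>n. \<psi> n \<in> test_functions U" "\<And>n x. \<bar>\<psi> n x - c n x\<bar> \<le> 1 / (real n + 1)"
    by blast
  \<comment> \<open>The approximation may exceed 1 by \<open>1 / (n + 1)\<close>; dividing restores
    the bound without affecting the limit.\<close>
  define w where "w n = (\<lambda>x. \<psi> n x * (1 / (1 + 1 / (real n + 1))))" for n
  have cn: "\<bar>c n x\<bar> \<le> 1" for n x
  proof -
    have "\<bar>c n x\<bar> = cut n x * \<bar>max (- 1) (min 1 (k n x))\<bar>" using chi by (simp add: c_def abs_mult)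
    also have "\<dots> \<le> 1 * 1" using chi by (intro mult_mono) auto
    finally show ?thesis by simp
  qed
  have w1: "\<bar>w n x\<bar> \<le> 1" for n x
  proof -
    have "\<bar>\<psi> n x\<bar> \<le> 1 + 1 / (real n + 1)" using \<psi>(2)[of n x] cn[of n x] by linarith
    moreover have q: "1 + 1 / (real n + 1) > 0" by (simp add: add_pos_pos)
    moreover have "\<bar>w n x\<bar> = \<bar>\<psi> n x\<bar> / (1 + 1 / (real n + 1))"
      unfolding w_def abs_mult abs_of_pos[OF divide_pos_pos[OF zero_less_one q]] by simp
    ultimately show ?thesis by (simp only: divide_le_eq_1_pos)
  qed
  have contk: "continuous_on UNIV (\<psi> n)" for n
    by (rule test_functionsD(3)[OF \<psi>(1)])
  have wlim: "(\<lambda>n. w n x) \<longlonglongrightarrow> s x" if "x \<notin> N" for x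
  proof -
    have "(\<lambda>n. c n x) \<longlonglongrightarrow> s x"
    proof (cases "x \<in> U")
      case True
      have d: "infdist x (- U) > 0"
        using True U(1) Une in_closed_iff_infdist_zero[of "- U" x] infdist_nonneg[of x "- U"]
        by (auto simp: less_le)
      have "\<forall>\<^sub>F n in sequentially. cut n x = 1"
      proof -
        obtain n0 :: nat where n0: "real n0 \<ge> 2 / infdist x (- U)" using real_arch_simple by blast
        have "cut n x = 1" if "n \<ge> n0" for n
        proof -
          have "real n \<ge> 2 / infdist x (- U)" using n0 that by linarith
          then have "real n * infdist x (- U) \<ge> 2" using d by (simp add: field_simps)
          then show ?thesis by (simp add: cut_def)
        qed
        then show ?thesis using eventually_sequentially by blast
      qed
      moreover have "(\<lambda>n. max (- 1) (min 1 (k n x))) \<longlonglongrightarrow> max (-1) (min 1 (s x))"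
        by (intro tendsto_intros lim that)
      moreover have "max (-1) (min 1 (s x)) = s x" by (auto simp: s_def sgn_if indicator_def)
      ultimately have "(\<lambda>n. max (- 1) (min 1 (k n x))) \<longlonglongrightarrow> s x" by simp
      then show ?thesis
      proof (rule Lim_transform_eventually)
        show "\<forall>\<^sub>F n in sequentially. max (- 1) (min 1 (k n x)) = c n x"
          using \<open>\<forall>\<^sub>F n in sequentially. cut n x = 1\<close> by eventually_elim (simp add: c_def)
      qed
    next
      case False
      then have "infdist x (- U) = 0" by simp
      then show ?thesis using False by (simp add: c_def cut_def s_def)
    qed
    moreover have "(\<lambda>n. \<psi> n x - c n x) \<longlonglongrightarrow> 0"
    proof (rule Lim_null_comparison)
      show "\<forall>\<^sub>F n in sequentially. norm (\<psi> n x - c n x) \<le> 1 / (real n + 1)"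
        using \<psi>(2) by simp
      show "(\<lambda>n. 1 / (real n + 1)) \<longlonglongrightarrow> 0" by real_asymp
    qed
    ultimately have "(\<lambda>n. (\<psi> n x - c n x) + c n x) \<longlonglongrightarrow> 0 + s x" by (intro tendsto_add)
    then have "(\<lambda>n. \<psi> n x) \<longlonglongrightarrow> s x" by simp
    moreover have "(\<lambda>n. 1 / (1 + 1 / (real n + 1))) \<longlonglongrightarrow> 1"
      by real_asymp
    ultimately have "(\<lambda>n. \<psi> n x * (1 / (1 + 1 / (real n + 1)))) \<longlonglongrightarrow> s x * 1"
      by (rule tendsto_mult)
    then show ?thesis unfolding w_def by simp
  qed
  have "(\<lambda>n. \<integral>x. w n x * g x \<partial>lborel) \<longlonglongrightarrow> (LBINT x. s x * g x)"
  proof (rule integral_dominated_convergence)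
    show "integrable lborel (\<lambda>x. \<bar>g x\<bar>)" using g by simp
    show "(\<lambda>x. w n x * g x) \<in> borel_measurable lborel" for n
      using borel_measurable_continuous_onI[OF contk[of n]] unfolding w_def by measurable
    show "(\<lambda>x. s x * g x) \<in> borel_measurable lborel" by measurable
    have "AE x in lborel. x \<notin> N"
      using N AE_not_in[of N lebesgue] by (simp add: negligible_iff_null_sets AE_completion_iff)
    then show "AE x in lborel. (\<lambda>n. w n x * g x) \<longlonglongrightarrow> s x * g x"
      by eventually_elim (intro tendsto_intros wlim)
    show "AE x in lborel. norm (w n x * g x) \<le> \<bar>g x\<bar>" for n
      using w1[of n] by (auto simp: abs_mult intro!: mult_left_le_one_le)
  qed
  moreover have "(LBINT x. s x * g x) = (LBINT x. indicator U x * \<bar>g x\<bar>)"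
    by (intro Bochner_Integration.integral_cong refl) (auto simp: s_def sgn_if indicator_def)
  ultimately have "\<forall>\<^sub>F n in sequentially. (LBINT x. w n x * g x) > (LBINT x. indicator U x * \<bar>g x\<bar>) - e"
    using \<open>e > 0\<close> by (intro order_tendstoD(1)) auto
  then obtain n where n: "(LBINT x. w n x * g x) > (LBINT x. indicator U x * \<bar>g x\<bar>) - e"
    by (auto simp: eventually_sequentially)
  show ?thesis
  proof
    show "w n \<in> test_functions U"
      unfolding w_def using \<psi>(1) by (intro test_functions_cmult) simp
  qed (use n w1 in auto)
qed

section \<open>The variation of an integrable function\<close>

lemma test_fieldsD:
  assumes "\<phi> \<in> test_fields U"
  shows "b \<in> Basis \<Longrightarrow> (\<lambda>x. \<phi> x \<bullet> b) \<in> test_functions U"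
    "continuous_on UNIV \<phi>" "continuous_on UNIV (divergence \<phi>)"
    "\<exists>K. compact K \<and> K \<subseteq> U \<and> (\<forall>x. x \<notin> K \<longrightarrow> \<phi> x = 0 \<and> divergence \<phi> x = 0)"
proof -
  show c: "b \<in> Basis \<Longrightarrow> (\<lambda>x. \<phi> x \<bullet> b) \<in> test_functions U" for b
    using assms by (simp add: test_fields_def)
  have "continuous_on UNIV (\<lambda>x. \<Sum>b\<in>Basis. (\<phi> x \<bullet> b) *\<^sub>R b)"
  proof (rule continuous_on_sum)
    show "continuous_on UNIV (\<lambda>x. (\<phi> x \<bullet> b) *\<^sub>R b)" if "b \<in> Basis" for b
      by (rule continuous_on_scaleR[OF test_functionsD(3)[OF c[OF that]] continuous_on_const])
  qed
  then show "continuous_on UNIV \<phi>" by (simp add: euclidean_representation)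
  show "continuous_on UNIV (divergence \<phi>)"
    unfolding divergence_def
  proof (rule continuous_on_sum)
    show "continuous_on UNIV (partial b (\<lambda>y. \<phi> y \<bullet> b))" if "b \<in> Basis" for b
      by (rule test_functionsD(4)[OF c[OF that]])
  qed
  define K where "K = (\<Union>b\<in>Basis. closure {x. \<phi> x \<bullet> b \<noteq> 0})"
  have "compact K"
    unfolding K_def
  proof (rule compact_UN)
    show "compact (closure {x. \<phi> x \<bullet> b \<noteq> 0})" if "b \<in> Basis" for b
      by (rule test_functionsD(5)[OF c[OF that]])
  qed simp
  moreover have "K \<subseteq> U"
    unfolding K_def
  proof (rule UN_least)
    show "closure {x. \<phi> x \<bullet> b \<noteq> 0} \<subseteq> U" if "b \<in> Basis" for b
      by (rule test_functionsD(6)[OF c[OF that]])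
  qed
  moreover have "\<phi> x = 0 \<and> divergence \<phi> x = 0" if x: "x \<notin> K" for x
  proof
    have nK: "x \<notin> closure {x. \<phi> x \<bullet> b \<noteq> 0}" if "b \<in> Basis" for b
      using x that unfolding K_def by blast
    have "\<phi> x \<bullet> b = 0" if "b \<in> Basis" for b
      by (rule test_functionsD(8)[OF c[OF that] nK[OF that]])
    then show "\<phi> x = 0" by (simp add: euclidean_eq_iff[of "\<phi> x" 0])
    have "partial b (\<lambda>y. \<phi> y \<bullet> b) x = 0" if b: "b \<in> Basis" for b
    proof (rule partial_eqI[where D="\<lambda>_. 0"])
      have op: "open (- closure {x. \<phi> x \<bullet> b \<noteq> 0})" by (rule open_Compl[OF closed_closure])
      have eq: "0 = \<phi> y \<bullet> b" if "y \<in> - closure {x. \<phi> x \<bullet> b \<noteq> 0}" for y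
        by (rule test_functionsD(8)[OF c[OF b], symmetric]) (use that in \<open>rule ComplD\<close>)
      have "x \<in> - closure {x. \<phi> x \<bullet> b \<noteq> 0}" using nK[OF b] by simp
      from has_derivative_transform_within_open[OF has_derivative_const op this eq]
      show "((\<lambda>y. \<phi> y \<bullet> b) has_derivative (\<lambda>_. 0)) (at x)" .
    qed
    then show "divergence \<phi> x = 0" by (simp add: divergence_def)
  qed
  ultimately show "\<exists>K. compact K \<and> K \<subseteq> U \<and> (\<forall>x. x \<notin> K \<longrightarrow> \<phi> x = 0 \<and> divergence \<phi> x = 0)"
    by (intro exI[of _ K] conjI) simp_all
qed

lemma test_functions_mono: "U \<subseteq> V \<Longrightarrow> test_functions U \<subseteq> test_functions V"
  by (auto simp: test_functions_def)

lemma test_fields_mono: "U \<subseteq> V \<Longrightarrow> test_fields U \<subseteq> test_fields V"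
  unfolding test_fields_def using test_functions_mono[of U V] by blast

lemma nn_integral_lborel_translate:
  fixes f :: "'a::euclidean_space \<Rightarrow> ennreal"
  assumes [measurable]: "f \<in> borel_measurable borel"
  shows "(\<integral>\<^sup>+x. f (x + z) \<partial>lborel) = (\<integral>\<^sup>+x. f x \<partial>lborel)"
proof -
  have "(\<integral>\<^sup>+x. f x \<partial>lborel) = (\<integral>\<^sup>+x. f x \<partial>distr lborel borel ((+) z))"
    by (simp add: lborel_distr_plus)
  also have "\<dots> = (\<integral>\<^sup>+x. f (z + x) \<partial>lborel)"
    by (intro nn_integral_distr) auto
  finally show ?thesis by (simp add: add.commute)
qed

lemma integral_lborel_translate:
  fixes f :: "'a::euclidean_space \<Rightarrow> real"
  assumes [measurable]: "f \<in> borel_measurable borel"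
  shows "(LBINT x. f (x + z)) = (LBINT x. f x)"
    "integrable lborel (\<lambda>x. f (x + z)) \<longleftrightarrow> integrable lborel f"
proof -
  have "(LBINT x. f x) = (\<integral>x. f x \<partial>distr lborel borel ((+) z))"
    by (simp add: lborel_distr_plus)
  also have "\<dots> = (LBINT x. f (z + x))"
    by (intro integral_distr) auto
  finally show "(LBINT x. f (x + z)) = (LBINT x. f x)" by (simp add: add.commute)
  have "integrable lborel f \<longleftrightarrow> integrable (distr lborel borel ((+) z)) f"
    by (simp add: lborel_distr_plus)
  also have "\<dots> \<longleftrightarrow> integrable lborel (\<lambda>x. f (z + x))"
    by (intro integrable_distr_eq) auto
  finally show "integrable lborel (\<lambda>x. f (x + z)) \<longleftrightarrow> integrable lborel f" by (simp add: add.commute)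
qed

lemma bounded_continuous_compact_support:
  fixes g :: "'a::euclidean_space \<Rightarrow> 'b::euclidean_space"
  assumes "continuous_on UNIV g" "compact K" "\<And>x. x \<notin> K \<Longrightarrow> g x = 0"
  obtains B where "B > 0" "\<And>x. norm (g x) \<le> B"
proof -
  have "compact (g ` K)" using assms by (intro compact_continuous_image) (auto intro: continuous_on_subset)
  then obtain B where B: "B > 0" "\<forall>y\<in>g ` K. norm y \<le> B"
    using compact_imp_bounded bounded_pos by metis
  show ?thesis
  proof (rule that[OF B(1)])
    fix x show "norm (g x) \<le> B" using B assms(3)[of x] by (cases "x \<in> K") auto
  qed
qed

lemma integrable_mult_bounded_continuous:
  fixes f g :: "'a::euclidean_space \<Rightarrow> real"
  assumes f: "integrable lborel f" and g: "continuous_on UNIV g" "\<And>x. \<bar>g x\<bar> \<le> B"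
  shows "integrable lborel (\<lambda>x. f x * g x)"
proof (rule Bochner_Integration.integrable_bound)
  show "integrable lborel (\<lambda>x. f x * B)" using f by simp
  show "(\<lambda>x. f x * g x) \<in> borel_measurable lborel"
    using f borel_measurable_continuous_onI[OF g(1)] by measurable
  have "\<bar>g x\<bar> \<le> \<bar>B\<bar>" for x using g(2)[of x] by linarith
  then show "AE x in lborel. norm (f x * g x) \<le> norm (f x * B)"
    by (auto simp: abs_mult intro!: mult_left_mono)
qed

lemma integrable_mult_divergence:
  assumes "integrable lborel f" "\<phi> \<in> test_fields U"
  shows "integrable lborel (\<lambda>x. f x * divergence \<phi> x)"
proof -
  obtain K where K: "compact K" "\<forall>x. x \<notin> K \<longrightarrow> divergence \<phi> x = 0"
    using test_fieldsD(4)[OF assms(2)] by auto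
  obtain B where "\<And>x. norm (divergence \<phi> x) \<le> B"
    using bounded_continuous_compact_support[OF test_fieldsD(3)[OF assms(2)] K(1)] K(2) by metis
  then show ?thesis
    by (intro integrable_mult_bounded_continuous[OF assms(1) test_fieldsD(3)[OF assms(2)]]) auto
qed

lemma borel_measurable_rep_L0 [measurable]: "rep_L0 v \<in> borel_measurable lebesgue"
proof -
  have "ae_eq (rep_L0 v) (rep_L0 v)"
    using Quotient3_rep_reflp[OF Quotient3_L0] by blast
  then show ?thesis by (simp add: ae_eq_def)
qed

section \<open>The variation of a Borel function as a set function\<close>

definition tv :: "'a::euclidean_space set \<Rightarrow> ('a \<Rightarrow> real) \<Rightarrow> ereal" where
  "tv U f = (SUP \<phi> \<in> {\<phi> \<in> test_fields U. \<forall>x. norm (\<phi> x) \<le> 1}.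
     ereal (LBINT x. f x * divergence \<phi> x))"

lemma zero_test_field: "(\<lambda>x. 0) \<in> test_fields U"
proof -
  have "(\<lambda>x::'a. 0::real) \<in> test_functions U"
    by (rule test_functionsI[of _ "{}"]) (auto intro: smooth_alg.const)
  then show ?thesis by (simp add: test_fields_def)
qed

lemma tv_upper:
  "\<phi> \<in> test_fields U \<Longrightarrow> (\<And>x. norm (\<phi> x) \<le> 1) \<Longrightarrow> ereal (LBINT x. f x * divergence \<phi> x) \<le> tv U f"
  unfolding tv_def by (intro SUP_upper) auto

lemma tv_nonneg: "0 \<le> tv U f"
proof -
  have "ereal (LBINT x. f x * divergence (\<lambda>x. 0) x) \<le> tv U f"
    by (rule tv_upper) (auto simp: zero_test_field)
  moreover have "divergence (\<lambda>x::'a. 0::'a) = (\<lambda>x. 0)"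
    by (intro ext) (simp add: divergence_def partial_def)
  ultimately show ?thesis by (simp add: zero_ereal_def)
qed

lemma tv_mono: "U \<subseteq> V \<Longrightarrow> tv U f \<le> tv V f"
  unfolding tv_def using test_fields_mono[of U V] by (intro SUP_subset_mono) auto

lemma total_variation_eq_tv:
  assumes "open U" and f: "f \<in> borel_measurable borel" "AE x in lborel. x \<in> U \<longrightarrow> rep_L0 v x = f x"
  shows "total_variation U v = tv U f"
  unfolding total_variation_def tv_def
proof (intro SUP_cong refl arg_cong[where f=ereal])
  fix \<phi> assume "\<phi> \<in> {\<phi> \<in> test_fields U. \<forall>x. norm (\<phi> x) \<le> 1}"
  then have \<phi>: "\<phi> \<in> test_fields U" by auto
  have d: "divergence \<phi> x = 0" if "x \<notin> U" for x using test_fieldsD(4)[OF \<phi>] that by blast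
  have [measurable]: "divergence \<phi> \<in> borel_measurable borel"
    using test_fieldsD(3)[OF \<phi>] borel_measurable_continuous_onI by blast
  have m: "(\<lambda>x. f x * divergence \<phi> x) \<in> borel_measurable lborel" using f by measurable
  have m2: "divergence \<phi> \<in> borel_measurable lebesgue" by (rule measurable_completion) simp
  have "(\<integral>x. rep_L0 v x * divergence \<phi> x \<partial>lebesgue_on U) =
        (\<integral>x. indicator U x *\<^sub>R (rep_L0 v x * divergence \<phi> x) \<partial>lebesgue)"
    using assms(1) by (intro integral_restrict_space) auto
  also have "\<dots> = (\<integral>x. f x * divergence \<phi> x \<partial>lebesgue)"
  proof (rule integral_cong_AE)
    show "(\<lambda>x. indicator U x *\<^sub>R (rep_L0 v x * divergence \<phi> x)) \<in> borel_measurable lebesgue"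
    proof -
      have "U \<in> sets lebesgue" using assms(1) by (intro sets_completionI_sets) auto
      then show ?thesis
        using m2 by (intro borel_measurable_scaleR borel_measurable_times borel_measurable_indicator) auto
    qed
    show "(\<lambda>x. f x * divergence \<phi> x) \<in> borel_measurable lebesgue"
      using m by (rule measurable_completion)
    have "AE x in lebesgue. x \<in> U \<longrightarrow> rep_L0 v x = f x" using f(2) by (simp add: AE_completion_iff)
    then show "AE x in lebesgue. indicator U x *\<^sub>R (rep_L0 v x * divergence \<phi> x) = f x * divergence \<phi> x"
      by eventually_elim (auto simp: d indicator_def)
  qed
  also have "\<dots> = (LBINT x. f x * divergence \<phi> x)" using m by (rule integral_completion)
  finally show "(\<integral>x. rep_L0 v x * divergence \<phi> x \<partial>lebesgue_on U) = (LBINT x. f x * divergence \<phi> x)" .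
qed

lemma test_functions_add:
  assumes "\<phi> \<in> test_functions U" "\<psi> \<in> test_functions U"
  shows "(\<lambda>x. \<phi> x + \<psi> x) \<in> test_functions U"
proof -
  let ?A = "closure {x. \<phi> x \<noteq> 0}" and ?B = "closure {x. \<psi> x \<noteq> 0}"
  have "{x. \<phi> x + \<psi> x \<noteq> 0} \<subseteq> ?A \<union> ?B"
    using closure_subset[of "{x. \<phi> x \<noteq> 0}"] closure_subset[of "{x. \<psi> x \<noteq> 0}"] by fastforce
  then have s: "closure {x. \<phi> x + \<psi> x \<noteq> 0} \<subseteq> ?A \<union> ?B" by (intro closure_minimal) auto
  moreover have "compact (?A \<union> ?B)"
    using test_functionsD(5)[OF assms(1)] test_functionsD(5)[OF assms(2)] by (rule compact_Un)
  ultimately have "compact (closure {x. \<phi> x + \<psi> x \<noteq> 0})"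
    by (meson bounded_subset compact_eq_bounded_closed closed_closure)
  moreover have "closure {x. \<phi> x + \<psi> x \<noteq> 0} \<subseteq> U"
    using s test_functionsD(6)[OF assms(1)] test_functionsD(6)[OF assms(2)] by auto
  ultimately show ?thesis
    using C_k_add[OF test_functionsD(1)[OF assms(1)] test_functionsD(1)[OF assms(2)]]
    by (simp add: test_functions_def)
qed

lemma test_fields_add:
  assumes "\<phi> \<in> test_fields U" "\<psi> \<in> test_fields U"
  shows "(\<lambda>x. \<phi> x + \<psi> x) \<in> test_fields U"
    "divergence (\<lambda>x. \<phi> x + \<psi> x) x = divergence \<phi> x + divergence \<psi> x"
proof -
  show "(\<lambda>x. \<phi> x + \<psi> x) \<in> test_fields U"
    using test_functions_add[OF test_fieldsD(1)[OF assms(1)] test_fieldsD(1)[OF assms(2)]]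
    by (auto simp: test_fields_def inner_add_left)
  have "partial b (\<lambda>y. (\<phi> y + \<psi> y) \<bullet> b) x = partial b (\<lambda>y. \<phi> y \<bullet> b) x + partial b (\<lambda>y. \<psi> y \<bullet> b) x"
    if b: "b \<in> Basis" for b
  proof -
    have d: "(\<lambda>y. \<phi> y \<bullet> b) differentiable at x" "(\<lambda>y. \<psi> y \<bullet> b) differentiable at x"
      using test_functionsD(2)[OF test_fieldsD(1)[OF assms(1) b]] test_functionsD(2)[OF test_fieldsD(1)[OF assms(2) b]]
      by auto
    have "((\<lambda>y. (\<phi> y + \<psi> y) \<bullet> b) has_derivative
        (\<lambda>h. grad (\<lambda>y. \<phi> y \<bullet> b) x \<bullet> h + grad (\<lambda>y. \<psi> y \<bullet> b) x \<bullet> h)) (at x)"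
      unfolding inner_add_left by (intro has_derivative_add has_derivative_grad d)
    from partial_eqI[OF this, of b] partial_eqI[OF has_derivative_grad[OF d(1)], of b]
      partial_eqI[OF has_derivative_grad[OF d(2)], of b]
    show ?thesis by simp
  qed
  then show "divergence (\<lambda>x. \<phi> x + \<psi> x) x = divergence \<phi> x + divergence \<psi> x"
    by (simp add: divergence_def sum.distrib)
qed

text \<open>The sum of two fields with disjoint supports is still bounded by 1. Superadditivity on
  disjoint sets and tightness both follow from this.\<close>

lemma tv_add_test_field:
  assumes f: "integrable lborel f" and \<phi>: "\<phi> \<in> test_fields U" "\<And>x. norm (\<phi> x) \<le> 1"
    and V: "V \<subseteq> U" and disj: "\<And>x. x \<in> V \<Longrightarrow> \<phi> x = 0"
  shows "ereal (LBINT x. f x * divergence \<phi> x) + tv V f \<le> tv U f"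
proof -
  let ?I = "\<lambda>\<phi>. \<integral>x. f x * divergence \<phi> x \<partial>lborel"
  have *: "ereal (?I \<psi>) \<le> tv U f - ereal (?I \<phi>)" if \<psi>: "\<psi> \<in> test_fields V" "\<forall>x. norm (\<psi> x) \<le> 1" for \<psi>
  proof -
    have \<psi>U: "\<psi> \<in> test_fields U" using \<psi>(1) test_fields_mono[OF V] by blast
    have "norm (\<phi> x + \<psi> x) \<le> 1" for x
    proof (cases "x \<in> V")
      case True then show ?thesis using disj \<psi>(2) by simp
    next
      case False
      then have "\<psi> x = 0" using test_fieldsD(4)[OF \<psi>(1)] by blast
      then show ?thesis using \<phi>(2) by simp
    qed
    then have "ereal (?I (\<lambda>x. \<phi> x + \<psi> x)) \<le> tv U f"
      by (intro tv_upper test_fields_add(1) \<phi> \<psi>U)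
    moreover have "?I (\<lambda>x. \<phi> x + \<psi> x) = ?I \<phi> + ?I \<psi>"
      unfolding test_fields_add(2)[OF \<phi>(1) \<psi>U] distrib_left
      by (rule Bochner_Integration.integral_add[OF integrable_mult_divergence[OF f \<phi>(1)]
            integrable_mult_divergence[OF f \<psi>U]])
    ultimately show ?thesis by (cases "tv U f") auto
  qed
  then have "tv V f \<le> tv U f - ereal (?I \<phi>)"
    unfolding tv_def[of V] by (intro SUP_least) auto
  then show ?thesis by (cases "tv U f"; cases "tv V f") auto
qed

lemma tv_disjoint_add:
  assumes f: "integrable lborel f" and "U \<inter> V = {}" "U \<union> V \<subseteq> W"
  shows "tv U f + tv V f \<le> tv W f"
proof -
  have "ereal (LBINT x. f x * divergence \<phi> x) \<le> tv W f - tv V f"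
    if \<phi>: "\<phi> \<in> test_fields U" "\<forall>x. norm (\<phi> x) \<le> 1" and fin: "tv W f \<noteq> \<infinity>" for \<phi>
  proof -
    have z: "\<phi> x = 0" if "x \<in> V" for x
      using test_fieldsD(4)[OF \<phi>(1)] that assms(2) by blast
    have "ereal (LBINT x. f x * divergence \<phi> x) + tv V f \<le> tv W f"
      by (rule tv_add_test_field[OF f]) (use \<phi> z test_fields_mono[of U W] assms in auto)
    then show ?thesis using fin tv_nonneg[of V f] by (cases "tv W f"; cases "tv V f") auto
  qed
  then have "tv W f \<noteq> \<infinity> \<Longrightarrow> tv U f \<le> tv W f - tv V f"
    unfolding tv_def[of U] by (intro SUP_least) auto
  then show ?thesis
    using tv_nonneg[of U f] tv_nonneg[of V f] by (cases "tv W f"; cases "tv V f"; cases "tv U f") auto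
qed

lemma tv_disjoint_sum:
  assumes f: "integrable lborel f" and "finite I" "disjoint_family_on W I" "\<And>i. i \<in> I \<Longrightarrow> W i \<subseteq> U"
  shows "(\<Sum>i\<in>I. tv (W i) f) \<le> tv U f"
proof -
  have "(\<Sum>i\<in>I. tv (W i) f) \<le> tv (\<Union>i\<in>I. W i) f"
    using assms(2,3)
  proof (induction I rule: finite_induct)
    case (insert i I)
    have "(\<Sum>i\<in>insert i I. tv (W i) f) \<le> tv (W i) f + tv (\<Union>i\<in>I. W i) f"
      using insert disjoint_family_on_mono[of I "insert i I" W] by (auto intro!: add_left_mono)
    also have "\<dots> \<le> tv (\<Union>i\<in>insert i I. W i) f"
      by (rule tv_disjoint_add[OF f]) (use insert in \<open>auto simp: disjoint_family_on_def\<close>)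
    finally show ?case .
  qed (simp add: tv_nonneg)
  also have "\<dots> \<le> tv U f" using assms(4) by (intro tv_mono) auto
  finally show ?thesis .
qed

text \<open>Take the support of a nearly optimal field as \<open>K\<close>: whatever variation is
  left outside \<open>K\<close> could be added to that field. This replaces inner regularity of the
  variation measure.\<close>

lemma tv_tight:
  assumes f: "integrable lborel f" and fin: "tv U f < \<infinity>" and "e > 0"
  obtains K where "compact K" "K \<subseteq> U" "tv (U - K) f \<le> ereal e"
proof -
  obtain T where T: "tv U f = ereal T" using fin tv_nonneg[of U f] by (cases "tv U f") auto
  have "ereal (T - e) < tv U f" using \<open>e > 0\<close> by (simp add: T)
  then obtain \<phi> where \<phi>: "\<phi> \<in> test_fields U" "\<forall>x. norm (\<phi> x) \<le> 1"
    and gt: "T - e < (LBINT x. f x * divergence \<phi> x)"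
    unfolding tv_def less_SUP_iff by auto
  obtain K where K: "compact K" "K \<subseteq> U" "\<forall>x. x \<notin> K \<longrightarrow> \<phi> x = 0"
    using test_fieldsD(4)[OF \<phi>(1)] by auto
  have "ereal (LBINT x. f x * divergence \<phi> x) + tv (U - K) f \<le> tv U f"
    by (rule tv_add_test_field[OF f \<phi>(1)]) (use \<phi> K in auto)
  then have "tv (U - K) f \<le> ereal e" using gt T by (cases "tv (U - K) f") auto
  with K(1,2) show ?thesis by (rule that)
qed

section \<open>Variation and translates\<close>

lemma test_functions_translate:
  assumes \<psi>: "\<psi> \<in> test_functions U" and W: "\<And>y. y \<in> U \<Longrightarrow> y + a \<in> W"
  shows "(\<lambda>x. \<psi> (x - a) * c) \<in> test_functions W"
proof -
  let ?K = "(\<lambda>y. y + a) ` closure {x. \<psi> x \<noteq> 0}"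
  have K: "compact ?K" by (intro compact_continuous_image test_functionsD(5)[OF \<psi>] continuous_intros)
  have "{x. \<psi> (x - a) * c \<noteq> 0} \<subseteq> ?K"
  proof
    fix x assume "x \<in> {x. \<psi> (x - a) * c \<noteq> 0}"
    then have "x - a \<in> closure {x. \<psi> x \<noteq> 0}"
      using closure_subset[of "{x. \<psi> x \<noteq> 0}"] by auto
    then have "(x - a) + a \<in> ?K" by (rule imageI)
    then show "x \<in> ?K" by simp
  qed
  then have sub: "closure {x. \<psi> (x - a) * c \<noteq> 0} \<subseteq> ?K"
    using K by (intro closure_minimal compact_imp_closed)
  moreover have "?K \<subseteq> W" using test_functionsD(6)[OF \<psi>] W by auto
  moreover have "compact (closure {x. \<psi> (x - a) * c \<noteq> 0})"
    using sub K by (meson bounded_subset compact_eq_bounded_closed closed_closure)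
  ultimately show ?thesis
    using C_k_affine[OF test_functionsD(1)[OF \<psi>]] by (simp add: test_functions_def subset_trans[OF sub])
qed

text \<open>The fundamental theorem of calculus along the segment from \<open>y\<close> to
  \<open>y - z\<close>, followed by Fubini; the integrand is dominated by a multiple of
  \<open>\<bar>f y\<bar>\<close> on the unit time interval.\<close>

lemma integral_translate_difference:
  fixes f :: "'a::euclidean_space \<Rightarrow> real"
  assumes f: "integrable lborel f" and \<psi>: "\<psi> \<in> test_functions U"
  shows "(LBINT y. f y * (\<psi> (y - z) - \<psi> y)) =
     (LBINT t. indicator {0..1} t * (LBINT y. f y * - (grad \<psi> (y - t *\<^sub>R z) \<bullet> z)))"
proof -
  let ?g = "\<lambda>x. grad \<psi> x \<bullet> z"
  have gc: "continuous_on UNIV ?g"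
    unfolding grad_def using test_functionsD(4)[OF \<psi>] by (intro continuous_intros) auto
  have gz: "?g x = 0" if "x \<notin> closure {x. \<psi> x \<noteq> 0}" for x
  proof -
    have op: "open (- closure {x. \<psi> x \<noteq> 0})" by (rule open_Compl[OF closed_closure])
    have eq: "0 = \<psi> y" if "y \<in> - closure {x. \<psi> x \<noteq> 0}" for y
      by (rule test_functionsD(8)[OF \<psi>, symmetric]) (use that in \<open>rule ComplD\<close>)
    have "x \<in> - closure {x. \<psi> x \<noteq> 0}" using that by simp
    from has_derivative_transform_within_open[OF has_derivative_const op this eq]
    have "(\<psi> has_derivative (\<lambda>_. 0)) (at x)" .
    then have "partial b \<psi> x = 0" for b by (rule partial_eqI)
    then show ?thesis by (simp add: grad_def)
  qed
  obtain B where "B > 0" "\<And>x. norm (?g x) \<le> B"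
    by (rule bounded_continuous_compact_support[OF gc test_functionsD(5)[OF \<psi>]]) (use gz in auto)
  then have B: "B > 0" "\<And>x. \<bar>?g x\<bar> \<le> B" by auto
  have gm[measurable]: "?g \<in> borel_measurable borel" using gc borel_measurable_continuous_onI by blast
  have fm[measurable]: "f \<in> borel_measurable borel" using f by auto
  let ?k = "\<lambda>y t. indicator {0..1::real} t * (f y * - ?g (y - t *\<^sub>R z))"
  have km: "(\<lambda>(y, t). ?k y t) \<in> borel_measurable (lborel \<Otimes>\<^sub>M lborel)"
    unfolding case_prod_beta by measurable
  have FTC: "(LBINT t. indicator {0..1::real} t * - ?g (y - t *\<^sub>R z)) = \<psi> (y - z) - \<psi> y" for y
  proof -
    have "(LBINT t. indicator {0..1::real} t *\<^sub>R - ?g (y - t *\<^sub>R z)) = \<psi> (y - 1 *\<^sub>R z) - \<psi> (y - 0 *\<^sub>R z)"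
    proof (rule integral_FTC_Icc)
      fix t :: real
      have "(\<psi> has_derivative (\<lambda>h. grad \<psi> (y - t *\<^sub>R z) \<bullet> h)) (at (y - t *\<^sub>R z))"
        using test_functionsD(2)[OF \<psi>] by (rule has_derivative_grad)
      moreover have "((\<lambda>t. y - t *\<^sub>R z) has_derivative (\<lambda>h. - (h *\<^sub>R z))) (at t within {0..1})"
        by (auto intro!: derivative_eq_intros)
      ultimately have "((\<lambda>t. \<psi> (y - t *\<^sub>R z)) has_derivative (\<lambda>h. grad \<psi> (y - t *\<^sub>R z) \<bullet> (- (h *\<^sub>R z)))) (at t within {0..1})"
        by (rule has_derivative_compose[rotated])
      then show "((\<lambda>t. \<psi> (y - t *\<^sub>R z)) has_vector_derivative - ?g (y - t *\<^sub>R z)) (at t within {0..1})"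
        by (simp add: has_vector_derivative_def)
    next
      show "continuous_on {0..1} (\<lambda>t. - ?g (y - t *\<^sub>R z))"
        by (intro continuous_intros continuous_on_compose2[OF gc]) auto
    qed simp
    then show ?thesis by simp
  qed
  have "integrable (lborel \<Otimes>\<^sub>M lborel) (\<lambda>(y, t). ?k y t)"
  proof (rule lborel_pair.Fubini_integrable[OF km])
    have int: "integrable lborel (\<lambda>t. ?k y t)" for y
    proof (rule Bochner_Integration.integrable_bound)
      show "integrable lborel (\<lambda>t. indicator {0..1::real} t * (\<bar>f y\<bar> * B))" by simp
      show "AE t in lborel. norm (?k y t) \<le> norm (indicator {0..1::real} t * (\<bar>f y\<bar> * B))"
        using B by (auto simp: abs_mult indicator_def intro!: mult_left_mono)
    qed measurable
    then show "AE y in lborel. integrable lborel (\<lambda>t. case (y, t) of (y, t) \<Rightarrow> ?k y t)" by simp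
    show "integrable lborel (\<lambda>y. \<integral>t. norm (case (y, t) of (y, t) \<Rightarrow> ?k y t) \<partial>lborel)"
    proof (rule Bochner_Integration.integrable_bound)
      show "integrable lborel (\<lambda>y. \<bar>f y\<bar> * B)" using f by simp
      show "(\<lambda>y. \<integral>t. norm (case (y, t) of (y, t) \<Rightarrow> ?k y t) \<partial>lborel) \<in> borel_measurable lborel"
        using km by measurable
      show "AE y in lborel. norm (LBINT t. norm (case (y, t) of (y, t) \<Rightarrow> ?k y t)) \<le> norm (\<bar>f y\<bar> * B)"
      proof (rule AE_I2)
        fix y
        have c: "integrable lborel (\<lambda>t. indicator {0..1::real} t * (\<bar>f y\<bar> * B))" by simp
        have "(LBINT t. norm (?k y t)) \<le> (LBINT t. indicator {0..1::real} t * (\<bar>f y\<bar> * B))"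
          by (rule integral_mono[OF integrable_norm[OF int] c])
            (use B in \<open>auto simp: abs_mult indicator_def intro!: mult_left_mono\<close>)
        then show "norm (LBINT t. norm (case (y, t) of (y, t) \<Rightarrow> ?k y t)) \<le> norm (\<bar>f y\<bar> * B)"
          using B by simp
      qed
    qed
  qed
  then have Fubini: "(LBINT t. (LBINT y. ?k y t)) = (LBINT y. (LBINT t. ?k y t))"
    by (rule lborel_pair.Fubini_integral[of "\<lambda>y t. ?k y t"])
  have inner: "(LBINT t. ?k y t) = f y * (\<psi> (y - z) - \<psi> y)" for y
  proof -
    have "(LBINT t. ?k y t) = (LBINT t. f y * (indicator {0..1::real} t * - ?g (y - t *\<^sub>R z)))"
      by (intro Bochner_Integration.integral_cong refl) simp
    then show ?thesis unfolding integral_mult_right_zero FTC .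
  qed
  have "(LBINT t. indicator {0..1} t * (LBINT y. f y * - ?g (y - t *\<^sub>R z))) =
      (LBINT t. (LBINT y. ?k y t))"
    by (simp only: integral_mult_right_zero)
  also have "\<dots> = (LBINT y. f y * (\<psi> (y - z) - \<psi> y))"
    unfolding Fubini by (simp only: inner)
  finally show ?thesis by (rule sym)
qed

text \<open>By duality the difference is tested with \<psi> on \<open>U\<close>, and the translation
  is moved onto \<psi>. At every time \<open>t\<close> of the segment the translate of \<psi> by
  \<open>t *\<^sub>R z\<close>, times the unit vector opposite to \<open>z\<close>, is an admissible
  field on \<open>W\<close>, so each time contributes at most \<open>norm z * T\<close>.\<close>

lemma tv_translation:
  fixes f :: "'a::euclidean_space \<Rightarrow> real"
  assumes f: "integrable lborel f" and U: "open U" "bounded U"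
    and W: "\<And>y t. y \<in> U \<Longrightarrow> 0 \<le> t \<Longrightarrow> t \<le> 1 \<Longrightarrow> y + t *\<^sub>R z \<in> W"
    and T: "tv W f \<le> ereal T"
  shows "(LBINT y. indicator U y * \<bar>f (y + z) - f y\<bar>) \<le> norm z * T"
proof (cases "z = 0")
  case False
  let ?G = "\<lambda>y. f (y + z) - f y"
  have fm[measurable]: "f \<in> borel_measurable borel" using f by auto
  have fz: "integrable lborel (\<lambda>y. f (y + z))"
    using integral_lborel_translate(2)[OF fm] f by simp
  show ?thesis
  proof (rule field_le_epsilon)
    fix e :: real assume "e > 0"
    have Gi: "integrable lborel ?G" using f fz by simp
    obtain \<psi> where \<psi>: "\<psi> \<in> test_functions U" "\<And>x. \<bar>\<psi> x\<bar> \<le> 1"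
      and le: "(LBINT x. indicator U x * \<bar>?G x\<bar>) \<le> (LBINT x. \<psi> x * ?G x) + e"
      by (rule integral_abs_eq_SUP_test_functions[OF Gi U \<open>e > 0\<close>]) (rule that, assumption+)
    have \<psi>c: "continuous_on UNIV \<psi>" "continuous_on UNIV (\<lambda>y. \<psi> (y - z))"
      using test_functionsD(3)[OF \<psi>(1)] by (auto intro!: continuous_intros continuous_on_compose2[of UNIV \<psi>])
    have i1: "integrable lborel (\<lambda>x. f x * \<psi> (x - z))" "integrable lborel (\<lambda>x. f x * \<psi> x)" "integrable lborel (\<lambda>x. f (x + z) * \<psi> x)"
      using \<psi>(2) by (auto intro!: integrable_mult_bounded_continuous f fz \<psi>c)
    have "(LBINT x. f (x + z) * \<psi> x) = (LBINT x. f x * \<psi> (x - z))"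
      using integral_lborel_translate(1)[of "\<lambda>x. f x * \<psi> (x - z)" z] i1 by auto
    then have "(LBINT x. \<psi> x * ?G x) = (LBINT y. f y * (\<psi> (y - z) - \<psi> y))"
      using i1 by (simp add: right_diff_distrib left_diff_distrib mult.commute)
    also have "\<dots> = (LBINT t. indicator {0..1} t * (LBINT y. f y * - (grad \<psi> (y - t *\<^sub>R z) \<bullet> z)))"
      by (rule integral_translate_difference[OF f \<psi>(1)])
    also have "\<dots> \<le> norm z * T"
    proof -
      have inner: "(LBINT y. f y * - (grad \<psi> (y - t *\<^sub>R z) \<bullet> z)) \<le> norm z * T" if t: "t \<in> {0..1}" for t
      proof -
        define \<phi> where "\<phi> y = \<psi> (y - t *\<^sub>R z) *\<^sub>R (- (z /\<^sub>R norm z))" for y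
        have comp: "(\<lambda>y. \<phi> y \<bullet> b) = (\<lambda>y. \<psi> (y - t *\<^sub>R z) * (- (z /\<^sub>R norm z) \<bullet> b))" for b
          by (simp add: \<phi>_def mult.assoc)
        have "\<phi> \<in> test_fields W"
          unfolding test_fields_def mem_Collect_eq comp
          using W t by (intro ballI test_functions_translate[OF \<psi>(1)]) auto
        moreover have "norm (\<phi> x) \<le> 1" for x using \<psi>(2) False by (simp add: \<phi>_def abs_mult mult.assoc)
        ultimately have le: "ereal (LBINT x. f x * divergence \<phi> x) \<le> tv W f" by (rule tv_upper)
        have div: "divergence \<phi> x = - (grad \<psi> (x - t *\<^sub>R z) \<bullet> z) / norm z" for x
        proof -
          have "partial b (\<lambda>y. \<phi> y \<bullet> b) x = partial b \<psi> (x - t *\<^sub>R z) * (- (z /\<^sub>R norm z) \<bullet> b)" for b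
          proof -
            have D: "(\<psi> has_derivative (\<lambda>h. grad \<psi> (x - t *\<^sub>R z) \<bullet> h)) (at (x - t *\<^sub>R z))"
              using test_functionsD(2)[OF \<psi>(1)] by (rule has_derivative_grad)
            moreover have "((\<lambda>x. x - t *\<^sub>R z) has_derivative (\<lambda>h. h)) (at x)" by (auto intro!: derivative_eq_intros)
            ultimately have "((\<lambda>x. \<psi> (x - t *\<^sub>R z)) has_derivative (\<lambda>h. grad \<psi> (x - t *\<^sub>R z) \<bullet> h)) (at x)"
              by (rule has_derivative_compose[rotated])
            then have "((\<lambda>y. \<phi> y \<bullet> b) has_derivative (\<lambda>h. (grad \<psi> (x - t *\<^sub>R z) \<bullet> h) * (- (z /\<^sub>R norm z) \<bullet> b))) (at x)"
              unfolding comp by (auto intro!: derivative_eq_intros)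
            from partial_eqI[OF this, of b] partial_eqI[OF D, of b] show ?thesis by simp
          qed
          then show ?thesis
            by (simp add: divergence_def grad_def inner_sum_left sum_divide_distrib sum_negf inner_commute[of z] field_simps)
        qed
        have "(LBINT x. f x * divergence \<phi> x) \<le> T" using le T by (metis ereal_less_eq(3) order_trans)
        moreover have "(LBINT x. f x * - (grad \<psi> (x - t *\<^sub>R z) \<bullet> z)) = norm z * (LBINT x. f x * divergence \<phi> x)"
          unfolding integral_mult_right_zero[symmetric] div
          using False by (intro Bochner_Integration.integral_cong refl) simp
        ultimately show ?thesis by (simp add: mult_left_mono)
      qed
      have T0: "0 \<le> T" using T tv_nonneg[of W f] by (metis ereal_less_eq(5) order_trans)
      have c: "integrable lborel (\<lambda>t. indicator {0..1::real} t * (norm z * T))" by simp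
      have "(LBINT t. indicator {0..1} t * (LBINT y. f y * - (grad \<psi> (y - t *\<^sub>R z) \<bullet> z))) \<le>
            (LBINT t. indicator {0..1::real} t * (norm z * T))"
        by (rule integral_mono'[OF c]) (use inner T0 in \<open>auto simp: indicator_def\<close>)
      also have "\<dots> = norm z * T" by simp
      finally show ?thesis .
    qed
    finally show "(LBINT x. indicator U x * \<bar>?G x\<bar>) \<le> norm z * T + e" using le by simp
  qed
qed simp

section \<open>Translations on a Lipschitz domain\<close>

text \<open>The interior cone condition, uniform near \<open>x0\<close>, with axis \<open>e\<close>.\<close>

definition cone_in :: "'a::euclidean_space set \<Rightarrow> 'a \<Rightarrow> real \<Rightarrow> 'a \<Rightarrow> real \<Rightarrow> bool" where
  "cone_in \<Omega> x0 r e c \<longleftrightarrow> norm e = 1 \<and> 0 < c \<and> c \<le> 1 \<and> 0 < r \<and>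
     (\<forall>y s z. y \<in> closure \<Omega> \<longrightarrow> y \<in> ball x0 r \<longrightarrow> 0 < s \<longrightarrow> norm (z - s *\<^sub>R e) < c * s \<longrightarrow>
        y + z \<in> ball x0 r \<longrightarrow> y + z \<in> \<Omega>)"

lemma cone_inD:
  assumes "cone_in \<Omega> x0 r e c"
  shows "norm e = 1" "0 < c" "c \<le> 1" "0 < r"
    "\<And>y s z. \<lbrakk>y \<in> closure \<Omega>; y \<in> ball x0 r; 0 < s; norm (z - s *\<^sub>R e) < c * s; y + z \<in> ball x0 r\<rbrakk> \<Longrightarrow> y + z \<in> \<Omega>"
proof -
  show "norm e = 1" "0 < c" "c \<le> 1" "0 < r" using assms unfolding cone_in_def by simp_all
  have "\<forall>y s z. y \<in> closure \<Omega> \<longrightarrow> y \<in> ball x0 r \<longrightarrow> 0 < s \<longrightarrow> norm (z - s *\<^sub>R e) < c * s \<longrightarrow>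
        y + z \<in> ball x0 r \<longrightarrow> y + z \<in> \<Omega>"
    using assms unfolding cone_in_def by simp
  then show "\<And>y s z. \<lbrakk>y \<in> closure \<Omega>; y \<in> ball x0 r; 0 < s; norm (z - s *\<^sub>R e) < c * s; y + z \<in> ball x0 r\<rbrakk> \<Longrightarrow> y + z \<in> \<Omega>"
    by simp
qed

lemma bounded_Compl_nonempty:
  fixes S :: "'a::euclidean_space set"
  assumes "bounded S"
  shows "- S \<noteq> {}"
proof
  assume "- S = {}"
  then have "S = UNIV" by auto
  then show False using assms not_bounded_UNIV by metis
qed

lemma lipschitz_boundary_cone:
  assumes lip: "lipschitz_boundary \<Omega>" and x0: "x0 \<in> frontier \<Omega>"
  obtains r e c where "cone_in \<Omega> x0 r e c"
proof -
  from lip x0 obtain r e L \<gamma> where r: "r > 0" and e: "norm e = 1" and L: "L-lipschitz_on {y. y \<bullet> e = 0} \<gamma>"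
    and \<Omega>: "\<Omega> \<inter> ball x0 r = {y \<in> ball x0 r. \<gamma> (y - (y \<bullet> e) *\<^sub>R e) < y \<bullet> e}"
    unfolding lipschitz_boundary_def by blast
  have L0: "L \<ge> 0" using L by (rule lipschitz_on_nonneg)
  \<comment> \<open>Let \<open>u\<close> be the deviation of \<open>z\<close> from the axis vector.
    The horizontal part of \<open>z\<close> is at most \<open>2 * norm u\<close>, so the graph rises
    by at most \<open>2 * L * norm u\<close>, while the height gained is at least
    \<open>s - norm u\<close>. Any opening below \<open>1 / (2 * L + 1)\<close> would do.\<close>
  define c where "c = 1 / (2 * L + 2)"
  have c: "0 < c" "c \<le> 1" using L0 by (auto simp: c_def)
  have ee: "e \<bullet> e = 1" using e by (simp add: norm_eq_1)
  have inner: "y + z \<in> \<Omega>"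
    if y: "y \<in> \<Omega>" "y \<in> ball x0 r" and s: "0 < s" and z: "norm (z - s *\<^sub>R e) < c * s" and yz: "y + z \<in> ball x0 r" for y s z
  proof -
    define P where "P x = x - (x \<bullet> e) *\<^sub>R e" for x
    define u where "u = z - s *\<^sub>R e"
    have P0: "P x \<bullet> e = 0" for x by (simp add: P_def inner_diff_left ee)
    have uz: "\<bar>u \<bullet> e\<bar> \<le> norm u" using Cauchy_Schwarz_ineq2[of u e] e by simp
    have "P z = P u" by (simp add: P_def u_def inner_diff_left ee algebra_simps)
    then have "norm (P z) \<le> norm u + norm ((u \<bullet> e) *\<^sub>R e)"
      using norm_triangle_ineq4[of u "(u \<bullet> e) *\<^sub>R e"] by (simp only: P_def)
    then have Pz: "norm (P z) \<le> 2 * norm u" using uz e by simp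
    have "dist (\<gamma> (P (y + z))) (\<gamma> (P y)) \<le> L * dist (P (y + z)) (P y)"
      by (rule lipschitz_onD[OF L]) (simp_all add: P0)
    moreover have "P (y + z) - P y = P z" by (simp add: P_def inner_add_left algebra_simps)
    ultimately have "\<gamma> (P (y + z)) \<le> \<gamma> (P y) + L * norm (P z)" by (simp add: dist_norm)
    also have "\<dots> \<le> \<gamma> (P y) + L * (2 * norm u)" using Pz L0 by (intro add_left_mono mult_left_mono)
    also have "\<gamma> (P y) < y \<bullet> e"
    proof -
      have "y \<in> \<Omega> \<inter> ball x0 r" using y by simp
      then show ?thesis unfolding \<Omega> P_def by simp
    qed
    finally have 1: "\<gamma> (P (y + z)) < y \<bullet> e + 2 * L * norm u" by simp
    have "norm u * (2 * L + 2) < s" using z L0 by (simp add: u_def c_def field_simps)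
    moreover have "norm u * (2 * L + 2) = 2 * L * norm u + 2 * norm u" by (simp add: algebra_simps)
    ultimately have "2 * L * norm u + norm u < s" using norm_ge_zero[of u] by linarith
    moreover have "z \<bullet> e = s + u \<bullet> e" by (simp add: u_def inner_diff_left ee)
    ultimately have "2 * L * norm u < z \<bullet> e" using uz by linarith
    with 1 have "\<gamma> (P (y + z)) < (y + z) \<bullet> e" by (simp add: inner_add_left)
    then have "y + z \<in> \<Omega> \<inter> ball x0 r" unfolding \<Omega> using yz by (simp add: P_def)
    then show ?thesis by simp
  qed
  have "cone_in \<Omega> x0 r e c"
    unfolding cone_in_def
  proof (intro conjI e c r allI impI)
    fix y s z
    assume y: "y \<in> closure \<Omega>" "y \<in> ball x0 r" and s: "0 < s" and z: "norm (z - s *\<^sub>R e) < c * s" and yz: "y + z \<in> ball x0 r"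
    \<comment> \<open>A point of the closure is replaced by a point of \<Omega> so near that the
      corrected displacement stays in the open cone and the new base point stays in the
      ball.\<close>
    define d where "d = min (r - dist x0 y) (c * s - norm (z - s *\<^sub>R e))"
    have d: "d > 0" using y z by (simp add: d_def)
    obtain y' where y': "y' \<in> \<Omega>" "dist y' y < d"
      using y(1) d unfolding closure_approachable by blast
    have "y' + (z + y - y') \<in> \<Omega>"
    proof (rule inner[OF y'(1) _ s])
      have "dist x0 y' \<le> dist x0 y + dist y' y" using dist_triangle[of x0 y' y] by (simp add: dist_commute)
      then show "y' \<in> ball x0 r" using y'(2) by (simp add: d_def)
      have "norm (z + y - y' - s *\<^sub>R e) = norm ((z - s *\<^sub>R e) + (y - y'))" by (simp add: algebra_simps)
      also have "\<dots> \<le> norm (z - s *\<^sub>R e) + norm (y - y')" by (rule norm_triangle_ineq)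
      also have "\<dots> < c * s" using y'(2) by (simp add: d_def dist_norm norm_minus_commute)
      finally show "norm (z + y - y' - s *\<^sub>R e) < c * s" .
      show "y' + (z + y - y') \<in> ball x0 r" using yz by (simp add: add.commute)
    qed
    then show "y + z \<in> \<Omega>" by (simp add: add.commute)
  qed
  then show ?thesis by (rule that)
qed

lemma integrable_indicator_mult:
  fixes g :: "'a \<Rightarrow> real"
  assumes "A \<in> sets M" "integrable M g"
  shows "integrable M (\<lambda>y. indicator A y * g y)"
  using integrable_mult_indicator[OF assms] by simp

text \<open>Translates of \<open>A\<close> by multiples of \<zeta> are disjoint, so the
  \<open>N\<close> increments are integrals of the same difference over disjoint sets. The whole
  chain costs \<open>norm \<zeta> * T\<close>, as much as a single step.\<close>

lemma telescoping_translates: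
  fixes f :: "'a::euclidean_space \<Rightarrow> real"
  assumes f: "integrable lborel f" and A: "open A" "bounded A"
    and disj: "\<And>a k. \<lbrakk>a \<in> A; 1 \<le> k; k < N\<rbrakk> \<Longrightarrow> a + real k *\<^sub>R \<zeta> \<notin> A"
    and W: "\<And>a t. \<lbrakk>a \<in> A; 0 \<le> t; t \<le> real N\<rbrakk> \<Longrightarrow> a + t *\<^sub>R \<zeta> \<in> W"
    and T: "tv W f \<le> ereal T"
  shows "(\<Sum>k<N. \<integral>y. indicator A y * \<bar>f (y + real (Suc k) *\<^sub>R \<zeta>) - f (y + real k *\<^sub>R \<zeta>)\<bar> \<partial>lborel) \<le> norm \<zeta> * T"
proof -
  have fm[measurable]: "f \<in> borel_measurable borel" using f by auto
  have Am[measurable]: "A \<in> sets borel" using A by auto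
  define S where "S k = (\<lambda>a. a + real k *\<^sub>R \<zeta>) ` A" for k
  have So: "open (S k)" for k
    using open_translation[OF A(1), of "real k *\<^sub>R \<zeta>"] by (simp add: S_def add.commute)
  have [measurable]: "S k \<in> sets borel" for k using So by auto
  have memS: "y \<in> S k \<longleftrightarrow> y - real k *\<^sub>R \<zeta> \<in> A" for k y
    unfolding S_def image_iff by (metis add_diff_cancel diff_add_cancel)
  then have indS: "indicator (S k) y = (indicator A (y - real k *\<^sub>R \<zeta>) :: real)" for k y
    by (simp add: indicator_def)
  have no: False if "x \<in> S i" "x \<in> S j" "i < j" "j < N" for i j x
  proof -
    have e: "(x - real j *\<^sub>R \<zeta>) + real (j - i) *\<^sub>R \<zeta> = x - real i *\<^sub>R \<zeta>"
      using \<open>i < j\<close> by (simp add: of_nat_diff algebra_simps)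
    have "1 \<le> j - i" "j - i < N" using that by auto
    then show False using disj[of "x - real j *\<^sub>R \<zeta>" "j - i", unfolded e] that by (simp add: memS)
  qed
  have dS: "disjoint_family_on S {..<N}"
    unfolding disjoint_family_on_def
  proof (intro ballI impI)
    fix i j assume "i \<in> {..<N}" "j \<in> {..<N}" "i \<noteq> j"
    then show "S i \<inter> S j = {}" using no[of _ i j] no[of _ j i] by (cases "i < j") auto
  qed
  let ?g = "\<lambda>y. \<bar>f (y + \<zeta>) - f y\<bar>"
  have gi: "integrable lborel ?g" using f integral_lborel_translate(2)[OF fm, of \<zeta>] by auto
  define U where "U = (\<Union>k<N. S k)"
  have U: "open U" "bounded U"
  proof -
    show "open U" unfolding U_def using So by auto
    have "bounded (S k)" for k
      using bounded_translation[OF A(2), of "real k *\<^sub>R \<zeta>"] by (simp add: S_def add.commute)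
    then show "bounded U" unfolding U_def by (intro bounded_UN) auto
  qed
  have "(\<Sum>k<N. \<integral>y. indicator A y * \<bar>f (y + real (Suc k) *\<^sub>R \<zeta>) - f (y + real k *\<^sub>R \<zeta>)\<bar> \<partial>lborel) =
        (\<Sum>k<N. \<integral>y. indicator (S k) y * ?g y \<partial>lborel)"
  proof (intro sum.cong refl)
    fix k
    have "(LBINT y. indicator (S k) y * ?g y) = (LBINT y. indicator (S k) (y + real k *\<^sub>R \<zeta>) * ?g (y + real k *\<^sub>R \<zeta>))"
      by (rule integral_lborel_translate(1)[symmetric]) measurable
    then show "(LBINT y. indicator A y * \<bar>f (y + real (Suc k) *\<^sub>R \<zeta>) - f (y + real k *\<^sub>R \<zeta>)\<bar>) =
      (LBINT y. indicator (S k) y * ?g y)"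
      by (simp add: indS algebra_simps)
  qed
  also have "\<dots> = (LBINT y. (\<Sum>k<N. indicator (S k) y * ?g y))"
  proof (rule Bochner_Integration.integral_sum[symmetric])
    show "integrable lborel (\<lambda>y. indicator (S k) y * ?g y)" for k
      by (rule integrable_indicator_mult) (use gi in auto)
  qed
  also have "\<dots> = (LBINT y. indicator U y * ?g y)"
    unfolding U_def using dS by (intro Bochner_Integration.integral_cong refl)
      (simp add: indicator_UN_disjoint flip: sum_distrib_right)
  also have "\<dots> \<le> norm \<zeta> * T"
  proof (rule tv_translation[OF f U _ T])
    fix y t :: _ assume "y \<in> U" "(0::real) \<le> t" "t \<le> 1"
    then obtain a k where "a \<in> A" "k < N" "y = a + real k *\<^sub>R \<zeta>" by (auto simp: U_def S_def)
    then have "y + t *\<^sub>R \<zeta> = a + (real k + t) *\<^sub>R \<zeta>" "real k + t \<le> real N"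
      using \<open>t \<le> 1\<close> by (auto simp: algebra_simps)
    then show "y + t *\<^sub>R \<zeta> \<in> W" using W[OF \<open>a \<in> A\<close>, of "real k + t"] \<open>0 \<le> t\<close> by simp
  qed
  finally show ?thesis .
qed

text \<open>Telescoping at each point; thanks to the disjoint translates the bound is the length of
  one step and not that of the path.\<close>

lemma translate_N_difference:
  fixes f :: "'a::euclidean_space \<Rightarrow> real"
  assumes f: "integrable lborel f" and A: "open A" "bounded A"
    and disj: "\<And>a k. \<lbrakk>a \<in> A; 1 \<le> k; k < N\<rbrakk> \<Longrightarrow> a + real k *\<^sub>R \<zeta> \<notin> A"
    and W: "\<And>a t. \<lbrakk>a \<in> A; 0 \<le> t; t \<le> real N\<rbrakk> \<Longrightarrow> a + t *\<^sub>R \<zeta> \<in> W"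
    and T: "tv W f \<le> ereal T" and "j \<le> N"
  shows "(LBINT y. indicator A y * \<bar>f (y + real j *\<^sub>R \<zeta>) - f y\<bar>) \<le> norm \<zeta> * T"
proof -
  have fm[measurable]: "f \<in> borel_measurable borel" using f by auto
  have Am: "A \<in> sets lborel" using A by auto
  have ft: "integrable lborel (\<lambda>y. f (y + a))" for a using f integral_lborel_translate(2)[OF fm] by simp
  have d: "integrable lborel (\<lambda>y. indicator A y * \<bar>f (y + a) - f (y + b)\<bar>)" for a b
    using ft by (intro integrable_indicator_mult[OF Am]) auto
  have "(LBINT y. indicator A y * \<bar>f (y + real j *\<^sub>R \<zeta>) - f y\<bar>) \<le>
     (LBINT y. (\<Sum>k<j. indicator A y * \<bar>f (y + real (Suc k) *\<^sub>R \<zeta>) - f (y + real k *\<^sub>R \<zeta>)\<bar>))"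
  proof (rule integral_mono)
    show "integrable lborel (\<lambda>y. indicator A y * \<bar>f (y + real j *\<^sub>R \<zeta>) - f y\<bar>)" using d[of _ 0] by simp
    show "integrable lborel (\<lambda>y. \<Sum>k<j. indicator A y * \<bar>f (y + real (Suc k) *\<^sub>R \<zeta>) - f (y + real k *\<^sub>R \<zeta>)\<bar>)"
      by (intro Bochner_Integration.integrable_sum d)
    fix y
    have "f (y + real j *\<^sub>R \<zeta>) - f y = (\<Sum>k<j. f (y + real (Suc k) *\<^sub>R \<zeta>) - f (y + real k *\<^sub>R \<zeta>))"
      by (subst sum_lessThan_telescope) simp
    then have "\<bar>f (y + real j *\<^sub>R \<zeta>) - f y\<bar> \<le> (\<Sum>k<j. \<bar>f (y + real (Suc k) *\<^sub>R \<zeta>) - f (y + real k *\<^sub>R \<zeta>)\<bar>)"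
      by (simp only: sum_abs)
    then show "indicator A y * \<bar>f (y + real j *\<^sub>R \<zeta>) - f y\<bar> \<le>
      (\<Sum>k<j. indicator A y * \<bar>f (y + real (Suc k) *\<^sub>R \<zeta>) - f (y + real k *\<^sub>R \<zeta>)\<bar>)"
      by (simp add: mult_left_mono flip: sum_distrib_left)
  qed
  also have "\<dots> = (\<Sum>k<j. \<integral>y. indicator A y * \<bar>f (y + real (Suc k) *\<^sub>R \<zeta>) - f (y + real k *\<^sub>R \<zeta>)\<bar> \<partial>lborel)"
    by (intro Bochner_Integration.integral_sum d)
  also have "\<dots> \<le> (\<Sum>k<N. \<integral>y. indicator A y * \<bar>f (y + real (Suc k) *\<^sub>R \<zeta>) - f (y + real k *\<^sub>R \<zeta>)\<bar> \<partial>lborel)"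
    using \<open>j \<le> N\<close> by (intro sum_mono2) auto
  also have "\<dots> \<le> norm \<zeta> * T" by (rule telescoping_translates[OF f A disj W T])
  finally show ?thesis .
qed

text \<open>The mass on \<open>A\<close> is compared with the mass on each of \<open>N\<close>
  translates and the results are averaged. Being disjoint, the translates share the total mass,
  whence the factor \<open>1 / N\<close>.\<close>

lemma integral_over_translates:
  fixes f :: "'a::euclidean_space \<Rightarrow> real"
  assumes f: "integrable lborel f" and A: "open A" "bounded A" and N: "N \<ge> 1"
    and disj: "\<And>a k. \<lbrakk>a \<in> A; 1 \<le> k; k < N\<rbrakk> \<Longrightarrow> a + real k *\<^sub>R \<zeta> \<notin> A"
    and W: "\<And>a t. \<lbrakk>a \<in> A; 0 \<le> t; t \<le> real N\<rbrakk> \<Longrightarrow> a + t *\<^sub>R \<zeta> \<in> W"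
    and T: "tv W f \<le> ereal T"
  shows "(LBINT y. indicator A y * \<bar>f y\<bar>) \<le> (LBINT y. \<bar>f y\<bar>) / real N + norm \<zeta> * T"
proof -
  have fm[measurable]: "f \<in> borel_measurable borel" using f by auto
  have Am[measurable]: "A \<in> sets lborel" using A by auto
  have ft: "integrable lborel (\<lambda>y. f (y + a))" for a using f integral_lborel_translate(2)[OF fm] by simp
  have d: "integrable lborel (\<lambda>y. indicator A y * \<bar>f (y + a) - f y\<bar>)" for a
    using ft f by (intro integrable_indicator_mult[OF Am]) auto
  have i: "integrable lborel (\<lambda>y. indicator A y * \<bar>f (y + a)\<bar>)" for a
    using ft by (intro integrable_indicator_mult[OF Am]) auto
  have i': "integrable lborel (\<lambda>y. indicator A (y - a) * \<bar>f y\<bar>)" for a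
  proof -
    have [measurable]: "A \<in> sets borel" using Am by simp
    have "(\<lambda>y. indicator A (y - a) * \<bar>f y\<bar>) \<in> borel_measurable borel" by measurable
    from integral_lborel_translate(2)[OF this, of a] i[of a] show ?thesis by simp
  qed
  let ?I = "\<integral>y. indicator A y * \<bar>f y\<bar> \<partial>lborel"
  have one: "?I \<le> (LBINT y. indicator A (y - real j *\<^sub>R \<zeta>) * \<bar>f y\<bar>) + norm \<zeta> * T" if "j < N" for j
  proof -
    have "?I \<le> (LBINT y. indicator A y * \<bar>f (y + real j *\<^sub>R \<zeta>)\<bar> + indicator A y * \<bar>f (y + real j *\<^sub>R \<zeta>) - f y\<bar>)"
      using i[of 0] i d by (intro integral_mono) (auto simp: indicator_def)
    also have "\<dots> = (LBINT y. indicator A y * \<bar>f (y + real j *\<^sub>R \<zeta>)\<bar>) +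
       (LBINT y. indicator A y * \<bar>f (y + real j *\<^sub>R \<zeta>) - f y\<bar>)"
      by (intro Bochner_Integration.integral_add i d)
    also have "(LBINT y. indicator A y * \<bar>f (y + real j *\<^sub>R \<zeta>) - f y\<bar>) \<le> norm \<zeta> * T"
      by (rule translate_N_difference[OF f A disj W T]) (use that in auto)
    also have "(LBINT y. indicator A y * \<bar>f (y + real j *\<^sub>R \<zeta>)\<bar>) =
       (LBINT y. indicator A (y - real j *\<^sub>R \<zeta>) * \<bar>f y\<bar>)"
    proof -
      have [measurable]: "A \<in> sets borel" using Am by simp
      have "(\<lambda>y. indicator A (y - real j *\<^sub>R \<zeta>) * \<bar>f y\<bar>) \<in> borel_measurable borel" by measurable
      from integral_lborel_translate(1)[OF this, of "real j *\<^sub>R \<zeta>"] show ?thesis by simp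
    qed
    finally show ?thesis by simp
  qed
  have "(\<Sum>j<N. indicator A (y - real j *\<^sub>R \<zeta>)) \<le> (1::real)" for y
  proof -
    have "card {j\<in>{..<N}. y - real j *\<^sub>R \<zeta> \<in> A} \<le> 1"
    proof (rule card_le_Suc0_iff_eq[THEN iffD2, unfolded One_nat_def[symmetric]])
      have no: False if "y - real i *\<^sub>R \<zeta> \<in> A" "y - real j *\<^sub>R \<zeta> \<in> A" "i < j" "j < N" for i j
      proof -
        have e: "(y - real j *\<^sub>R \<zeta>) + real (j - i) *\<^sub>R \<zeta> = y - real i *\<^sub>R \<zeta>"
          using \<open>i < j\<close> by (simp add: of_nat_diff algebra_simps)
        have "1 \<le> j - i" "j - i < N" using that by auto
        then show False using disj[of "y - real j *\<^sub>R \<zeta>" "j - i", unfolded e] that by simp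
      qed
      then show "\<forall>i\<in>{j\<in>{..<N}. y - real j *\<^sub>R \<zeta> \<in> A}. \<forall>k\<in>{j\<in>{..<N}. y - real j *\<^sub>R \<zeta> \<in> A}. i = k"
        using linorder_neqE_nat by (intro ballI) (clarsimp, meson)
    qed simp
    moreover have "(\<Sum>j<N. indicator A (y - real j *\<^sub>R \<zeta>)) = real (card {j\<in>{..<N}. y - real j *\<^sub>R \<zeta> \<in> A})"
      by (simp add: indicator_def sum.If_cases Int_def)
    ultimately show ?thesis by simp
  qed
  note le1 = this
  have "real N * ?I = (\<Sum>j<N. ?I)" by simp
  also have "\<dots> \<le> (\<Sum>j<N. (LBINT y. indicator A (y - real j *\<^sub>R \<zeta>) * \<bar>f y\<bar>) + norm \<zeta> * T)"
    using one by (intro sum_mono) auto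
  also have "\<dots> = (LBINT y. (\<Sum>j<N. indicator A (y - real j *\<^sub>R \<zeta>) * \<bar>f y\<bar>)) + real N * (norm \<zeta> * T)"
    unfolding sum.distrib Bochner_Integration.integral_sum[OF i'] by simp
  also have "(LBINT y. (\<Sum>j<N. indicator A (y - real j *\<^sub>R \<zeta>) * \<bar>f y\<bar>)) \<le> (LBINT y. \<bar>f y\<bar>)"
  proof (rule integral_mono)
    show "integrable lborel (\<lambda>y. \<Sum>j<N. indicator A (y - real j *\<^sub>R \<zeta>) * \<bar>f y\<bar>)"
      by (intro Bochner_Integration.integrable_sum i')
    show "(\<Sum>j<N. indicator A (y - real j *\<^sub>R \<zeta>) * \<bar>f y\<bar>) \<le> \<bar>f y\<bar>" for y
      using mult_right_mono[OF le1[of y], of "\<bar>f y\<bar>"] by (simp add: sum_distrib_right)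
  qed (use f in auto)
  finally show ?thesis using N by (simp add: field_simps)
qed

text \<open>The layer is pushed inwards along the cone axis. A step of length
  \<open>\<epsilon> / c\<close> already clears it, and about \<open>c * r / (2 * \<epsilon>)\<close>
  such steps fit into the ball, so both terms of \<open>integral_over_translates\<close> are of
  order \<epsilon>. The bound on \<epsilon> makes room for at least two steps, so rounding down
  loses at most a factor 2.\<close>

lemma boundary_layer_local:
  fixes f :: "'a::euclidean_space \<Rightarrow> real"
  assumes cone: "cone_in \<Omega> x0 r e c" and \<Omega>: "open \<Omega>" "bounded \<Omega>"
    and f: "integrable lborel f" and T: "tv \<Omega> f \<le> ereal T" and \<epsilon>: "0 < \<epsilon>" "\<epsilon> \<le> c * r / 4"
  shows "(LBINT y. indicator {y \<in> \<Omega> \<inter> ball x0 (r / 2). infdist y (- \<Omega>) < \<epsilon>} y * \<bar>f y\<bar>)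
     \<le> \<epsilon> * (8 / (c * r) * (LBINT y. \<bar>f y\<bar>) + T / c)"
proof -
  note cn = cone_inD[OF cone]
  define A where "A = {y \<in> \<Omega> \<inter> ball x0 (r / 2). infdist y (- \<Omega>) < \<epsilon>}"
  define \<zeta> where "\<zeta> = (\<epsilon> / c) *\<^sub>R e"
  define N where "N = nat \<lfloor>(r / 2) / (\<epsilon> / c)\<rfloor>"
  have n\<zeta>: "norm \<zeta> = \<epsilon> / c" using cn \<epsilon> by (simp add: \<zeta>_def)
  have "2 \<le> (r / 2) / (\<epsilon> / c)" using \<epsilon> cn by (simp add: field_simps)
  moreover have "nat \<lfloor>X\<rfloor> \<ge> 1 \<and> real (nat \<lfloor>X\<rfloor>) \<le> X \<and> real (nat \<lfloor>X\<rfloor>) \<ge> X / 2" if "2 \<le> X" for X :: real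
    using that by linarith
  ultimately have N: "N \<ge> 1" "real N \<le> (r / 2) / (\<epsilon> / c)" "real N \<ge> (r / 2) / (\<epsilon> / c) / 2"
    unfolding N_def by blast+
  have Ne: "real N * (\<epsilon> / c) \<le> r / 2" using N(2) cn \<epsilon> by (simp add: field_simps)
  have Ao: "open A"
  proof -
    have "A = (\<Omega> \<inter> ball x0 (r / 2)) \<inter> {y. infdist y (- \<Omega>) < \<epsilon>}" by (auto simp: A_def)
    moreover have "open {y. infdist y (- \<Omega>) < \<epsilon>}" by (intro open_Collect_less continuous_intros)
    ultimately show ?thesis using \<Omega> by auto
  qed
  have Ab: "bounded A" using \<Omega>(2) by (rule bounded_subset) (auto simp: A_def)
  have cA: "A \<subseteq> closure \<Omega>" using closure_subset by (auto simp: A_def)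
  have in_ball: "a + t *\<^sub>R e \<in> ball x0 r" if "a \<in> A" "0 \<le> t" "t \<le> r / 2" for a t
  proof -
    have "dist x0 (a + t *\<^sub>R e) \<le> dist x0 a + t" using cn(1) \<open>0 \<le> t\<close> norm_triangle_ineq4[of "x0 - a" "t *\<^sub>R e"]
      by (simp add: dist_norm diff_diff_add)
    then show ?thesis using that by (simp add: A_def)
  qed
  have ab: "a \<in> ball x0 r" if "a \<in> A" for a using that cn(4) by (auto simp: A_def)
  have "(LBINT y. indicator A y * \<bar>f y\<bar>) \<le> (LBINT y. \<bar>f y\<bar>) / real N + norm \<zeta> * T"
  proof (rule integral_over_translates[OF f Ao Ab N(1) _ _ T])
    fix a k assume a: "a \<in> A" and k: "1 \<le> k" "k < N"
    show "a + real k *\<^sub>R \<zeta> \<notin> A"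
    proof
      assume b: "a + real k *\<^sub>R \<zeta> \<in> A"
      have "- \<Omega> \<noteq> {}" by (rule bounded_Compl_nonempty[OF \<Omega>(2)])
      then obtain q where q: "q \<in> - \<Omega>" "dist (a + real k *\<^sub>R \<zeta>) q < \<epsilon>"
      proof -
        obtain q where "q \<in> - \<Omega>" "infdist (a + real k *\<^sub>R \<zeta>) (- \<Omega>) = dist (a + real k *\<^sub>R \<zeta>) q"
          using infdist_attains_inf[OF closed_Compl[OF \<Omega>(1)] \<open>- \<Omega> \<noteq> {}\<close>] by metis
        then show ?thesis using b that by (simp add: A_def)
      qed
      \<comment> \<open>A point \<open>q\<close> of the complement within \<epsilon> of the shifted
        point would lie in the open cone with vertex \<open>a\<close>, hence in \<Omega>.\<close>
      have "a + (q - a) \<in> \<Omega>"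
      proof (rule cn(5)[of a "real k * (\<epsilon> / c)"])
        show "a \<in> closure \<Omega>" "a \<in> ball x0 r" using a cA ab by auto
        show "0 < real k * (\<epsilon> / c)" using k \<epsilon> cn by simp
        have "norm (q - a - (real k * (\<epsilon> / c)) *\<^sub>R e) = dist (a + real k *\<^sub>R \<zeta>) q"
          by (simp add: dist_norm \<zeta>_def norm_minus_commute algebra_simps)
        also have "\<dots> < \<epsilon>" by (rule q)
        also have "\<epsilon> \<le> c * (real k * (\<epsilon> / c))" using k cn \<epsilon> by simp
        finally show "norm (q - a - (real k * (\<epsilon> / c)) *\<^sub>R e) < c * (real k * (\<epsilon> / c))" .
        have "dist x0 q \<le> dist x0 (a + real k *\<^sub>R \<zeta>) + dist (a + real k *\<^sub>R \<zeta>) q" by (rule dist_triangle)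
        also have "\<dots> < r / 2 + \<epsilon>" using b q by (intro add_strict_mono) (auto simp: A_def)
        also have "\<dots> \<le> r"
        proof -
          have "c * r \<le> 1 * r" using cn(3,4) by (intro mult_right_mono) auto
          then show ?thesis using \<epsilon> by linarith
        qed
        finally show "a + (q - a) \<in> ball x0 r" by simp
      qed
      with q show False by simp
    qed
  next
    fix a t assume a: "a \<in> A" and t: "(0::real) \<le> t" "t \<le> real N"
    show "a + t *\<^sub>R \<zeta> \<in> \<Omega>"
    proof (cases "t = 0")
      case False
      have "t * (\<epsilon> / c) \<le> r / 2"
      proof -
        have "t * (\<epsilon> / c) \<le> real N * (\<epsilon> / c)" using t(2) \<epsilon> cn(2) by (intro mult_right_mono) auto
        then show ?thesis using Ne by linarith
      qed
      then have "a + (t * (\<epsilon> / c)) *\<^sub>R e \<in> ball x0 r" using in_ball[OF a] t \<epsilon> cn by simp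
      then have "a + (t * (\<epsilon> / c)) *\<^sub>R e \<in> \<Omega>"
        using False a t \<epsilon> cn(1-4) cA ab by (intro cn(5)[of a "t * (\<epsilon> / c)"]) auto
      then show ?thesis by (simp add: \<zeta>_def)
    qed (use a in \<open>auto simp: A_def\<close>)
  qed
  also have "\<dots> \<le> \<epsilon> * (8 / (c * r) * (LBINT y. \<bar>f y\<bar>) + T / c)"
  proof -
    have "1 / real N \<le> \<epsilon> * (8 / (c * r))"
      using N \<epsilon> cn by (simp add: field_simps)
    from mult_right_mono[OF this, of "\<integral>y. \<bar>f y\<bar> \<partial>lborel"]
    show ?thesis by (simp add: n\<zeta> algebra_simps)
  qed
  finally show ?thesis by (simp add: A_def)
qed

lemma frontier_point_near:
  fixes \<Omega> :: "'a::euclidean_space set"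
  assumes "open \<Omega>" "y \<in> \<Omega>" "infdist y (- \<Omega>) < \<epsilon>" "bounded \<Omega>"
  obtains p where "p \<in> frontier \<Omega>" "dist y p < \<epsilon>"
proof -
  have ne: "- \<Omega> \<noteq> {}" by (rule bounded_Compl_nonempty[OF assms(4)])
  obtain q where q: "q \<in> - \<Omega>" "infdist y (- \<Omega>) = dist y q"
    using infdist_attains_inf[OF closed_Compl[OF assms(1)] ne] by metis
  have "closed_segment y q \<inter> frontier \<Omega> \<noteq> {}"
    by (rule connected_Int_frontier) (use assms(2) q in auto)
  then obtain p where p: "p \<in> closed_segment y q" "p \<in> frontier \<Omega>" by auto
  have "dist y p \<le> dist y q" using segment_bound(1)[OF p(1)] by (simp add: dist_norm norm_minus_commute)
  with q assms(3) have "dist y p < \<epsilon>" by simp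
  with p(2) show ?thesis by (rule that)
qed

text \<open>Finitely many cones suffice by compactness. The covering uses a quarter of each radius:
  a layer point is within \<open>\<epsilon> \<le> r x / 4\<close> of the frontier, hence within half
  the radius of a chosen centre, where the local estimate applies.\<close>

lemma boundary_layer:
  fixes \<Omega> :: "'a::euclidean_space set"
  assumes \<Omega>: "open \<Omega>" "bounded \<Omega>" and lip: "lipschitz_boundary \<Omega>"
  obtains C \<epsilon>0 where "C \<ge> 0" "\<epsilon>0 > 0"
    "\<And>f T \<epsilon>. \<lbrakk>integrable lborel f; tv \<Omega> f \<le> ereal T; 0 < \<epsilon>; \<epsilon> \<le> \<epsilon>0\<rbrakk> \<Longrightarrow>
      (LBINT y. indicator {y \<in> \<Omega>. infdist y (- \<Omega>) < \<epsilon>} y * \<bar>f y\<bar>) \<le> C * \<epsilon> * ((LBINT y. \<bar>f y\<bar>) + T)"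
proof -
  have "\<exists>r e c. cone_in \<Omega> x r e c" if "x \<in> frontier \<Omega>" for x
    using lipschitz_boundary_cone[OF lip that] by metis
  then obtain r e c where cone: "\<And>x. x \<in> frontier \<Omega> \<Longrightarrow> cone_in \<Omega> x (r x) (e x) (c x)" by metis
  have cpt: "compact (frontier \<Omega>)" by (rule compact_frontier_bounded[OF \<Omega>(2)])
  obtain X where X: "X \<subseteq> frontier \<Omega>" "finite X" "frontier \<Omega> \<subseteq> (\<Union>x\<in>X. ball x (r x / 4))"
  proof (rule compactE_image[OF cpt, of "frontier \<Omega>" "\<lambda>x. ball x (r x / 4)"])
    show "frontier \<Omega> \<subseteq> (\<Union>x\<in>frontier \<Omega>. ball x (r x / 4))"
      using cone_inD(4)[OF cone] by force
  qed auto
  define \<epsilon>0 where "\<epsilon>0 = Min (insert 1 ((\<lambda>x. c x * r x / 4) ` X))"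
  have e0: "\<epsilon>0 > 0"
    unfolding \<epsilon>0_def using X cone_inD(2,4)[OF cone] by (subst Min_gr_iff) auto
  have e0x: "\<epsilon>0 \<le> c x * r x / 4" if "x \<in> X" for x
    unfolding \<epsilon>0_def using X that by (intro Min_le) auto
  define C where "C = (\<Sum>x\<in>X. 8 / (c x * r x) + 1 / c x)"
  have C0: "C \<ge> 0"
    unfolding C_def by (intro sum_nonneg) (use X cone_inD(2,4)[OF cone] in \<open>auto intro!: add_nonneg_nonneg divide_nonneg_nonneg simp: less_imp_le subset_iff\<close>)
  show ?thesis
  proof (rule that[OF C0 e0])
    fix f :: "'a \<Rightarrow> real" and T \<epsilon> :: real
    assume f: "integrable lborel f" and T: "tv \<Omega> f \<le> ereal T" and \<epsilon>: "0 < \<epsilon>" "\<epsilon> \<le> \<epsilon>0"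
    let ?n = "\<integral>y. \<bar>f y\<bar> \<partial>lborel"
    let ?A = "{y \<in> \<Omega>. infdist y (- \<Omega>) < \<epsilon>}" and ?L = "\<lambda>x. {y \<in> \<Omega> \<inter> ball x (r x / 2). infdist y (- \<Omega>) < \<epsilon>}"
    have T0: "T \<ge> 0" using T tv_nonneg[of \<Omega> f] by (metis ereal_less_eq(5) order_trans)
    have n0: "?n \<ge> 0" by simp
    have oI: "open {y. infdist y (- \<Omega>) < \<epsilon>}" by (intro open_Collect_less continuous_intros)
    have Ls: "?L x \<in> sets lborel" for x
    proof -
      have "?L x = (\<Omega> \<inter> ball x (r x / 2)) \<inter> {y. infdist y (- \<Omega>) < \<epsilon>}" by auto
      moreover have "open ((\<Omega> \<inter> ball x (r x / 2)) \<inter> {y. infdist y (- \<Omega>) < \<epsilon>})" using oI \<Omega> by auto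
      ultimately show ?thesis by simp
    qed
    have As: "?A \<in> sets lborel"
    proof -
      have "?A = \<Omega> \<inter> {y. infdist y (- \<Omega>) < \<epsilon>}" by auto
      moreover have "open (\<Omega> \<inter> {y. infdist y (- \<Omega>) < \<epsilon>})" using oI \<Omega> by auto
      ultimately show ?thesis by simp
    qed
    have cover: "indicator ?A y \<le> (\<Sum>x\<in>X. indicator (?L x) y :: real)" for y
    proof (cases "y \<in> ?A")
      case True
      then obtain p where p: "p \<in> frontier \<Omega>" "dist y p < \<epsilon>"
        using frontier_point_near[OF \<Omega>(1) _ _ \<Omega>(2)] by blast
      then obtain x where x: "x \<in> X" "dist x p < r x / 4" using X(3) by auto
      have "c x * r x \<le> 1 * r x"
        using cone_inD(3,4)[OF cone[of x]] X(1) x(1) by (intro mult_right_mono) auto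
      then have "\<epsilon> \<le> r x / 4" using \<epsilon>(2) e0x[OF x(1)] by linarith
      then have "dist x y < r x / 2" using p(2) x(2) dist_triangle2[of x y p] by (simp add: dist_commute)
      then have "y \<in> ?L x" using True by simp
      then have "1 \<le> (\<Sum>x\<in>X. indicator (?L x) y :: real)"
        using member_le_sum[of x X "\<lambda>x. indicator (?L x) y :: real"] x(1) X(2) by simp
      then show ?thesis using True by simp
    qed (simp add: sum_nonneg)
    have "(LBINT y. indicator ?A y * \<bar>f y\<bar>) \<le> (LBINT y. (\<Sum>x\<in>X. indicator (?L x) y * \<bar>f y\<bar>))"
    proof (rule integral_mono)
      show "integrable lborel (\<lambda>y. indicator ?A y * \<bar>f y\<bar>)" using f by (intro integrable_indicator_mult[OF As]) auto
      show "integrable lborel (\<lambda>y. \<Sum>x\<in>X. indicator (?L x) y * \<bar>f y\<bar>)"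
        using f by (intro Bochner_Integration.integrable_sum integrable_indicator_mult[OF Ls]) auto
      show "indicator ?A y * \<bar>f y\<bar> \<le> (\<Sum>x\<in>X. indicator (?L x) y * \<bar>f y\<bar>)" for y
        using mult_right_mono[OF cover, of "\<bar>f y\<bar>" y] by (simp only: sum_distrib_right abs_ge_zero simp_thms)
    qed
    also have "\<dots> = (\<Sum>x\<in>X. \<integral>y. indicator (?L x) y * \<bar>f y\<bar> \<partial>lborel)"
      using f by (intro Bochner_Integration.integral_sum integrable_indicator_mult[OF Ls]) auto
    also have "\<dots> \<le> (\<Sum>x\<in>X. \<epsilon> * (?n + T) * (8 / (c x * r x) + 1 / c x))"
    proof (rule sum_mono)
      fix x assume x: "x \<in> X"
      note cx = cone[of x] and cd = cone_inD[OF cone[of x]]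
      have xf: "x \<in> frontier \<Omega>" using x X by auto
      have "(LBINT y. indicator (?L x) y * \<bar>f y\<bar>) \<le> \<epsilon> * (8 / (c x * r x) * ?n + T / c x)"
        using e0x[OF x] \<epsilon> by (intro boundary_layer_local[OF cx[OF xf] \<Omega> f T]) auto
      also have "\<dots> \<le> \<epsilon> * ((?n + T) * (8 / (c x * r x) + 1 / c x))"
      proof (intro mult_left_mono)
        have "a * ?n + T * b \<le> (?n + T) * (a + b)" if "a \<ge> 0" "b \<ge> 0" for a b
          using that T0 n0 by (simp add: distrib_left distrib_right mult.commute)
        from this[of "8 / (c x * r x)" "1 / c x"]
        show "8 / (c x * r x) * ?n + T / c x \<le> (?n + T) * (8 / (c x * r x) + 1 / c x)"
          using cd(2,4)[OF xf] by simp
      qed (use \<epsilon> in simp)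
      finally show "(LBINT y. indicator (?L x) y * \<bar>f y\<bar>) \<le> \<epsilon> * (?n + T) * (8 / (c x * r x) + 1 / c x)"
        by (simp add: mult.assoc)
    qed
    also have "\<dots> = C * \<epsilon> * (?n + T)" by (simp add: C_def mult.commute mult.left_commute flip: sum_distrib_left)
    finally show "(LBINT y. indicator ?A y * \<bar>f y\<bar>) \<le> C * \<epsilon> * (?n + T)" .
  qed
qed

text \<open>Points at depth more than \<open>norm h\<close> move inside \<Omega> and are covered by
  \<open>tv_translation\<close>. For the others both \<open>y\<close> and \<open>y + h\<close> lie
  either outside \<Omega>, where \<open>f\<close> vanishes, or at depth at most
  \<open>2 * norm h\<close>, thus in the layer of width \<open>3 * norm h\<close>, whose mass is
  itself of order \<open>norm h\<close>.\<close>

theorem translation_modulus: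
  fixes \<Omega> :: "'a::euclidean_space set"
  assumes \<Omega>: "open \<Omega>" "bounded \<Omega>" and lip: "lipschitz_boundary \<Omega>"
  obtains C h0 where "C \<ge> 0" "h0 > 0"
    "\<And>f T h. \<lbrakk>integrable lborel f; \<And>x. x \<notin> \<Omega> \<Longrightarrow> f x = 0; tv \<Omega> f \<le> ereal T; norm h < h0\<rbrakk> \<Longrightarrow>
      (LBINT y. \<bar>f (y + h) - f y\<bar>) \<le> C * norm h * ((LBINT y. \<bar>f y\<bar>) + T)"
proof -
  obtain C \<epsilon>0 where C: "C \<ge> 0" "\<epsilon>0 > 0"
    and layer: "\<And>f T \<epsilon>. \<lbrakk>integrable lborel f; tv \<Omega> f \<le> ereal T; 0 < \<epsilon>; \<epsilon> \<le> \<epsilon>0\<rbrakk> \<Longrightarrow>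
      (LBINT y. indicator {y \<in> \<Omega>. infdist y (- \<Omega>) < \<epsilon>} y * \<bar>f y\<bar>) \<le> C * \<epsilon> * ((LBINT y. \<bar>f y\<bar>) + T)"
    by (rule boundary_layer[OF \<Omega> lip]) (rule that, assumption+)
  have ne: "- \<Omega> \<noteq> {}" by (rule bounded_Compl_nonempty[OF \<Omega>(2)])
  show ?thesis
  proof (rule that[of "1 + 6 * C" "\<epsilon>0 / 3"])
    show "1 + 6 * C \<ge> 0" "\<epsilon>0 / 3 > 0" using C by auto
    fix f :: "'a \<Rightarrow> real" and T :: real and h :: 'a
    assume f: "integrable lborel f" and f0: "\<And>x. x \<notin> \<Omega> \<Longrightarrow> f x = 0" and T: "tv \<Omega> f \<le> ereal T" and h: "norm h < \<epsilon>0 / 3"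
    let ?n = "\<integral>y. \<bar>f y\<bar> \<partial>lborel"
    have fm[measurable]: "f \<in> borel_measurable borel" using f by auto
    have T0: "T \<ge> 0" using T tv_nonneg[of \<Omega> f] by (metis ereal_less_eq(5) order_trans)
    show "(LBINT y. \<bar>f (y + h) - f y\<bar>) \<le> (1 + 6 * C) * norm h * (?n + T)"
    proof (cases "h = 0")
      case False
      define U where "U = {y. infdist y (- \<Omega>) > norm h}"
      define A where "A = {y \<in> \<Omega>. infdist y (- \<Omega>) < 3 * norm h}"
      have h0: "norm h > 0" using False by simp
      have U\<Omega>: "U \<subseteq> \<Omega>"
      proof
        fix y assume "y \<in> U"
        then have "infdist y (- \<Omega>) \<noteq> 0" using h0 by (auto simp: U_def)
        then show "y \<in> \<Omega>" using infdist_zero[of y "- \<Omega>"] by blast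
      qed
      have Uo: "open U" unfolding U_def by (intro open_Collect_less continuous_intros)
      have Ub: "bounded U" using U\<Omega> \<Omega>(2) bounded_subset by metis
      have Us: "U \<in> sets lborel" using Uo by simp
      have As[measurable]: "A \<in> sets borel"
      proof -
        have "A = \<Omega> \<inter> {y. infdist y (- \<Omega>) < 3 * norm h}" by (auto simp: A_def)
        moreover have "open {y. infdist y (- \<Omega>) < 3 * norm h}" by (intro open_Collect_less continuous_intros)
        ultimately show ?thesis using \<Omega> by auto
      qed
      have fh: "integrable lborel (\<lambda>y. f (y + h))" using f integral_lborel_translate(2)[OF fm] by simp
      have part1: "(LBINT y. indicator U y * \<bar>f (y + h) - f y\<bar>) \<le> norm h * T"
      proof (rule tv_translation[OF f Uo Ub _ T])
        fix y t :: _ assume y: "y \<in> U" and t: "(0::real) \<le> t" "t \<le> 1"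
        show "y + t *\<^sub>R h \<in> \<Omega>"
        proof (rule ccontr)
          assume "y + t *\<^sub>R h \<notin> \<Omega>"
          then have "infdist y (- \<Omega>) \<le> dist y (y + t *\<^sub>R h)" by (intro infdist_le) simp
          also have "\<dots> \<le> norm h" using t by (simp add: dist_norm mult_left_le_one_le)
          finally show False using y by (simp add: U_def)
        qed
      qed
      define g where "g y = indicator A y * \<bar>f y\<bar>" for y
      have gm: "g \<in> borel_measurable borel" unfolding g_def[abs_def] by measurable
      have gi: "integrable lborel g" unfolding g_def[abs_def] using f As by (intro integrable_indicator_mult) auto
      have gh: "integrable lborel (\<lambda>y. g (y + h))" using gi integral_lborel_translate(2)[OF gm] by simp
      have gle: "(LBINT y. g y) \<le> C * (3 * norm h) * (?n + T)"
        unfolding g_def A_def using h h0 by (intro layer[OF f T]) auto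
      have pt: "\<bar>f (y + h) - f y\<bar> \<le> indicator U y * \<bar>f (y + h) - f y\<bar> + (g (y + h) + g y)" for y
      proof (cases "y \<in> U")
        case True
        then show ?thesis by (simp add: g_def)
      next
        case False
        then have y: "infdist y (- \<Omega>) \<le> norm h" by (simp add: U_def)
        have "infdist (y + h) (- \<Omega>) \<le> infdist y (- \<Omega>) + dist (y + h) y" by (rule infdist_triangle)
        moreover have "dist (y + h) y = norm h" by (simp add: dist_norm)
        ultimately have "infdist (y + h) (- \<Omega>) < 3 * norm h" using y h0 by linarith
        then have "g (y + h) = \<bar>f (y + h)\<bar>" using f0[of "y + h"] by (cases "y + h \<in> \<Omega>") (auto simp: g_def A_def)
        moreover have "g y = \<bar>f y\<bar>"
        proof -
          have "infdist y (- \<Omega>) < 3 * norm h" using y h0 by linarith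
          then show ?thesis using f0[of y] by (cases "y \<in> \<Omega>") (auto simp: g_def A_def)
        qed
        ultimately show ?thesis using False by simp
      qed
      have iU: "integrable lborel (\<lambda>y. indicator U y * \<bar>f (y + h) - f y\<bar>)"
        using f fh by (intro integrable_indicator_mult[OF Us]) auto
      have "(LBINT y. \<bar>f (y + h) - f y\<bar>) \<le> (LBINT y. indicator U y * \<bar>f (y + h) - f y\<bar> + (g (y + h) + g y))"
        using f fh iU gi gh pt by (intro integral_mono) auto
      also have "\<dots> = (LBINT y. indicator U y * \<bar>f (y + h) - f y\<bar>) + ((LBINT y. g (y + h)) + (LBINT y. g y))"
        using iU gi gh by simp
      also have "(LBINT y. g (y + h)) = (LBINT y. g y)" by (rule integral_lborel_translate(1)[OF gm])
      also have "(LBINT y. indicator U y * \<bar>f (y + h) - f y\<bar>) + ((LBINT y. g y) + (LBINT y. g y))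
         \<le> norm h * T + 2 * (C * (3 * norm h) * (?n + T))" using part1 gle by linarith
      also have "\<dots> \<le> (1 + 6 * C) * norm h * (?n + T)"
      proof -
        have "norm h * T \<le> norm h * (?n + T)" by (intro mult_left_mono) auto
        then show ?thesis by (simp add: algebra_simps)
      qed
      finally show ?thesis .
    qed simp
  qed
qed

section \<open>From translations to the Sobolev inequality\<close>

text \<open>Divided by the length of \<open>h\<close>, a difference quotient of the indicator
  function of \<open>E\<close>; a substitute for the perimeter.\<close>

definition lost :: "'a::euclidean_space set \<Rightarrow> 'a \<Rightarrow> ennreal" where
  "lost E h = emeasure lborel {x \<in> E. x + h \<notin> E}"

lemma lost_altdef:
  fixes E :: "'a::euclidean_space set"
  assumes [measurable]: "E \<in> sets borel"
  shows "lost E h = (\<integral>\<^sup>+x. indicator E x * indicator (- E) (x + h) \<partial>lborel)"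
proof -
  have "(\<integral>\<^sup>+x. indicator E x * indicator (- E) (x + h) \<partial>lborel) =
      (\<integral>\<^sup>+x. indicator {x \<in> E. x + h \<notin> E} x \<partial>lborel :: ennreal)"
    by (intro nn_integral_cong) (auto simp: indicator_def)
  also have "\<dots> = lost E h"
    unfolding lost_def by (intro nn_integral_indicator) measurable
  finally show ?thesis ..
qed

text \<open>A point that is outside after \<open>N + 1\<close> steps was outside after
  \<open>N\<close> steps or left with the last one, and the latter set is a translate of the points
  lost in one step.\<close>

lemma lost_multiple:
  fixes E :: "'a::euclidean_space set"
  assumes [measurable]: "E \<in> sets borel"
  shows "lost E (real N *\<^sub>R h) \<le> of_nat N * lost E h"
proof (induction N)
  case 0
  have "{x \<in> E. x \<notin> E} = {}" by auto
  then show ?case by (simp add: lost_def)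
next
  case (Suc N)
  let ?h = "real N *\<^sub>R h"
  have "lost E (real (Suc N) *\<^sub>R h) \<le> emeasure lborel ({x \<in> E. x + ?h \<notin> E} \<union> {x. x + ?h \<in> E \<and> (x + ?h) + h \<notin> E})"
    unfolding lost_def by (intro emeasure_mono) (auto simp: algebra_simps)
  also have "\<dots> \<le> lost E ?h + emeasure lborel {x. x + ?h \<in> E \<and> (x + ?h) + h \<notin> E}"
    unfolding lost_def by (intro emeasure_subadditive) measurable
  also have "emeasure lborel {x. x + ?h \<in> E \<and> (x + ?h) + h \<notin> E} =
      (\<integral>\<^sup>+x. indicator {x. x + ?h \<in> E \<and> (x + ?h) + h \<notin> E} x \<partial>lborel)"
    by (intro nn_integral_indicator[symmetric]) measurable
  also have "\<dots> = (\<integral>\<^sup>+x. indicator {x \<in> E. x + h \<notin> E} (x + ?h) \<partial>lborel)"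
    by (intro nn_integral_cong) (auto simp: indicator_def)
  also have "\<dots> = lost E h"
    unfolding lost_def by (subst nn_integral_lborel_translate) auto
  finally show ?case
    using Suc by (auto simp: distrib_right add.commute intro: order_trans add_mono)
qed

lemma measurable_lost_scaled [measurable]:
  assumes [measurable]: "E \<in> sets borel"
  shows "(\<lambda>u. lost E (c *\<^sub>R u)) \<in> borel_measurable borel"
proof -
  have "(\<lambda>u. \<integral>\<^sup>+x. indicator E x * indicator (- E) (x + c *\<^sub>R u) \<partial>lborel) \<in> borel_measurable lborel"
    by measurable
  then show ?thesis by (simp add: lost_altdef)
qed

section \<open>An isoperimetric estimate by averaging over a ball\<close>

abbreviation unit_vol :: "'a::euclidean_space itself \<Rightarrow> real" where
  "unit_vol _ \<equiv> measure lborel (ball (0::'a) 1)"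

lemma unit_vol_pos: "unit_vol TYPE('a::euclidean_space) > 0"
  by (simp add: content_ball_pos)

lemma emeasure_unit_ball: "emeasure lborel (ball (0::'a::euclidean_space) 1) = ennreal (unit_vol TYPE('a))"
  using emeasure_bounded_finite[OF bounded_ball, of "0::'a" 1]
  by (intro emeasure_eq_ennreal_measure) (auto simp: less_top)

lemma lost_average_lower:
  fixes E :: "'a::euclidean_space set"
  assumes E[measurable]: "E \<in> sets borel" and fin: "emeasure lborel E = ennreal m" and "m \<ge> 0"
    and \<rho>: "\<rho> > 0" "2 * m \<le> unit_vol TYPE('a) * \<rho> ^ DIM('a)"
  shows "ennreal (m * unit_vol TYPE('a) / 2) \<le> (\<integral>\<^sup>+u\<in>ball 0 1. lost E (\<rho> *\<^sub>R u) \<partial>lborel)"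
proof -
  let ?w = "unit_vol TYPE('a)" and ?B = "ball (0::'a) 1"
  have [measurable]: "- E \<in> sets borel" "?B \<in> sets borel" using E by auto
  \<comment> \<open>For fixed \<open>x\<close>, at least half of the directions \<open>u\<close>
    take \<open>x + \<rho> *\<^sub>R u\<close> out of \<open>E\<close>, because \<open>E\<close> has
    at most half the volume of a ball of radius \<rho>. The claim is the integral of this over
    \<open>x\<close> in \<open>E\<close>.\<close>
  have ge: "ennreal (?w / 2) \<le> (\<integral>\<^sup>+u. indicator ?B u * indicator (- E) (x + \<rho> *\<^sub>R u) \<partial>lborel)" for x
  proof -
    let ?S = "{u. x + \<rho> *\<^sub>R u \<in> E}"
    have Sm: "?S \<in> sets borel" by measurable
    have "?S = (\<lambda>y. (1 / \<rho>) *\<^sub>R y + (- (1 / \<rho>) *\<^sub>R x)) ` E"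
    proof (rule Set.set_eqI)
      fix u
      have "u = (1 / \<rho>) *\<^sub>R (x + \<rho> *\<^sub>R u) + (- (1 / \<rho>) *\<^sub>R x)"
        using \<rho>(1) by (simp add: scaleR_add_right)
      moreover have "x + \<rho> *\<^sub>R ((1 / \<rho>) *\<^sub>R y + (- (1 / \<rho>) *\<^sub>R x)) = y" for y
        using \<rho>(1) by (simp add: scaleR_diff_right)
      ultimately show "u \<in> ?S \<longleftrightarrow> u \<in> (\<lambda>y. (1 / \<rho>) *\<^sub>R y + (- (1 / \<rho>) *\<^sub>R x)) ` E"
        by (auto intro: image_eqI)
    qed
    then have "emeasure lebesgue ?S = ennreal ((1 / \<rho>) ^ DIM('a)) * emeasure lebesgue E"
      using emeasure_lebesgue_affine[of "1 / \<rho>" "- (1 / \<rho>) *\<^sub>R x" E] \<rho>(1) by simp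
    moreover have "emeasure lebesgue ?S = emeasure lborel ?S" "emeasure lebesgue E = emeasure lborel E"
      using Sm E by (simp_all add: emeasure_completion)
    ultimately have S: "emeasure lborel ?S = ennreal ((1 / \<rho>) ^ DIM('a) * m)"
      using fin \<open>m \<ge> 0\<close> \<rho>(1) by (simp add: ennreal_mult)
    have "(1 / \<rho>) ^ DIM('a) * m \<le> ?w / 2"
      using \<rho> by (simp add: field_simps power_one_over)
    then have S2: "emeasure lborel ?S \<le> ennreal (?w / 2)" by (simp add: S ennreal_leI)
    have "ennreal (?w / 2) + ennreal (?w / 2) = emeasure lborel ?B"
      by (simp add: emeasure_unit_ball flip: ennreal_plus)
    also have "\<dots> \<le> emeasure lborel ((?B - ?S) \<union> ?S)" by (intro emeasure_mono) auto
    also have "\<dots> \<le> emeasure lborel (?B - ?S) + emeasure lborel ?S"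
      by (intro emeasure_subadditive) measurable
    also have "\<dots> \<le> emeasure lborel (?B - ?S) + ennreal (?w / 2)" by (intro add_left_mono S2)
    finally have "ennreal (?w / 2) \<le> emeasure lborel (?B - ?S)"
      by (simp add: ennreal_add_left_cancel_le add.commute)
    also have "\<dots> = (\<integral>\<^sup>+u. indicator (?B - ?S) u \<partial>lborel)"
      using Sm by (intro nn_integral_indicator[symmetric]) auto
    also have "\<dots> = (\<integral>\<^sup>+u. indicator ?B u * indicator (- E) (x + \<rho> *\<^sub>R u) \<partial>lborel)"
      by (intro nn_integral_cong) (auto simp: indicator_def)
    finally show ?thesis .
  qed
  have "ennreal (m * ?w / 2) = (\<integral>\<^sup>+x. indicator E x * ennreal (?w / 2) \<partial>lborel)"
    using \<open>m \<ge> 0\<close> by (simp add: nn_integral_multc fin ennreal_mult flip: times_divide_eq_right)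
  also have "\<dots> \<le> (\<integral>\<^sup>+x. indicator E x * (\<integral>\<^sup>+u. indicator ?B u * indicator (- E) (x + \<rho> *\<^sub>R u) \<partial>lborel) \<partial>lborel)"
    by (intro nn_integral_mono mult_left_mono ge) auto
  also have "\<dots> = (\<integral>\<^sup>+x. \<integral>\<^sup>+u. indicator E x * (indicator ?B u * indicator (- E) (x + \<rho> *\<^sub>R u)) \<partial>lborel \<partial>lborel)"
    by (subst nn_integral_cmult) measurable
  also have "\<dots> = (\<integral>\<^sup>+u. \<integral>\<^sup>+x. indicator E x * (indicator ?B u * indicator (- E) (x + \<rho> *\<^sub>R u)) \<partial>lborel \<partial>lborel)"
    by (rule lborel_pair.Fubini') measurable
  also have "\<dots> = (\<integral>\<^sup>+u\<in>?B. lost E (\<rho> *\<^sub>R u) \<partial>lborel)"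
  proof (intro nn_integral_cong)
    fix u
    have "(\<integral>\<^sup>+x. indicator E x * (indicator ?B u * indicator (- E) (x + \<rho> *\<^sub>R u)) \<partial>lborel) =
      (\<integral>\<^sup>+x. indicator ?B u * indicator {x \<in> E. x + \<rho> *\<^sub>R u \<notin> E} x \<partial>lborel)"
      by (intro nn_integral_cong) (auto simp: indicator_def)
    also have "\<dots> = lost E (\<rho> *\<^sub>R u) * indicator ?B u"
      by (subst nn_integral_cmult_indicator) (auto simp: lost_def mult.commute)
    finally show "(\<integral>\<^sup>+x. indicator E x * (indicator ?B u * indicator (- E) (x + \<rho> *\<^sub>R u)) \<partial>lborel) =
      lost E (\<rho> *\<^sub>R u) * indicator ?B u" .
  qed
  finally show ?thesis .
qed

text \<open>The exponent \<open>1 - 1/n\<close> vanishes for \<open>n = 1\<close>; the case distinction gives \<open>0\<close>, not \<open>0 powr 0\<close>, on null sets.\<close>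

definition isop :: "'a::euclidean_space itself \<Rightarrow> real \<Rightarrow> real" where
  "isop _ m = (if m > 0 then m powr (1 - 1 / real DIM('a)) else 0)"

text \<open>Moved by the vectors of a ball of volume \<open>2m\<close>, a set of volume \<open>m\<close> leaves at least half of itself on
  average; subadditivity of the loss then lets the radius of the ball tend to \<open>0\<close>.\<close>

definition sobolev_const :: "'a::euclidean_space itself \<Rightarrow> real" where
  "sobolev_const _ = 4 * (2 / unit_vol TYPE('a)) powr (1 / real DIM('a))"

lemma sobolev_const_pos: "sobolev_const TYPE('a::euclidean_space) > 0"
  using unit_vol_pos[where 'a='a] by (simp add: sobolev_const_def)

lemma isoperimetric_scale:
  fixes E :: "'a::euclidean_space set"
  assumes E[measurable]: "E \<in> sets borel" and fin: "emeasure lborel E = ennreal m" and "m \<ge> 0"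
  shows "\<exists>r0>0. \<forall>\<rho>. 0 < \<rho> \<and> \<rho> \<le> r0 \<longrightarrow>
     ennreal (isop TYPE('a) m * unit_vol TYPE('a)) \<le>
       ennreal (sobolev_const TYPE('a) / \<rho>) * (\<integral>\<^sup>+u\<in>ball 0 1. lost E (\<rho> *\<^sub>R u) \<partial>lborel)"
proof (cases "m = 0")
  case True
  then show ?thesis by (intro exI[of _ 1]) (auto simp: isop_def)
next
  case False
  then have m: "m > 0" using \<open>m \<ge> 0\<close> by simp
  let ?w = "unit_vol TYPE('a)"
  have w: "?w > 0" by (rule unit_vol_pos)
  \<comment> \<open>The radius of the ball of volume \<open>2 * m\<close>, the smallest scale to
    which \<open>lost_average_lower\<close> applies.\<close>
  define R where "R = (2 * m / ?w) powr (1 / real DIM('a))"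
  have R: "R > 0" using m w by (simp add: R_def)
  have RD: "R ^ DIM('a) = 2 * m / ?w"
    using R m w by (simp add: R_def powr_powr powr_realpow[symmetric])
  show ?thesis
  proof (intro exI[of _ R] conjI R allI impI)
    fix \<rho> assume \<rho>: "0 < \<rho> \<and> \<rho> \<le> R"
    \<comment> \<open>\<open>N\<close> steps of size \<rho> reach the scale \<open>R\<close>; since
      \<open>\<rho> \<le> R\<close>, rounding up at most doubles the quotient. This factor, and the
      half in \<open>lost_average_lower\<close>, account for the 4 in
      \<open>sobolev_const\<close>.\<close>
    define N where "N = nat \<lceil>R / \<rho>\<rceil>"
    have N: "R \<le> real N * \<rho>" "real N \<le> 2 * R / \<rho>"
    proof -
      have "R / \<rho> \<le> real N" unfolding N_def by linarith
      then show "R \<le> real N * \<rho>" using \<rho> by (simp add: field_simps)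
      have "real N \<le> R / \<rho> + 1" using R \<rho> unfolding N_def by (simp add: of_nat_nat)
      also have "1 \<le> R / \<rho>" using \<rho> by simp
      finally show "real N \<le> 2 * R / \<rho>" by simp
    qed
    have "2 * m \<le> ?w * (real N * \<rho>) ^ DIM('a)"
    proof -
      have "2 * m = ?w * R ^ DIM('a)" using RD w by simp
      also have "\<dots> \<le> ?w * (real N * \<rho>) ^ DIM('a)"
        using N(1) R w by (intro mult_left_mono power_mono) auto
      finally show ?thesis .
    qed
    then have "ennreal (m * ?w / 2) \<le> (\<integral>\<^sup>+u\<in>ball 0 1. lost E ((real N * \<rho>) *\<^sub>R u) \<partial>lborel)"
      using N R by (intro lost_average_lower[OF E fin \<open>m \<ge> 0\<close>]) auto
    also have "\<dots> \<le> (\<integral>\<^sup>+u\<in>ball 0 1. of_nat N * lost E (\<rho> *\<^sub>R u) \<partial>lborel)"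
      using lost_multiple[OF E, of N] by (intro nn_integral_mono mult_right_mono) (simp_all flip: scaleR_scaleR)
    also have "\<dots> = of_nat N * (\<integral>\<^sup>+u\<in>ball 0 1. lost E (\<rho> *\<^sub>R u) \<partial>lborel)"
    proof -
      have [measurable]: "ball (0::'a) 1 \<in> sets borel" by simp
      show ?thesis by (subst nn_integral_cmult[symmetric]) (measurable, simp add: mult.assoc)
    qed
    also have "\<dots> \<le> ennreal (2 * R / \<rho>) * (\<integral>\<^sup>+u\<in>ball 0 1. lost E (\<rho> *\<^sub>R u) \<partial>lborel)"
      using N(2) by (intro mult_right_mono) (simp_all add: ennreal_of_nat_eq_real_of_nat ennreal_leI)
    finally have *: "ennreal (m * ?w / 2) \<le> ennreal (2 * R / \<rho>) * (\<integral>\<^sup>+u\<in>ball 0 1. lost E (\<rho> *\<^sub>R u) \<partial>lborel)" .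
    have i: "isop TYPE('a) m * ?w = (2 / R * (2 / ?w) powr (1 / real DIM('a))) * (m * ?w / 2)"
    proof -
      have "R = m powr (1 / real DIM('a)) * (2 / ?w) powr (1 / real DIM('a))"
        using m w by (simp add: R_def mult.commute flip: powr_mult)
      moreover have "m powr (1 - 1 / real DIM('a)) * m powr (1 / real DIM('a)) = m"
        using m by (simp flip: powr_add)
      ultimately show ?thesis
        using m w by (simp add: isop_def field_simps)
    qed
    have "ennreal (isop TYPE('a) m * ?w) = ennreal (2 / R * (2 / ?w) powr (1 / real DIM('a))) * ennreal (m * ?w / 2)"
      unfolding i using R m w by (intro ennreal_mult) auto
    also have "\<dots> \<le> ennreal (2 / R * (2 / ?w) powr (1 / real DIM('a))) *
        (ennreal (2 * R / \<rho>) * (\<integral>\<^sup>+u\<in>ball 0 1. lost E (\<rho> *\<^sub>R u) \<partial>lborel))"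
      by (intro mult_left_mono *) auto
    also have "\<dots> = ennreal (2 / R * (2 / ?w) powr (1 / real DIM('a)) * (2 * R / \<rho>)) *
        (\<integral>\<^sup>+u\<in>ball 0 1. lost E (\<rho> *\<^sub>R u) \<partial>lborel)"
      using R w \<rho> by (subst ennreal_mult) (auto simp: mult.assoc)
    also have "2 / R * (2 / ?w) powr (1 / real DIM('a)) * (2 * R / \<rho>) = sobolev_const TYPE('a) / \<rho>"
      using R by (simp add: sobolev_const_def)
    finally show "ennreal (isop TYPE('a) m * ?w) \<le>
      ennreal (sobolev_const TYPE('a) / \<rho>) * (\<integral>\<^sup>+u\<in>ball 0 1. lost E (\<rho> *\<^sub>R u) \<partial>lborel)" .
  qed
qed

lemma isop_measurable [measurable]: "isop TYPE('a::euclidean_space) \<in> borel_measurable borel"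
  unfolding isop_def by measurable

section \<open>Superlevel sets and the Sobolev inequality\<close>

lemma superlevel_finite:
  fixes f :: "'a::euclidean_space \<Rightarrow> real"
  assumes "integrable lborel f" "\<And>x. f x \<ge> 0" "t > 0"
  shows "emeasure lborel {x. f x > t} = ennreal (measure lborel {x. f x > t})"
proof -
  have [measurable]: "f \<in> borel_measurable borel" using assms by auto
  have "ennreal t * emeasure lborel {x. f x > t} = (\<integral>\<^sup>+x. ennreal t * indicator {x. f x > t} x \<partial>lborel)"
    by (subst nn_integral_cmult_indicator) measurable
  also have "\<dots> \<le> (\<integral>\<^sup>+x. ennreal (f x) \<partial>lborel)"
    using assms(2) by (intro nn_integral_mono) (auto simp: indicator_def intro!: ennreal_leI less_imp_le)
  also have "\<dots> < \<infinity>"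
    using assms integrableD(2)[OF assms(1)] nn_integral_eq_integral[of lborel f] by auto
  finally have "emeasure lborel {x. f x > t} < \<infinity>"
    using assms(3) by (auto simp: ennreal_mult_less_top)
  then show ?thesis by (intro emeasure_eq_ennreal_measure) auto
qed

lemma superlevel_measurable:
  fixes f :: "'a::euclidean_space \<Rightarrow> real"
  assumes [measurable]: "f \<in> borel_measurable borel"
  shows "(\<lambda>t. measure lborel {x. f x > t}) \<in> borel_measurable borel"
proof -
  have "(\<lambda>t. emeasure lborel {x. f x > t}) = (\<lambda>t. \<integral>\<^sup>+x. of_bool (f x > t) \<partial>lborel)"
  proof
    fix t
    have "emeasure lborel {x. f x > t} = (\<integral>\<^sup>+x. indicator {x. f x > t} x \<partial>lborel)"
      by (intro nn_integral_indicator[symmetric]) measurable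
    then show "emeasure lborel {x. f x > t} = (\<integral>\<^sup>+x. of_bool (f x > t) \<partial>lborel)"
      by (simp add: indicator_def)
  qed
  moreover have "(\<lambda>t. \<integral>\<^sup>+x. of_bool (f x > t) \<partial>lborel) \<in> borel_measurable (borel :: real measure)"
    by measurable
  ultimately have "(\<lambda>t. enn2real (emeasure lborel {x. f x > t})) \<in> borel_measurable borel" by simp
  then show ?thesis by (simp add: measure_def)
qed

text \<open>Integrated over all levels, the loss of the superlevel sets under translation by
  \<open>h\<close> is at most the integral of the difference of \<open>f\<close>, so it is at most
  \<open>K * norm h\<close>. At scale \<open>\<rho> k\<close> the isoperimetric estimate contributes
  a factor \<open>1 / \<rho> k\<close>, which this bound cancels.\<close>

lemma coarea_isoperimetric:
  fixes f :: "'a::euclidean_space \<Rightarrow> real"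
  assumes int: "integrable lborel f" and f0: "\<And>x. f x \<ge> 0" and "h0 > 0" "K \<ge> 0"
    and mod: "\<And>h. norm h < h0 \<Longrightarrow> (\<integral>\<^sup>+x. ennreal \<bar>f (x + h) - f x\<bar> \<partial>lborel) \<le> ennreal (K * norm h)"
  shows "(\<integral>\<^sup>+t\<in>{0<..}. ennreal (isop TYPE('a) (measure lborel {x. f x > t})) \<partial>lborel)
      \<le> ennreal (sobolev_const TYPE('a) * K)"
proof -
  let ?w = "unit_vol TYPE('a)" and ?c = "sobolev_const TYPE('a)" and ?B = "ball (0::'a) 1"
  have fm[measurable]: "f \<in> borel_measurable borel" using int by auto
  have [measurable]: "?B \<in> sets borel" by simp
  have w: "?w > 0" and c: "?c > 0" by (rule unit_vol_pos sobolev_const_pos)+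
  define m where "m t = measure lborel {x. f x > t}" for t
  define \<rho> where "\<rho> k = 1 / real (Suc k)" for k
  have \<rho>: "\<rho> k > 0" for k by (simp add: \<rho>_def)
  have \<rho>0: "\<rho> \<longlonglongrightarrow> 0" unfolding \<rho>_def by (rule LIMSEQ_Suc) (rule lim_1_over_n)
  define A where "A k t = (\<integral>\<^sup>+u\<in>?B. lost {x. f x > t} (\<rho> k *\<^sub>R u) \<partial>lborel)" for k t
  have lost_eq: "lost {x. f x > t} h = (\<integral>\<^sup>+x. indicator {y. y > t} (f x) * indicator {y. y \<le> t} (f (x + h)) \<partial>lborel)" for t h
    by (subst lost_altdef) (auto intro!: nn_integral_cong simp: indicator_def)
  have A_eq: "A k t = (\<integral>\<^sup>+u. \<integral>\<^sup>+x. indicator ?B u * (of_bool (t < f x) * of_bool (f (x + \<rho> k *\<^sub>R u) \<le> t)) \<partial>lborel \<partial>lborel)" for k t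
  proof -
    have "lost {x. f x > t} (\<rho> k *\<^sub>R u) * indicator ?B u =
       (\<integral>\<^sup>+x. indicator ?B u * (of_bool (t < f x) * of_bool (f (x + \<rho> k *\<^sub>R u) \<le> t)) \<partial>lborel)" for u
      unfolding lost_eq
      by (subst nn_integral_multc[symmetric]) (auto simp: mult.commute indicator_def intro!: nn_integral_cong)
    then show ?thesis by (simp add: A_def)
  qed
  have A_m[measurable]: "A k \<in> borel_measurable borel" for k
  proof -
    have "(\<lambda>t. \<integral>\<^sup>+u. \<integral>\<^sup>+x. indicator ?B u * (of_bool (t < f x) * of_bool (f (x + \<rho> k *\<^sub>R u) \<le> t)) \<partial>lborel \<partial>lborel)
        \<in> borel_measurable (borel :: real measure)"
      by measurable
    then show ?thesis by (simp add: A_eq[abs_def])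
  qed
  have m_mono: "m t \<le> m s" if "0 < s" "s \<le> t" for s t
    unfolding m_def
    by (rule measure_mono_fmeasurable) (use that superlevel_finite[OF int f0, of s] in \<open>auto simp: fmeasurable_def\<close>)
  have m_meas[measurable]: "m \<in> borel_measurable borel"
    unfolding m_def[abs_def] by (rule superlevel_measurable[OF fm])
  have step: "(\<integral>\<^sup>+t\<in>{0<..}. ennreal (?c / \<rho> k) * A k t \<partial>lborel) \<le> ennreal (?c * K * ?w)" if k: "\<rho> k < h0" for k
  proof -
    have "(\<integral>\<^sup>+t\<in>{0<..}. A k t \<partial>lborel) =
      (\<integral>\<^sup>+t. \<integral>\<^sup>+u. (\<integral>\<^sup>+x. indicator {0<..} t * (indicator ?B u * (of_bool (t < f x) * of_bool (f (x + \<rho> k *\<^sub>R u) \<le> t))) \<partial>lborel) \<partial>lborel \<partial>lborel)"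
      unfolding A_eq by (subst nn_integral_cmult | subst nn_integral_multc[symmetric] | simp add: mult.commute)+
    also have "\<dots> = (\<integral>\<^sup>+u. \<integral>\<^sup>+t. (\<integral>\<^sup>+x. indicator {0<..} t * (indicator ?B u * (of_bool (t < f x) * of_bool (f (x + \<rho> k *\<^sub>R u) \<le> t))) \<partial>lborel) \<partial>lborel \<partial>lborel)"
      by (rule lborel_pair.Fubini') measurable
    also have "\<dots> = (\<integral>\<^sup>+u. \<integral>\<^sup>+x. (\<integral>\<^sup>+t. indicator {0<..} t * (indicator ?B u * (of_bool (t < f x) * of_bool (f (x + \<rho> k *\<^sub>R u) \<le> t))) \<partial>lborel) \<partial>lborel \<partial>lborel)"
      by (intro nn_integral_cong lborel_pair.Fubini') measurable
    also have "\<dots> \<le> (\<integral>\<^sup>+u. indicator ?B u * ennreal (K * \<rho> k) \<partial>lborel)"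
    proof (rule nn_integral_mono)
      fix u
      show "(\<integral>\<^sup>+x. (\<integral>\<^sup>+t. indicator {0<..} t * (indicator ?B u * (of_bool (t < f x) * of_bool (f (x + \<rho> k *\<^sub>R u) \<le> t))) \<partial>lborel) \<partial>lborel)
           \<le> indicator ?B u * ennreal (K * \<rho> k)"
      proof (cases "u \<in> ?B")
        case True
        have "(\<integral>\<^sup>+x. (\<integral>\<^sup>+t. indicator {0<..} t * (indicator ?B u * (of_bool (t < f x) * of_bool (f (x + \<rho> k *\<^sub>R u) \<le> t))) \<partial>lborel) \<partial>lborel)
          \<le> (\<integral>\<^sup>+x. ennreal \<bar>f (x + \<rho> k *\<^sub>R u) - f x\<bar> \<partial>lborel)"
        proof (rule nn_integral_mono)
          \<comment> \<open>The levels separating the two values form an interval no longer than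
            their difference; this is the only trace of the coarea formula.\<close>
          fix x
          have "(\<integral>\<^sup>+t. indicator {0<..} t * (indicator ?B u * (of_bool (t < f x) * of_bool (f (x + \<rho> k *\<^sub>R u) \<le> t))) \<partial>lborel)
             \<le> (\<integral>\<^sup>+t. indicator {f (x + \<rho> k *\<^sub>R u)..f x} t \<partial>lborel)"
            by (intro nn_integral_mono) (auto simp: indicator_def)
          also have "\<dots> = emeasure lborel {f (x + \<rho> k *\<^sub>R u)..f x}" by simp
          also have "\<dots> \<le> ennreal \<bar>f (x + \<rho> k *\<^sub>R u) - f x\<bar>"
            by (cases "f (x + \<rho> k *\<^sub>R u) \<le> f x") auto
          finally show "(\<integral>\<^sup>+t. indicator {0<..} t * (indicator ?B u * (of_bool (t < f x) * of_bool (f (x + \<rho> k *\<^sub>R u) \<le> t))) \<partial>lborel)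
             \<le> ennreal \<bar>f (x + \<rho> k *\<^sub>R u) - f x\<bar>" .
        qed
        also have "\<dots> \<le> ennreal (K * norm (\<rho> k *\<^sub>R u))"
        proof (rule mod)
          have "norm (\<rho> k *\<^sub>R u) \<le> \<rho> k" using True \<rho>[of k] by (simp add: mult_left_le)
          then show "norm (\<rho> k *\<^sub>R u) < h0" using k by simp
        qed
        also have "\<dots> \<le> ennreal (K * \<rho> k)"
          using True \<rho>[of k] \<open>K \<ge> 0\<close> by (intro ennreal_leI mult_left_mono) (auto simp: mult_left_le)
        finally show ?thesis using True by simp
      qed simp
    qed
    also have "\<dots> = ennreal (K * \<rho> k) * ennreal ?w"
      by (subst nn_integral_multc) (simp_all add: emeasure_unit_ball mult.commute)
    finally have AK: "(\<integral>\<^sup>+t\<in>{0<..}. A k t \<partial>lborel) \<le> ennreal (K * \<rho> k) * ennreal ?w" .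
    have "(\<integral>\<^sup>+t\<in>{0<..}. ennreal (?c / \<rho> k) * A k t \<partial>lborel) = ennreal (?c / \<rho> k) * (\<integral>\<^sup>+t\<in>{0<..}. A k t \<partial>lborel)"
      by (subst nn_integral_cmult[symmetric]) (measurable, simp add: mult.assoc)
    also have "\<dots> \<le> ennreal (?c / \<rho> k) * (ennreal (K * \<rho> k) * ennreal ?w)"
      by (intro mult_left_mono AK) simp
    also have "\<dots> = ennreal ((?c / \<rho> k) * ((K * \<rho> k) * ?w))"
    proof -
      have "ennreal a * (ennreal b * ennreal d) = ennreal (a * (b * d))" if "a \<ge> 0" "b \<ge> 0" "d \<ge> 0" for a b d
        using that by (simp add: ennreal_mult)
      then show ?thesis using c w \<rho>[of k] \<open>K \<ge> 0\<close> by simp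
    qed
    also have "(?c / \<rho> k) * ((K * \<rho> k) * ?w) = ?c * K * ?w"
      using \<rho>[of k] by simp
    finally show ?thesis .
  qed
  have "(\<integral>\<^sup>+t\<in>{0<..}. ennreal (isop TYPE('a) (m t) * ?w) \<partial>lborel) \<le>
        (\<integral>\<^sup>+t. liminf (\<lambda>k. ennreal (?c / \<rho> k) * A k t * indicator {0<..} t) \<partial>lborel)"
  proof (rule nn_integral_mono)
    fix t :: real
    show "ennreal (isop TYPE('a) (m t) * ?w) * indicator {0<..} t \<le> liminf (\<lambda>k. ennreal (?c / \<rho> k) * A k t * indicator {0<..} t)"
    proof (cases "t > 0")
      case True
      have E: "{x. f x > t} \<in> sets borel" by measurable
      obtain r0 where r0: "r0 > 0" "\<And>\<rho>. 0 < \<rho> \<Longrightarrow> \<rho> \<le> r0 \<Longrightarrow> ennreal (isop TYPE('a) (m t) * ?w) \<le>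
         ennreal (?c / \<rho>) * (\<integral>\<^sup>+u\<in>?B. lost {x. f x > t} (\<rho> *\<^sub>R u) \<partial>lborel)"
        using isoperimetric_scale[OF E superlevel_finite[OF int f0 True]] unfolding m_def by auto
      have "\<forall>\<^sub>F k in sequentially. \<rho> k < r0" using \<rho>0 r0(1) by (rule order_tendstoD)
      then have "\<forall>\<^sub>F k in sequentially. ennreal (isop TYPE('a) (m t) * ?w) \<le> ennreal (?c / \<rho> k) * A k t"
        by eventually_elim (use r0(2) \<rho> in \<open>auto simp: A_def less_imp_le\<close>)
      then have "ennreal (isop TYPE('a) (m t) * ?w) \<le> liminf (\<lambda>k. ennreal (?c / \<rho> k) * A k t)"
        by (rule Liminf_bounded)
      then show ?thesis using True by simp
    qed simp
  qed
  \<comment> \<open>The scale below which the isoperimetric estimate holds depends on the level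
    \<open>t\<close>, so the limit is taken by Fatou's lemma.\<close>
  also have "\<dots> \<le> liminf (\<lambda>k. \<integral>\<^sup>+t. ennreal (?c / \<rho> k) * A k t * indicator {0<..} t \<partial>lborel)"
    by (rule nn_integral_liminf) measurable
  also have "\<dots> \<le> limsup (\<lambda>k. \<integral>\<^sup>+t. ennreal (?c / \<rho> k) * A k t * indicator {0<..} t \<partial>lborel)"
    by (rule Liminf_le_Limsup) simp
  also have "\<dots> \<le> ennreal (?c * K * ?w)"
  proof (rule Limsup_bounded)
    show "\<forall>\<^sub>F k in sequentially. (\<integral>\<^sup>+t. ennreal (?c / \<rho> k) * A k t * indicator {0<..} t \<partial>lborel) \<le> ennreal (?c * K * ?w)"
      using order_tendstoD(2)[OF \<rho>0 \<open>h0 > 0\<close>] by eventually_elim (rule step)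
  qed
  finally have "(\<integral>\<^sup>+t\<in>{0<..}. ennreal (isop TYPE('a) (m t) * ?w) \<partial>lborel) \<le> ennreal (?c * K * ?w)" .
  moreover have "(\<integral>\<^sup>+t\<in>{0<..}. ennreal (isop TYPE('a) (m t) * ?w) \<partial>lborel) =
      ennreal ?w * (\<integral>\<^sup>+t\<in>{0<..}. ennreal (isop TYPE('a) (m t)) \<partial>lborel)"
    by (subst nn_integral_cmult[symmetric])
      (measurable, use w in \<open>auto intro!: nn_integral_cong simp: isop_def ennreal_mult mult.assoc mult.left_commute mult.commute\<close>)
  moreover have "ennreal (?c * K * ?w) = ennreal ?w * ennreal (?c * K)"
    using w c \<open>K \<ge> 0\<close> by (simp add: ennreal_mult mult.commute)
  ultimately have "ennreal ?w * (\<integral>\<^sup>+t\<in>{0<..}. ennreal (isop TYPE('a) (m t)) \<partial>lborel) \<le> ennreal ?w * ennreal (?c * K)"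
    by simp
  then show ?thesis
    using w unfolding m_def by (subst (asm) ennreal_mult_le_mult_iff) auto
qed

text \<open>The function \<theta> is nonincreasing on positive levels with integral at most
  \<open>A\<close>, hence \<open>t * \<theta> t \<le> A\<close>. For \<open>n = 1\<close> it is 1
  wherever the superlevel set has positive measure, so there are no such levels above
  \<open>A\<close>. For \<open>n \<ge> 2\<close> the measure is the power
  \<open>q = n / (n - 1)\<close> of \<theta>; in the layer-cake integral one factor \<theta> is kept
  and the others combine with the power of \<open>t\<close> into
  \<open>(t * \<theta> t) powr (q - 1)\<close>.\<close>

theorem sobolev_inequality:
  fixes f :: "'a::euclidean_space \<Rightarrow> real"
  assumes int: "integrable lborel f" and f0: "\<And>x. f x \<ge> 0" and "h0 > 0" "K \<ge> 0"
    and mod: "\<And>h. norm h < h0 \<Longrightarrow> (\<integral>\<^sup>+x. ennreal \<bar>f (x + h) - f x\<bar> \<partial>lborel) \<le> ennreal (K * norm h)"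
  defines "n \<equiv> real DIM('a)" and "A \<equiv> sobolev_const TYPE('a) * K"
  shows "DIM('a) = 1 \<Longrightarrow> AE x in lborel. f x \<le> A"
    "DIM('a) \<ge> 2 \<Longrightarrow> (\<integral>\<^sup>+x. ennreal (f x powr (n / (n - 1))) \<partial>lborel) \<le> ennreal (n / (n - 1) * A powr (n / (n - 1)))"
proof -
  have fm[measurable]: "f \<in> borel_measurable borel" using int by auto
  define m where "m t = measure lborel {x. f x > t}" for t
  define \<theta> where "\<theta> t = isop TYPE('a) (m t)" for t
  have A0: "A \<ge> 0" unfolding A_def using sobolev_const_pos[where 'a='a] \<open>K \<ge> 0\<close> by simp
  have total: "(\<integral>\<^sup>+t\<in>{0<..}. ennreal (\<theta> t) \<partial>lborel) \<le> ennreal A"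
    unfolding \<theta>_def m_def A_def by (rule coarea_isoperimetric[OF int f0 \<open>h0 > 0\<close> \<open>K \<ge> 0\<close> mod])
  have fin: "emeasure lborel {x. f x > t} = ennreal (m t)" if "t > 0" for t
    unfolding m_def by (rule superlevel_finite[OF int f0 that])
  have m0: "m t \<ge> 0" for t by (simp add: m_def)
  have m_mono: "m t \<le> m s" if "0 < s" "s \<le> t" for s t
    unfolding m_def
    by (rule measure_mono_fmeasurable) (use that superlevel_finite[OF int f0, of s] in \<open>auto simp: fmeasurable_def\<close>)
  have n1: "n \<ge> 1" unfolding n_def using DIM_positive[where 'a='a] by linarith
  have \<theta>_mono: "\<theta> t \<le> \<theta> s" if "0 < s" "s \<le> t" for s t
    using m_mono[OF that] m0[of t] n1 unfolding \<theta>_def isop_def n_def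
    by (auto intro!: powr_mono2 simp: field_simps)
  have t\<theta>: "t * \<theta> t \<le> A" if t: "t > 0" for t
  proof -
    have "ennreal (t * \<theta> t) = (\<integral>\<^sup>+s. ennreal (\<theta> t) * indicator {0<..t} s \<partial>lborel)"
      using t by (subst nn_integral_cmult_indicator) (auto simp: mult.commute \<theta>_def isop_def ennreal_mult)
    also have "\<dots> \<le> (\<integral>\<^sup>+s\<in>{0<..}. ennreal (\<theta> s) \<partial>lborel)"
      by (intro nn_integral_mono) (auto simp: indicator_def intro!: ennreal_leI \<theta>_mono)
    also note total
    finally show ?thesis using A0 by (simp add: ennreal_le_iff)
  qed
  show "AE x in lborel. f x \<le> A" if "DIM('a) = 1"
  proof -
    have "m t = 0" if t: "t > A" for t
    proof (rule ccontr)
      assume "m t \<noteq> 0"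
      then have "\<theta> t = 1" using m0[of t] \<open>DIM('a) = 1\<close> by (simp add: \<theta>_def isop_def)
      with t\<theta>[of t] t A0 show False by simp
    qed
    then have "emeasure lborel {x. f x > A + 1 / real (Suc k)} = 0" for k
      using fin[of "A + 1 / real (Suc k)"] A0 by (simp add: add_nonneg_pos)
    then have "AE x in lborel. \<forall>k. \<not> f x > A + 1 / real (Suc k)"
      by (auto intro!: AE_all_countable[THEN iffD2] AE_I[where N="{x. f x > A + 1 / real (Suc k)}" for k])
    then show ?thesis
    proof eventually_elim
      case (elim x)
      show ?case
      proof (rule field_le_epsilon)
        fix e :: real assume "e > 0"
        then obtain k where "1 / real (Suc k) < e" using nat_approx_posE by blast
        then show "f x \<le> A + e" using elim[rule_format, of k] by linarith
      qed
    qed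
  qed
  show "(\<integral>\<^sup>+x. ennreal (f x powr (n / (n - 1))) \<partial>lborel) \<le> ennreal (n / (n - 1) * A powr (n / (n - 1)))"
    if n2: "DIM('a) \<ge> 2"
  proof -
    define q where "q = n / (n - 1)"
    have n: "n \<ge> 2" using n2 by (simp add: n_def)
    have q: "q > 1" using n by (simp add: q_def field_simps)
    have q1: "1 - 1 / n = 1 / q" using n by (simp add: q_def field_simps)
    have mq: "m t = \<theta> t powr q" for t
      using m0[of t] q by (auto simp: \<theta>_def isop_def powr_powr q1 simp flip: n_def)
    have \<theta>0: "\<theta> t \<ge> 0" for t by (simp add: \<theta>_def isop_def)
    have layer: "ennreal (c powr q) = (\<integral>\<^sup>+t. ennreal (q * t powr (q - 1)) * (indicator {0<..} t * of_bool (t < c)) \<partial>lborel)"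
      if c: "c \<ge> 0" for c
    proof -
      define F where "F t = (if t > 0 then t powr q else 0)" for t
      \<comment> \<open>At the left end point the rule for powers does not apply;
        \<open>q > 1\<close> makes the difference quotient tend to 0.\<close>
      have F0: "(F has_real_derivative 0) (at 0)"
        unfolding DERIV_def
      proof (rule Lim_null_comparison)
        show "((\<lambda>h::real. \<bar>h\<bar> powr (q - 1)) \<longlongrightarrow> 0) (at 0)"
          using q by (intro tendsto_zero_powrI[where b="q - 1"] tendsto_rabs_zero tendsto_ident_at tendsto_const) auto
        show "\<forall>\<^sub>F h in at 0. norm ((F (0 + h) - F 0) / h) \<le> \<bar>h\<bar> powr (q - 1)"
          by (rule always_eventually) (auto simp: F_def powr_diff divide_nonneg_nonpos)
      qed
      have "(\<integral>\<^sup>+t. ennreal (q * t powr (q - 1)) * indicator {0..c} t \<partial>lborel) = ennreal (F c - F 0)"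
      proof (rule nn_integral_FTC_Icc)
        fix t assume t: "t \<in> {0..c}"
        show "(F has_real_derivative q * t powr (q - 1)) (at t)"
        proof (cases "t = 0")
          case False
          then have "((\<lambda>t. t powr q) has_real_derivative q * t powr (q - 1)) (at t)"
            using t by (auto intro!: derivative_eq_intros)
          moreover have "\<forall>\<^sub>F x in nhds t. x powr q = F x"
            using False t eventually_nhds_in_open[of "{0<..}" t] by (auto elim!: eventually_mono simp: F_def)
          ultimately show ?thesis by (subst DERIV_cong_ev[OF refl _ refl, symmetric, where f="\<lambda>t. t powr q"])
        qed (use F0 q in simp)
      qed (use q c in auto)
      moreover have "F c - F 0 = c powr q" using c q by (auto simp: F_def)
      moreover have "(\<integral>\<^sup>+t. ennreal (q * t powr (q - 1)) * indicator {0..c} t \<partial>lborel) =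
         (\<integral>\<^sup>+t. ennreal (q * t powr (q - 1)) * (indicator {0<..} t * of_bool (t < c)) \<partial>lborel)"
      proof (rule nn_integral_cong_AE)
        have "AE t in lborel. t \<noteq> 0 \<and> t \<noteq> c" using AE_lborel_singleton[of "0::real"] AE_lborel_singleton[of c] by auto
        then show "AE t in lborel. ennreal (q * t powr (q - 1)) * indicator {0..c} t =
          ennreal (q * t powr (q - 1)) * (indicator {0<..} t * of_bool (t < c))"
          by eventually_elim (auto simp: indicator_def)
      qed
      ultimately show ?thesis using q by simp
    qed
    have "(\<integral>\<^sup>+x. ennreal (f x powr q) \<partial>lborel) =
      (\<integral>\<^sup>+x. \<integral>\<^sup>+t. ennreal (q * t powr (q - 1)) * (indicator {0<..} t * of_bool (t < f x)) \<partial>lborel \<partial>lborel)"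
      by (intro nn_integral_cong layer f0)
    also have "\<dots> = (\<integral>\<^sup>+t. \<integral>\<^sup>+x. ennreal (q * t powr (q - 1)) * (indicator {0<..} t * of_bool (t < f x)) \<partial>lborel \<partial>lborel)"
      by (rule lborel_pair.Fubini') measurable
    also have "\<dots> = (\<integral>\<^sup>+t\<in>{0<..}. ennreal (q * t powr (q - 1)) * ennreal (m t) \<partial>lborel)"
    proof (intro nn_integral_cong)
      fix t :: real
      have "(\<integral>\<^sup>+x. ennreal (q * t powr (q - 1)) * (indicator {0<..} t * of_bool (t < f x)) \<partial>lborel) =
        (\<integral>\<^sup>+x. (ennreal (q * t powr (q - 1)) * indicator {0<..} t) * indicator {x. t < f x} x \<partial>lborel)"
        by (intro nn_integral_cong) (auto simp: indicator_def)
      also have "\<dots> = (ennreal (q * t powr (q - 1)) * indicator {0<..} t) * emeasure lborel {x. t < f x}"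
        by (intro nn_integral_cmult_indicator) measurable
      finally show "(\<integral>\<^sup>+x. ennreal (q * t powr (q - 1)) * (indicator {0<..} t * of_bool (t < f x)) \<partial>lborel) =
        ennreal (q * t powr (q - 1)) * ennreal (m t) * indicator {0<..} t"
        using fin[of t] by (auto simp: indicator_def)
    qed
    also have "\<dots> \<le> (\<integral>\<^sup>+t\<in>{0<..}. ennreal (q * A powr (q - 1)) * ennreal (\<theta> t) \<partial>lborel)"
    proof (intro nn_integral_mono)
      fix t :: real
      show "ennreal (q * t powr (q - 1)) * ennreal (m t) * indicator {0<..} t \<le>
         ennreal (q * A powr (q - 1)) * ennreal (\<theta> t) * indicator {0<..} t"
      proof (cases "t > 0")
        case True
        have "t powr (q - 1) * m t = (t * \<theta> t) powr (q - 1) * \<theta> t"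
          using True \<theta>0[of t] q unfolding mq by (cases "\<theta> t = 0") (auto simp: powr_mult powr_diff)
        also have "\<dots> \<le> A powr (q - 1) * \<theta> t"
          using t\<theta>[OF True] \<theta>0[of t] q True by (intro mult_right_mono powr_mono2) auto
        finally have "q * t powr (q - 1) * m t \<le> q * A powr (q - 1) * \<theta> t"
          using q by (simp add: mult.assoc)
        then show ?thesis using True q m0[of t] \<theta>0[of t] by (simp add: ennreal_leI flip: ennreal_mult)
      qed simp
    qed
    also have "\<dots> = ennreal (q * A powr (q - 1)) * (\<integral>\<^sup>+t\<in>{0<..}. ennreal (\<theta> t) \<partial>lborel)"
    proof -
      have [measurable]: "m \<in> borel_measurable borel"
        unfolding m_def[abs_def] by (rule superlevel_measurable[OF fm])
      have [measurable]: "\<theta> \<in> borel_measurable borel"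
        unfolding \<theta>_def[abs_def] by measurable
      show ?thesis by (subst nn_integral_cmult[symmetric]) (measurable, simp add: mult.assoc)
    qed
    also have "\<dots> \<le> ennreal (q * A powr (q - 1)) * ennreal A" by (intro mult_left_mono total) simp
    also have "\<dots> = ennreal (q * A powr q)"
      using q A0 by (cases "A = 0") (auto simp: powr_diff simp flip: ennreal_mult)
    finally show ?thesis by (simp add: q_def)
  qed
qed

section \<open>Boundary traces almost everywhere\<close>

text \<open>Radius 0 means an empty ball and must count 0 also for \<open>d = 0\<close>, where its
  power would be 1.\<close>

abbreviation weight :: "nat \<Rightarrow> (nat \<Rightarrow> real) \<Rightarrow> ennreal" where
  "weight d \<rho> \<equiv> suminf (\<lambda>k. ennreal (if \<rho> k > 0 then \<rho> k ^ d else 0))"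

text \<open>Covers of total weight at most \<open>1 / (m + 1)\<close> are taken for all
  \<open>m\<close>; the intersection of their unions is a Borel set containing \<open>B\<close> that
  inherits every one of these covers.\<close>

lemma hausdorff_null_set:
  fixes B :: "'a::euclidean_space set"
  assumes cover: "\<And>\<delta>. \<delta> > 0 \<Longrightarrow> \<exists>p \<rho>. (\<forall>k::nat. 0 \<le> \<rho> k \<and> \<rho> k \<le> \<delta>) \<and> B \<subseteq> (\<Union>k. ball (p k) (\<rho> k)) \<and>
      weight d \<rho> \<le> ennreal \<delta>"
  obtains N where "N \<in> null_sets (hausdorff_measure d)" "B \<subseteq> N"
proof -
  have "\<forall>m. \<exists>p \<rho>. (\<forall>k::nat. 0 \<le> \<rho> k \<and> \<rho> k \<le> 1 / real (Suc m)) \<and> B \<subseteq> (\<Union>k. ball (p k) (\<rho> k)) \<and>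
      weight d \<rho> \<le> ennreal (1 / real (Suc m))"
    by (intro allI cover) simp
  from choice[OF this] obtain p where "\<forall>m. \<exists>\<rho>. (\<forall>k::nat. 0 \<le> \<rho> k \<and> \<rho> k \<le> 1 / real (Suc m)) \<and> B \<subseteq> (\<Union>k. ball (p m k) (\<rho> k)) \<and>
      weight d \<rho> \<le> ennreal (1 / real (Suc m))" ..
  from choice[OF this] obtain \<rho> where "\<forall>m. (\<forall>k::nat. 0 \<le> \<rho> m k \<and> \<rho> m k \<le> 1 / real (Suc m)) \<and> B \<subseteq> (\<Union>k. ball (p m k) (\<rho> m k)) \<and>
      weight d (\<rho> m) \<le> ennreal (1 / real (Suc m))" ..
  then have \<rho>: "\<And>m k. 0 \<le> \<rho> m k \<and> \<rho> m k \<le> 1 / real (Suc m)"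
    and B: "\<And>m. B \<subseteq> (\<Union>k. ball (p m k) (\<rho> m k))"
    and sum: "\<And>m. weight d (\<rho> m) \<le> ennreal (1 / real (Suc m))"
    by blast+
  define N where "N = (\<Inter>m. \<Union>k. ball (p m k) (\<rho> m k))"
  have Ns: "N \<in> sets borel" unfolding N_def by (intro sets.countable_INT sets.countable_UN) auto
  have pre: "hausdorff_pre d \<delta> N \<le> ennreal e" if "\<delta> > 0" "e > 0" for \<delta> e
  proof -
    have v0: "unit_ball_vol (real d) \<ge> 0" by (simp add: unit_ball_vol_nonneg)
    have "unit_ball_vol (real d) + 1 > 0" using v0 by linarith
    then have "min (\<delta> / 2) (e / (unit_ball_vol (real d) + 1)) > 0" using that by simp
    then obtain m where m: "1 / real (Suc m) < min (\<delta> / 2) (e / (unit_ball_vol (real d) + 1))"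
      using nat_approx_posE by blast
    let ?C = "\<lambda>k. ball (p m k) (\<rho> m k)"
    have "hausdorff_pre d \<delta> N \<le> suminf (\<lambda>i. if ?C i = {} then 0
            else ennreal (unit_ball_vol (real d) * (diameter (?C i) / 2) ^ d))"
      unfolding hausdorff_pre_def
    proof (rule INF_lower, safe)
      show "x \<in> (\<Union>k. ?C k)" if "x \<in> N" for x using that by (auto simp: N_def)
      show "diameter (?C i) \<le> \<delta>" for i
        using \<rho>[of m i] m by (simp add: diameter_ball)
    qed auto
    also have "\<dots> \<le> suminf (\<lambda>i. ennreal (unit_ball_vol (real d)) * ennreal (if \<rho> m i > 0 then \<rho> m i ^ d else 0))"
      using \<rho>[of m] by (intro suminf_le) (auto simp: diameter_ball ennreal_mult v0 not_less)
    also have "\<dots> = ennreal (unit_ball_vol (real d)) * weight d (\<rho> m)"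
      by (rule ennreal_suminf_cmult)
    also have "\<dots> \<le> ennreal (unit_ball_vol (real d)) * ennreal (1 / real (Suc m))"
      by (intro mult_left_mono sum) simp
    also have "\<dots> = ennreal (unit_ball_vol (real d) * (1 / real (Suc m)))"
      by (rule ennreal_mult[symmetric]) (use v0 in auto)
    also have "\<dots> \<le> ennreal e"
    proof (rule ennreal_leI)
      have "unit_ball_vol (real d) * (1 / real (Suc m)) \<le> (unit_ball_vol (real d) + 1) * (e / (unit_ball_vol (real d) + 1))"
        using m v0 by (intro mult_mono) auto
      then show "unit_ball_vol (real d) * (1 / real (Suc m)) \<le> e" using v0 by simp
    qed
    finally show ?thesis .
  qed
  have "hausdorff_pre d \<delta> N \<le> 0" if "\<delta> > 0" for \<delta>
    by (rule ennreal_le_epsilon) (use pre[OF that] in auto)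
  then have "(SUP \<delta>\<in>{0<..}. hausdorff_pre d \<delta> N) = 0"
    by (intro antisym SUP_least) auto
  \<comment> \<open>The value prescribed in \<open>measure_of\<close> is 0 here, and so is its
    default value.\<close>
  then have "emeasure (hausdorff_measure d) N = 0"
    unfolding hausdorff_measure_def emeasure_measure_of_conv by simp
  moreover have "sets (hausdorff_measure d :: 'a measure) = sets borel"
    unfolding hausdorff_measure_def
    using sets.sigma_sets_eq[of "borel :: 'a measure"] by (simp add: sets_measure_of_conv)
  ultimately have "N \<in> null_sets (hausdorff_measure d)" using Ns by auto
  moreover have "B \<subseteq> N" using B by (auto simp: N_def)
  ultimately show ?thesis by (rule that)
qed

text \<open>The segment \<open>z\<close> is cut into steps of length between \<open>2 * r\<close>
  and \<open>4 * r\<close>. Each step moves the ball off itself, so the chain of translates is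
  disjoint, and the entire displacement costs one step.\<close>

lemma tilted_column:
  fixes f :: "'a::euclidean_space \<Rightarrow> real"
  assumes f: "integrable lborel f" and \<Omega>: "open \<Omega>" and r: "r > 0" "4 * r \<le> norm z"
    and W: "\<And>y t. \<lbrakk>y \<in> \<Omega> \<inter> ball x r; 0 \<le> t; t \<le> 1\<rbrakk> \<Longrightarrow> y + t *\<^sub>R z \<in> W"
    and T: "tv W f \<le> ereal T"
  shows "(LBINT y. indicator (\<Omega> \<inter> ball x r) y * \<bar>f (y + z) - f y\<bar>) \<le> 4 * r * T"
proof -
  define N where "N = nat \<lfloor>norm z / (2 * r)\<rfloor>"
  define \<zeta> where "\<zeta> = (1 / real N) *\<^sub>R z"
  have "2 \<le> norm z / (2 * r)" using r by (simp add: field_simps)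
  moreover have "nat \<lfloor>X\<rfloor> \<ge> 1 \<and> real (nat \<lfloor>X\<rfloor>) \<le> X \<and> real (nat \<lfloor>X\<rfloor>) \<ge> X / 2" if "2 \<le> X" for X :: real
    using that by linarith
  ultimately have N: "N \<ge> 1" "real N \<le> norm z / (2 * r)" "real N \<ge> norm z / (2 * r) / 2"
    unfolding N_def by blast+
  have z: "z = real N *\<^sub>R \<zeta>" using N(1) by (simp add: \<zeta>_def)
  have n\<zeta>: "2 * r \<le> norm \<zeta>" "norm \<zeta> \<le> 4 * r"
    using N r by (simp_all add: \<zeta>_def field_simps)
  have T0: "T \<ge> 0" using T tv_nonneg[of W f] by (metis ereal_less_eq(5) order_trans)
  have "(LBINT y. indicator (\<Omega> \<inter> ball x r) y * \<bar>f (y + real N *\<^sub>R \<zeta>) - f y\<bar>) \<le> norm \<zeta> * T"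
  proof (rule translate_N_difference[OF f _ _ _ _ T order_refl])
    show "open (\<Omega> \<inter> ball x r)" "bounded (\<Omega> \<inter> ball x r)" using \<Omega> by (auto intro: bounded_Int)
    fix a k assume a: "a \<in> \<Omega> \<inter> ball x r" and k: "1 \<le> k" "k < N"
    show "a + real k *\<^sub>R \<zeta> \<notin> \<Omega> \<inter> ball x r"
    proof
      assume b: "a + real k *\<^sub>R \<zeta> \<in> \<Omega> \<inter> ball x r"
      have "dist a (a + real k *\<^sub>R \<zeta>) < 2 * r"
        using a b dist_triangle2[of a "a + real k *\<^sub>R \<zeta>" x] by (simp add: dist_commute)
      moreover have "norm \<zeta> \<le> real k * norm \<zeta>" using k mult_right_mono[of 1 "real k" "norm \<zeta>"] by simp
      ultimately show False using n\<zeta>(1) by (simp add: dist_norm)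
    qed
  next
    fix a t assume a: "a \<in> \<Omega> \<inter> ball x r" and t: "(0::real) \<le> t" "t \<le> real N"
    have "a + (t / real N) *\<^sub>R z \<in> W" using N t by (intro W[OF a]) (auto simp: field_simps)
    then show "a + t *\<^sub>R \<zeta> \<in> W" by (simp add: \<zeta>_def)
  qed
  also have "\<dots> \<le> 4 * r * T" using n\<zeta>(2) T0 by (rule mult_right_mono)
  finally show ?thesis by (simp flip: z)
qed

text \<open>Each piece of \<Omega> near a frontier point sweeps out a column along \<open>z\<close>.
  The separation of the centres makes the columns disjoint, so their variations add up to at most
  the variation on the set \<open>V\<close>, which contains them all because they stay within
  \<open>3 * s\<close> of the frontier.\<close>

lemma columns_sum:
  fixes f :: "'a::euclidean_space \<Rightarrow> real"
  assumes cone: "cone_in \<Omega> x0 r0 e c" and \<Omega>: "open \<Omega>" and f: "integrable lborel f"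
    and I: "finite I" "I \<subseteq> frontier \<Omega> \<inter> ball x0 (r0 / 4)"
    and rr: "\<And>x. x \<in> I \<Longrightarrow> 0 < rr x \<and> rr x \<le> s / 8" and s: "0 < s" "s \<le> r0 / 16"
    and sep: "\<And>x y. \<lbrakk>x \<in> I; y \<in> I; x \<noteq> y\<rbrakk> \<Longrightarrow> (1 + 4 / c) * (rr x + rr y) \<le> dist x y"
    and z: "norm (z - s *\<^sub>R e) < c / 2 * s"
    and V: "\<And>y x. \<lbrakk>y \<in> \<Omega>; x \<in> frontier \<Omega>; dist x y < 3 * s\<rbrakk> \<Longrightarrow> y \<in> V" and T: "tv V f \<le> ereal T"
  shows "(\<Sum>x\<in>I. (1 / rr x) * (LBINT y. indicator (\<Omega> \<inter> ball x (rr x)) y * \<bar>f (y + z) - f y\<bar>)) \<le> 4 * T"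
proof -
  note cn = cone_inD[OF cone]
  have cs: "c / 2 * s \<le> s / 2" using mult_right_mono[OF cn(3), of "s / 2"] s by simp
  have z2: "norm z < 2 * s" "s / 2 \<le> norm z"
  proof -
    have "norm (s *\<^sub>R e) = s" using cn(1) s by simp
    moreover have "norm z \<le> norm (z - s *\<^sub>R e) + norm (s *\<^sub>R e)" "norm (s *\<^sub>R e) \<le> norm z + norm (z - s *\<^sub>R e)"
      using norm_triangle_ineq[of "z - s *\<^sub>R e" "s *\<^sub>R e"] norm_triangle_ineq4[of z "z - s *\<^sub>R e"] by auto
    ultimately show "norm z < 2 * s" "s / 2 \<le> norm z" using z cs s by linarith+
  qed
  have tz: "norm (t *\<^sub>R z - (t * s) *\<^sub>R e) < c / 2 * (t * s)" if "t > 0" for t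
  proof -
    have "t *\<^sub>R z - (t * s) *\<^sub>R e = t *\<^sub>R (z - s *\<^sub>R e)" by (simp add: scaleR_diff_right)
    then have "norm (t *\<^sub>R z - (t * s) *\<^sub>R e) = t * norm (z - s *\<^sub>R e)" using that by simp
    then show ?thesis using mult_strict_left_mono[OF z that] by (simp add: mult.left_commute)
  qed
  define W where "W x = {y + t *\<^sub>R z | y t. y \<in> \<Omega> \<inter> ball x (rr x) \<and> 0 \<le> t \<and> t \<le> 1}" for x
  have WV: "W x \<subseteq> V" if x: "x \<in> I" for x
  proof
    fix w assume "w \<in> W x"
    then obtain y t where y: "y \<in> \<Omega>" "dist x y < rr x" and t: "0 \<le> t" "t \<le> 1" and w: "w = y + t *\<^sub>R z"
      by (auto simp: W_def)
    have xf: "x \<in> frontier \<Omega>" "dist x0 x < r0 / 4" using x I by auto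
    have "norm (t *\<^sub>R z) \<le> norm z" using t by (simp add: mult_left_le_one_le)
    then have yw: "dist y w < 2 * s" using z2 by (simp add: w dist_norm)
    have xw: "dist x w < 3 * s" using dist_triangle[of x w y] y(2) yw rr[OF x] s by linarith
    have "w \<in> \<Omega>"
    proof (cases "t = 0")
      case False
      then have t0: "t > 0" using t by simp
      have "y + t *\<^sub>R z \<in> \<Omega>"
      proof (rule cn(5)[of y "t * s"])
        show "y \<in> closure \<Omega>" using y closure_subset by auto
        show "y \<in> ball x0 r0"
          using dist_triangle[of x0 y x] y(2) rr[OF x] xf s by simp
        show "0 < t * s" using t0 s by simp
        show "norm (t *\<^sub>R z - (t * s) *\<^sub>R e) < c * (t * s)"
          using tz[OF t0] mult_pos_pos[OF cn(2) \<open>0 < t * s\<close>] by simp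
        show "y + t *\<^sub>R z \<in> ball x0 r0"
          using dist_triangle[of x0 w x] xw xf s by (simp add: w)
      qed
      then show ?thesis by (simp add: w)
    qed (use y w in simp)
    then show "w \<in> V" using V[OF _ xf(1) xw] by simp
  qed
  have no: False if x: "x \<in> I" and y: "y \<in> I" and xy: "x \<noteq> y" and a: "dist x a < rr x" and b: "dist y b < rr y"
    and ba: "b = a + \<tau> *\<^sub>R z" and \<tau>: "0 \<le> \<tau>" "\<tau> \<le> 1" for x y a b \<tau>
  proof -
    define u where "u = (y - b) + (a - x)"
    have u: "norm u < rr x + rr y"
      using norm_triangle_ineq[of "y - b" "a - x"] a b by (simp add: u_def dist_norm norm_minus_commute)
    have yx: "y = x + (\<tau> *\<^sub>R z + u)" by (simp add: u_def ba)
    have xf: "x \<in> frontier \<Omega>" "dist x0 x < r0 / 4" "y \<in> frontier \<Omega>" "dist x0 y < r0 / 4" using x y I by auto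
    \<comment> \<open>If \<open>u\<close> were smaller, \<open>y\<close> would lie in the open cone
      with vertex \<open>x\<close>, hence in \<Omega>, although it is a frontier point. So the
      displacement along \<open>z\<close> is bounded by \<open>u\<close>, and \<open>x\<close> and
      \<open>y\<close> would be closer than the separation \<open>1 + 4 / c\<close> permits.\<close>
    have "c / 2 * (\<tau> * s) \<le> norm u"
    proof (rule ccontr)
      assume less: "\<not> ?thesis"
      then have \<tau>0: "\<tau> > 0" using \<tau> by (cases "\<tau> = 0") auto
      have "norm (\<tau> *\<^sub>R z + u - (\<tau> * s) *\<^sub>R e) \<le> norm (\<tau> *\<^sub>R z - (\<tau> * s) *\<^sub>R e) + norm u"
        using norm_triangle_ineq[of "\<tau> *\<^sub>R z - (\<tau> * s) *\<^sub>R e" u] by (simp add: algebra_simps)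
      also have "\<dots> < c * (\<tau> * s)" using tz[OF \<tau>0] less by simp
      finally have "x + (\<tau> *\<^sub>R z + u) \<in> \<Omega>"
        using xf \<tau>0 s cn(4) by (intro cn(5)[of x "\<tau> * s"]) (auto simp: frontier_def simp flip: yx)
      then have "y \<in> \<Omega>" by (simp flip: yx)
      then show False using xf(3) \<Omega> by (simp add: frontier_def interior_open)
    qed
    then have ts: "\<tau> * s \<le> 2 / c * norm u" using cn(2) by (simp add: field_simps)
    have "dist x y \<le> \<tau> * norm z + norm u"
      using norm_triangle_ineq[of "\<tau> *\<^sub>R z" u] \<tau> by (subst dist_commute, subst yx) (simp add: dist_norm)
    also have "\<tau> * norm z \<le> \<tau> * (2 * s)" using z2 \<tau> by (intro mult_left_mono) auto
    also have "\<tau> * (2 * s) + norm u \<le> (1 + 4 / c) * norm u"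
    proof -
      have "(1 + 4 / c) * norm u = norm u + 2 * (2 / c * norm u)" by (simp add: algebra_simps)
      then show ?thesis using ts by linarith
    qed
    also have "\<dots> < (1 + 4 / c) * (rr x + rr y)"
      using u cn(2) by (intro mult_strict_left_mono) (auto simp: add_pos_pos)
    finally show False using sep[OF x y xy] by simp
  qed
  have disj: "disjoint_family_on W I"
    unfolding disjoint_family_on_def
  proof (intro ballI impI, rule ccontr)
    fix x y assume x: "x \<in> I" and y: "y \<in> I" and xy: "x \<noteq> y" and "W x \<inter> W y \<noteq> {}"
    then obtain a t b t' where ab: "dist x a < rr x" "dist y b < rr y" "0 \<le> t" "t \<le> 1" "0 \<le> t'" "t' \<le> 1"
       "a + t *\<^sub>R z = b + t' *\<^sub>R z"
      by (auto simp: W_def)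
    show False
    proof (cases "t' \<le> t")
      case True
      have "b = a + (t - t') *\<^sub>R z" using ab(7) by (simp add: algebra_simps)
      then show False by (rule no[OF x y xy ab(1,2)]) (use ab True in auto)
    next
      case False
      have "a = b + (t' - t) *\<^sub>R z" using ab(7) by (simp add: algebra_simps)
      then show False by (rule no[OF y x xy[symmetric] ab(2,1)]) (use ab False in auto)
    qed
  qed
  have fin: "tv (W x) f = ereal (real_of_ereal (tv (W x) f))" if "x \<in> I" for x
    using order_trans[OF tv_mono[OF WV[OF that]] T] tv_nonneg[of "W x" f] by (cases "tv (W x) f") auto
  have "(\<Sum>x\<in>I. (1 / rr x) * (LBINT y. indicator (\<Omega> \<inter> ball x (rr x)) y * \<bar>f (y + z) - f y\<bar>))
     \<le> (\<Sum>x\<in>I. 4 * real_of_ereal (tv (W x) f))"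
  proof (rule sum_mono)
    fix x assume x: "x \<in> I"
    have "(LBINT y. indicator (\<Omega> \<inter> ball x (rr x)) y * \<bar>f (y + z) - f y\<bar>) \<le> 4 * rr x * real_of_ereal (tv (W x) f)"
    proof (rule tilted_column[OF f \<Omega>])
      show "0 < rr x" "4 * rr x \<le> norm z" using rr[OF x] z2 by auto
      show "y + t *\<^sub>R z \<in> W x" if "y \<in> \<Omega> \<inter> ball x (rr x)" "0 \<le> t" "t \<le> 1" for y t
        using that unfolding W_def by blast
      show "tv (W x) f \<le> ereal (real_of_ereal (tv (W x) f))" using fin[OF x] by simp
    qed
    then show "(1 / rr x) * (LBINT y. indicator (\<Omega> \<inter> ball x (rr x)) y * \<bar>f (y + z) - f y\<bar>) \<le> 4 * real_of_ereal (tv (W x) f)"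
      using rr[OF x] by (simp add: field_simps)
  qed
  also have "\<dots> = 4 * (\<Sum>x\<in>I. real_of_ereal (tv (W x) f))" by (simp add: sum_distrib_left)
  also have "\<dots> \<le> 4 * T"
  proof -
    have "ereal (\<Sum>x\<in>I. real_of_ereal (tv (W x) f)) = (\<Sum>x\<in>I. tv (W x) f)"
      by (subst sum_ereal[symmetric]) (intro sum.cong, auto simp: fin[symmetric])
    also have "\<dots> \<le> tv V f" by (rule tv_disjoint_sum[OF f I(1) disj WV])
    finally have "ereal (\<Sum>x\<in>I. real_of_ereal (tv (W x) f)) \<le> ereal T" using T by (rule order_trans)
    then show ?thesis by simp
  qed
  finally show ?thesis .
qed

section \<open>Oscillation at the boundary and averages over an inner ball\<close>

lemma ball_average_continuous:
  fixes f :: "'a::euclidean_space \<Rightarrow> real"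
  assumes f: "integrable lborel f"
  shows "isCont (\<lambda>y. \<integral>z. indicator (ball a r) z * f (y + z) \<partial>lborel) x"
proof -
  have fm[measurable]: "f \<in> borel_measurable borel" using f by auto
  have [measurable]: "ball a r \<in> sets borel" by simp
  have eq: "(LBINT z. indicator (ball a r) z * f (y + z)) = (LBINT w. indicator (ball a r) (w - y) * f w)" for y
    using integral_lborel_translate(1)[of "\<lambda>w. indicator (ball a r) (w - y) * f w" y] by (simp add: add.commute)
  show ?thesis
    unfolding eq continuous_at_sequentially
  proof (intro allI impI)
    fix Y assume Y: "Y \<longlonglongrightarrow> x"
    have "(\<lambda>k. \<integral>w. indicator (ball a r) (w - Y k) * f w \<partial>lborel) \<longlonglongrightarrow> (LBINT w. indicator (ball a r) (w - x) * f w)"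
    proof (rule integral_dominated_convergence)
      show "integrable lborel (\<lambda>w. \<bar>f w\<bar>)" using f by simp
      show "(\<lambda>w. indicator (ball a r) (w - x) * f w) \<in> borel_measurable lborel" by measurable
      show "(\<lambda>w. indicator (ball a r) (w - Y k) * f w) \<in> borel_measurable lborel" for k by measurable
      show "AE w in lborel. norm (indicator (ball a r) (w - Y k) * f w) \<le> \<bar>f w\<bar>" for k
        by (simp add: indicator_def)
      have "AE w in lborel. w \<notin> sphere (a + x) r"
        using AE_not_in[of "sphere (a + x) r" lebesgue] negligible_sphere[of "a + x" r]
        by (simp add: negligible_iff_null_sets AE_completion_iff)
      then show "AE w in lborel. (\<lambda>k. indicator (ball a r) (w - Y k) * f w) \<longlonglongrightarrow> indicator (ball a r) (w - x) * f w"
      proof eventually_elim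
        case (elim w)
        have lim: "(\<lambda>k. dist a (w - Y k)) \<longlonglongrightarrow> dist a (w - x)" by (intro tendsto_intros Y)
        have ne: "dist a (w - x) \<noteq> r"
          using elim by (simp add: dist_norm algebra_simps)
        have "\<forall>\<^sub>F k in sequentially. indicator (ball a r) (w - Y k) * f w = indicator (ball a r) (w - x) * f w"
        proof (cases "dist a (w - x) < r")
          case True
          show ?thesis using order_tendstoD(2)[OF lim True] by eventually_elim (use True in simp)
        next
          case False
          then have gt: "r < dist a (w - x)" using ne by simp
          show ?thesis using order_tendstoD(1)[OF lim gt] by eventually_elim (use gt in simp)
        qed
        then show ?case by (rule tendsto_eventually)
      qed
    qed
    then show "((\<lambda>y. \<integral>w. indicator (ball a r) (w - y) * f w \<partial>lborel) \<circ> Y) \<longlonglongrightarrow> (LBINT w. indicator (ball a r) (w - x) * f w)"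
      by (simp add: o_def)
  qed
qed

text \<open>If the averages of \<open>f\<close> over \<open>y + B\<close> are close to
  \<open>a\<close> for all \<open>y\<close> in \<open>A\<close>, then the deviation of
  \<open>f\<close> from \<open>a\<close> on \<open>A\<close> is controlled by the differences
  \<open>f (y + z) - f y\<close> with \<open>z\<close> in \<open>B\<close>.\<close>

lemma average_lower:
  fixes f :: "'a::euclidean_space \<Rightarrow> real"
  assumes f: "integrable lborel f" and A: "A \<in> sets borel" "bounded A" and B: "B \<in> sets borel" "bounded B"
    and g: "\<And>y. y \<in> A \<Longrightarrow> \<bar>(LBINT z. indicator B z * f (y + z)) - measure lborel B * a\<bar> \<le> \<gamma>"
    and \<gamma>: "\<gamma> \<ge> 0"
  shows "ennreal (measure lborel B * (LBINT y. indicator A y * \<bar>f y - a\<bar>)) \<le>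
     (\<integral>\<^sup>+z. indicator B z * (\<integral>\<^sup>+y. indicator A y * ennreal \<bar>f (y + z) - f y\<bar> \<partial>lborel) \<partial>lborel) + ennreal (\<gamma> * measure lborel A)"
proof -
  note [measurable] = A(1) B(1)
  have fm[measurable]: "f \<in> borel_measurable borel" using f by auto
  let ?b = "measure lborel B"
  have finA: "emeasure lborel A = ennreal (measure lborel A)"
    using emeasure_bounded_finite[OF A(2)] by (intro emeasure_eq_ennreal_measure) (auto simp: less_top)
  have finB: "emeasure lborel B < \<infinity>" using emeasure_bounded_finite[OF B(2)] by simp
  have constA: "integrable lborel (\<lambda>y. indicator A y * k)" for k :: real
    using integrable_real_indicator[OF _ , of A lborel] emeasure_bounded_finite[OF A(2)] A(1) by simp
  have constB: "integrable lborel (\<lambda>y. indicator B y * k)" for k :: real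
    using integrable_real_indicator[OF _ , of B lborel] finB B(1) by simp
  have pt: "ennreal (?b * \<bar>f y - a\<bar>) \<le> (\<integral>\<^sup>+z. indicator B z * ennreal \<bar>f (y + z) - f y\<bar> \<partial>lborel) + ennreal \<gamma>"
    if y: "y \<in> A" for y
  proof -
    have fy: "integrable lborel (\<lambda>z. f (y + z))"
      using f integral_lborel_translate(2)[OF fm, of y] by (simp add: add.commute)
    have i1: "integrable lborel (\<lambda>z. indicator B z * f (y + z))" using fy B by (intro integrable_indicator_mult) auto
    have i: "integrable lborel (\<lambda>z. indicator B z * (f (y + z) - f y))"
      using Bochner_Integration.integrable_diff[OF i1 constB[of "f y"]] by (simp add: right_diff_distrib)
    have "(LBINT z. indicator B z * (f (y + z) - f y)) = (LBINT z. indicator B z * f (y + z)) - ?b * f y"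
      using Bochner_Integration.integral_diff[OF i1 constB[of "f y"]] by (simp add: right_diff_distrib)
    then have "?b * \<bar>f y - a\<bar> \<le> \<bar>\<integral>z. indicator B z * (f (y + z) - f y) \<partial>lborel\<bar> + \<gamma>"
      using g[OF y] by (simp add: abs_mult[symmetric] right_diff_distrib flip: abs_mult)
         (smt (verit) abs_mult measure_nonneg right_diff_distrib abs_of_nonneg)
    then have "ennreal (?b * \<bar>f y - a\<bar>) \<le> ennreal \<bar>\<integral>z. indicator B z * (f (y + z) - f y) \<partial>lborel\<bar> + ennreal \<gamma>"
      using \<gamma> by (simp add: ennreal_leI flip: ennreal_plus)
    also have "ennreal \<bar>\<integral>z. indicator B z * (f (y + z) - f y) \<partial>lborel\<bar> \<le> (\<integral>\<^sup>+z. ennreal (norm (indicator B z * (f (y + z) - f y))) \<partial>lborel)"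
      using integral_norm_bound_ennreal[OF i] by simp
    also have "(\<integral>\<^sup>+z. ennreal (norm (indicator B z * (f (y + z) - f y))) \<partial>lborel) = (\<integral>\<^sup>+z. indicator B z * ennreal \<bar>f (y + z) - f y\<bar> \<partial>lborel)"
      by (intro nn_integral_cong) (auto simp: indicator_def)
    finally show ?thesis by simp
  qed
  have iA: "integrable lborel (\<lambda>y. indicator A y * \<bar>f y - a\<bar>)"
  proof -
    have "integrable lborel (\<lambda>y. \<bar>indicator A y * f y - indicator A y * a\<bar>)"
      using A by (intro integrable_abs Bochner_Integration.integrable_diff[OF integrable_indicator_mult[OF _ f] constA[of a]]) auto
    moreover have "\<bar>indicator A y * f y - indicator A y * a\<bar> = indicator A y * \<bar>f y - a\<bar>" for y
      by (simp add: indicator_def)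
    ultimately show ?thesis by simp
  qed
  have "ennreal (?b * (LBINT y. indicator A y * \<bar>f y - a\<bar>)) = (\<integral>\<^sup>+y. ennreal (?b * (indicator A y * \<bar>f y - a\<bar>)) \<partial>lborel)"
    by (subst nn_integral_eq_integral) (use iA in auto)
  also have "\<dots> \<le> (\<integral>\<^sup>+y. (\<integral>\<^sup>+z. indicator A y * (indicator B z * ennreal \<bar>f (y + z) - f y\<bar>) \<partial>lborel) + indicator A y * ennreal \<gamma> \<partial>lborel)"
  proof (rule nn_integral_mono)
    fix y
    show "ennreal (?b * (indicator A y * \<bar>f y - a\<bar>)) \<le>
       (\<integral>\<^sup>+z. indicator A y * (indicator B z * ennreal \<bar>f (y + z) - f y\<bar>) \<partial>lborel) + indicator A y * ennreal \<gamma>"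
      using pt[of y] by (cases "y \<in> A") auto
  qed
  also have "\<dots> = (\<integral>\<^sup>+y. \<integral>\<^sup>+z. indicator A y * (indicator B z * ennreal \<bar>f (y + z) - f y\<bar>) \<partial>lborel \<partial>lborel) +
     (\<integral>\<^sup>+y. indicator A y * ennreal \<gamma> \<partial>lborel)"
    by (rule nn_integral_add) measurable
  also have "(\<integral>\<^sup>+y. indicator A y * ennreal \<gamma> \<partial>lborel) = ennreal (\<gamma> * measure lborel A)"
    using \<gamma> by (subst mult.commute) (simp add: nn_integral_cmult_indicator finA ennreal_mult)
  also have "(\<integral>\<^sup>+y. \<integral>\<^sup>+z. indicator A y * (indicator B z * ennreal \<bar>f (y + z) - f y\<bar>) \<partial>lborel \<partial>lborel) =
     (\<integral>\<^sup>+z. \<integral>\<^sup>+y. indicator A y * (indicator B z * ennreal \<bar>f (y + z) - f y\<bar>) \<partial>lborel \<partial>lborel)"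
    by (rule lborel_pair.Fubini') measurable
  also have "\<dots> = (\<integral>\<^sup>+z. indicator B z * (\<integral>\<^sup>+y. indicator A y * ennreal \<bar>f (y + z) - f y\<bar> \<partial>lborel) \<partial>lborel)"
    by (intro nn_integral_cong) (subst nn_integral_cmult[symmetric], auto simp: mult.left_commute)
  finally show ?thesis .
qed

lemma ball_radius_lower:
  fixes x y :: "'a::euclidean_space"
  assumes "disjnt (ball x r) (ball y s)" "0 < r" "0 < s"
  shows "r + s \<le> dist x y"
proof (rule ccontr)
  assume less: "\<not> ?thesis"
  define t where "t = r / (r + s)"
  define p where "p = x + t *\<^sub>R (y - x)"
  have t: "0 < t" "t < 1" "t * (r + s) = r" "(1 - t) * (r + s) = s" using assms(2,3) by (auto simp: t_def field_simps)
  have "dist x p = t * dist x y" using t by (simp add: p_def dist_norm norm_minus_commute)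
  also have "\<dots> < t * (r + s)" using t(1) less by (intro mult_strict_left_mono) auto
  finally have 1: "dist x p < r" by (simp add: t)
  have "y - p = (1 - t) *\<^sub>R (y - x)" by (simp add: p_def algebra_simps)
  then have "dist y p = (1 - t) * dist x y" using t by (simp add: dist_norm norm_minus_commute)
  also have "\<dots> < (1 - t) * (r + s)" using t(2) less by simp
  finally have 2: "dist y p < s" by (simp add: t)
  show False using assms(1) 1 2 by (auto simp: disjnt_def)
qed

text \<open>At a bad point take for \<open>a\<close> the average over a ball \<open>B\<close>
  shifted inwards. This average is continuous in the point, so the deviation on arbitrarily small
  balls must come from differences along vectors of \<open>B\<close>. A Vitali selection makes the
  columns over the selected balls disjoint; \<open>columns_sum\<close> then bounds the sum of the
  radii to the power \<open>n - 1\<close> by a multiple of the variation near the frontier.\<close>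

lemma trace_content:
  fixes f :: "'a::euclidean_space \<Rightarrow> real"
  assumes cone: "cone_in \<Omega> x0 r0 e c" and \<Omega>: "open \<Omega>" and f: "integrable lborel f" and fin: "tv \<Omega> f < \<infinity>"
    and \<epsilon>: "\<epsilon> > 0" and \<delta>: "\<delta> > 0"
    and Bad: "\<And>x a. x \<in> Bad \<Longrightarrow> x \<in> frontier \<Omega> \<inter> ball x0 (r0 / 4) \<and>
       \<not> (\<forall>\<^sub>F r in at_right 0. (LBINT y. indicator (\<Omega> \<inter> ball x r) y * \<bar>f y - a\<bar>) \<le> \<epsilon> * r ^ DIM('a))"
  shows "\<exists>p \<rho>. (\<forall>k::nat. 0 \<le> \<rho> k \<and> \<rho> k \<le> \<delta>) \<and> Bad \<subseteq> (\<Union>k. ball (p k) (\<rho> k)) \<and>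
      weight (DIM('a) - 1) \<rho> \<le> ennreal \<delta>"
proof -
  note cn = cone_inD[OF cone]
  let ?d = "DIM('a) - 1"
  have fm[measurable]: "f \<in> borel_measurable borel" using f by auto
  define M where "M = 1 + 4 / c"
  have M: "M > 0" using cn(2) by (simp add: M_def add_pos_pos)
  \<comment> \<open>Chosen to end with exactly \<delta>: the selected radii will satisfy a bound
    \<open>8 * \<eta> / \<epsilon>\<close>, and the final radii are larger by 5, from Vitali, and by
    \<open>M\<close>, from the separation of columns.\<close>
  define \<eta> where "\<eta> = \<epsilon> * \<delta> / (8 * (5 * M) ^ ?d)"
  have \<eta>: "\<eta> > 0" using \<epsilon> \<delta> M by (simp add: \<eta>_def)
  obtain K where K: "compact K" "K \<subseteq> \<Omega>" "tv (\<Omega> - K) f \<le> ereal \<eta>"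
    by (rule tv_tight[OF f fin \<eta>])
  obtain d where d: "d > 0" "\<And>x y. x \<in> K \<Longrightarrow> y \<in> - \<Omega> \<Longrightarrow> d \<le> dist x y"
  proof -
    have "\<exists>d>0. \<forall>x\<in>K. \<forall>y\<in>- \<Omega>. d \<le> dist x y"
      by (rule separate_compact_closed) (use K \<Omega> in auto)
    then show ?thesis using that by blast
  qed
  \<comment> \<open>Columns start within \<open>s / 8\<close> of a frontier point and are shorter
    than \<open>2 * s\<close>; with \<open>3 * s \<le> d\<close> they avoid \<open>K\<close>, and
    with \<open>s \<le> r0 / 16\<close> they remain in the ball of the cone condition.\<close>
  define s where "s = min (d / 3) (r0 / 16)"
  have s: "0 < s" "s \<le> r0 / 16" "3 * s \<le> d" using d(1) cn(4) by (auto simp: s_def)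
  have V: "y \<in> \<Omega> - K" if "y \<in> \<Omega>" "x \<in> frontier \<Omega>" "dist x y < 3 * s" for x y
  proof -
    have "x \<in> - \<Omega>" using that(2) \<Omega> by (simp add: frontier_def interior_open)
    then show ?thesis using d(2)[of y x] that s by (auto simp: dist_commute)
  qed
  define B where "B = ball (s *\<^sub>R e) (c / 2 * s)"
  have Bm[measurable]: "B \<in> sets borel" "bounded B" by (auto simp: B_def)
  define b where "b = measure lborel B"
  have b: "b > 0" unfolding b_def B_def using cn(2) s(1) by (simp add: content_ball_pos)
  have finB: "emeasure lborel B = ennreal b"
    unfolding b_def using emeasure_bounded_finite[OF Bm(2)] by (intro emeasure_eq_ennreal_measure) (auto simp: less_top)
  define G where "G y = (LBINT z. indicator B z * f (y + z))" for y
  define w where "w = unit_vol TYPE('a)"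
  have w: "w > 0" unfolding w_def by (rule unit_vol_pos)
  \<comment> \<open>The error of the average over the part of a ball of radius \<open>r\<close> in
    \<Omega> is then at most half of the deviation present at a bad point.\<close>
  define \<gamma> where "\<gamma> = b * \<epsilon> / (2 * w)"
  have \<gamma>: "\<gamma> > 0" using b \<epsilon> w by (simp add: \<gamma>_def)
  define A where "A x r = \<Omega> \<inter> ball x r" for x r
  have Am[measurable]: "A x r \<in> sets borel" and Ab: "bounded (A x r)" for x r
    using \<Omega> by (auto simp: A_def intro: bounded_Int)
  have Aw: "measure lborel (A x r) \<le> w * r ^ DIM('a)" if "r > 0" for x r
  proof -
    have "measure lborel (A x r) \<le> measure lborel (ball x r)"
      using emeasure_bounded_finite[OF bounded_ball, of x r] \<Omega>
      by (intro measure_mono_fmeasurable) (auto simp: A_def fmeasurable_def)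
    also have "\<dots> = w * r ^ DIM('a)" using that by (simp add: content_ball w_def)
    finally show ?thesis .
  qed
  define J where "J x r z = (\<integral>\<^sup>+y. indicator (A x r) y * ennreal \<bar>f (y + z) - f y\<bar> \<partial>lborel)" for x r z
  have Jm[measurable]: "J x r \<in> borel_measurable borel" for x r
  proof -
    have "(\<lambda>z. \<integral>\<^sup>+y. indicator (A x r) y * ennreal \<bar>f (y + z) - f y\<bar> \<partial>lborel) \<in> borel_measurable borel" by measurable
    then show ?thesis by (simp add: J_def[abs_def])
  qed
  have Jeq: "J x r z = ennreal (LBINT y. indicator (A x r) y * \<bar>f (y + z) - f y\<bar>)" for x r z
  proof -
    have "integrable lborel (\<lambda>y. indicator (A x r) y * \<bar>f (y + z) - f y\<bar>)"
      using f integral_lborel_translate(2)[OF fm, of z] by (intro integrable_indicator_mult) auto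
    then have "ennreal (LBINT y. indicator (A x r) y * \<bar>f (y + z) - f y\<bar>) =
       (\<integral>\<^sup>+y. ennreal (indicator (A x r) y * \<bar>f (y + z) - f y\<bar>) \<partial>lborel)"
      by (intro nn_integral_eq_integral[symmetric]) auto
    also have "\<dots> = J x r z" unfolding J_def by (intro nn_integral_cong) (auto simp: indicator_def)
    finally show ?thesis ..
  qed
  have radius: "\<exists>r. 0 < r \<and> r \<le> s / 8 \<and> 5 * M * r \<le> \<delta> \<and>
      ennreal (b * (\<epsilon> / 2 * r ^ DIM('a))) \<le> (\<integral>\<^sup>+z. indicator B z * J x r z \<partial>lborel)" if x: "x \<in> Bad" for x
  proof -
    \<comment> \<open>The definition of badness quantifies over all constants, so it may be used
      with the one suggested by the inner average.\<close>
    define a where "a = G x / b"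
    have "isCont G x" unfolding G_def B_def by (rule ball_average_continuous[OF f])
    then obtain \<rho> where \<rho>: "\<rho> > 0" "\<And>y. dist y x < \<rho> \<Longrightarrow> dist (G y) (G x) < \<gamma>"
      using \<gamma> unfolding continuous_at_eps_delta by metis
    define R where "R = min \<rho> (min (s / 8) (\<delta> / (5 * M)))"
    have R: "R > 0" using \<rho> s \<delta> M by (simp add: R_def)
    have "\<exists>\<^sub>F r in at_right 0. \<epsilon> * r ^ DIM('a) < (LBINT y. indicator (A x r) y * \<bar>f y - a\<bar>)"
      using Bad[OF x, of a] by (simp add: frequently_def A_def not_less)
    then have "\<exists>\<^sub>F r in at_right 0. \<epsilon> * r ^ DIM('a) < (LBINT y. indicator (A x r) y * \<bar>f y - a\<bar>) \<and> (r \<in> {0<..<R})"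
      using eventually_at_right_real[OF R] by (rule frequently_eventually_frequently)
    then obtain r where r: "\<epsilon> * r ^ DIM('a) < (LBINT y. indicator (A x r) y * \<bar>f y - a\<bar>)" "0 < r" "r < R"
      using frequently_ex by fastforce
    have "ennreal (b * (LBINT y. indicator (A x r) y * \<bar>f y - a\<bar>)) \<le>
       (\<integral>\<^sup>+z. indicator B z * J x r z \<partial>lborel) + ennreal (\<gamma> * measure lborel (A x r))"
      unfolding J_def b_def
    proof (rule average_lower[OF f Am Ab Bm])
      fix y assume "y \<in> A x r"
      then have "dist y x < \<rho>" using r by (simp add: A_def R_def dist_commute)
      from \<rho>(2)[OF this]
      show "\<bar>(LBINT z. indicator B z * f (y + z)) - measure lborel B * a\<bar> \<le> \<gamma>"
        using b by (simp add: a_def G_def b_def dist_real_def)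
    qed (use \<gamma> in simp)
    also have "ennreal (\<gamma> * measure lborel (A x r)) \<le> ennreal (b * (\<epsilon> / 2 * r ^ DIM('a)))"
    proof (rule ennreal_leI)
      have "\<gamma> * measure lborel (A x r) \<le> \<gamma> * (w * r ^ DIM('a))" using \<gamma> Aw[OF r(2)] by (intro mult_left_mono) auto
      also have "\<dots> = b * (\<epsilon> / 2 * r ^ DIM('a))" using w by (simp add: \<gamma>_def)
      finally show "\<gamma> * measure lborel (A x r) \<le> b * (\<epsilon> / 2 * r ^ DIM('a))" .
    qed
    finally have *: "ennreal (b * (LBINT y. indicator (A x r) y * \<bar>f y - a\<bar>)) \<le>
       (\<integral>\<^sup>+z. indicator B z * J x r z \<partial>lborel) + ennreal (b * (\<epsilon> / 2 * r ^ DIM('a)))"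
      by (simp add: add_left_mono)
    have nn: "b * (\<epsilon> / 2 * r ^ DIM('a)) \<ge> 0" using b \<epsilon> r by simp
    have "ennreal (b * (\<epsilon> / 2 * r ^ DIM('a))) + ennreal (b * (\<epsilon> / 2 * r ^ DIM('a))) = ennreal (b * (\<epsilon> * r ^ DIM('a)))"
      using nn by (subst ennreal_plus[symmetric]) (simp_all add: mult.left_commute)
    also have "\<dots> \<le> ennreal (b * (LBINT y. indicator (A x r) y * \<bar>f y - a\<bar>))"
      using r b by (intro ennreal_leI mult_left_mono) auto
    also note *
    finally have "ennreal (b * (\<epsilon> / 2 * r ^ DIM('a))) \<le> (\<integral>\<^sup>+z. indicator B z * J x r z \<partial>lborel)"
      by (simp add: ennreal_add_left_cancel_le add.commute)
    moreover have "r \<le> s / 8" "5 * M * r \<le> \<delta>"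
    proof -
      have "r \<le> \<delta> / (5 * M)" using r(3) by (simp add: R_def)
      then show "5 * M * r \<le> \<delta>" using M by (simp add: field_simps)
      show "r \<le> s / 8" using r(3) by (simp add: R_def)
    qed
    ultimately show ?thesis using r(2) by blast
  qed
  then have "\<forall>x\<in>Bad. \<exists>r. 0 < r \<and> r \<le> s / 8 \<and> 5 * M * r \<le> \<delta> \<and>
      ennreal (b * (\<epsilon> / 2 * r ^ DIM('a))) \<le> (\<integral>\<^sup>+z. indicator B z * J x r z \<partial>lborel)" by blast
  from bchoice[OF this] obtain rr where "\<forall>x\<in>Bad. 0 < rr x \<and> rr x \<le> s / 8 \<and> 5 * M * rr x \<le> \<delta> \<and>
      ennreal (b * (\<epsilon> / 2 * rr x ^ DIM('a))) \<le> (\<integral>\<^sup>+z. indicator B z * J x (rr x) z \<partial>lborel)" ..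
  then have rr: "\<And>x. x \<in> Bad \<Longrightarrow> 0 < rr x \<and> rr x \<le> s / 8 \<and> 5 * M * rr x \<le> \<delta>"
    and low: "\<And>x. x \<in> Bad \<Longrightarrow> ennreal (b * (\<epsilon> / 2 * rr x ^ DIM('a))) \<le> (\<integral>\<^sup>+z. indicator B z * J x (rr x) z \<partial>lborel)"
    by blast+
  have Bcov: "Bad \<subseteq> (\<Union>x\<in>Bad. ball x (M * rr x))" using rr M by force
  have Brad: "0 < M * rr x \<and> M * rr x \<le> \<delta>" if "x \<in> Bad" for x
  proof -
    have "0 < M * rr x" using rr[OF that] M by simp
    moreover have "5 * (M * rr x) \<le> \<delta>" using rr[OF that] by (simp add: mult.assoc)
    ultimately show ?thesis by linarith
  qed
  \<comment> \<open>Vitali is applied to the balls enlarged by \<open>M\<close>, so that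
    disjointness means the separation demanded by \<open>columns_sum\<close>.\<close>
  obtain C where C: "countable C" "C \<subseteq> Bad"
    "pairwise (\<lambda>i j. disjnt (ball i (M * rr i)) (ball j (M * rr j))) C"
    "Bad \<subseteq> (\<Union>x\<in>C. ball x (5 * (M * rr x)))"
    by (rule Vitali_covering_lemma_balls[OF Bcov Brad])
  have finite_sum: "(\<Sum>x\<in>I. (5 * M * rr x) ^ ?d) \<le> \<delta>" if I: "finite I" "I \<subseteq> C" for I
  proof -
    have IB: "x \<in> Bad" if "x \<in> I" for x using that I C(2) by blast
    have step: "b * (\<epsilon> / 2 * rr x ^ ?d) = (1 / rr x) * (b * (\<epsilon> / 2 * rr x ^ DIM('a)))" if "x \<in> I" for x
    proof -
      have "rr x ^ DIM('a) = rr x * rr x ^ ?d" by (simp flip: power_Suc)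
      then show ?thesis using rr[OF IB[OF that]] by simp
    qed
    have "ennreal (\<Sum>x\<in>I. b * (\<epsilon> / 2 * rr x ^ ?d)) = (\<Sum>x\<in>I. ennreal (1 / rr x) * ennreal (b * (\<epsilon> / 2 * rr x ^ DIM('a))))"
    proof -
      have "ennreal (b * (\<epsilon> / 2 * rr x ^ ?d)) = ennreal (1 / rr x) * ennreal (b * (\<epsilon> / 2 * rr x ^ DIM('a)))" if "x \<in> I" for x
        unfolding step[OF that] using rr[OF IB[OF that]] b \<epsilon> by (intro ennreal_mult) auto
      moreover have "0 \<le> b * (\<epsilon> / 2 * rr x ^ ?d)" if "x \<in> I" for x
        using rr[OF IB[OF that]] b \<epsilon> by simp
      ultimately show ?thesis by (subst sum_ennreal[symmetric]) (auto intro!: sum.cong)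
    qed
    also have "\<dots> \<le> (\<Sum>x\<in>I. ennreal (1 / rr x) * (\<integral>\<^sup>+z. indicator B z * J x (rr x) z \<partial>lborel))"
      by (intro sum_mono mult_left_mono low IB) auto
    also have "\<dots> = (\<Sum>x\<in>I. \<integral>\<^sup>+z. ennreal (1 / rr x) * (indicator B z * J x (rr x) z) \<partial>lborel)"
      by (intro sum.cong refl nn_integral_cmult[symmetric]) measurable
    also have "\<dots> = (\<integral>\<^sup>+z. (\<Sum>x\<in>I. ennreal (1 / rr x) * (indicator B z * J x (rr x) z)) \<partial>lborel)"
      by (rule nn_integral_sum[symmetric]) measurable
    also have "\<dots> \<le> (\<integral>\<^sup>+z. indicator B z * ennreal (4 * \<eta>) \<partial>lborel)"
    proof (rule nn_integral_mono)
      fix z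
      show "(\<Sum>x\<in>I. ennreal (1 / rr x) * (indicator B z * J x (rr x) z)) \<le> indicator B z * ennreal (4 * \<eta>)"
      proof (cases "z \<in> B")
        case True
        have "(\<Sum>x\<in>I. (1 / rr x) * (LBINT y. indicator (\<Omega> \<inter> ball x (rr x)) y * \<bar>f (y + z) - f y\<bar>)) \<le> 4 * \<eta>"
        proof (rule columns_sum[OF cone \<Omega> f I(1) _ _ s(1,2) _ _ V K(3)])
          show "I \<subseteq> frontier \<Omega> \<inter> ball x0 (r0 / 4)" using Bad IB by blast
          show "0 < rr x \<and> rr x \<le> s / 8" if "x \<in> I" for x using rr[OF IB[OF that]] by simp
          show "norm (z - s *\<^sub>R e) < c / 2 * s" using True by (simp add: B_def dist_norm norm_minus_commute)
          show "(1 + 4 / c) * (rr x + rr y) \<le> dist x y" if xy: "x \<in> I" "y \<in> I" "x \<noteq> y" for x y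
          proof -
            have "disjnt (ball x (M * rr x)) (ball y (M * rr y))"
              using C(3) xy I(2) unfolding pairwise_def by blast
            then have "M * rr x + M * rr y \<le> dist x y"
              using Brad[OF IB[OF xy(1)]] Brad[OF IB[OF xy(2)]] by (intro ball_radius_lower) auto
            then show ?thesis by (simp add: M_def distrib_left)
          qed
        qed
        moreover have "(\<Sum>x\<in>I. ennreal (1 / rr x) * (indicator B z * J x (rr x) z)) =
           ennreal (\<Sum>x\<in>I. (1 / rr x) * (LBINT y. indicator (\<Omega> \<inter> ball x (rr x)) y * \<bar>f (y + z) - f y\<bar>))"
        proof -
          have nn: "0 \<le> (LBINT y. indicator (\<Omega> \<inter> ball x (rr x)) y * \<bar>f (y + z) - f y\<bar>)" for x by simp
          have "ennreal (1 / rr x) * (indicator B z * J x (rr x) z) =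
             ennreal ((1 / rr x) * (LBINT y. indicator (\<Omega> \<inter> ball x (rr x)) y * \<bar>f (y + z) - f y\<bar>))" if "x \<in> I" for x
            using True rr[OF IB[OF that]] nn unfolding Jeq A_def by (subst ennreal_mult) auto
          moreover have "0 \<le> (1 / rr x) * (LBINT y. indicator (\<Omega> \<inter> ball x (rr x)) y * \<bar>f (y + z) - f y\<bar>)" if "x \<in> I" for x
            using rr[OF IB[OF that]] nn by (intro mult_nonneg_nonneg) auto
          ultimately show ?thesis by (subst sum_ennreal[symmetric]) (auto intro!: sum.cong)
        qed
        ultimately show ?thesis using True by (simp add: ennreal_leI)
      qed simp
    qed
    also have "\<dots> = ennreal (b * (4 * \<eta>))"
    proof -
      have "(\<integral>\<^sup>+z. indicator B z * ennreal (4 * \<eta>) \<partial>lborel) = (\<integral>\<^sup>+z. ennreal (4 * \<eta>) * indicator B z \<partial>lborel)"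
        by (simp only: mult.commute)
      also have "\<dots> = ennreal (4 * \<eta>) * ennreal b"
        by (subst nn_integral_cmult_indicator) (auto simp: finB)
      also have "\<dots> = ennreal (b * (4 * \<eta>))"
        using b \<eta> by (subst ennreal_mult[symmetric]) (auto simp: mult.commute)
      finally show ?thesis .
    qed
    finally have "(\<Sum>x\<in>I. b * (\<epsilon> / 2 * rr x ^ ?d)) \<le> b * (4 * \<eta>)"
      using b \<eta> by (subst (asm) ennreal_le_iff) auto
    then have "b * ((\<epsilon> / 2) * (\<Sum>x\<in>I. rr x ^ ?d)) \<le> b * (4 * \<eta>)" by (simp only: sum_distrib_left)
    then have "(\<epsilon> / 2) * (\<Sum>x\<in>I. rr x ^ ?d) \<le> 4 * \<eta>" using b by simp
    then have "(\<Sum>x\<in>I. rr x ^ ?d) \<le> 8 * \<eta> / \<epsilon>" using \<epsilon> by (simp add: field_simps)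
    then have "(5 * M) ^ ?d * (\<Sum>x\<in>I. rr x ^ ?d) \<le> (5 * M) ^ ?d * (8 * \<eta> / \<epsilon>)" using M by (intro mult_left_mono) auto
    also have "\<dots> = \<delta>" using M \<epsilon> by (simp add: \<eta>_def)
    also have "(5 * M) ^ ?d * (\<Sum>x\<in>I. rr x ^ ?d) = (\<Sum>x\<in>I. (5 * M * rr x) ^ ?d)"
      by (simp add: sum_distrib_left power_mult_distrib)
    finally show ?thesis .
  qed
  define p where "p = from_nat_into C"
  \<comment> \<open>Indices that enumerate no selected centre receive radius 0 and hence weight
    0.\<close>
  define \<rho> where "\<rho> k = (if k \<in> to_nat_on C ` C then 5 * M * rr (p k) else 0)" for k
  have pk: "p k \<in> C \<and> to_nat_on C (p k) = k" if "k \<in> to_nat_on C ` C" for k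
    using that C(1) by (auto simp: p_def)
  show ?thesis
  proof (intro exI[of _ p] exI[of _ \<rho>] conjI allI)
    fix k
    show "0 \<le> \<rho> k" "\<rho> k \<le> \<delta>"
    proof -
      have "p k \<in> Bad" if "k \<in> to_nat_on C ` C" using pk[OF that] C(2) by blast
      then have "0 \<le> 5 * M * rr (p k) \<and> 5 * M * rr (p k) \<le> \<delta>" if "k \<in> to_nat_on C ` C"
        using rr[of "p k"] M that by simp
      then show "0 \<le> \<rho> k" "\<rho> k \<le> \<delta>" using \<delta> unfolding \<rho>_def by auto
    qed
  next
    show "Bad \<subseteq> (\<Union>k. ball (p k) (\<rho> k))"
    proof
      fix x assume "x \<in> Bad"
      then obtain y where y: "y \<in> C" "x \<in> ball y (5 * (M * rr y))" using C(4) by blast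
      have "p (to_nat_on C y) = y" using C(1) y(1) by (simp add: p_def)
      then show "x \<in> (\<Union>k. ball (p k) (\<rho> k))"
        using y by (intro UN_I[of "to_nat_on C y"]) (auto simp: \<rho>_def mult.assoc)
    qed
  next
    show "weight ?d \<rho> \<le> ennreal \<delta>"
      unfolding suminf_eq_SUP
    proof (rule SUP_least)
      fix n
      define Kn where "Kn = {k\<in>{..<n}. k \<in> to_nat_on C ` C}"
      have inj: "inj_on p Kn" by (rule inj_onI) (metis (no_types, lifting) Kn_def mem_Collect_eq pk)
      have "(\<Sum>k<n. ennreal (if \<rho> k > 0 then \<rho> k ^ ?d else 0)) = (\<Sum>k\<in>Kn. ennreal ((5 * M * rr (p k)) ^ ?d))"
      proof (rule sum.mono_neutral_cong_right)
        show "ennreal (if \<rho> k > 0 then \<rho> k ^ ?d else 0) = ennreal ((5 * M * rr (p k)) ^ ?d)" if "k \<in> Kn" for k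
          using that pk[of k] C(2) rr[of "p k"] M by (auto simp: Kn_def \<rho>_def)
      qed (auto simp: Kn_def \<rho>_def)
      also have "\<dots> = ennreal (\<Sum>k\<in>Kn. (5 * M * rr (p k)) ^ ?d)"
      proof (rule sum_ennreal)
        fix k assume "k \<in> Kn"
        then have "p k \<in> Bad" using pk[of k] C(2) by (auto simp: Kn_def)
        then show "0 \<le> (5 * M * rr (p k)) ^ ?d" using rr[of "p k"] M by simp
      qed
      also have "(\<Sum>k\<in>Kn. (5 * M * rr (p k)) ^ ?d) = (\<Sum>x\<in>p ` Kn. (5 * M * rr x) ^ ?d)"
        by (simp add: sum.reindex[OF inj])
      also have "ennreal \<dots> \<le> ennreal \<delta>"
      proof (intro ennreal_leI finite_sum)
        show "p ` Kn \<subseteq> C" by (rule image_subsetI) (use pk in \<open>simp add: Kn_def\<close>)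
      qed (simp add: Kn_def)
      finally show "(\<Sum>k<n. ennreal (if \<rho> k > 0 then \<rho> k ^ ?d else 0)) \<le> ennreal \<delta>" .
    qed
  qed
qed

text \<open>The ball of radius \<open>c * r / 2\<close> about the point at distance
  \<open>r / 2\<close> along the axis lies in the cone. This density is what makes traces
  unique.\<close>

lemma cone_lower_density:
  fixes \<Omega> :: "'a::euclidean_space set"
  assumes cone: "cone_in \<Omega> x0 r0 e c" and \<Omega>: "open \<Omega>" and x: "x \<in> frontier \<Omega>" "x \<in> ball x0 (r0 / 4)"
    and r: "0 < r" "r \<le> r0 / 4"
  shows "unit_vol TYPE('a) * (c / 2) ^ DIM('a) * r ^ DIM('a) \<le> measure lborel (\<Omega> \<inter> ball x r)"
proof -
  note cn = cone_inD[OF cone]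
  let ?B = "ball (x + (r / 2) *\<^sub>R e) (c * (r / 2))"
  have cr: "c * (r / 2) \<le> r / 2" using mult_right_mono[OF cn(3), of "r / 2"] r by simp
  have ne: "norm ((r / 2) *\<^sub>R e) = r / 2" using cn(1) r by simp
  have sub: "?B \<subseteq> \<Omega> \<inter> ball x r"
  proof
    fix y assume y: "y \<in> ?B"
    have "norm (y - x) \<le> norm (y - x - (r / 2) *\<^sub>R e) + norm ((r / 2) *\<^sub>R e)"
      using norm_triangle_ineq[of "y - x - (r / 2) *\<^sub>R e" "(r / 2) *\<^sub>R e"] by simp
    moreover have 1: "norm (y - x - (r / 2) *\<^sub>R e) < c * (r / 2)"
      using y by (simp add: dist_norm norm_minus_commute algebra_simps)
    ultimately have "norm (y - x) < r" using cr ne by linarith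
    then have yr: "dist x y < r" by (simp add: dist_norm norm_minus_commute)
    have "x + (y - x) \<in> \<Omega>"
    proof (rule cn(5)[OF _ _ _ 1])
      show "x \<in> closure \<Omega>" "x \<in> ball x0 r0" "0 < r / 2" using x r by (auto simp: frontier_def)
      show "x + (y - x) \<in> ball x0 r0" using dist_triangle[of x0 y x] yr x r by simp
    qed
    then show "y \<in> \<Omega> \<inter> ball x r" using yr by simp
  qed
  have "unit_vol TYPE('a) * (c / 2) ^ DIM('a) * r ^ DIM('a) = measure lborel ?B"
    using r cn(2) by (simp add: content_ball power_mult_distrib power_divide)
  also have "\<dots> \<le> measure lborel (\<Omega> \<inter> ball x r)"
    using \<Omega> emeasure_bounded_finite[of "\<Omega> \<inter> ball x r"] sub
    by (intro measure_mono_fmeasurable) (auto simp: fmeasurable_def bounded_Int)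
  finally show ?thesis .
qed

section \<open>From small oscillation to the trace\<close>

definition mean_dev :: "'a::euclidean_space set \<Rightarrow> ('a \<Rightarrow> real) \<Rightarrow> 'a \<Rightarrow> real \<Rightarrow> real \<Rightarrow> real" where
  "mean_dev \<Omega> f x t r = (LBINT y. indicator (\<Omega> \<inter> ball x r) y * \<bar>f y - t\<bar>)"

abbreviation is_trace :: "'a::euclidean_space set \<Rightarrow> ('a \<Rightarrow> real) \<Rightarrow> 'a \<Rightarrow> real \<Rightarrow> bool" where
  "is_trace \<Omega> f x t \<equiv> ((\<lambda>r. mean_dev \<Omega> f x t r / r ^ DIM('a)) \<longlongrightarrow> 0) (at_right 0)"

lemma integrable_mean_dev:
  fixes f :: "'a::euclidean_space \<Rightarrow> real"
  assumes "integrable lborel f" "A \<in> sets borel" "bounded A"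
  shows "integrable lborel (\<lambda>y. indicator A y * k)" "integrable lborel (\<lambda>y. indicator A y * \<bar>f y - t\<bar>)"
    "(LBINT y. indicator A y * k) = measure lborel A * (k::real)"
proof -
  have c: "integrable lborel (\<lambda>y. indicator A y * k)" for k :: real
    using integrable_real_indicator[of A lborel] emeasure_bounded_finite[OF assms(3)] assms(2) by simp
  then show "integrable lborel (\<lambda>y. indicator A y * k)" .
  have "integrable lborel (\<lambda>y. \<bar>indicator A y * f y - indicator A y * t\<bar>)"
    using assms by (intro integrable_abs Bochner_Integration.integrable_diff[OF integrable_indicator_mult[OF _ assms(1)] c[of t]]) auto
  moreover have "\<bar>indicator A y * f y - indicator A y * t\<bar> = indicator A y * \<bar>f y - t\<bar>" for y
    by (simp add: indicator_def)
  ultimately show "integrable lborel (\<lambda>y. indicator A y * \<bar>f y - t\<bar>)" by simp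
  show "(LBINT y. indicator A y * k) = measure lborel A * k" using assms(2) by simp
qed

lemma mean_dev_triangle:
  fixes f :: "'a::euclidean_space \<Rightarrow> real"
  assumes f: "integrable lborel f" and \<Omega>: "open \<Omega>"
  shows "measure lborel (\<Omega> \<inter> ball x r) * \<bar>s - t\<bar> \<le> mean_dev \<Omega> f x s r + mean_dev \<Omega> f x t r"
    "mean_dev \<Omega> f x t r \<le> mean_dev \<Omega> f x s r + measure lborel (\<Omega> \<inter> ball x r) * \<bar>s - t\<bar>"
proof -
  have A: "\<Omega> \<inter> ball x r \<in> sets borel" "bounded (\<Omega> \<inter> ball x r)" using \<Omega> by (auto simp: bounded_Int)
  note I = integrable_mean_dev[OF f A]
  have "(LBINT y. indicator (\<Omega> \<inter> ball x r) y * \<bar>s - t\<bar>) \<le>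
     (LBINT y. indicator (\<Omega> \<inter> ball x r) y * \<bar>f y - s\<bar> + indicator (\<Omega> \<inter> ball x r) y * \<bar>f y - t\<bar>)"
    by (intro integral_mono I Bochner_Integration.integrable_add) (auto simp: indicator_def)
  then show "measure lborel (\<Omega> \<inter> ball x r) * \<bar>s - t\<bar> \<le> mean_dev \<Omega> f x s r + mean_dev \<Omega> f x t r"
    unfolding mean_dev_def I(3) Bochner_Integration.integral_add[OF I(2) I(2)] .
  have "(LBINT y. indicator (\<Omega> \<inter> ball x r) y * \<bar>f y - t\<bar>) \<le>
     (LBINT y. indicator (\<Omega> \<inter> ball x r) y * \<bar>f y - s\<bar> + indicator (\<Omega> \<inter> ball x r) y * \<bar>s - t\<bar>)"
    by (intro integral_mono I Bochner_Integration.integrable_add) (auto simp: indicator_def)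
  then show "mean_dev \<Omega> f x t r \<le> mean_dev \<Omega> f x s r + measure lborel (\<Omega> \<inter> ball x r) * \<bar>s - t\<bar>"
    unfolding mean_dev_def Bochner_Integration.integral_add[OF I(2) I(1)] unfolding I(3) .
qed

lemma measure_ball_Int_le:
  fixes \<Omega> :: "'a::euclidean_space set"
  assumes "open \<Omega>" "r > 0"
  shows "measure lborel (\<Omega> \<inter> ball x r) \<le> unit_vol TYPE('a) * r ^ DIM('a)"
proof -
  have "measure lborel (\<Omega> \<inter> ball x r) \<le> measure lborel (ball x r)"
    using emeasure_bounded_finite[OF bounded_ball, of x r] assms(1)
    by (intro measure_mono_fmeasurable) (auto simp: fmeasurable_def)
  then show ?thesis using assms(2) by (simp add: content_ball)
qed

lemma trace_unique:
  fixes f :: "'a::euclidean_space \<Rightarrow> real"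
  assumes cone: "cone_in \<Omega> x0 r0 e c" and \<Omega>: "open \<Omega>" and x: "x \<in> frontier \<Omega>" "x \<in> ball x0 (r0 / 4)"
    and f: "integrable lborel f"
    and s: "is_trace \<Omega> f x s"
    and t: "is_trace \<Omega> f x t"
  shows "s = t"
proof -
  note cn = cone_inD[OF cone]
  define \<kappa> where "\<kappa> = unit_vol TYPE('a) * (c / 2) ^ DIM('a)"
  have \<kappa>: "\<kappa> > 0" using unit_vol_pos[where 'a='a] cn(2) by (simp add: \<kappa>_def)
  have lim: "((\<lambda>r. mean_dev \<Omega> f x s r / r ^ DIM('a) + mean_dev \<Omega> f x t r / r ^ DIM('a)) \<longlongrightarrow> 0 + 0) (at_right 0)"
    by (intro tendsto_add s t)
  have "\<forall>\<^sub>F r in at_right 0. r \<in> {0<..<r0 / 4}" using cn(4) by (intro eventually_at_right_real) simp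
  then have "\<forall>\<^sub>F r in at_right 0. \<kappa> * \<bar>s - t\<bar> \<le> mean_dev \<Omega> f x s r / r ^ DIM('a) + mean_dev \<Omega> f x t r / r ^ DIM('a)"
  proof eventually_elim
    case (elim r)
    have "\<kappa> * r ^ DIM('a) * \<bar>s - t\<bar> \<le> measure lborel (\<Omega> \<inter> ball x r) * \<bar>s - t\<bar>"
      unfolding \<kappa>_def using elim by (intro mult_right_mono cone_lower_density[OF cone \<Omega> x]) auto
    also note mean_dev_triangle(1)[OF f \<Omega>]
    finally show ?case using elim by (simp add: field_simps)
  qed
  from tendsto_lowerbound[OF lim this] have "\<kappa> * \<bar>s - t\<bar> \<le> 0" by simp
  then show "s = t" using \<kappa> by (simp add: mult_le_0_iff)
qed

text \<open>Two constants that both approximate \<open>f\<close> on the same small ball are close,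
  because \<Omega> has positive lower density there. So approximations with error tending to 0 form
  a Cauchy sequence, whose limit is the trace.\<close>

lemma trace_limit:
  fixes f :: "'a::euclidean_space \<Rightarrow> real"
  assumes cone: "cone_in \<Omega> x0 r0 e c" and \<Omega>: "open \<Omega>" and x: "x \<in> frontier \<Omega>" "x \<in> ball x0 (r0 / 4)"
    and f: "integrable lborel f"
    and ex: "\<And>m::nat. \<exists>a. \<forall>\<^sub>F r in at_right 0. mean_dev \<Omega> f x a r \<le> 1 / real (Suc m) * r ^ DIM('a)"
  shows "\<exists>t. is_trace \<Omega> f x t"
proof -
  note cn = cone_inD[OF cone]
  define \<kappa> where "\<kappa> = unit_vol TYPE('a) * (c / 2) ^ DIM('a)"
  define w where "w = unit_vol TYPE('a)"
  have w: "w > 0" unfolding w_def by (rule unit_vol_pos)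
  have \<kappa>: "\<kappa> > 0" using unit_vol_pos[where 'a='a] cn(2) by (simp add: \<kappa>_def)
  have ev0: "\<forall>\<^sub>F r in at_right 0. r \<in> {0<..<r0 / 4}" using cn(4) by (intro eventually_at_right_real) simp
  have "\<exists>a. \<forall>m. \<forall>\<^sub>F r in at_right 0. mean_dev \<Omega> f x (a m) r \<le> 1 / real (Suc m) * r ^ DIM('a)"
    by (intro choice allI ex)
  then obtain a where a: "\<And>m. \<forall>\<^sub>F r in at_right 0. mean_dev \<Omega> f x (a m) r \<le> 1 / real (Suc m) * r ^ DIM('a)" by blast
  have diff: "\<kappa> * \<bar>a m - a k\<bar> \<le> 1 / real (Suc m) + 1 / real (Suc k)" for m k
  proof -
    have "\<forall>\<^sub>F r in at_right 0. r \<in> {0<..<r0 / 4} \<and> mean_dev \<Omega> f x (a m) r \<le> 1 / real (Suc m) * r ^ DIM('a) \<and>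
       mean_dev \<Omega> f x (a k) r \<le> 1 / real (Suc k) * r ^ DIM('a)"
      by (intro eventually_conj ev0 a)
    then obtain r where r: "r \<in> {0<..<r0 / 4}" "mean_dev \<Omega> f x (a m) r \<le> 1 / real (Suc m) * r ^ DIM('a)"
       "mean_dev \<Omega> f x (a k) r \<le> 1 / real (Suc k) * r ^ DIM('a)"
      using eventually_happens'[OF trivial_limit_at_right_real] by blast
    have "\<kappa> * r ^ DIM('a) * \<bar>a m - a k\<bar> \<le> measure lborel (\<Omega> \<inter> ball x r) * \<bar>a m - a k\<bar>"
      unfolding \<kappa>_def using r(1) by (intro mult_right_mono cone_lower_density[OF cone \<Omega> x]) auto
    also have "\<dots> \<le> mean_dev \<Omega> f x (a m) r + mean_dev \<Omega> f x (a k) r" by (rule mean_dev_triangle(1)[OF f \<Omega>])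
    also have "\<dots> \<le> (1 / real (Suc m) + 1 / real (Suc k)) * r ^ DIM('a)"
      using r(2,3) by (simp only: distrib_right)
    finally have "(\<kappa> * \<bar>a m - a k\<bar>) * r ^ DIM('a) \<le> (1 / real (Suc m) + 1 / real (Suc k)) * r ^ DIM('a)"
      by (simp only: mult.assoc mult.commute mult.left_commute)
    moreover have "r ^ DIM('a) > 0" using r(1) by simp
    ultimately show ?thesis by (rule mult_right_le_imp_le)
  qed
  have "Cauchy a"
  proof (rule metric_CauchyI)
    fix e :: real assume "e > 0"
    then obtain N where N: "1 / real (Suc N) < \<kappa> * e / 2" using nat_approx_posE[of "\<kappa> * e / 2"] \<kappa> by auto
    show "\<exists>M. \<forall>m\<ge>M. \<forall>n\<ge>M. dist (a m) (a n) < e"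
    proof (intro exI allI impI)
      fix m n assume mn: "N \<le> m" "N \<le> n"
      have "1 / real (Suc m) \<le> 1 / real (Suc N)" "1 / real (Suc n) \<le> 1 / real (Suc N)"
        using mn by (auto intro!: divide_left_mono)
      then have "\<kappa> * \<bar>a m - a n\<bar> < \<kappa> * e" using diff[of m n] N by linarith
      then show "dist (a m) (a n) < e" using \<kappa> by (simp add: dist_real_def)
    qed
  qed
  then obtain t where t: "a \<longlonglongrightarrow> t" using Cauchy_convergent_iff convergent_def by blast
  have at: "\<kappa> * \<bar>a m - t\<bar> \<le> 1 / real (Suc m)" for m
  proof -
    have "(\<lambda>k. \<kappa> * \<bar>a m - a k\<bar>) \<longlonglongrightarrow> \<kappa> * \<bar>a m - t\<bar>" by (intro tendsto_intros t)
    moreover have "(\<lambda>k. 1 / real (Suc m) + 1 / real (Suc k)) \<longlonglongrightarrow> 1 / real (Suc m) + 0"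
      using lim_1_over_n by (intro tendsto_intros LIMSEQ_Suc)
    ultimately show ?thesis using diff LIMSEQ_le[of _ _ "\<lambda>k. 1 / real (Suc m) + 1 / real (Suc k)" "1 / real (Suc m) + 0"]
      by simp
  qed
  have "is_trace \<Omega> f x t"
    unfolding tendsto_iff
  proof (intro allI impI)
    fix e :: real assume "e > 0"
    then obtain m where m: "1 / real (Suc m) < e / (1 + w / \<kappa>)"
      using nat_approx_posE[of "e / (1 + w / \<kappa>)"] w \<kappa> by (auto simp: add_pos_pos)
    show "\<forall>\<^sub>F r in at_right 0. dist (mean_dev \<Omega> f x t r / r ^ DIM('a)) 0 < e"
      using ev0 a[of m]
    proof eventually_elim
      case (elim r)
      have r: "r > 0" using elim by simp
      have nn: "mean_dev \<Omega> f x t r \<ge> 0" by (simp add: mean_dev_def)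
      have "mean_dev \<Omega> f x t r \<le> mean_dev \<Omega> f x (a m) r + measure lborel (\<Omega> \<inter> ball x r) * \<bar>a m - t\<bar>"
        by (rule mean_dev_triangle(2)[OF f \<Omega>])
      also have "\<dots> \<le> 1 / real (Suc m) * r ^ DIM('a) + (w * r ^ DIM('a)) * (1 / real (Suc m) / \<kappa>)"
      proof (intro add_mono elim(2) mult_mono)
        show "measure lborel (\<Omega> \<inter> ball x r) \<le> w * r ^ DIM('a)" unfolding w_def by (rule measure_ball_Int_le[OF \<Omega> r])
        show "\<bar>a m - t\<bar> \<le> 1 / real (Suc m) / \<kappa>"
          using at[of m] \<kappa> by (simp only: pos_le_divide_eq mult.commute)
      qed (use w r in auto)
      also have "\<dots> = (1 / real (Suc m) * (1 + w / \<kappa>)) * r ^ DIM('a)"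
        by (simp add: divide_inverse algebra_simps)
      also have "\<dots> < e * r ^ DIM('a)"
      proof (rule mult_strict_right_mono)
        have "1 + w / \<kappa> > 0" using w \<kappa> by (simp add: add_pos_pos)
        then show "1 / real (Suc m) * (1 + w / \<kappa>) < e" using m by (simp add: pos_less_divide_eq)
      qed (use r in simp)
      finally show ?case using r nn by (simp add: dist_real_def pos_divide_less_eq)
    qed
  qed
  then show ?thesis by blast
qed

text \<open>The exceptional set is covered by one null set for each of finitely many cones and each
  accuracy \<open>1 / (m + 1)\<close>, a countable union.\<close>

theorem trace_exists:
  fixes f :: "'a::euclidean_space \<Rightarrow> real"
  assumes \<Omega>: "open \<Omega>" "bounded \<Omega>" and lip: "lipschitz_boundary \<Omega>" and f: "integrable lborel f" and fin: "tv \<Omega> f < \<infinity>"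
  shows "\<exists>N\<in>null_sets (hausdorff_measure (DIM('a) - 1)). \<forall>x\<in>frontier \<Omega> - N.
     \<exists>t. is_trace \<Omega> f x t"
proof -
  have "\<forall>x\<in>frontier \<Omega>. \<exists>q. cone_in \<Omega> x (fst q) (fst (snd q)) (snd (snd q))"
  proof
    fix x assume "x \<in> frontier \<Omega>"
    then obtain r e c where "cone_in \<Omega> x r e c" using lipschitz_boundary_cone[OF lip] by metis
    then show "\<exists>q. cone_in \<Omega> x (fst q) (fst (snd q)) (snd (snd q))" by (intro exI[of _ "(r, e, c)"]) simp
  qed
  from bchoice[OF this] obtain q where q: "\<forall>x\<in>frontier \<Omega>. cone_in \<Omega> x (fst (q x)) (fst (snd (q x))) (snd (snd (q x)))" ..
  define R where "R x = fst (q x)" for x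
  have cone: "cone_in \<Omega> x (R x) (fst (snd (q x))) (snd (snd (q x)))" if "x \<in> frontier \<Omega>" for x
    using q that by (simp add: R_def)
  have cpt: "compact (frontier \<Omega>)" by (rule compact_frontier_bounded[OF \<Omega>(2)])
  obtain X where X: "X \<subseteq> frontier \<Omega>" "finite X" "frontier \<Omega> \<subseteq> (\<Union>x\<in>X. ball x (R x / 4))"
  proof (rule compactE_image[OF cpt, of "frontier \<Omega>" "\<lambda>x. ball x (R x / 4)"])
    show "frontier \<Omega> \<subseteq> (\<Union>x\<in>frontier \<Omega>. ball x (R x / 4))"
    proof
      fix x assume x: "x \<in> frontier \<Omega>"
      then have "x \<in> ball x (R x / 4)" using cone_inD(4)[OF cone[OF x]] by simp
      then show "x \<in> (\<Union>x\<in>frontier \<Omega>. ball x (R x / 4))" using x by blast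
    qed
  qed auto
  define Bad where "Bad x0 m = {x \<in> frontier \<Omega> \<inter> ball x0 (R x0 / 4).
     \<not> (\<exists>a. \<forall>\<^sub>F r in at_right 0. mean_dev \<Omega> f x a r \<le> 1 / real (Suc m) * r ^ DIM('a))}" for x0 m
  have "\<exists>N\<in>null_sets (hausdorff_measure (DIM('a) - 1)). Bad x0 m \<subseteq> N" if x0: "x0 \<in> X" for x0 m
  proof -
    have x0f: "x0 \<in> frontier \<Omega>" using x0 X by auto
    have "\<exists>p \<rho>. (\<forall>k::nat. 0 \<le> \<rho> k \<and> \<rho> k \<le> \<delta>) \<and> Bad x0 m \<subseteq> (\<Union>k. ball (p k) (\<rho> k)) \<and>
      weight (DIM('a) - 1) \<rho> \<le> ennreal \<delta>" if "\<delta> > 0" for \<delta>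
    proof (rule trace_content[OF cone[OF x0f] \<Omega>(1) f fin _ that])
      show "0 < 1 / real (Suc m)" by simp
      show "x \<in> frontier \<Omega> \<inter> ball x0 (R x0 / 4) \<and>
       \<not> (\<forall>\<^sub>F r in at_right 0. (LBINT y. indicator (\<Omega> \<inter> ball x r) y * \<bar>f y - a\<bar>) \<le> 1 / real (Suc m) * r ^ DIM('a))"
        if "x \<in> Bad x0 m" for x a
        using that unfolding Bad_def mean_dev_def by blast
    qed
    from hausdorff_null_set[OF this] show ?thesis by metis
  qed
  note ex = this
  have "\<forall>z\<in>X \<times> (UNIV :: nat set). \<exists>N. N \<in> null_sets (hausdorff_measure (DIM('a) - 1)) \<and> Bad (fst z) (snd z) \<subseteq> N"
  proof
    fix z assume "z \<in> X \<times> (UNIV :: nat set)"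
    then have "fst z \<in> X" by auto
    from ex[OF this, of "snd z"]
    show "\<exists>N. N \<in> null_sets (hausdorff_measure (DIM('a) - 1)) \<and> Bad (fst z) (snd z) \<subseteq> N" by blast
  qed
  from bchoice[OF this] obtain N where N: "\<forall>z\<in>X \<times> (UNIV :: nat set). N z \<in> null_sets (hausdorff_measure (DIM('a) - 1)) \<and> Bad (fst z) (snd z) \<subseteq> N z" ..
  show ?thesis
  proof (rule bexI[where x="\<Union>z\<in>X \<times> UNIV. N z"], rule ballI)
    have "countable (X \<times> (UNIV :: nat set))" using X(2) by (simp add: countable_finite)
    then show "(\<Union>z\<in>X \<times> UNIV. N z) \<in> null_sets (hausdorff_measure (DIM('a) - 1))"
      using N by (intro null_sets_UN') auto
    fix x assume x: "x \<in> frontier \<Omega> - (\<Union>z\<in>X \<times> UNIV. N z)"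
    then obtain x0 where x0: "x0 \<in> X" "x \<in> ball x0 (R x0 / 4)" using X(3) by blast
    have x0f: "x0 \<in> frontier \<Omega>" using x0 X by auto
    have xf: "x \<in> frontier \<Omega>" using x by simp
    show "\<exists>t. is_trace \<Omega> f x t"
    proof (rule trace_limit[OF cone[OF x0f] \<Omega>(1) xf x0(2) f])
      fix m :: nat
      have "x \<notin> Bad x0 m"
      proof
        assume "x \<in> Bad x0 m"
        moreover have "Bad x0 m \<subseteq> N (x0, m)" using N x0(1) by (metis SigmaI UNIV_I fst_conv snd_conv)
        ultimately have "x \<in> N (x0, m)" by blast
        then show False using x x0(1) by blast
      qed
      then show "\<exists>a. \<forall>\<^sub>F r in at_right 0. mean_dev \<Omega> f x a r \<le> 1 / real (Suc m) * r ^ DIM('a)"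
        using xf x0(2) unfolding Bad_def by blast
    qed
  qed
qed

section \<open>Lebesgue spaces\<close>

lemma L0_eq_iff: "u = v \<longleftrightarrow> (AE x in lebesgue. rep_L0 u x = rep_L0 v x)"
proof -
  have m: "rep_L0 w \<in> borel_measurable lebesgue" for w :: "'a L0"
    using Quotient3_rep_reflp[OF Quotient3_L0, of w] by (simp add: ae_eq_def)
  have "ae_eq (rep_L0 u) (rep_L0 v) \<longleftrightarrow> u = v"
    using Quotient3_rel_rep[OF Quotient3_L0] .
  then show ?thesis using m by (simp add: ae_eq_def)
qed

lemma rep_abs_L0:
  assumes "f \<in> borel_measurable lebesgue"
  shows "AE x in lebesgue. rep_L0 (abs_L0 f) x = f x"
proof -
  have "ae_eq f f" using assms by (simp add: ae_eq_def)
  then have "ae_eq (rep_L0 (abs_L0 f)) f"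
    using rep_abs_rsp_left[OF Quotient3_L0] by metis
  then show ?thesis by (simp add: ae_eq_def)
qed

lemma rep_L0_ops:
  "AE x in lebesgue. rep_L0 (u + v) x = rep_L0 u x + rep_L0 v x"
  "AE x in lebesgue. rep_L0 (u - v) x = rep_L0 u x - rep_L0 v x"
  "AE x in lebesgue. rep_L0 (- u) x = - rep_L0 u x"
  "AE x in lebesgue. rep_L0 (c *\<^sub>R u) x = c * rep_L0 u x"
  "AE x in lebesgue. rep_L0 0 x = 0"
proof -
  have "u + v = abs_L0 (\<lambda>x. rep_L0 u x + rep_L0 v x)"
    unfolding plus_L0_def by simp
  then show "AE x in lebesgue. rep_L0 (u + v) x = rep_L0 u x + rep_L0 v x"
    using rep_abs_L0[of "\<lambda>x. rep_L0 u x + rep_L0 v x"] by simp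
  have "u - v = abs_L0 (\<lambda>x. rep_L0 u x - rep_L0 v x)"
    unfolding minus_L0_def by simp
  then show "AE x in lebesgue. rep_L0 (u - v) x = rep_L0 u x - rep_L0 v x"
    using rep_abs_L0[of "\<lambda>x. rep_L0 u x - rep_L0 v x"] by simp
  have "- u = abs_L0 (\<lambda>x. - rep_L0 u x)"
    unfolding uminus_L0_def by simp
  then show "AE x in lebesgue. rep_L0 (- u) x = - rep_L0 u x"
    using rep_abs_L0[of "\<lambda>x. - rep_L0 u x"] by simp
  have "c *\<^sub>R u = abs_L0 (\<lambda>x. c * rep_L0 u x)"
    unfolding scaleR_L0_def by simp
  then show "AE x in lebesgue. rep_L0 (c *\<^sub>R u) x = c * rep_L0 u x"
    using rep_abs_L0[of "\<lambda>x. c * rep_L0 u x"] by simp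
  show "AE x in lebesgue. rep_L0 0 x = (0::real)"
    using rep_abs_L0[of "\<lambda>x. 0"] by (simp add: zero_L0_def)
qed

lemma AE_lebesgue_lborel: "(AE x in lebesgue. P x) \<longleftrightarrow> (AE x in lborel. P x)"
  by (rule AE_completion_iff)

lemma borel_representative:
  fixes v :: "'a::euclidean_space L0"
  assumes "open \<Omega>" and v: "AE x in lebesgue. x \<notin> \<Omega> \<longrightarrow> rep_L0 v x = 0"
  obtains g where "g \<in> borel_measurable borel" "AE x in lebesgue. rep_L0 v x = g x" "\<And>x. x \<notin> \<Omega> \<Longrightarrow> g x = 0"
proof -
  obtain g' where g'[measurable]: "g' \<in> borel_measurable lborel" and eq: "AE x in lborel. rep_L0 v x = g' x"
    using completion_ex_borel_measurable_real[OF borel_measurable_rep_L0[of v]] by auto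
  have [measurable]: "\<Omega> \<in> sets borel" using assms(1) by auto
  have "(\<lambda>x. indicator \<Omega> x * g' x) \<in> borel_measurable borel" using g' by measurable
  moreover have "AE x in lebesgue. rep_L0 v x = indicator \<Omega> x * g' x"
    using eq[folded AE_lebesgue_lborel] v by eventually_elim (auto simp: indicator_def)
  ultimately show ?thesis by (rule that) simp
qed

section \<open>Norms, Minkowski and Hoelder inequalities on classes\<close>

definition Lint :: "real \<Rightarrow> 'a::euclidean_space L0 \<Rightarrow> real" where
  "Lint p v = (\<integral>x. \<bar>rep_L0 v x\<bar> powr p \<partial>lebesgue)"

lemma Lnorm_Lint: "Lnorm (ereal p) v = Lint p v powr (1 / p)"
  by (simp add: Lnorm_def Lint_def)

lemma Lint_nonneg [simp]: "Lint p v \<ge> 0"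
  by (simp add: Lint_def)

lemma Lnorm_nonneg [simp]: "Lnorm (ereal p) v \<ge> 0"
  by (simp add: Lnorm_Lint)

lemma Lint_Lnorm: "p > 0 \<Longrightarrow> Lint p v = Lnorm (ereal p) v powr p"
  by (simp add: Lnorm_Lint powr_powr)

lemma Lp_finite_iff: "v \<in> Lp \<Omega> (ereal p) \<longleftrightarrow>
   (AE x in lebesgue. x \<notin> \<Omega> \<longrightarrow> rep_L0 v x = 0) \<and> integrable lebesgue (\<lambda>x. \<bar>rep_L0 v x\<bar> powr p)"
  by (simp add: Lp_def)

lemma Lp_1_iff: "v \<in> Lp \<Omega> 1 \<longleftrightarrow>
   (AE x in lebesgue. x \<notin> \<Omega> \<longrightarrow> rep_L0 v x = 0) \<and> integrable lebesgue (rep_L0 v)"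
proof -
  have "integrable lebesgue (\<lambda>x. \<bar>rep_L0 v x\<bar>) \<longleftrightarrow> integrable lebesgue (rep_L0 v)"
    by (rule integrable_abs_iff) measurable
  then show ?thesis using Lp_finite_iff[of v \<Omega> 1] by (simp add: one_ereal_def)
qed

lemma Lnorm_1: "Lnorm 1 v = (\<integral>x. \<bar>rep_L0 v x\<bar> \<partial>lebesgue)"
  by (simp add: Lnorm_def)

lemma powr_add_le:
  assumes "p \<ge> 1" "a \<ge> 0" "b \<ge> 0"
  shows "(a + b) powr p \<le> 2 powr p * (a powr p + b powr (p::real))"
proof -
  have "(a + b) powr p \<le> (2 * max a b) powr p"
    using assms by (intro powr_mono2) auto
  also have "\<dots> = 2 powr p * max a b powr p" using assms by (intro powr_mult)
  also have "max a b powr p \<le> a powr p + b powr p" by (auto simp: max_def)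
  finally show ?thesis by simp
qed

lemma Lp_add:
  assumes "u \<in> Lp \<Omega> (ereal p)" "v \<in> Lp \<Omega> (ereal p)" "p \<ge> 1"
  shows "u + v \<in> Lp \<Omega> (ereal p)"
  unfolding Lp_finite_iff
proof
  have "AE x in lebesgue. x \<notin> \<Omega> \<longrightarrow> rep_L0 u x = 0" "AE x in lebesgue. x \<notin> \<Omega> \<longrightarrow> rep_L0 v x = 0"
    using assms by (simp_all add: Lp_finite_iff)
  with rep_L0_ops(1)[of u v] show "AE x in lebesgue. x \<notin> \<Omega> \<longrightarrow> rep_L0 (u + v) x = 0"
    by eventually_elim auto
  show "integrable lebesgue (\<lambda>x. \<bar>rep_L0 (u + v) x\<bar> powr p)"
  proof (rule Bochner_Integration.integrable_bound)
    show "integrable lebesgue (\<lambda>x. 2 powr p * (\<bar>rep_L0 u x\<bar> powr p + \<bar>rep_L0 v x\<bar> powr p))"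
      using assms by (simp add: Lp_finite_iff)
    show "(\<lambda>x. \<bar>rep_L0 (u + v) x\<bar> powr p) \<in> borel_measurable lebesgue" by measurable
    show "AE x in lebesgue. norm (\<bar>rep_L0 (u + v) x\<bar> powr p) \<le> norm (2 powr p * (\<bar>rep_L0 u x\<bar> powr p + \<bar>rep_L0 v x\<bar> powr p))"
      using rep_L0_ops(1)[of u v]
    proof eventually_elim
      case (elim x)
      have "\<bar>rep_L0 u x + rep_L0 v x\<bar> powr p \<le> (\<bar>rep_L0 u x\<bar> + \<bar>rep_L0 v x\<bar>) powr p"
        using assms(3) by (intro powr_mono2) auto
      also have "\<dots> \<le> 2 powr p * (\<bar>rep_L0 u x\<bar> powr p + \<bar>rep_L0 v x\<bar> powr p)"
        using assms(3) by (intro powr_add_le) auto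
      finally show ?case by (simp add: elim)
    qed
  qed
qed

lemma Lint_scale: "Lint p (c *\<^sub>R v) = \<bar>c\<bar> powr p * Lint p v"
  "v \<in> Lp \<Omega> (ereal p) \<Longrightarrow> c *\<^sub>R v \<in> Lp \<Omega> (ereal p)"
proof -
  have eq: "AE x in lebesgue. \<bar>rep_L0 (c *\<^sub>R v) x\<bar> powr p = \<bar>c\<bar> powr p * \<bar>rep_L0 v x\<bar> powr p"
    using rep_L0_ops(4)[of c v] by eventually_elim (simp add: abs_mult powr_mult)
  have m: "(\<lambda>x. \<bar>rep_L0 (c *\<^sub>R v) x\<bar> powr p) \<in> borel_measurable lebesgue" by measurable
  have m2: "(\<lambda>x. \<bar>c\<bar> powr p * \<bar>rep_L0 v x\<bar> powr p) \<in> borel_measurable lebesgue" by measurable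
  have "Lint p (c *\<^sub>R v) = (\<integral>x. \<bar>c\<bar> powr p * \<bar>rep_L0 v x\<bar> powr p \<partial>lebesgue)"
    unfolding Lint_def by (rule integral_cong_AE[OF m m2 eq])
  then show "Lint p (c *\<^sub>R v) = \<bar>c\<bar> powr p * Lint p v" by (simp add: Lint_def)
  assume v: "v \<in> Lp \<Omega> (ereal p)"
  have "integrable lebesgue (\<lambda>x. \<bar>rep_L0 (c *\<^sub>R v) x\<bar> powr p)"
    using integrable_cong_AE[OF m m2 eq] v by (simp add: Lp_finite_iff)
  moreover have "AE x in lebesgue. x \<notin> \<Omega> \<longrightarrow> rep_L0 v x = 0" using v by (simp add: Lp_finite_iff)
  with rep_L0_ops(4)[of c v] have "AE x in lebesgue. x \<notin> \<Omega> \<longrightarrow> rep_L0 (c *\<^sub>R v) x = 0"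
    by eventually_elim auto
  ultimately show "c *\<^sub>R v \<in> Lp \<Omega> (ereal p)" by (simp add: Lp_finite_iff)
qed

lemma Lp_diff:
  assumes "u \<in> Lp \<Omega> (ereal p)" "v \<in> Lp \<Omega> (ereal p)" "p \<ge> 1"
  shows "u - v \<in> Lp \<Omega> (ereal p)"
  using Lp_add[OF assms(1) Lint_scale(2)[OF assms(2), of "- 1"] assms(3)] by simp

lemma Lnorm_scale: "p > 0 \<Longrightarrow> Lnorm (ereal p) (c *\<^sub>R v) = \<bar>c\<bar> * Lnorm (ereal p) v"
  by (simp add: Lnorm_Lint Lint_scale powr_mult powr_powr)

lemma powr_convex_combination:
  fixes a b l p :: real
  assumes "p \<ge> 1" "a \<ge> 0" "b \<ge> 0" "0 < l" "l < 1"
  shows "(l * a + (1 - l) * b) powr p \<le> l * a powr p + (1 - l) * b powr p"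
proof -
  have ends: "(m * c) powr p \<le> m * c powr p" if "0 < m" "m < 1" "c \<ge> 0" for m c :: real
  proof -
    have "m powr p \<le> m powr 1" using that assms(1) by (intro powr_mono') auto
    then show ?thesis using that by (simp add: powr_mult mult_right_mono)
  qed
  consider "a = 0" | "b = 0" | "a > 0" "b > 0" using assms by linarith
  then show ?thesis
  proof cases
    case 1 then show ?thesis using ends[of "1 - l" b] assms by simp
  next
    case 2 then show ?thesis using ends[of l a] assms by simp
  next
    case 3
    have "((1 - l) * b + l * a) powr p \<le> (1 - l) * b powr p + l * a powr p"
      using convex_onD[OF powr_convex[OF assms(1)], of l b a] 3 assms by simp
    then show ?thesis by (simp add: add.commute)
  qed
qed

text \<open>Convexity of the power, with weights proportional to the two norms and both functions
  normalised. The norms are enlarged by \<open>e / 2\<close> so that the division makes sense when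
  one of them is 0.\<close>

lemma Lnorm_triangle:
  assumes u: "u \<in> Lp \<Omega> (ereal p)" and v: "v \<in> Lp \<Omega> (ereal p)" and p: "p \<ge> 1"
  shows "Lnorm (ereal p) (u + v) \<le> Lnorm (ereal p) u + Lnorm (ereal p) v"
proof (rule field_le_epsilon)
  fix e :: real assume e: "e > 0"
  define a b where "a = Lnorm (ereal p) u + e / 2" and "b = Lnorm (ereal p) v + e / 2"
  have ab: "a > 0" "b > 0" using e by (auto simp: a_def b_def add_nonneg_pos)
  define l where "l = a / (a + b)"
  have l: "0 < l" "l < 1" "1 - l = b / (a + b)" using ab by (auto simp: l_def field_simps)
  have le1: "Lint p w / c powr p \<le> 1" if "c \<ge> Lnorm (ereal p) w" "c > 0" for w :: "'a L0" and c
  proof -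
    have "Lint p w \<le> c powr p" using p that by (simp add: Lint_Lnorm powr_mono2)
    then show ?thesis using that by simp
  qed
  have iu: "integrable lebesgue (\<lambda>x. \<bar>rep_L0 u x\<bar> powr p)" "integrable lebesgue (\<lambda>x. \<bar>rep_L0 v x\<bar> powr p)"
    using u v by (simp_all add: Lp_finite_iff)
  have "Lint p (u + v) \<le> (\<integral>x. (a + b) powr p * (l * (\<bar>rep_L0 u x\<bar> powr p / a powr p) + (1 - l) * (\<bar>rep_L0 v x\<bar> powr p / b powr p)) \<partial>lebesgue)"
    unfolding Lint_def
  proof (rule integral_mono_AE)
    show "integrable lebesgue (\<lambda>x. \<bar>rep_L0 (u + v) x\<bar> powr p)"
      using Lp_add[OF u v p] by (simp add: Lp_finite_iff)
    show "integrable lebesgue (\<lambda>x. (a + b) powr p * (l * (\<bar>rep_L0 u x\<bar> powr p / a powr p) + (1 - l) * (\<bar>rep_L0 v x\<bar> powr p / b powr p)))"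
      using iu by (intro integrable_mult_right Bochner_Integration.integrable_add integrable_divide) auto
    show "AE x in lebesgue. \<bar>rep_L0 (u + v) x\<bar> powr p \<le>
        (a + b) powr p * (l * (\<bar>rep_L0 u x\<bar> powr p / a powr p) + (1 - l) * (\<bar>rep_L0 v x\<bar> powr p / b powr p))"
      using rep_L0_ops(1)[of u v]
    proof eventually_elim
      case (elim x)
      let ?U = "\<bar>rep_L0 u x\<bar>" and ?V = "\<bar>rep_L0 v x\<bar>"
      have "\<bar>rep_L0 (u + v) x\<bar> powr p \<le> (?U + ?V) powr p" unfolding elim using p by (intro powr_mono2) auto
      also have "?U + ?V = (a + b) * (l * (?U / a) + (1 - l) * (?V / b))"
      proof -
        have "(a + b) * l = a" "(a + b) * (1 - l) = b" unfolding l(3) using ab by (simp_all add: l_def)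
        then show ?thesis using ab by (simp add: distrib_left mult.assoc[symmetric])
      qed
      also have "\<dots> powr p = (a + b) powr p * (l * (?U / a) + (1 - l) * (?V / b)) powr p"
        using ab l by (intro powr_mult)
      also have "\<dots> \<le> (a + b) powr p * (l * (?U / a) powr p + (1 - l) * (?V / b) powr p)"
        using ab l p by (intro mult_left_mono powr_convex_combination) auto
      finally show ?case using ab by (simp add: powr_divide)
    qed
  qed
  also have "\<dots> = (a + b) powr p * (l * (Lint p u / a powr p) + (1 - l) * (Lint p v / b powr p))"
    using iu by (simp add: Lint_def)
  also have "\<dots> \<le> (a + b) powr p * (l * 1 + (1 - l) * 1)"
    using l ab e by (intro mult_left_mono add_mono le1) (auto simp: a_def b_def)
  finally have "Lint p (u + v) \<le> (a + b) powr p" by simp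
  then have "Lnorm (ereal p) (u + v) \<le> ((a + b) powr p) powr (1 / p)"
    unfolding Lnorm_Lint using p by (intro powr_mono2) auto
  then show "Lnorm (ereal p) (u + v) \<le> Lnorm (ereal p) u + Lnorm (ereal p) v + e"
    using p ab by (simp add: powr_powr a_def b_def)
qed

lemma Lnorm_eq_0_iff:
  assumes "v \<in> Lp \<Omega> (ereal p)" "p > 0"
  shows "Lnorm (ereal p) v = 0 \<longleftrightarrow> v = 0"
proof
  assume "Lnorm (ereal p) v = 0"
  then have "Lint p v = 0" using assms(2) by (simp add: Lnorm_Lint)
  then have "AE x in lebesgue. \<bar>rep_L0 v x\<bar> powr p = 0"
    unfolding Lint_def using assms(1) by (subst (asm) integral_nonneg_eq_0_iff_AE) (auto simp: Lp_finite_iff)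
  with rep_L0_ops(5) show "v = 0" unfolding L0_eq_iff by eventually_elim simp
next
  assume "v = 0"
  have "AE x in lebesgue. \<bar>rep_L0 (0::'a L0) x\<bar> powr p = 0"
    using rep_L0_ops(5) by eventually_elim (use assms(2) in simp)
  then have "Lint p (0 :: 'a L0) = 0"
    unfolding Lint_def by (simp add: integral_eq_zero_AE)
  then show "Lnorm (ereal p) v = 0" using assms(2) \<open>v = 0\<close> by (simp add: Lnorm_Lint)
qed

lemma Lp_metric:
  assumes p: "p \<ge> 1"
  shows "Metric_space (Lp \<Omega> (ereal p) :: 'a::euclidean_space L0 set) (Ldist (ereal p))"
proof
  fix x y z :: "'a L0"
  show "0 \<le> Ldist (ereal p) x y" by (simp add: Ldist_def)
  have "y - x = (- 1) *\<^sub>R (x - y)" by simp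
  then show "Ldist (ereal p) x y = Ldist (ereal p) y x"
    unfolding Ldist_def using Lnorm_scale[of p "- 1" "x - y"] p by simp
  show "x \<in> Lp \<Omega> (ereal p) \<Longrightarrow> y \<in> Lp \<Omega> (ereal p) \<Longrightarrow> (Ldist (ereal p) x y = 0) = (x = y)"
    unfolding Ldist_def using Lnorm_eq_0_iff[OF Lp_diff[of x \<Omega> p y]] p by simp
  assume "x \<in> Lp \<Omega> (ereal p)" "y \<in> Lp \<Omega> (ereal p)" "z \<in> Lp \<Omega> (ereal p)"
  then have "Lnorm (ereal p) ((x - y) + (y - z)) \<le> Lnorm (ereal p) (x - y) + Lnorm (ereal p) (y - z)"
    using p by (intro Lnorm_triangle Lp_diff)
  then show "Ldist (ereal p) x z \<le> Ldist (ereal p) x y + Ldist (ereal p) y z"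
    by (simp add: Ldist_def)
qed

text \<open>Young's inequality for the functions divided by positive numbers \<open>a\<close> and
  \<open>b\<close> not below their norms; letting these decrease to the norms also covers a norm
  equal to 0.\<close>

lemma pairing_Hoelder:
  assumes w: "w \<in> Lp \<Omega> (ereal p')" and v: "v \<in> Lp \<Omega> (ereal p)" and p: "p > 1" "p' = p / (p - 1)"
  shows "integrable lebesgue (\<lambda>x. rep_L0 w x * rep_L0 v x)"
    "\<bar>pairing w v\<bar> \<le> Lnorm (ereal p') w * Lnorm (ereal p) v"
proof -
  have p': "p' > 1" "1 / p' + 1 / p = 1"
  proof -
    show "p' > 1" unfolding p(2) using p(1) by (simp add: pos_less_divide_eq)
    have "1 / p' = (p - 1) / p" by (simp add: p(2))
    then show "1 / p' + 1 / p = 1" using p(1) by (simp add: diff_divide_distrib)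
  qed
  have iw: "integrable lebesgue (\<lambda>x. \<bar>rep_L0 w x\<bar> powr p')" "integrable lebesgue (\<lambda>x. \<bar>rep_L0 v x\<bar> powr p)"
    using w v by (simp_all add: Lp_finite_iff)
  have key: "integrable lebesgue (\<lambda>x. rep_L0 w x * rep_L0 v x) \<and> \<bar>pairing w v\<bar> \<le> a * b"
    if ab: "a > 0" "b > 0" "a \<ge> Lnorm (ereal p') w" "b \<ge> Lnorm (ereal p) v" for a b
  proof -
    let ?h = "\<lambda>x. a * b * (\<bar>rep_L0 w x\<bar> powr p' / a powr p' / p' + \<bar>rep_L0 v x\<bar> powr p / b powr p / p)"
    have hi: "integrable lebesgue ?h"
      using iw by (intro integrable_mult_right Bochner_Integration.integrable_add integrable_divide) auto
    have le: "\<bar>rep_L0 w x * rep_L0 v x\<bar> \<le> ?h x" for x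
    proof -
      have "(\<bar>rep_L0 w x\<bar> / a) * (\<bar>rep_L0 v x\<bar> / b) \<le> (\<bar>rep_L0 w x\<bar> / a) powr p' / p' + (\<bar>rep_L0 v x\<bar> / b) powr p / p"
        using ab p p' by (intro Youngs_inequality) auto
      then have "a * b * ((\<bar>rep_L0 w x\<bar> / a) * (\<bar>rep_L0 v x\<bar> / b)) \<le> ?h x"
        using ab by (intro mult_left_mono) (auto simp: powr_divide)
      then show ?thesis using ab by (simp add: abs_mult)
    qed
    have i: "integrable lebesgue (\<lambda>x. rep_L0 w x * rep_L0 v x)"
    proof (rule Bochner_Integration.integrable_bound[OF hi])
      show "AE x in lebesgue. norm (rep_L0 w x * rep_L0 v x) \<le> norm (?h x)"
        using le by (intro AE_I2) (metis abs_ge_self order_trans real_norm_def)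
    qed measurable
    have "\<bar>pairing w v\<bar> \<le> (\<integral>x. \<bar>rep_L0 w x * rep_L0 v x\<bar> \<partial>lebesgue)"
      unfolding pairing_def by (rule integral_abs_bound)
    also have "\<dots> \<le> (\<integral>x. ?h x \<partial>lebesgue)" using i hi le by (intro integral_mono) auto
    also have "\<dots> = a * b * (Lint p' w / a powr p' / p' + Lint p v / b powr p / p)"
      using iw by (simp add: Lint_def)
    also have "\<dots> \<le> a * b * (1 / p' + 1 / p)"
    proof (intro mult_left_mono add_mono divide_right_mono)
      show "Lint p' w / a powr p' \<le> 1" "Lint p v / b powr p \<le> 1"
        using ab p p' by (simp_all add: Lint_Lnorm powr_mono2)
    qed (use ab p p' in auto)
    finally show ?thesis using i by (simp add: p')
  qed
  show "integrable lebesgue (\<lambda>x. rep_L0 w x * rep_L0 v x)"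
    using key[of "Lnorm (ereal p') w + 1" "Lnorm (ereal p) v + 1"] by (simp add: add_nonneg_pos)
  let ?A = "Lnorm (ereal p') w" and ?B = "Lnorm (ereal p) v"
  have "((\<lambda>e. (?A + e) * (?B + e)) \<longlongrightarrow> (?A + 0) * (?B + 0)) (at_right 0)"
    by (intro tendsto_intros)
  moreover have "\<forall>\<^sub>F e in at_right 0. \<bar>pairing w v\<bar> \<le> (?A + e) * (?B + e)"
    using key by (intro eventually_at_rightI[of 0 1]) (auto simp: add_nonneg_pos)
  ultimately have "\<bar>pairing w v\<bar> \<le> (?A + 0) * (?B + 0)" by (rule tendsto_lowerbound) simp
  then show "\<bar>pairing w v\<bar> \<le> ?A * ?B" by simp
qed

section \<open>The embedding of the space BV\<close>

text \<open>Negating an admissible field gives an admissible field.\<close>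

lemma tv_abs_le:
  assumes f: "integrable lborel f" and S: "tv U f \<le> ereal S" and \<phi>: "\<phi> \<in> test_fields U" "\<And>x. norm (\<phi> x) \<le> 1"
  shows "\<bar>\<integral>x. f x * divergence \<phi> x \<partial>lborel\<bar> \<le> S"
proof -
  have c: "(\<lambda>x. \<phi> x \<bullet> b) \<in> test_functions U" if "b \<in> Basis" for b using test_fieldsD(1)[OF \<phi>(1) that] .
  have "(\<lambda>x. - \<phi> x) \<in> test_fields U"
    unfolding test_fields_def using test_functions_cmult[OF c, of _ "- 1"] by simp
  moreover have "divergence (\<lambda>x. - \<phi> x) x = - divergence \<phi> x" for x
  proof -
    have "partial b (\<lambda>y. (- \<phi> y) \<bullet> b) x = - partial b (\<lambda>y. \<phi> y \<bullet> b) x" if b: "b \<in> Basis" for b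
    proof -
      have D: "((\<lambda>y. \<phi> y \<bullet> b) has_derivative (\<lambda>h. grad (\<lambda>y. \<phi> y \<bullet> b) x \<bullet> h)) (at x)"
        by (rule has_derivative_grad[OF test_functionsD(2)[OF c[OF b]]])
      have "((\<lambda>y. (- \<phi> y) \<bullet> b) has_derivative (\<lambda>h. - (grad (\<lambda>y. \<phi> y \<bullet> b) x \<bullet> h))) (at x)"
        unfolding inner_minus_left by (rule has_derivative_minus[OF D])
      from partial_eqI[OF this, of b] partial_eqI[OF D, of b] show ?thesis by simp
    qed
    then show ?thesis by (simp add: divergence_def sum_negf)
  qed
  ultimately have "ereal (LBINT x. f x * - divergence \<phi> x) \<le> tv U f"
    using tv_upper[of "\<lambda>x. - \<phi> x" U f] \<phi>(2) by simp
  then have "ereal (LBINT x. f x * - divergence \<phi> x) \<le> ereal S" using S by (rule order_trans)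
  moreover have "ereal (LBINT x. f x * divergence \<phi> x) \<le> ereal S"
    using tv_upper[OF \<phi>, of f] S by (rule order_trans)
  ultimately show ?thesis by simp
qed

lemma tv_linear:
  assumes f: "integrable lborel f" and g: "integrable lborel g"
    and S: "tv U f \<le> ereal S" and T: "tv U g \<le> ereal T"
  shows "tv U (\<lambda>x. a * f x + b * g x) \<le> ereal (\<bar>a\<bar> * S + \<bar>b\<bar> * T)"
  unfolding tv_def
proof (rule SUP_least)
  fix \<phi> assume "\<phi> \<in> {\<phi> \<in> test_fields U. \<forall>x. norm (\<phi> x) \<le> 1}"
  then have \<phi>: "\<phi> \<in> test_fields U" "\<And>x. norm (\<phi> x) \<le> 1" by auto
  let ?I = "\<lambda>f. \<integral>x. f x * divergence \<phi> x \<partial>lborel"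
  note i = integrable_mult_divergence[OF f \<phi>(1)] integrable_mult_divergence[OF g \<phi>(1)]
  have "(LBINT x. (a * f x + b * g x) * divergence \<phi> x) = a * ?I f + b * ?I g"
    using Bochner_Integration.integral_add[OF integrable_mult_right[OF i(1), of a] integrable_mult_right[OF i(2), of b]]
    by (simp add: distrib_right mult.assoc)
  also have "\<dots> \<le> \<bar>a\<bar> * \<bar>?I f\<bar> + \<bar>b\<bar> * \<bar>?I g\<bar>"
    by (intro add_mono) (simp_all flip: abs_mult)
  also have "\<dots> \<le> \<bar>a\<bar> * S + \<bar>b\<bar> * T"
    by (intro add_mono mult_left_mono tv_abs_le[OF f S \<phi>] tv_abs_le[OF g T \<phi>]) auto
  finally show "ereal (LBINT x. (a * f x + b * g x) * divergence \<phi> x) \<le> ereal (\<bar>a\<bar> * S + \<bar>b\<bar> * T)" by simp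
qed

lemma tv_scale:
  assumes f: "integrable lborel f" and c: "c > 0"
  shows "tv U (\<lambda>x. c * f x) = ereal c * tv U f"
proof -
  have "(LBINT x. c * f x * divergence \<phi> x) = c * (LBINT x. f x * divergence \<phi> x)" for \<phi>
    by (simp add: mult.assoc)
  then have "tv U (\<lambda>x. c * f x) = (SUP \<phi> \<in> {\<phi> \<in> test_fields U. \<forall>x. norm (\<phi> x) \<le> 1}.
     ereal c * ereal (LBINT x. f x * divergence \<phi> x))"
    by (simp add: tv_def)
  also have "\<dots> = ereal c * tv U f"
    unfolding tv_def using c zero_test_field[of U]
    by (intro Sup_ereal_mult_left'[symmetric]) auto
  finally show ?thesis .
qed

text \<open>The bridge from classes to functions: Borel measurable, and zero everywhere off \<Omega>
  rather than almost everywhere, as the translation estimates demand.\<close>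

definition L1_rep :: "'a::euclidean_space set \<Rightarrow> 'a L0 \<Rightarrow> ('a \<Rightarrow> real) \<Rightarrow> bool" where
  "L1_rep \<Omega> v g \<longleftrightarrow> integrable lborel g \<and> (AE x in lebesgue. rep_L0 v x = g x) \<and> (\<forall>x. x \<notin> \<Omega> \<longrightarrow> g x = 0)"

lemma L1_repD:
  assumes "L1_rep \<Omega> v g"
  shows "integrable lborel g" "AE x in lebesgue. rep_L0 v x = g x" "x \<notin> \<Omega> \<Longrightarrow> g x = 0" "g \<in> borel_measurable borel"
    "v \<in> Lp \<Omega> 1" "Lnorm 1 v = (LBINT x. \<bar>g x\<bar>)"
proof -
  show i: "integrable lborel g" and e: "AE x in lebesgue. rep_L0 v x = g x" and z: "x \<notin> \<Omega> \<Longrightarrow> g x = 0" for x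
    using assms by (auto simp: L1_rep_def)
  show gm: "g \<in> borel_measurable borel" using i by auto
  then have gb: "g \<in> borel_measurable lborel" by simp
  have gl: "g \<in> borel_measurable lebesgue" by (rule measurable_completion[OF gb])
  have il: "integrable lebesgue g" using i integrable_completion[OF gb] by simp
  have "integrable lebesgue (rep_L0 v)"
    using integrable_cong_AE[OF borel_measurable_rep_L0 gl e] il by simp
  moreover have "AE x in lebesgue. x \<notin> \<Omega> \<longrightarrow> rep_L0 v x = 0"
    using e by eventually_elim (use z in auto)
  ultimately show "v \<in> Lp \<Omega> 1" by (simp add: Lp_1_iff)
  have "Lnorm 1 v = (\<integral>x. \<bar>g x\<bar> \<partial>lebesgue)"
    unfolding Lnorm_1 using e gl by (intro integral_cong_AE) (auto elim: eventually_mono)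
  also have "\<dots> = (LBINT x. \<bar>g x\<bar>)" using gb by (intro integral_completion) auto
  finally show "Lnorm 1 v = (LBINT x. \<bar>g x\<bar>)" .
qed

lemma L1_rep_exists:
  assumes "open \<Omega>" "v \<in> Lp \<Omega> 1"
  obtains g where "L1_rep \<Omega> v g"
proof -
  have v: "AE x in lebesgue. x \<notin> \<Omega> \<longrightarrow> rep_L0 v x = 0" "integrable lebesgue (rep_L0 v)"
    using assms(2) by (auto simp: Lp_1_iff)
  obtain g where g: "g \<in> borel_measurable borel" "AE x in lebesgue. rep_L0 v x = g x" "\<And>x. x \<notin> \<Omega> \<Longrightarrow> g x = 0"
    by (rule borel_representative[OF assms(1) v(1)]) (rule that, assumption+)
  have gb: "g \<in> borel_measurable lborel" using g(1) by simp
  have gl: "g \<in> borel_measurable lebesgue" by (rule measurable_completion[OF gb])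
  have "integrable lebesgue g" using integrable_cong_AE[OF borel_measurable_rep_L0 gl g(2)] v(2) by simp
  then have "integrable lborel g" using integrable_completion[OF gb] by simp
  then show ?thesis using g by (intro that) (auto simp: L1_rep_def)
qed

lemma L1_rep_linear:
  assumes "L1_rep \<Omega> u f" "L1_rep \<Omega> v g"
  shows "L1_rep \<Omega> (a *\<^sub>R u + b *\<^sub>R v) (\<lambda>x. a * f x + b * g x)"
  unfolding L1_rep_def
proof (intro conjI)
  show "integrable lborel (\<lambda>x. a * f x + b * g x)"
    using assms by (auto simp: L1_rep_def)
  show "AE x in lebesgue. rep_L0 (a *\<^sub>R u + b *\<^sub>R v) x = a * f x + b * g x"
    using rep_L0_ops(1)[of "a *\<^sub>R u" "b *\<^sub>R v"] rep_L0_ops(4)[of a u] rep_L0_ops(4)[of b v]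
      L1_repD(2)[OF assms(1)] L1_repD(2)[OF assms(2)]
    by eventually_elim simp
  show "\<forall>x. x \<notin> \<Omega> \<longrightarrow> a * f x + b * g x = 0" using L1_repD(3)[OF assms(1)] L1_repD(3)[OF assms(2)] by simp
qed

lemma L1_rep_scale: "L1_rep \<Omega> v g \<Longrightarrow> L1_rep \<Omega> (c *\<^sub>R v) (\<lambda>x. c * g x)"
  using L1_rep_linear[of \<Omega> v g v g c 0] by simp

lemma total_variation_L1_rep:
  assumes "open \<Omega>" "L1_rep \<Omega> v g"
  shows "total_variation \<Omega> v = tv \<Omega> g"
proof (rule total_variation_eq_tv[OF assms(1) L1_repD(4)[OF assms(2)]])
  show "AE x in lborel. x \<in> \<Omega> \<longrightarrow> rep_L0 v x = g x"
    using L1_repD(2)[OF assms(2)] unfolding AE_lebesgue_lborel by eventually_elim simp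
qed

section \<open>Functions of bounded variation as classes\<close>

definition TV :: "'a::euclidean_space set \<Rightarrow> 'a L0 \<Rightarrow> real" where
  "TV \<Omega> v = real_of_ereal (total_variation \<Omega> v)"

lemma BV_rep:
  assumes "open \<Omega>" "v \<in> BV \<Omega>"
  obtains g where "L1_rep \<Omega> v g" "tv \<Omega> g = ereal (TV \<Omega> v)" "total_variation \<Omega> v = ereal (TV \<Omega> v)"
proof -
  have v: "v \<in> Lp \<Omega> 1" "total_variation \<Omega> v < \<infinity>" using assms(2) by (auto simp: BV_def)
  obtain g where g: "L1_rep \<Omega> v g" by (rule L1_rep_exists[OF assms(1) v(1)])
  have eq: "total_variation \<Omega> v = tv \<Omega> g" by (rule total_variation_L1_rep[OF assms(1) g])
  then have "tv \<Omega> g = ereal (TV \<Omega> v)" using v(2) tv_nonneg[of \<Omega> g] unfolding TV_def by (cases "tv \<Omega> g") auto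
  with g eq show ?thesis by (intro that) auto
qed

lemma TV_nonneg:
  assumes "open \<Omega>" "v \<in> BV \<Omega>"
  shows "TV \<Omega> v \<ge> 0"
proof (rule BV_rep[OF assms])
  fix g assume "tv \<Omega> g = ereal (TV \<Omega> v)"
  then show ?thesis using tv_nonneg[of \<Omega> g] by simp
qed

lemma BV_scale:
  assumes "open \<Omega>" "v \<in> BV \<Omega>" "c > 0"
  shows "c *\<^sub>R v \<in> BV \<Omega>" "total_variation \<Omega> (c *\<^sub>R v) = ereal c * total_variation \<Omega> v"
proof -
  obtain g where g: "L1_rep \<Omega> v g" "tv \<Omega> g = ereal (TV \<Omega> v)" "total_variation \<Omega> v = ereal (TV \<Omega> v)"
    by (rule BV_rep[OF assms(1,2)])
  have cg: "L1_rep \<Omega> (c *\<^sub>R v) (\<lambda>x. c * g x)" by (rule L1_rep_scale[OF g(1)])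
  have eq: "total_variation \<Omega> (c *\<^sub>R v) = ereal c * ereal (TV \<Omega> v)"
    unfolding total_variation_L1_rep[OF assms(1) cg] tv_scale[OF L1_repD(1)[OF g(1)] assms(3)] g(2) ..
  then show "total_variation \<Omega> (c *\<^sub>R v) = ereal c * total_variation \<Omega> v" using g(3) by simp
  show "c *\<^sub>R v \<in> BV \<Omega>" using eq L1_repD(5)[OF cg] by (simp add: BV_def)
qed

lemma BV_diff:
  assumes "open \<Omega>" "u \<in> BV \<Omega>" "v \<in> BV \<Omega>"
  shows "u - v \<in> BV \<Omega>" "TV \<Omega> (u - v) \<le> TV \<Omega> u + TV \<Omega> v" "Lnorm 1 (u - v) \<le> Lnorm 1 u + Lnorm 1 v"
proof -
  obtain f where f: "L1_rep \<Omega> u f" "tv \<Omega> f = ereal (TV \<Omega> u)" by (rule BV_rep[OF assms(1,2)])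
  obtain g where g: "L1_rep \<Omega> v g" "tv \<Omega> g = ereal (TV \<Omega> v)" by (rule BV_rep[OF assms(1,3)])
  have r: "L1_rep \<Omega> (u - v) (\<lambda>x. 1 * f x + (- 1) * g x)" using L1_rep_linear[OF f(1) g(1), of 1 "- 1"] by simp
  have "total_variation \<Omega> (u - v) \<le> ereal (TV \<Omega> u + TV \<Omega> v)"
    unfolding total_variation_L1_rep[OF assms(1) r]
    using tv_linear[OF L1_repD(1)[OF f(1)] L1_repD(1)[OF g(1)], of \<Omega> "TV \<Omega> u" "TV \<Omega> v" 1 "- 1"] f g by simp
  moreover have "0 \<le> total_variation \<Omega> (u - v)" unfolding total_variation_L1_rep[OF assms(1) r] by (rule tv_nonneg)
  ultimately show "u - v \<in> BV \<Omega>" "TV \<Omega> (u - v) \<le> TV \<Omega> u + TV \<Omega> v"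
    using L1_repD(5)[OF r] unfolding BV_def TV_def by (cases "total_variation \<Omega> (u - v)"; auto)+
  have "Lnorm 1 (u - v) = (LBINT x. \<bar>f x - g x\<bar>)" using L1_repD(6)[OF r] by simp
  also have "\<dots> \<le> (LBINT x. \<bar>f x\<bar> + \<bar>g x\<bar>)"
    using L1_repD(1)[OF f(1)] L1_repD(1)[OF g(1)] by (intro integral_mono) auto
  also have "\<dots> = Lnorm 1 u + Lnorm 1 v"
    using L1_repD(1)[OF f(1)] L1_repD(1)[OF g(1)] L1_repD(6)[OF f(1)] L1_repD(6)[OF g(1)] by simp
  finally show "Lnorm 1 (u - v) \<le> Lnorm 1 u + Lnorm 1 v" .
qed

lemma nn_integral_modulus_abs:
  fixes g :: "'a::euclidean_space \<Rightarrow> real"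
  assumes g: "integrable lborel g" and le: "(LBINT y. \<bar>g (y + h) - g y\<bar>) \<le> B"
  shows "(\<integral>\<^sup>+x. ennreal \<bar>\<bar>g (x + h)\<bar> - \<bar>g x\<bar>\<bar> \<partial>lborel) \<le> ennreal B"
proof -
  have gm: "g \<in> borel_measurable borel" using g by auto
  have i: "integrable lborel (\<lambda>y. \<bar>g (y + h) - g y\<bar>)"
    using g integral_lborel_translate(2)[OF gm, of h] by auto
  have "(\<integral>\<^sup>+x. ennreal \<bar>\<bar>g (x + h)\<bar> - \<bar>g x\<bar>\<bar> \<partial>lborel) \<le> (\<integral>\<^sup>+x. ennreal \<bar>g (x + h) - g x\<bar> \<partial>lborel)"
    by (intro nn_integral_mono ennreal_leI abs_triangle_ineq3)
  also have "\<dots> = ennreal (LBINT y. \<bar>g (y + h) - g y\<bar>)"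
    by (intro nn_integral_eq_integral i) auto
  also have "\<dots> \<le> ennreal B" by (rule ennreal_leI[OF le])
  finally show ?thesis .
qed

lemma Lint_L1_rep:
  assumes g: "L1_rep \<Omega> v g" and le: "(\<integral>\<^sup>+x. ennreal (\<bar>g x\<bar> powr q) \<partial>lborel) \<le> ennreal B" and "B \<ge> 0"
  shows "v \<in> Lp \<Omega> (ereal q)" "Lint q v \<le> B"
proof -
  have gb[measurable]: "g \<in> borel_measurable borel" by (rule L1_repD(4)[OF g])
  have qb: "(\<lambda>x. \<bar>g x\<bar> powr q) \<in> borel_measurable lborel" by measurable
  have ql: "(\<lambda>x. \<bar>g x\<bar> powr q) \<in> borel_measurable lebesgue" by (rule measurable_completion[OF qb])
  have i: "integrable lborel (\<lambda>x. \<bar>g x\<bar> powr q)"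
    using qb le_less_trans[OF le ennreal_less_top] by (intro integrableI_nonneg) auto
  have e: "AE x in lebesgue. \<bar>rep_L0 v x\<bar> powr q = \<bar>g x\<bar> powr q"
    using L1_repD(2)[OF g] by eventually_elim simp
  have m: "(\<lambda>x. \<bar>rep_L0 v x\<bar> powr q) \<in> borel_measurable lebesgue" by measurable
  have "integrable lebesgue (\<lambda>x. \<bar>rep_L0 v x\<bar> powr q)"
    using integrable_cong_AE[OF m ql e] integrable_completion[OF qb] i by simp
  moreover have "AE x in lebesgue. x \<notin> \<Omega> \<longrightarrow> rep_L0 v x = 0"
    using L1_repD(2)[OF g] by eventually_elim (use L1_repD(3)[OF g] in auto)
  ultimately show "v \<in> Lp \<Omega> (ereal q)" by (simp add: Lp_finite_iff)
  have "Lint q v = (LBINT x. \<bar>g x\<bar> powr q)"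
    unfolding Lint_def using integral_cong_AE[OF m ql e] integral_completion[OF qb] by simp
  moreover have "ennreal (LBINT x. \<bar>g x\<bar> powr q) \<le> ennreal B"
    using le nn_integral_eq_integral[OF i] by simp
  ultimately show "Lint q v \<le> B" using \<open>B \<ge> 0\<close> by (simp add: ennreal_le_iff)
qed

text \<open>Combines the translation modulus with the Sobolev inequality, applied to the absolute
  value of the representative, which has no larger translation differences.\<close>

theorem sobolev_BV:
  fixes \<Omega> :: "'a::euclidean_space set"
  assumes \<Omega>: "open \<Omega>" "bounded \<Omega>" and lip: "lipschitz_boundary \<Omega>"
  obtains C where "C \<ge> 1"
    "\<And>v. v \<in> BV \<Omega> \<Longrightarrow> DIM('a) = 1 \<Longrightarrow> AE x in lebesgue. \<bar>rep_L0 v x\<bar> \<le> C * (TV \<Omega> v + Lnorm 1 v)"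
    "\<And>v n. v \<in> BV \<Omega> \<Longrightarrow> DIM('a) \<ge> 2 \<Longrightarrow> n = real DIM('a) \<Longrightarrow> v \<in> Lp \<Omega> (ereal (n / (n - 1))) \<and>
       Lint (n / (n - 1)) v \<le> n / (n - 1) * (C * (TV \<Omega> v + Lnorm 1 v)) powr (n / (n - 1))"
proof -
  obtain C h0 where C: "C \<ge> 0" "h0 > 0"
    and mod: "\<And>f T h. \<lbrakk>integrable lborel f; \<And>x. x \<notin> \<Omega> \<Longrightarrow> f x = 0; tv \<Omega> f \<le> ereal T; norm h < h0\<rbrakk> \<Longrightarrow>
      (LBINT y. \<bar>f (y + h) - f y\<bar>) \<le> C * norm h * ((LBINT y. \<bar>f y\<bar>) + T)"
    by (rule translation_modulus[OF \<Omega> lip]) (rule that, assumption, assumption, blast)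
  \<comment> \<open>A constant of at least 1 keeps the bound for functions of norm 1 above 1, so
    that powers of it grow with the exponent.\<close>
  define D where "D = max 1 (sobolev_const TYPE('a) * C)"
  have sc: "sobolev_const TYPE('a) > 0" by (rule sobolev_const_pos)
  have key: "\<exists>g K. L1_rep \<Omega> v g \<and> K \<ge> 0 \<and> sobolev_const TYPE('a) * K \<le> D * (TV \<Omega> v + Lnorm 1 v) \<and>
     (\<forall>h. norm h < h0 \<longrightarrow> (\<integral>\<^sup>+x. ennreal \<bar>\<bar>g (x + h)\<bar> - \<bar>g x\<bar>\<bar> \<partial>lborel) \<le> ennreal (K * norm h))" if v: "v \<in> BV \<Omega>" for v
  proof -
    obtain g where g: "L1_rep \<Omega> v g" "tv \<Omega> g = ereal (TV \<Omega> v)" by (rule BV_rep[OF \<Omega>(1) v])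
    define K where "K = C * (TV \<Omega> v + Lnorm 1 v)"
    have n0: "Lnorm 1 v \<ge> 0" by (simp add: Lnorm_1)
    have s0: "TV \<Omega> v + Lnorm 1 v \<ge> 0" using TV_nonneg[OF \<Omega>(1) v] n0 by simp
    have "K \<ge> 0" unfolding K_def using C s0 by simp
    moreover have "sobolev_const TYPE('a) * K \<le> D * (TV \<Omega> v + Lnorm 1 v)"
      unfolding K_def mult.assoc[symmetric] using s0 by (intro mult_right_mono) (auto simp: D_def)
    moreover have "(\<integral>\<^sup>+x. ennreal \<bar>\<bar>g (x + h)\<bar> - \<bar>g x\<bar>\<bar> \<partial>lborel) \<le> ennreal (K * norm h)" if h: "norm h < h0" for h
    proof (rule nn_integral_modulus_abs[OF L1_repD(1)[OF g(1)]])
      have "(LBINT y. \<bar>g (y + h) - g y\<bar>) \<le> C * norm h * ((LBINT y. \<bar>g y\<bar>) + TV \<Omega> v)"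
        by (rule mod[OF L1_repD(1)[OF g(1)] L1_repD(3)[OF g(1)] _ h]) (simp_all add: g(2))
      then show "(LBINT y. \<bar>g (y + h) - g y\<bar>) \<le> K * norm h"
        by (simp add: K_def L1_repD(6)[OF g(1)] algebra_simps)
    qed
    ultimately show ?thesis using g(1) by blast
  qed
  show ?thesis
  proof (rule that[of D])
    show "D \<ge> 1" by (simp add: D_def)
  next
    fix v assume v: "v \<in> BV \<Omega>" and d: "DIM('a) = 1"
    obtain g K where g: "L1_rep \<Omega> v g" "K \<ge> 0" "sobolev_const TYPE('a) * K \<le> D * (TV \<Omega> v + Lnorm 1 v)"
      "\<And>h. norm h < h0 \<Longrightarrow> (\<integral>\<^sup>+x. ennreal \<bar>\<bar>g (x + h)\<bar> - \<bar>g x\<bar>\<bar> \<partial>lborel) \<le> ennreal (K * norm h)"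
      using key[OF v] by blast
    have "AE x in lborel. \<bar>g x\<bar> \<le> sobolev_const TYPE('a) * K"
      by (rule sobolev_inequality(1)[OF _ _ C(2) g(2) g(4) d]) (use L1_repD(1)[OF g(1)] in auto)
    then have "AE x in lebesgue. \<bar>g x\<bar> \<le> sobolev_const TYPE('a) * K" unfolding AE_lebesgue_lborel .
    with L1_repD(2)[OF g(1)] show "AE x in lebesgue. \<bar>rep_L0 v x\<bar> \<le> D * (TV \<Omega> v + Lnorm 1 v)"
      by eventually_elim (use g(3) in linarith)
  next
    fix v n assume v: "v \<in> BV \<Omega>" and d: "DIM('a) \<ge> 2" and n: "n = real DIM('a)"
    obtain g K where g: "L1_rep \<Omega> v g" "K \<ge> 0" "sobolev_const TYPE('a) * K \<le> D * (TV \<Omega> v + Lnorm 1 v)"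
      "\<And>h. norm h < h0 \<Longrightarrow> (\<integral>\<^sup>+x. ennreal \<bar>\<bar>g (x + h)\<bar> - \<bar>g x\<bar>\<bar> \<partial>lborel) \<le> ennreal (K * norm h)"
      using key[OF v] by blast
    have q: "n / (n - 1) \<ge> 0" using d n by simp
    let ?B = "n / (n - 1) * (D * (TV \<Omega> v + Lnorm 1 v)) powr (n / (n - 1))"
    have "(\<integral>\<^sup>+x. ennreal (\<bar>g x\<bar> powr (n / (n - 1))) \<partial>lborel) \<le>
        ennreal (n / (n - 1) * (sobolev_const TYPE('a) * K) powr (n / (n - 1)))"
      unfolding n by (rule sobolev_inequality(2)[OF _ _ C(2) g(2) g(4) d]) (use L1_repD(1)[OF g(1)] in auto)
    also have "\<dots> \<le> ennreal ?B"
      using q g(2,3) sc by (intro ennreal_leI mult_left_mono powr_mono2) auto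
    finally have le: "(\<integral>\<^sup>+x. ennreal (\<bar>g x\<bar> powr (n / (n - 1))) \<partial>lborel) \<le> ennreal ?B" .
    have "?B \<ge> 0" using q by (intro mult_nonneg_nonneg) auto
    from Lint_L1_rep[OF g(1) le this] show "v \<in> Lp \<Omega> (ereal (n / (n - 1))) \<and> Lint (n / (n - 1)) v \<le> ?B" by blast
  qed
qed

section \<open>Interpolation between exponents\<close>

lemma powr_interpolation:
  fixes t K p q :: real
  assumes "t \<ge> 0" "K > 0" "1 \<le> p" "p \<le> q"
  shows "t powr p \<le> K powr (p - 1) * t + K powr (p - q) * t powr q"
proof (cases "t \<le> K")
  case True
  have "t powr p = t powr (p - 1) * t"
    using assms powr_add[of t "p - 1" 1] by (cases "t = 0") auto
  also have "\<dots> \<le> K powr (p - 1) * t" using assms True by (intro mult_right_mono powr_mono2) auto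
  finally show ?thesis by (simp add: add_increasing2)
next
  case False
  then have "t powr p = t powr (p - q) * t powr q"
    using assms by (simp flip: powr_add)
  also have "\<dots> \<le> K powr (p - q) * t powr q"
    using assms False by (intro mult_right_mono powr_mono2') auto
  finally show ?thesis using assms by (simp add: add_increasing)
qed

lemma Lint_dominated:
  assumes v: "v \<in> Lp \<Omega> 1" and i: "integrable lebesgue h" and le: "AE x in lebesgue. \<bar>rep_L0 v x\<bar> powr p \<le> h x"
  shows "v \<in> Lp \<Omega> (ereal p)" "Lint p v \<le> (\<integral>x. h x \<partial>lebesgue)"
proof -
  have j: "integrable lebesgue (\<lambda>x. \<bar>rep_L0 v x\<bar> powr p)"
    by (rule Bochner_Integration.integrable_bound[OF i]) (use le in \<open>auto elim: eventually_mono\<close>)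
  then show "v \<in> Lp \<Omega> (ereal p)" using v by (simp add: Lp_finite_iff Lp_1_iff)
  show "Lint p v \<le> (\<integral>x. h x \<partial>lebesgue)"
    unfolding Lint_def by (rule integral_mono_AE[OF j i le])
qed

lemma Lint_interpolation:
  assumes v: "v \<in> Lp \<Omega> 1" "v \<in> Lp \<Omega> (ereal q)" and "K > 0" "1 \<le> p" "p \<le> q"
  shows "v \<in> Lp \<Omega> (ereal p)" "Lint p v \<le> K powr (p - 1) * Lnorm 1 v + K powr (p - q) * Lint q v"
proof -
  have i: "integrable lebesgue (\<lambda>x. \<bar>rep_L0 v x\<bar>)" "integrable lebesgue (\<lambda>x. \<bar>rep_L0 v x\<bar> powr q)"
    using v by (auto simp: Lp_1_iff Lp_finite_iff)
  have ii: "integrable lebesgue (\<lambda>x. K powr (p - 1) * \<bar>rep_L0 v x\<bar> + K powr (p - q) * \<bar>rep_L0 v x\<bar> powr q)"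
    using i by auto
  have le: "AE x in lebesgue. \<bar>rep_L0 v x\<bar> powr p \<le> K powr (p - 1) * \<bar>rep_L0 v x\<bar> + K powr (p - q) * \<bar>rep_L0 v x\<bar> powr q"
    using powr_interpolation[OF _ assms(3-5)] by simp
  show "v \<in> Lp \<Omega> (ereal p)" by (rule Lint_dominated(1)[OF v(1) ii le])
  show "Lint p v \<le> K powr (p - 1) * Lnorm 1 v + K powr (p - q) * Lint q v"
    using Lint_dominated(2)[OF v(1) ii le] i unfolding Lnorm_1 Lint_def by simp
qed

lemma Lint_bounded:
  assumes v: "v \<in> Lp \<Omega> 1" and "AE x in lebesgue. \<bar>rep_L0 v x\<bar> \<le> B" and "1 \<le> p"
  shows "v \<in> Lp \<Omega> (ereal p)" "Lint p v \<le> B powr (p - 1) * Lnorm 1 v"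
proof -
  have i: "integrable lebesgue (\<lambda>x. B powr (p - 1) * \<bar>rep_L0 v x\<bar>)"
    using v by (auto simp: Lp_1_iff)
  have le: "AE x in lebesgue. \<bar>rep_L0 v x\<bar> powr p \<le> B powr (p - 1) * \<bar>rep_L0 v x\<bar>"
    using assms(2)
  proof eventually_elim
    case (elim x)
    have "\<bar>rep_L0 v x\<bar> powr p = \<bar>rep_L0 v x\<bar> powr (p - 1) * \<bar>rep_L0 v x\<bar>"
      using powr_add[of "\<bar>rep_L0 v x\<bar>" "p - 1" 1] by (cases "rep_L0 v x = 0") auto
    also have "\<dots> \<le> B powr (p - 1) * \<bar>rep_L0 v x\<bar>"
      using assms(3) elim by (intro mult_right_mono powr_mono2) auto
    finally show ?case .
  qed
  show "v \<in> Lp \<Omega> (ereal p)" by (rule Lint_dominated(1)[OF v(1) i le])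
  show "Lint p v \<le> B powr (p - 1) * Lnorm 1 v"
    using Lint_dominated(2)[OF v(1) i le] unfolding Lnorm_1 by simp
qed

text \<open>Two separate gains. An exponent \<open>q\<close> strictly above \<open>p\<close> makes
  convergence in the first norm imply convergence in the norm of exponent \<open>p\<close> on
  bounded sets of \<open>BV\<close>. A bound on \<open>Lint p v\<close> that is only linear in the
  variation makes the perturbation comparable with the energy; it rests on the upper bound for
  \<open>p\<close>.\<close>

lemma BV_embedding:
  fixes \<Omega> :: "'a::euclidean_space set"
  assumes \<Omega>: "open \<Omega>" "bounded \<Omega>" "lipschitz_boundary \<Omega>" and p: "1 < p" "p \<le> 1 + 1 / real DIM('a)"
  shows "\<exists>q>p. \<exists>C>0. (\<forall>v\<in>BV \<Omega>. v \<in> Lp \<Omega> (ereal q) \<and> Lint q v \<le> (C * (TV \<Omega> v + Lnorm 1 v)) powr q) \<and>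
     (\<forall>v\<in>BV \<Omega>. v \<in> Lp \<Omega> (ereal p)) \<and> (\<forall>v\<in>BV \<Omega>. Lnorm 1 v = 1 \<longrightarrow> Lint p v \<le> C * (TV \<Omega> v + 1))"
proof -
  obtain C where C: "C \<ge> 1"
    and one: "\<And>v. v \<in> BV \<Omega> \<Longrightarrow> DIM('a) = 1 \<Longrightarrow> AE x in lebesgue. \<bar>rep_L0 v x\<bar> \<le> C * (TV \<Omega> v + Lnorm 1 v)"
    and two: "\<And>v n. v \<in> BV \<Omega> \<Longrightarrow> DIM('a) \<ge> 2 \<Longrightarrow> n = real DIM('a) \<Longrightarrow> v \<in> Lp \<Omega> (ereal (n / (n - 1))) \<and>
       Lint (n / (n - 1)) v \<le> n / (n - 1) * (C * (TV \<Omega> v + Lnorm 1 v)) powr (n / (n - 1))"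
    by (rule sobolev_BV[OF \<Omega>]) (rule that, assumption, blast, blast)
  have v1: "v \<in> Lp \<Omega> 1" "TV \<Omega> v \<ge> 0" "Lnorm 1 v \<ge> 0" if "v \<in> BV \<Omega>" for v
    using that TV_nonneg[OF \<Omega>(1) that] by (auto simp: BV_def Lnorm_1)
  show ?thesis
  proof (cases "DIM('a) = 1")
    case True
    have q: "v \<in> Lp \<Omega> (ereal (p + 1)) \<and> Lint (p + 1) v \<le> (C * (TV \<Omega> v + Lnorm 1 v)) powr (p + 1)"
      if v: "v \<in> BV \<Omega>" for v
    proof
      let ?B = "C * (TV \<Omega> v + Lnorm 1 v)"
      have s: "Lnorm 1 v \<le> 1 * (TV \<Omega> v + Lnorm 1 v)" using v1[OF v] by simp
      also have "\<dots> \<le> ?B" using C v1[OF v] by (intro mult_right_mono) auto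
      finally have nB: "Lnorm 1 v \<le> ?B" .
      note L = Lint_bounded[OF v1(1)[OF v] one[OF v True], of "p + 1"]
      show "v \<in> Lp \<Omega> (ereal (p + 1))" using L(1) p by simp
      have "Lint (p + 1) v \<le> ?B powr p * Lnorm 1 v" using L(2) p by simp
      also have "\<dots> \<le> ?B powr p * ?B" by (intro mult_left_mono nB) auto
      also have "\<dots> = ?B powr (p + 1)" using nB v1[OF v] by (simp add: powr_add)
      finally show "Lint (p + 1) v \<le> ?B powr (p + 1)" .
    qed
    have "v \<in> Lp \<Omega> (ereal p)" if v: "v \<in> BV \<Omega>" for v
      using Lint_bounded(1)[OF v1(1)[OF v] one[OF v True], of p] p by simp
    moreover have "Lint p v \<le> C * (TV \<Omega> v + 1)" if v: "v \<in> BV \<Omega>" "Lnorm 1 v = 1" for v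
    proof -
      have B1: "1 * 1 \<le> C * (TV \<Omega> v + 1)" using C v1[OF v(1)] by (intro mult_mono) auto
      have "Lint p v \<le> (C * (TV \<Omega> v + 1)) powr (p - 1)"
        using Lint_bounded(2)[OF v1(1)[OF v(1)] one[OF v(1) True], of p] p v(2) by simp
      also have "\<dots> \<le> (C * (TV \<Omega> v + 1)) powr 1"
        using B1 p True by (intro powr_mono) auto
      finally show ?thesis using B1 by simp
    qed
    ultimately show ?thesis using q C p by (intro exI[of _ "p + 1"] conjI exI[of _ C]) auto
  next
    case False
    define n where "n = real DIM('a)"
    have d: "DIM('a) \<ge> 2" using False DIM_positive[where 'a='a] by linarith
    then have n: "n \<ge> 2" by (simp add: n_def)
    define q where "q = n / (n - 1)"
    have q1: "q \<ge> 1" unfolding q_def using n by simp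
    have "1 / n < 1 / (n - 1)" using n by (intro divide_strict_left_mono) auto
    then have pq: "p < q" using p n unfolding q_def n_def[symmetric] by (simp add: field_simps)
    have qn: "(n - 1) * q = n" using n by (simp add: q_def)
    have L: "v \<in> Lp \<Omega> (ereal q) \<and> Lint q v \<le> q * (C * (TV \<Omega> v + Lnorm 1 v)) powr q" if "v \<in> BV \<Omega>" for v
      using two[OF that d n_def] unfolding q_def .
    \<comment> \<open>The factor \<open>q\<close> is absorbed into the constant, as
      \<open>q \<le> q powr q\<close>.\<close>
    have E: "Lint q v \<le> (q * C * (TV \<Omega> v + Lnorm 1 v)) powr q" if v: "v \<in> BV \<Omega>" for v
    proof -
      have "q = q powr 1" using q1 by simp
      also have "\<dots> \<le> q powr q" using q1 by (intro powr_mono) auto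
      finally have "q * (C * (TV \<Omega> v + Lnorm 1 v)) powr q \<le> q powr q * (C * (TV \<Omega> v + Lnorm 1 v)) powr q"
        by (intro mult_right_mono) auto
      also have "\<dots> = (q * C * (TV \<Omega> v + Lnorm 1 v)) powr q"
        using q1 C v1[OF v] by (simp add: mult.assoc flip: powr_mult)
      finally show ?thesis using L[OF v] by linarith
    qed
    have P: "Lint p v \<le> ((1 + q) * C) * (TV \<Omega> v + 1)" if v: "v \<in> BV \<Omega>" "Lnorm 1 v = 1" for v
    proof -
      define B where "B = C * (TV \<Omega> v + 1)"
      have "1 * 1 \<le> B" unfolding B_def using C v1[OF v(1)] by (intro mult_mono) auto
      then have B: "B \<ge> 1" by simp
      \<comment> \<open>Interpolating at the level \<open>B powr n\<close> balances the two terms: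
        both become \<open>B powr (n * (p - 1))\<close>, which is at most \<open>B\<close> because
        \<open>n * (p - 1) \<le> 1\<close> and \<open>B \<ge> 1\<close>.\<close>
      have e1: "(B powr n) powr (p - 1) = B powr (n * (p - 1))" by (simp add: powr_powr)
      have "(B powr n) powr (p - q) * B powr q = B powr (n * (p - q) + q)" by (simp add: powr_powr powr_add)
      also have "n * (p - q) + q = n * (p - 1)" using qn by (simp add: algebra_simps)
      finally have e2: "(B powr n) powr (p - q) * B powr q = B powr (n * (p - 1))" .
      have "n * (p - 1) \<le> n * (1 / n)" using p(2) n unfolding n_def[symmetric] by (intro mult_left_mono) auto
      then have np: "n * (p - 1) \<le> 1" using n by simp
      have "Lint p v \<le> (B powr n) powr (p - 1) * 1 + (B powr n) powr (p - q) * Lint q v"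
        using Lint_interpolation(2)[OF v1(1)[OF v(1)], of q "B powr n" p] L[OF v(1)] v(2) B p pq by simp
      also have "\<dots> \<le> (B powr n) powr (p - 1) * 1 + (B powr n) powr (p - q) * (q * B powr q)"
        using L[OF v(1)] v(2) unfolding B_def by (intro add_left_mono mult_left_mono) auto
      also have "\<dots> = (1 + q) * B powr (n * (p - 1))" using e1 e2 by (simp add: algebra_simps)
      also have "\<dots> \<le> (1 + q) * B powr 1" using np B q1 by (intro mult_left_mono powr_mono) auto
      finally show ?thesis using B by (simp add: B_def mult.assoc)
    qed
    have M: "v \<in> Lp \<Omega> (ereal p)" if v: "v \<in> BV \<Omega>" for v
      using Lint_interpolation(1)[OF v1(1)[OF v], of q 1 p] L[OF v] p pq by simp
    have mono: "(q * C * (TV \<Omega> v + Lnorm 1 v)) powr q \<le> ((1 + q) * C * (TV \<Omega> v + Lnorm 1 v)) powr q" if v: "v \<in> BV \<Omega>" for v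
      using q1 C v1[OF v] by (intro powr_mono2 mult_right_mono mult_nonneg_nonneg) auto
    have E': "Lint q v \<le> ((1 + q) * C * (TV \<Omega> v + Lnorm 1 v)) powr q" if v: "v \<in> BV \<Omega>" for v
      using E[OF v] mono[OF v] by linarith
    have "(1 + q) * C > 0" using q1 C by simp
    then show ?thesis using L E' P M pq by blast
  qed
qed

section \<open>Scaling and test functions in the total variation energy\<close>

lemma boundary_trace_L1_rep:
  fixes \<Omega> :: "'a::euclidean_space set"
  assumes \<Omega>: "open \<Omega>" and g: "L1_rep \<Omega> v g"
  shows "boundary_trace \<Omega> v x = (THE t. is_trace \<Omega> g x t)"
proof -
  have gb[measurable]: "g \<in> borel_measurable borel" by (rule L1_repD(4)[OF g])
  have "(\<integral>y. \<bar>rep_L0 v y - t\<bar> \<partial>lebesgue_on (\<Omega> \<inter> ball x r)) = mean_dev \<Omega> g x t r" for t r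
  proof -
    have op: "open (\<Omega> \<inter> ball x r)" using \<Omega> by auto
    then have ob[measurable]: "\<Omega> \<inter> ball x r \<in> sets borel" by auto
    have mb: "(\<lambda>y. indicator (\<Omega> \<inter> ball x r) y * \<bar>g y - t\<bar>) \<in> borel_measurable lborel"
      by measurable
    have "\<Omega> \<inter> ball x r \<in> sets lebesgue" using ob by (metis sets_completionI_sets sets_lborel)
    then have "(\<integral>y. \<bar>rep_L0 v y - t\<bar> \<partial>lebesgue_on (\<Omega> \<inter> ball x r)) =
        (\<integral>y. indicator (\<Omega> \<inter> ball x r) y * \<bar>rep_L0 v y - t\<bar> \<partial>lebesgue)"
      by (subst integral_restrict_space) (auto simp: set_lebesgue_integral_def)
    also have "\<dots> = (\<integral>y. indicator (\<Omega> \<inter> ball x r) y * \<bar>g y - t\<bar> \<partial>lebesgue)"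
    proof (rule integral_cong_AE)
      show "(\<lambda>y. indicator (\<Omega> \<inter> ball x r) y * \<bar>rep_L0 v y - t\<bar>) \<in> borel_measurable lebesgue"
        using \<open>\<Omega> \<inter> ball x r \<in> sets lebesgue\<close> by measurable
      show "(\<lambda>y. indicator (\<Omega> \<inter> ball x r) y * \<bar>g y - t\<bar>) \<in> borel_measurable lebesgue"
        by (rule measurable_completion[OF mb])
      show "AE y in lebesgue. indicator (\<Omega> \<inter> ball x r) y * \<bar>rep_L0 v y - t\<bar> = indicator (\<Omega> \<inter> ball x r) y * \<bar>g y - t\<bar>"
        using L1_repD(2)[OF g] by eventually_elim simp
    qed
    also have "\<dots> = mean_dev \<Omega> g x t r"
      unfolding mean_dev_def by (rule integral_completion[OF mb])
    finally show ?thesis .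
  qed
  then show ?thesis by (simp add: boundary_trace_def)
qed

text \<open>Uniqueness on cones turns any limit that has been exhibited into the value of the
  description.\<close>

lemma boundary_trace_eqI:
  fixes \<Omega> :: "'a::euclidean_space set"
  assumes \<Omega>: "open \<Omega>" "lipschitz_boundary \<Omega>" and g: "L1_rep \<Omega> v g" and x: "x \<in> frontier \<Omega>"
    and t: "is_trace \<Omega> g x t"
  shows "boundary_trace \<Omega> v x = t"
  unfolding boundary_trace_L1_rep[OF \<Omega>(1) g]
proof (rule the_equality)
  show "is_trace \<Omega> g x t" by (rule t)
next
  fix s assume s: "is_trace \<Omega> g x s"
  obtain r e c where c: "cone_in \<Omega> x r e c" by (rule lipschitz_boundary_cone[OF \<Omega>(2) x])
  have "x \<in> ball x (r / 4)" using cone_inD(4)[OF c] by simp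
  from trace_unique[OF c \<Omega>(1) x this L1_repD(1)[OF g] s t] show "s = t" .
qed

lemma mean_dev_scale: "mean_dev \<Omega> (\<lambda>y. c * g y) x (c * t) r = \<bar>c\<bar> * mean_dev \<Omega> g x t r"
proof -
  have "\<bar>c * g y - c * t\<bar> = \<bar>c\<bar> * \<bar>g y - t\<bar>" for y
    by (metis abs_mult right_diff_distrib)
  then show ?thesis unfolding mean_dev_def by (simp add: mult.left_commute)
qed

lemma nn_integral_cmult_le:
  assumes "0 < c" "c < \<infinity>"
  shows "c * (\<integral>\<^sup>+x. f x \<partial>M) \<le> (\<integral>\<^sup>+x. c * f x \<partial>M)"
proof -
  have "c * (\<integral>\<^sup>+x. f x \<partial>M) = (SUP g \<in> {g. simple_function M g \<and> g \<le> f}. c * integral\<^sup>S M g)"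
    unfolding nn_integral_def
    by (subst SUP_mult_left_ennreal) simp_all
  also have "\<dots> \<le> (\<integral>\<^sup>+x. c * f x \<partial>M)"
  proof (rule SUP_least)
    fix g assume "g \<in> {g. simple_function M g \<and> g \<le> f}"
    then have g: "simple_function M g" "g \<le> f" by auto
    have "c * integral\<^sup>S M g = integral\<^sup>S M (\<lambda>x. c * g x)"
      by (rule simple_integral_mult[OF g(1), symmetric])
    also have "\<dots> \<le> (\<integral>\<^sup>+x. c * f x \<partial>M)"
      unfolding nn_integral_def using g
      by (intro SUP_upper) (auto simp: le_fun_def intro: mult_left_mono)
    finally show "c * integral\<^sup>S M g \<le> (\<integral>\<^sup>+x. c * f x \<partial>M)" .
  qed
  finally show ?thesis .
qed

text \<open>No measurability of the integrand is needed, and none is known for the trace.\<close>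

lemma nn_integral_cmult_any:
  assumes c: "c > 0"
  shows "(\<integral>\<^sup>+x. ennreal c * f x \<partial>M) = ennreal c * (\<integral>\<^sup>+x. f x \<partial>M)"
proof (rule antisym)
  have k: "ennreal (1 / c) * (ennreal c * y) = y" "ennreal c * (ennreal (1 / c) * y) = y" for y
    using c by (simp_all flip: mult.assoc ennreal_mult)
  have "ennreal (1 / c) * (\<integral>\<^sup>+x. ennreal c * f x \<partial>M) \<le> (\<integral>\<^sup>+x. f x \<partial>M)"
    using nn_integral_cmult_le[of "ennreal (1 / c)" M "\<lambda>x. ennreal c * f x"] c by (simp add: k)
  from mult_left_mono[OF this, of "ennreal c"]
  show "(\<integral>\<^sup>+x. ennreal c * f x \<partial>M) \<le> ennreal c * (\<integral>\<^sup>+x. f x \<partial>M)" by (simp add: k)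
  show "ennreal c * (\<integral>\<^sup>+x. f x \<partial>M) \<le> (\<integral>\<^sup>+x. ennreal c * f x \<partial>M)"
    using c by (intro nn_integral_cmult_le) auto
qed

section \<open>Homogeneity of the energy\<close>

abbreviation trace_integral :: "'a::euclidean_space set \<Rightarrow> 'a L0 \<Rightarrow> ennreal" where
  "trace_integral \<Omega> v \<equiv> \<integral>\<^sup>+x\<in>frontier \<Omega>. ennreal \<bar>boundary_trace \<Omega> v x\<bar> \<partial>hausdorff_measure (DIM('a) - 1)"

text \<open>Where no limit exists the description is arbitrary and need not scale; almost everywhere
  existence confines this to a null set.\<close>

lemma trace_integral_scale:
  fixes \<Omega> :: "'a::euclidean_space set"
  assumes \<Omega>: "open \<Omega>" "bounded \<Omega>" "lipschitz_boundary \<Omega>" and v: "v \<in> BV \<Omega>" and c: "c > 0"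
  shows "trace_integral \<Omega> (c *\<^sub>R v) = ennreal c * trace_integral \<Omega> v"
proof -
  obtain g where g: "L1_rep \<Omega> v g" "tv \<Omega> g = ereal (TV \<Omega> v)" by (rule BV_rep[OF \<Omega>(1) v])
  have "tv \<Omega> g < \<infinity>" using g(2) by simp
  from trace_exists[OF \<Omega> L1_repD(1)[OF g(1)] this]
  obtain N where N: "N \<in> null_sets (hausdorff_measure (DIM('a) - 1))"
    and ex: "\<And>x. x \<in> frontier \<Omega> - N \<Longrightarrow> \<exists>t. is_trace \<Omega> g x t"
    by blast
  have cg: "L1_rep \<Omega> (c *\<^sub>R v) (\<lambda>x. c * g x)" by (rule L1_rep_scale[OF g(1)])
  have eq: "boundary_trace \<Omega> (c *\<^sub>R v) x = c * boundary_trace \<Omega> v x" if x: "x \<in> frontier \<Omega> - N" for x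
  proof -
    have xf: "x \<in> frontier \<Omega>" using x by simp
    obtain t where t: "is_trace \<Omega> g x t" using ex[OF x] by blast
    have "is_trace \<Omega> (\<lambda>y. c * g y) x (c * t)"
      using tendsto_mult[OF tendsto_const[of "\<bar>c\<bar>"] t] by (simp add: mean_dev_scale)
    from boundary_trace_eqI[OF \<Omega>(1,3) cg xf this] boundary_trace_eqI[OF \<Omega>(1,3) g(1) xf t]
    show ?thesis by simp
  qed
  have "trace_integral \<Omega> (c *\<^sub>R v) =
     (\<integral>\<^sup>+x. ennreal c * (ennreal \<bar>boundary_trace \<Omega> v x\<bar> * indicator (frontier \<Omega>) x) \<partial>hausdorff_measure (DIM('a) - 1))"
  proof (rule nn_integral_cong_AE, rule AE_I'[OF N], safe)
    fix x assume "ennreal \<bar>boundary_trace \<Omega> (c *\<^sub>R v) x\<bar> * indicator (frontier \<Omega>) x \<noteq>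
       ennreal c * (ennreal \<bar>boundary_trace \<Omega> v x\<bar> * indicator (frontier \<Omega>) x)"
    moreover have "ennreal \<bar>boundary_trace \<Omega> (c *\<^sub>R v) x\<bar> = ennreal c * ennreal \<bar>boundary_trace \<Omega> v x\<bar>"
      if "x \<in> frontier \<Omega>" "x \<notin> N"
      using eq[of x] that c by (simp add: abs_mult ennreal_mult)
    ultimately show "x \<in> N" by (auto split: split_indicator_asm)
  qed
  then show ?thesis by (simp add: nn_integral_cmult_any[OF c])
qed

lemma E_TV_scale:
  assumes \<Omega>: "open \<Omega>" "bounded \<Omega>" "lipschitz_boundary \<Omega>" and c: "c > 0"
  shows "E_TV \<Omega> (c *\<^sub>R v) = ereal c * E_TV \<Omega> v"
proof (cases "v \<in> BV \<Omega>")
  case True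
  have "enn2ereal (ennreal c * y) = ereal c * enn2ereal y" for y
    using c by (simp add: times_ennreal.rep_eq)
  moreover have "0 \<le> total_variation \<Omega> v"
    using True TV_nonneg[OF \<Omega>(1) True] by (metis BV_rep[OF \<Omega>(1) True] ereal_less_eq(5))
  ultimately show ?thesis
    using True BV_scale[OF \<Omega>(1) True c] c
    by (simp add: E_TV_def trace_integral_scale[OF \<Omega> True c] ereal_pos_distrib del: One_nat_def)
next
  case False
  \<comment> \<open>Scaling back by \<open>1 / c\<close> would put \<open>v\<close> itself into
    \<open>BV \<Omega>\<close>, so both sides are infinite.\<close>
  have "c *\<^sub>R v \<notin> BV \<Omega>"
  proof
    assume "c *\<^sub>R v \<in> BV \<Omega>"
    from BV_scale(1)[OF \<Omega>(1) this, of "1 / c"] False c show False by simp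
  qed
  with False c show ?thesis by (simp add: E_TV_def)
qed

lemma E_TV_ge:
  assumes \<Omega>: "open \<Omega>" and v: "v \<in> BV \<Omega>"
  shows "ereal (TV \<Omega> v) \<le> E_TV \<Omega> v"
proof -
  have "total_variation \<Omega> v = ereal (TV \<Omega> v)" by (rule BV_rep[OF \<Omega> v])
  then show ?thesis using v by (simp add: E_TV_def ereal_le_add_self)
qed

lemma E_TV_nonneg: "open \<Omega> \<Longrightarrow> 0 \<le> E_TV \<Omega> v"
  using E_TV_ge[of \<Omega> v] TV_nonneg[of \<Omega> v] by (cases "v \<in> BV \<Omega>") (auto simp: E_TV_def intro: order_trans[rotated])

section \<open>Products and integration by parts for test functions\<close>

lemma C_k_Suc_imp: "C_k (Suc k) f \<Longrightarrow> C_k k f"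
proof (induction k arbitrary: f)
  case 0
  then show ?case by (auto intro!: continuous_at_imp_continuous_on differentiable_imp_continuous_within)
next
  case (Suc k)
  then show ?case using C_k.simps(2) by metis
qed

lemma partial_grad: "f differentiable (at x) \<Longrightarrow> partial b f x = grad f x \<bullet> b"
  by (intro partial_eqI has_derivative_grad)

lemma partial_mult:
  assumes "f differentiable (at x)" "g differentiable (at x)"
  shows "partial b (\<lambda>x. f x * g x) x = f x * partial b g x + partial b f x * g x"
  using partial_eqI[OF has_derivative_mult[OF has_derivative_grad[OF assms(1)] has_derivative_grad[OF assms(2)]], of b]
    partial_grad[OF assms(1), of b] partial_grad[OF assms(2), of b] by simp

lemma C_k_mult:
  assumes "C_k k f" "C_k k g"
  shows "C_k k (\<lambda>x. f x * g x)"
  using assms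
proof (induction k arbitrary: f g)
  case 0
  then show ?case by (auto intro!: continuous_intros)
next
  case (Suc k)
  note fg = C_k_Suc_imp[OF Suc.prems(1)] C_k_Suc_imp[OF Suc.prems(2)]
  have d: "f differentiable (at x)" "g differentiable (at x)" for x using Suc.prems by auto
  have "C_k k (partial b (\<lambda>x. f x * g x))" if b: "b \<in> Basis" for b
  proof -
    have "C_k k (partial b f)" "C_k k (partial b g)" using Suc.prems b by auto
    then have "C_k k (\<lambda>x. f x * partial b g x + partial b f x * g x)"
      using fg Suc.IH by (intro C_k_add) auto
    moreover have "partial b (\<lambda>x. f x * g x) = (\<lambda>x. f x * partial b g x + partial b f x * g x)"
      using partial_mult[OF d] by blast
    ultimately show ?thesis by simp
  qed
  moreover have "(\<lambda>x. f x * g x) differentiable (at x)" for x using d by (intro differentiable_mult) auto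
  ultimately show ?case by simp
qed

lemma test_functions_mult:
  assumes f: "f \<in> test_functions U" and g: "g \<in> test_functions V"
  shows "(\<lambda>x. f x * g x) \<in> test_functions U"
proof -
  have "{x. f x * g x \<noteq> 0} \<subseteq> {x. f x \<noteq> 0}" by auto
  then have "closure {x. f x * g x \<noteq> 0} \<subseteq> closure {x. f x \<noteq> 0}" by (rule closure_mono)
  moreover from this have "compact (closure {x. f x * g x \<noteq> 0})"
    using test_functionsD(5)[OF f] by (meson bounded_subset compact_eq_bounded_closed closed_closure)
  ultimately show ?thesis
    using test_functionsD(6)[OF f] C_k_mult[OF test_functionsD(1)[OF f] test_functionsD(1)[OF g]]
    by (auto simp: test_functions_def)
qed

lemma partial_outside_support:
  assumes \<psi>: "\<psi> \<in> test_functions U" and x: "x \<notin> closure {x. \<psi> x \<noteq> 0}"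
  shows "partial b \<psi> x = 0"
proof -
  have op: "open (- closure {x. \<psi> x \<noteq> 0})" by (rule open_Compl[OF closed_closure])
  have eq: "0 = \<psi> y" if "y \<in> - closure {x. \<psi> x \<noteq> 0}" for y
    by (rule test_functionsD(8)[OF \<psi>, symmetric]) (use that in \<open>rule ComplD\<close>)
  have "x \<in> - closure {x. \<psi> x \<noteq> 0}" using x by simp
  from has_derivative_transform_within_open[OF has_derivative_const op this eq]
  have "(\<psi> has_derivative (\<lambda>_. 0)) (at x)" .
  then show ?thesis by (rule partial_eqI)
qed

lemma integrable_continuous_compact_support:
  fixes g :: "'a::euclidean_space \<Rightarrow> 'b::euclidean_space"
  assumes g: "continuous_on UNIV g" and K: "compact K" "\<And>x. x \<notin> K \<Longrightarrow> g x = 0"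
  shows "integrable lborel g"
proof -
  have "integrable lborel (\<lambda>x. indicator K x *\<^sub>R g x)"
    by (rule borel_integrable_compact[OF K(1)]) (rule continuous_on_subset[OF g subset_UNIV])
  also have "(\<lambda>x. indicator K x *\<^sub>R g x) = g"
    using K(2) by (intro ext) (auto simp: indicator_def)
  finally show ?thesis .
qed

lemma integrable_test_function:
  assumes "\<psi> \<in> test_functions U"
  shows "integrable lborel \<psi>" "integrable lborel (partial b \<psi>)" "integrable lborel (grad \<psi>)"
proof -
  show "integrable lborel \<psi>"
    by (rule integrable_continuous_compact_support[OF test_functionsD(3,5)[OF assms]]) (rule test_functionsD(8)[OF assms])
  show p: "integrable lborel (partial b \<psi>)" for b
    by (rule integrable_continuous_compact_support[OF test_functionsD(4,5)[OF assms]]) (rule partial_outside_support[OF assms])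
  show "integrable lborel (grad \<psi>)"
    unfolding grad_def by (intro Bochner_Integration.integrable_sum integrable_scaleR_left p)
qed

lemma integrable_test_function_mult:
  fixes h :: "'a::euclidean_space \<Rightarrow> real"
  assumes f: "f \<in> test_functions U" and h: "continuous_on UNIV h"
  shows "integrable lborel (\<lambda>x. f x * h x)" "integrable lborel (\<lambda>x. partial b f x * h x)"
proof -
  note K = test_functionsD(5)[OF f]
  show "integrable lborel (\<lambda>x. f x * h x)"
  proof (rule integrable_continuous_compact_support[OF _ K])
    show "continuous_on UNIV (\<lambda>x. f x * h x)" by (intro continuous_intros test_functionsD(3)[OF f] h)
    fix x assume "x \<notin> closure {x. f x \<noteq> 0}"
    then have "f x = 0" by (rule test_functionsD(8)[OF f])
    then show "f x * h x = 0" by simp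
  qed
  show "integrable lborel (\<lambda>x. partial b f x * h x)"
  proof (rule integrable_continuous_compact_support[OF _ K])
    show "continuous_on UNIV (\<lambda>x. partial b f x * h x)" by (intro continuous_on_mult test_functionsD(4)[OF f] h)
    fix x assume "x \<notin> closure {x. f x \<noteq> 0}"
    then have "partial b f x = 0" by (rule partial_outside_support[OF f])
    then show "partial b f x * h x = 0" by simp
  qed
qed

text \<open>The translation formula is applied to the indicator of a ball containing the supports of
  all translates by at most one unit along \<open>b\<close>, so that the indicator acts as the
  constant 1. Its left side vanishes by translation invariance, and every time on its right side
  contributes the same integral.\<close>

lemma integral_partial_test_function:
  fixes \<psi> :: "'a::euclidean_space \<Rightarrow> real"
  assumes \<psi>: "\<psi> \<in> test_functions U" and b: "b \<in> Basis"
  shows "(LBINT x. partial b \<psi> x) = 0"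
proof -
  obtain R where R: "\<And>x. x \<in> closure {x. \<psi> x \<noteq> 0} \<Longrightarrow> norm x < R"
    using compact_imp_bounded[OF test_functionsD(5)[OF \<psi>]] unfolding bounded_iff
    by (metis gt_ex order_le_less_trans)
  let ?F = "indicator (ball 0 (R + 1)) :: 'a \<Rightarrow> real"
  have F: "integrable lborel ?F"
    using emeasure_bounded_finite[OF bounded_ball, of "0::'a" "R + 1"] by (intro integrable_real_indicator) auto
  have in1: "norm y < R + 1" if "y - s *\<^sub>R b \<in> closure {x. \<psi> x \<noteq> 0}" "0 \<le> s" "s \<le> 1" for y s
  proof -
    have "norm y \<le> norm (y - s *\<^sub>R b) + norm (s *\<^sub>R b)"
      using norm_triangle_ineq[of "y - s *\<^sub>R b" "s *\<^sub>R b"] by simp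
    with R[OF that(1)] that(2,3) b show ?thesis by simp
  qed
  have pm: "partial b \<psi> \<in> borel_measurable borel" "\<psi> \<in> borel_measurable borel"
    using test_functionsD(3,4)[OF \<psi>] by (auto intro: borel_measurable_continuous_onI)
  have e1: "?F y * (\<psi> (y - b) - \<psi> y) = \<psi> (y - b) - \<psi> y" for y
  proof (cases "norm y < R + 1")
    case False
    then have "y - 1 *\<^sub>R b \<notin> closure {x. \<psi> x \<noteq> 0}" "y - 0 *\<^sub>R b \<notin> closure {x. \<psi> x \<noteq> 0}"
      using in1[of y 1] in1[of y 0] by auto
    then show ?thesis using test_functionsD(8)[OF \<psi>, of "y - b"] test_functionsD(8)[OF \<psi>, of y] by simp
  qed simp
  have e2: "?F y * - (grad \<psi> (y - t *\<^sub>R b) \<bullet> b) = - partial b \<psi> (y - t *\<^sub>R b)" if t: "0 \<le> t" "t \<le> 1" for y t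
  proof (cases "norm y < R + 1")
    case False
    then have "y - t *\<^sub>R b \<notin> closure {x. \<psi> x \<noteq> 0}" using in1[of y t] t by auto
    from partial_outside_support[OF \<psi> this, of b]
    show ?thesis using False by simp
  qed (simp add: partial_grad[OF test_functionsD(2)[OF \<psi>]])
  have tr: "(LBINT y. partial b \<psi> (y - t *\<^sub>R b)) = (LBINT y. partial b \<psi> y)" for t
    using integral_lborel_translate(1)[OF pm(1), of "- t *\<^sub>R b"] by simp
  have "(LBINT y. \<psi> (y - b) - \<psi> y) =
     (LBINT t. indicator {0..1} t * (LBINT y. ?F y * - (grad \<psi> (y - t *\<^sub>R b) \<bullet> b)))"
    using integral_translate_difference[OF F \<psi>, of b] unfolding e1 .
  also have "\<dots> = (LBINT t. indicator {0..1::real} t * - (LBINT y. partial b \<psi> y))"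
  proof (intro Bochner_Integration.integral_cong refl)
    fix t :: real
    show "indicator {0..1} t * (LBINT y. ?F y * - (grad \<psi> (y - t *\<^sub>R b) \<bullet> b)) =
       indicator {0..1} t * - (LBINT y. partial b \<psi> y)"
    proof (cases "0 \<le> t \<and> t \<le> 1")
      case True
      then have "(LBINT y. ?F y * - (grad \<psi> (y - t *\<^sub>R b) \<bullet> b)) = (LBINT y. - partial b \<psi> (y - t *\<^sub>R b))"
        using e2 by simp
      then show ?thesis using tr[of t] by simp
    qed simp
  qed
  also have "\<dots> = - (LBINT y. partial b \<psi> y)" by simp
  finally have "(LBINT y. \<psi> (y - b) - \<psi> y) = - (LBINT y. partial b \<psi> y)" .
  moreover have "(LBINT y. \<psi> (y - b) - \<psi> y) = 0"
    using integral_lborel_translate[OF pm(2), of "- b"] integrable_test_function(1)[OF \<psi>] by simp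
  ultimately show ?thesis by simp
qed

lemma integration_by_parts:
  assumes f: "f \<in> test_functions U" and \<psi>: "\<psi> \<in> test_functions V" and b: "b \<in> Basis"
  shows "(LBINT x. f x * partial b \<psi> x) = - (LBINT x. partial b f x * \<psi> x)"
proof -
  have eq: "partial b (\<lambda>x. f x * \<psi> x) = (\<lambda>x. f x * partial b \<psi> x + partial b f x * \<psi> x)"
    using partial_mult[OF test_functionsD(2)[OF f] test_functionsD(2)[OF \<psi>]] by blast
  note i = integrable_test_function_mult(1)[OF f test_functionsD(4)[OF \<psi>], of b]
    integrable_test_function_mult(2)[OF f test_functionsD(3)[OF \<psi>], of b]
  have "(LBINT x. f x * partial b \<psi> x + partial b f x * \<psi> x) = 0"
    using integral_partial_test_function[OF test_functions_mult[OF f \<psi>] b] unfolding eq .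
  then show ?thesis using i by simp
qed

lemma integral_divergence_test_function:
  fixes f :: "'a::euclidean_space \<Rightarrow> real"
  assumes f: "f \<in> test_functions U" and \<phi>: "\<phi> \<in> test_fields V" "\<And>x. norm (\<phi> x) \<le> 1"
  shows "(LBINT x. f x * divergence \<phi> x) \<le> (LBINT x. norm (grad f x))"
proof -
  have c: "(\<lambda>x. \<phi> x \<bullet> b) \<in> test_functions V" if "b \<in> Basis" for b using test_fieldsD(1)[OF \<phi>(1) that] .
  have i: "integrable lborel (\<lambda>x. f x * partial b (\<lambda>x. \<phi> x \<bullet> b) x)"
      "integrable lborel (\<lambda>x. partial b f x * (\<phi> x \<bullet> b))" if b: "b \<in> Basis" for b
    using integrable_test_function_mult(1)[OF f test_functionsD(4)[OF c[OF b]], of b]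
      integrable_test_function_mult(2)[OF f test_functionsD(3)[OF c[OF b]], of b] .
  have "(LBINT x. f x * divergence \<phi> x) = (\<Sum>b\<in>Basis. \<integral>x. f x * partial b (\<lambda>x. \<phi> x \<bullet> b) x \<partial>lborel)"
    unfolding divergence_def sum_distrib_left using i(1) by (intro Bochner_Integration.integral_sum) auto
  also have "\<dots> = (\<Sum>b\<in>Basis. - (LBINT x. partial b f x * (\<phi> x \<bullet> b)))"
    by (intro sum.cong refl integration_by_parts[OF f c])
  also have "\<dots> = - (LBINT x. (\<Sum>b\<in>Basis. partial b f x * (\<phi> x \<bullet> b)))"
    using i(2) by (simp add: sum_negf)
  also have g: "(\<lambda>x. \<Sum>b\<in>Basis. partial b f x * (\<phi> x \<bullet> b)) = (\<lambda>x. grad f x \<bullet> \<phi> x)"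
  proof
    fix x show "(\<Sum>b\<in>Basis. partial b f x * (\<phi> x \<bullet> b)) = grad f x \<bullet> \<phi> x"
      unfolding grad_def inner_sum_left inner_scaleR_left by (simp add: inner_commute)
  qed
  finally have eq: "(LBINT x. f x * divergence \<phi> x) = (LBINT x. - (grad f x \<bullet> \<phi> x))" by simp
  also have "\<dots> \<le> (LBINT x. norm (grad f x))"
  proof (rule integral_mono)
    have "integrable lborel (\<lambda>x. grad f x \<bullet> \<phi> x)"
      unfolding g[symmetric] by (intro Bochner_Integration.integrable_sum i(2))
    then show "integrable lborel (\<lambda>x. - (grad f x \<bullet> \<phi> x))" by simp
    show "integrable lborel (\<lambda>x. norm (grad f x))" using integrable_test_function(3)[OF f] by auto
    fix x
    have "- (grad f x \<bullet> \<phi> x) \<le> norm (grad f x) * norm (\<phi> x)" using Cauchy_Schwarz_ineq2[of "grad f x" "\<phi> x"] by linarith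
    also have "\<dots> \<le> norm (grad f x) * 1" by (intro mult_left_mono \<phi>(2)) auto
    finally show "- (grad f x \<bullet> \<phi> x) \<le> norm (grad f x)" by simp
  qed
  finally show ?thesis .
qed

lemma tv_test_function: "f \<in> test_functions U \<Longrightarrow> tv V f \<le> ereal (LBINT x. norm (grad f x))"
  unfolding tv_def by (intro SUP_least) (auto intro: integral_divergence_test_function)

lemma L1_rep_abs_L0:
  fixes f :: "'a::euclidean_space \<Rightarrow> real"
  assumes "integrable lborel f" "\<And>x. x \<notin> \<Omega> \<Longrightarrow> f x = 0"
  shows "L1_rep \<Omega> (abs_L0 f) f"
proof -
  have "f \<in> borel_measurable lebesgue" using assms(1) by (intro measurable_completion) auto
  from rep_abs_L0[OF this] assms show ?thesis by (simp add: L1_rep_def)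
qed

text \<open>Close to the frontier the function vanishes identically, so its trace is 0 and only the
  interior variation remains.\<close>

lemma E_TV_test_function:
  fixes f :: "'a::euclidean_space \<Rightarrow> real"
  assumes \<Omega>: "open \<Omega>" "lipschitz_boundary \<Omega>" and f: "f \<in> test_functions \<Omega>"
  shows "L1_rep \<Omega> (abs_L0 f) f" "abs_L0 f \<in> BV \<Omega>" "E_TV \<Omega> (abs_L0 f) = tv \<Omega> f"
proof -
  show g: "L1_rep \<Omega> (abs_L0 f) f"
    by (rule L1_rep_abs_L0[OF integrable_test_function(1)[OF f] test_functionsD(7)[OF f]])
  have tv: "total_variation \<Omega> (abs_L0 f) = tv \<Omega> f" by (rule total_variation_L1_rep[OF \<Omega>(1) g])
  have "tv \<Omega> f < \<infinity>" using tv_test_function[OF f, of \<Omega>] by (cases "tv \<Omega> f") auto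
  then show bv: "abs_L0 f \<in> BV \<Omega>" using L1_repD(5)[OF g] tv by (simp add: BV_def)
  have "boundary_trace \<Omega> (abs_L0 f) x = 0" if x: "x \<in> frontier \<Omega>" for x
  proof (rule boundary_trace_eqI[OF \<Omega> g x])
    let ?K = "closure {x. f x \<noteq> 0}"
    have "x \<in> - ?K" using x test_functionsD(6)[OF f] \<Omega>(1) by (auto simp: frontier_def interior_open)
    moreover have "open (- ?K)" by (rule open_Compl[OF closed_closure])
    ultimately obtain e where e: "e > 0" "ball x e \<subseteq> - ?K" using open_contains_ball by blast
    have "\<forall>\<^sub>F r in at_right 0. mean_dev \<Omega> f x 0 r / r ^ DIM('a) = 0"
      unfolding eventually_at_right_field
    proof (intro exI[of _ e] conjI allI impI e(1))
      fix r assume "0 < r" "r < e"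
      have z: "indicator (\<Omega> \<inter> ball x r) y * \<bar>f y - 0\<bar> = 0" for y
      proof (cases "y \<in> ball x r")
        case True
        then have "y \<in> ball x e" using \<open>r < e\<close> by auto
        then have "y \<notin> ?K" using e(2) by auto
        then show ?thesis using test_functionsD(8)[OF f, of y] by simp
      qed simp
      have "mean_dev \<Omega> f x 0 r = (\<integral>y. 0 \<partial>(lborel :: 'a measure))"
        unfolding mean_dev_def by (rule Bochner_Integration.integral_cong[OF refl z])
      then show "mean_dev \<Omega> f x 0 r / r ^ DIM('a) = 0" by simp
    qed
    then show "is_trace \<Omega> f x 0"
      by (rule tendsto_eventually)
  qed
  then have "ennreal \<bar>boundary_trace \<Omega> (abs_L0 f) x\<bar> * indicator (frontier \<Omega>) x = 0" for x
    by (cases "x \<in> frontier \<Omega>") simp_all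
  then have "trace_integral \<Omega> (abs_L0 f) = 0" by (simp only: nn_integral_const) simp
  then show "E_TV \<Omega> (abs_L0 f) = tv \<Omega> f" using bv tv by (simp add: E_TV_def zero_ennreal.rep_eq)
qed

section \<open>Positivity of the optimal constant\<close>

lemma integral_lebesgue_on_lborel:
  fixes h k :: "'a::euclidean_space \<Rightarrow> real"
  assumes \<Omega>: "open \<Omega>" and h: "h \<in> borel_measurable borel" "\<And>x. x \<notin> \<Omega> \<Longrightarrow> h x = 0"
    and k: "k \<in> borel_measurable lebesgue" "AE x in lebesgue. k x = h x"
  shows "(\<integral>x. k x \<partial>lebesgue_on \<Omega>) = (LBINT x. h x)"
proof -
  have hl: "h \<in> borel_measurable lborel" using h by simp
  have hL[measurable]: "h \<in> borel_measurable lebesgue" by (rule measurable_completion[OF hl])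
  have \<Omega>L[measurable]: "\<Omega> \<in> sets lebesgue" using \<Omega> by auto
  have "(\<integral>x. k x \<partial>lebesgue_on \<Omega>) = (\<integral>x. indicator \<Omega> x * k x \<partial>lebesgue)"
    by (subst integral_restrict_space) (auto simp: set_lebesgue_integral_def)
  also have "\<dots> = (\<integral>x. h x \<partial>lebesgue)"
  proof (rule integral_cong_AE)
    show "(\<lambda>x. indicator \<Omega> x * k x) \<in> borel_measurable lebesgue" using k(1) by measurable
    show "AE x in lebesgue. indicator \<Omega> x * k x = h x"
      using k(2) by eventually_elim (use h(2) in \<open>auto split: split_indicator\<close>)
  qed (rule hL)
  also have "\<dots> = (LBINT x. h x)" by (rule integral_completion[OF hl])
  finally show ?thesis .
qed

lemma integrable_lebesgue_on:
  fixes h :: "'a::euclidean_space \<Rightarrow> 'b::euclidean_space"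
  assumes "open \<Omega>" "integrable lborel h"
  shows "integrable (lebesgue_on \<Omega>) h"
proof -
  have "h \<in> borel_measurable lborel" using assms(2) by auto
  then have i: "integrable lebesgue h" using assms(2) integrable_completion by blast
  have \<Omega>: "\<Omega> \<in> sets lebesgue" using assms(1) by auto
  have "set_integrable lebesgue \<Omega> h"
    unfolding set_integrable_def by (rule integrable_mult_indicator[OF \<Omega> i])
  then show ?thesis using \<Omega> by (subst integrable_restrict_space) (auto simp: set_integrable_def)
qed

text \<open>The extension by zero has no variation on the boundary: for test functions this is
  integration by parts on the whole space, and it passes to the limit for each fixed bounded
  field.\<close>

lemma W0_11_tv:
  fixes \<Omega> :: "'a::euclidean_space set"
  assumes \<Omega>: "open \<Omega>" and v: "W0_11 \<Omega> v g"
  shows "\<exists>f. L1_rep \<Omega> v f \<and> tv UNIV f \<le> ereal (\<integral>x. norm (g x) \<partial>lebesgue_on \<Omega>)"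
proof -
  from v have v1: "v \<in> Lp \<Omega> 1" and gi: "integrable (lebesgue_on \<Omega>) g" unfolding W0_11_def by auto
  from v obtain \<phi> where \<phi>: "\<And>j::nat. \<phi> j \<in> test_functions \<Omega>"
    and l1: "(\<lambda>j. \<integral>x. \<bar>\<phi> j x - rep_L0 v x\<bar> \<partial>lebesgue_on \<Omega>) \<longlonglongrightarrow> 0"
    and l2: "(\<lambda>j. \<integral>x. norm (grad (\<phi> j) x - g x) \<partial>lebesgue_on \<Omega>) \<longlonglongrightarrow> 0"
    unfolding W0_11_def by blast
  obtain f where f: "L1_rep \<Omega> v f" by (rule L1_rep_exists[OF \<Omega> v1])
  note fi = L1_repD(1)[OF f]
  have fb[measurable]: "f \<in> borel_measurable borel" by (rule L1_repD(4)[OF f])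
  have "(LBINT x. f x * divergence \<Phi> x) \<le> (\<integral>x. norm (g x) \<partial>lebesgue_on \<Omega>)"
    if \<Phi>: "\<Phi> \<in> test_fields UNIV" "\<And>x. norm (\<Phi> x) \<le> 1" for \<Phi> :: "'a \<Rightarrow> 'a"
  proof -
    obtain K where K: "compact K" "\<forall>x. x \<notin> K \<longrightarrow> divergence \<Phi> x = 0" using test_fieldsD(4)[OF \<Phi>(1)] by auto
    obtain M where M: "M > 0" "\<And>x. norm (divergence \<Phi> x) \<le> M"
      by (rule bounded_continuous_compact_support[OF test_fieldsD(3)[OF \<Phi>(1)] K(1)]) (use K(2) in auto)
    have step: "(LBINT x. f x * divergence \<Phi> x) \<le> M * (\<integral>x. \<bar>\<phi> j x - rep_L0 v x\<bar> \<partial>lebesgue_on \<Omega>)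
        + (\<integral>x. norm (grad (\<phi> j) x - g x) \<partial>lebesgue_on \<Omega>) + (\<integral>x. norm (g x) \<partial>lebesgue_on \<Omega>)" for j
    proof -
      note pi = integrable_test_function[OF \<phi>[of j]]
      have pb[measurable]: "\<phi> j \<in> borel_measurable borel" using pi(1) by auto
      have pl: "\<phi> j \<in> borel_measurable lborel" by simp
      have d1: "(\<integral>x. \<bar>\<phi> j x - rep_L0 v x\<bar> \<partial>lebesgue_on \<Omega>) = (LBINT x. \<bar>\<phi> j x - f x\<bar>)"
      proof (rule integral_lebesgue_on_lborel[OF \<Omega>])
        show "(\<lambda>x. \<bar>\<phi> j x - rep_L0 v x\<bar>) \<in> borel_measurable lebesgue"
          using measurable_completion[OF pl] borel_measurable_rep_L0[of v] by measurable
        show "AE x in lebesgue. \<bar>\<phi> j x - rep_L0 v x\<bar> = \<bar>\<phi> j x - f x\<bar>"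
          using L1_repD(2)[OF f] by eventually_elim simp
        fix x assume "x \<notin> \<Omega>"
        then show "\<bar>\<phi> j x - f x\<bar> = 0" using L1_repD(3)[OF f, of x] test_functionsD(7)[OF \<phi>[of j], of x] by simp
      qed measurable
      have nb: "(\<lambda>x. norm (grad (\<phi> j) x)) \<in> borel_measurable borel"
        using pi(3) by auto
      have nl: "(\<lambda>x. norm (grad (\<phi> j) x)) \<in> borel_measurable lborel" using nb by simp
      have d2: "(\<integral>x. norm (grad (\<phi> j) x) \<partial>lebesgue_on \<Omega>) = (LBINT x. norm (grad (\<phi> j) x))"
      proof (rule integral_lebesgue_on_lborel[OF \<Omega> nb _ measurable_completion[OF nl]])
        fix x assume "x \<notin> \<Omega>"
        then have "x \<notin> closure {x. \<phi> j x \<noteq> 0}" using test_functionsD(6)[OF \<phi>[of j]] by blast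
        from partial_outside_support[OF \<phi> this] show "norm (grad (\<phi> j) x) = 0" by (simp add: grad_def)
      qed simp
      have gli: "integrable (lebesgue_on \<Omega>) (grad (\<phi> j))" by (rule integrable_lebesgue_on[OF \<Omega> pi(3)])
      have "(\<integral>x. norm (grad (\<phi> j) x) \<partial>lebesgue_on \<Omega>) \<le> (\<integral>x. norm (grad (\<phi> j) x - g x) + norm (g x) \<partial>lebesgue_on \<Omega>)"
      proof (rule integral_mono)
        show "norm (grad (\<phi> j) x) \<le> norm (grad (\<phi> j) x - g x) + norm (g x)" for x
          using norm_triangle_ineq[of "grad (\<phi> j) x - g x" "g x"] by simp
      qed (use gli gi in auto)
      also have "\<dots> = (\<integral>x. norm (grad (\<phi> j) x - g x) \<partial>lebesgue_on \<Omega>) + (\<integral>x. norm (g x) \<partial>lebesgue_on \<Omega>)"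
        using gli gi by (intro Bochner_Integration.integral_add) auto
      finally have b2: "(LBINT x. \<phi> j x * divergence \<Phi> x) \<le>
          (\<integral>x. norm (grad (\<phi> j) x - g x) \<partial>lebesgue_on \<Omega>) + (\<integral>x. norm (g x) \<partial>lebesgue_on \<Omega>)"
        using integral_divergence_test_function[OF \<phi>[of j] \<Phi>] unfolding d2 by linarith
      note i1 = integrable_mult_divergence[OF fi \<Phi>(1)] and i2 = integrable_mult_divergence[OF pi(1) \<Phi>(1)]
      have "(LBINT x. f x * divergence \<Phi> x) - (LBINT x. \<phi> j x * divergence \<Phi> x)
          = (LBINT x. f x * divergence \<Phi> x - \<phi> j x * divergence \<Phi> x)"
        using i1 i2 by simp
      also have "\<dots> \<le> (LBINT x. M * \<bar>\<phi> j x - f x\<bar>)"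
      proof (rule integral_mono)
        show "integrable lborel (\<lambda>x. f x * divergence \<Phi> x - \<phi> j x * divergence \<Phi> x)" using i1 i2 by simp
        show "integrable lborel (\<lambda>x. M * \<bar>\<phi> j x - f x\<bar>)" using pi(1) fi by auto
        fix x
        have "f x * divergence \<Phi> x - \<phi> j x * divergence \<Phi> x \<le> \<bar>(f x - \<phi> j x) * divergence \<Phi> x\<bar>"
          by (simp add: left_diff_distrib)
        also have "\<dots> = \<bar>divergence \<Phi> x\<bar> * \<bar>\<phi> j x - f x\<bar>" by (simp add: abs_mult abs_minus_commute mult.commute)
        also have "\<dots> \<le> M * \<bar>\<phi> j x - f x\<bar>" using M(2)[of x] by (intro mult_right_mono) auto
        finally show "f x * divergence \<Phi> x - \<phi> j x * divergence \<Phi> x \<le> M * \<bar>\<phi> j x - f x\<bar>" .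
      qed
      finally show ?thesis using b2 unfolding d1 by simp
    qed
    have "(\<lambda>j. M * (\<integral>x. \<bar>\<phi> j x - rep_L0 v x\<bar> \<partial>lebesgue_on \<Omega>)
        + (\<integral>x. norm (grad (\<phi> j) x - g x) \<partial>lebesgue_on \<Omega>) + (\<integral>x. norm (g x) \<partial>lebesgue_on \<Omega>))
        \<longlonglongrightarrow> M * 0 + 0 + (\<integral>x. norm (g x) \<partial>lebesgue_on \<Omega>)"
      by (intro tendsto_intros l1 l2)
    from LIMSEQ_le_const[OF this] step show ?thesis by simp
  qed
  then have "tv UNIV f \<le> ereal (\<integral>x. norm (g x) \<partial>lebesgue_on \<Omega>)"
    unfolding tv_def by (intro SUP_least) auto
  with f show ?thesis by blast
qed

text \<open>Shows that the infimum defining \<open>C_BV\<close> is over a nonempty set. For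
  \<open>n \<ge> 2\<close> the factor \<open>q powr (1 / q)\<close> arises from taking a root in the
  Sobolev inequality.\<close>

lemma sobolev_W0_11:
  fixes \<Omega> :: "'a::euclidean_space set"
  assumes \<Omega>: "open \<Omega>" "bounded \<Omega>"
  shows "\<exists>C\<ge>0. \<forall>v g. W0_11 \<Omega> v g \<longrightarrow> v \<in> Lp \<Omega> (sobolev_exponent DIM('a)) \<and>
     Lnorm (sobolev_exponent DIM('a)) v \<le> C * (\<integral>x. norm (g x) \<partial>lebesgue_on \<Omega>)"
proof -
  define n where "n = real DIM('a)"
  define q where "q = n / (n - 1)"
  have sc: "sobolev_const TYPE('a) > 0" by (rule sobolev_const_pos)
  obtain R where R: "\<And>x. x \<in> \<Omega> \<Longrightarrow> norm x < R"
    using \<Omega>(2) unfolding bounded_iff by (metis gt_ex order_le_less_trans)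
  have key: "v \<in> Lp \<Omega> (sobolev_exponent DIM('a)) \<and>
     Lnorm (sobolev_exponent DIM('a)) v \<le> (if DIM('a) = 1 then 1 else q powr (1 / q)) * sobolev_const TYPE('a) * T"
    if v: "W0_11 \<Omega> v g" and T: "T = (\<integral>x. norm (g x) \<partial>lebesgue_on \<Omega>)" for v g T
  proof -
    from W0_11_tv[OF \<Omega>(1) v] obtain f where f: "L1_rep \<Omega> v f" "tv UNIV f \<le> ereal T" unfolding T by blast
    have T0: "T \<ge> 0" unfolding T by simp
    note fi = L1_repD(1)[OF f(1)]
    have mod: "(\<integral>\<^sup>+x. ennreal \<bar>\<bar>f (x + h)\<bar> - \<bar>f x\<bar>\<bar> \<partial>lborel) \<le> ennreal (T * norm h)" if h: "norm h < 1" for h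
    proof (rule nn_integral_modulus_abs[OF fi])
      \<comment> \<open>For translations shorter than 1 the difference is supported in the ball of
        radius \<open>R + 1\<close>, so the estimate on that bounded set is a global one.\<close>
      have eq: "indicator (ball 0 (R + 1)) y * \<bar>f (y + h) - f y\<bar> = \<bar>f (y + h) - f y\<bar>" for y
      proof (cases "norm y < R + 1")
        case False
        have "norm y \<le> norm (y + h) + norm h" using norm_triangle_ineq4[of "y + h" h] by simp
        then have "y \<notin> \<Omega>" "y + h \<notin> \<Omega>" using R[of y] R[of "y + h"] h False by auto
        then show ?thesis using L1_repD(3)[OF f(1)] by simp
      qed simp
      show "(LBINT y. \<bar>f (y + h) - f y\<bar>) \<le> T * norm h"
        using tv_translation[OF fi open_ball bounded_ball _ f(2), of 0 "R + 1" h] unfolding eq by (simp add: mult.commute)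
    qed
    have af: "integrable lborel (\<lambda>x. \<bar>f x\<bar>)" "\<And>x. \<bar>f x\<bar> \<ge> 0" using fi by auto
    note sob = sobolev_inequality[OF af zero_less_one T0 mod]
    let ?A = "sobolev_const TYPE('a) * T"
    have A0: "?A \<ge> 0" using sc T0 by simp
    show ?thesis
    proof (cases "DIM('a) = 1")
      case True
      have "AE x in lborel. \<bar>f x\<bar> \<le> ?A" by (rule sob(1)[OF _ True])
      then have "AE x in lebesgue. \<bar>f x\<bar> \<le> ?A" unfolding AE_lebesgue_lborel .
      with L1_repD(2)[OF f(1)] have "AE x in lebesgue. ereal \<bar>rep_L0 v x\<bar> \<le> ereal ?A"
        by eventually_elim simp
      then have le: "ess_norm v \<le> ereal ?A" unfolding ess_norm_def by (intro esssup_I) measurable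
      then have "real_of_ereal (ess_norm v) \<le> ?A" using A0 by (cases "ess_norm v") auto
      moreover have "ess_norm v < \<infinity>" using le by (cases "ess_norm v") auto
      moreover have "AE x in lebesgue. x \<notin> \<Omega> \<longrightarrow> rep_L0 v x = 0"
        using L1_repD(2)[OF f(1)] by eventually_elim (use L1_repD(3)[OF f(1)] in auto)
      ultimately show ?thesis using True by (simp add: sobolev_exponent_def Lp_def Lnorm_def)
    next
      case False
      then have d: "DIM('a) \<ge> 2" using DIM_positive[where 'a='a] by linarith
      then have n: "n \<ge> 2" by (simp add: n_def)
      then have q: "q > 0" by (simp add: q_def)
      have le: "(\<integral>\<^sup>+x. ennreal (\<bar>f x\<bar> powr q) \<partial>lborel) \<le> ennreal (q * ?A powr q)"
        using sob(2)[OF _ d] unfolding q_def n_def .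
      have "q * ?A powr q \<ge> 0" using q by simp
      note L = Lint_L1_rep[OF f(1) le this]
      have "Lnorm (ereal q) v \<le> (q * ?A powr q) powr (1 / q)"
        unfolding Lnorm_Lint using L(2) q by (intro powr_mono2) auto
      also have "\<dots> = q powr (1 / q) * (?A powr q) powr (1 / q)" using q by (simp add: powr_mult del: powr_powr)
      also have "(?A powr q) powr (1 / q) = ?A" using q A0 by (subst powr_powr) simp
      finally show ?thesis using L(1) False
        by (simp add: sobolev_exponent_def q_def n_def mult.assoc)
    qed
  qed
  show ?thesis
    by (rule exI[of _ "(if DIM('a) = 1 then 1 else q powr (1 / q)) * sobolev_const TYPE('a)"])
       (use key sc in auto)
qed

section \<open>Bump functions and the bound from below\<close>

lemma flat_exp_pos: "flat_exp m t > 0 \<longleftrightarrow> t > 0" "flat_exp m t \<ge> 0"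
  by (auto simp: flat_exp_def)

lemma test_function_bump:
  fixes a :: "'a::euclidean_space"
  assumes r: "r > 0" and U: "cball a r \<subseteq> U"
  shows "\<exists>f\<in>test_functions U. (\<forall>x. f x \<ge> 0) \<and> (\<forall>x. x \<notin> cball a r \<longrightarrow> f x = 0) \<and> (LBINT x. f x) = 1"
proof -
  let ?f = "\<lambda>x. flat_exp 0 (r\<^sup>2 - (x - a) \<bullet> (x - a))"
  have nrm: "(x - a) \<bullet> (x - a) < r\<^sup>2 \<longleftrightarrow> dist a x < r" for x
    using r norm_lt_square[of "x - a" r] by (simp add: dist_norm norm_minus_commute)
  have z: "?f x = 0" if "x \<notin> cball a r" for x
    using that nrm[of x] flat_exp_pos[of 0 "r\<^sup>2 - (x - a) \<bullet> (x - a)"] by (auto simp: less_le)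
  have f: "?f \<in> test_functions U"
    by (rule test_functionsI[OF smooth_alg.bump _ U z]) auto
  note fi = integrable_test_function(1)[OF f]
  have "(LBINT x. ?f x) \<noteq> 0"
  proof
    assume "(LBINT x. ?f x) = 0"
    then have "AE x in lborel. ?f x = 0"
      using integral_nonneg_eq_0_iff_AE[OF fi] flat_exp_pos(2) by auto
    then have "AE x in lborel. x \<notin> ball a r"
    proof eventually_elim
      case (elim x)
      then show ?case using nrm[of x] flat_exp_pos(1)[of 0 "r\<^sup>2 - (x - a) \<bullet> (x - a)"] by auto
    qed
    then have "ball a r \<in> null_sets lborel" by (subst AE_iff_null_sets) auto
    then have "negligible (ball a r)" unfolding negligible_iff_null_sets by (rule null_sets_completionI)
    then show False using open_not_negligible[of "ball a r"] r by auto
  qed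
  moreover have "(LBINT x. ?f x) \<ge> 0" using flat_exp_pos(2) by (intro integral_nonneg_AE) auto
  ultimately have pos: "(LBINT x. ?f x) > 0" by simp
  show ?thesis
  proof (intro bexI conjI allI impI)
    show "(\<lambda>x. ?f x * (1 / (LBINT x. ?f x))) \<in> test_functions U" by (rule test_functions_cmult[OF f])
    show "?f x * (1 / (LBINT x. ?f x)) \<ge> 0" for x using pos flat_exp_pos(2) by simp
    show "?f x * (1 / (LBINT x. ?f x)) = 0" if "x \<notin> cball a r" for x using z[OF that] by simp
    show "(LBINT x. ?f x * (1 / (LBINT x. ?f x))) = 1" using pos by simp
  qed
qed

lemma disjoint_test_functions:
  fixes \<Omega> :: "'a::euclidean_space set"
  assumes "open \<Omega>" "\<Omega> \<noteq> {}"
  shows "\<exists>f. \<forall>i<k::nat. f i \<in> test_functions \<Omega> \<and> (\<forall>x. f i x \<ge> 0) \<and> (LBINT x. f i x) = 1 \<and>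
     (\<forall>j<k. j \<noteq> i \<longrightarrow> (\<forall>x. f i x * f j x = 0))"
proof -
  obtain x0 R where R: "R > 0" "cball x0 R \<subseteq> \<Omega>" using assms by (metis ex_in_conv open_contains_cball)
  obtain b :: 'a where b: "b \<in> Basis" by (meson SOME_Basis)
  \<comment> \<open>Centres at distance \<open>s\<close> along one axis and radii
    \<open>s / 4\<close> give disjoint supports, and all of them fit into the ball of radius
    \<open>R\<close>.\<close>
  define s where "s = R / (real k + 1)"
  define a where "a i = x0 + (s * real i) *\<^sub>R b" for i
  have s: "s > 0" using R by (simp add: s_def)
  have sub: "cball (a i) (s / 4) \<subseteq> \<Omega>" if i: "i < k" for i
  proof -
    have "y \<in> cball x0 R" if "y \<in> cball (a i) (s / 4)" for y
    proof -
      have "dist x0 (a i) = s * real i" using b s by (simp add: a_def dist_norm)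
      then have "dist x0 y \<le> s * real i + s / 4" using that dist_triangle[of x0 y "a i"] by simp
      also have "\<dots> \<le> s * (real k + 1)"
      proof -
        have "s * real i \<le> s * real k" using i s by simp
        then show ?thesis using s unfolding distrib_left by linarith
      qed
      also have "\<dots> = R" by (simp add: s_def)
      finally show ?thesis by simp
    qed
    with R(2) show ?thesis by blast
  qed
  have "\<forall>i. \<exists>f. i < k \<longrightarrow> f \<in> test_functions \<Omega> \<and> (\<forall>x. f x \<ge> 0) \<and> (\<forall>x. x \<notin> cball (a i) (s / 4) \<longrightarrow> f x = 0) \<and>
      (LBINT x. f x) = 1"
    using test_function_bump[OF _ sub] s by (metis divide_pos_pos zero_less_numeral)
  from choice[OF this] obtain f where f: "\<And>i. i < k \<Longrightarrow> f i \<in> test_functions \<Omega> \<and> (\<forall>x. f i x \<ge> 0) \<and>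
      (\<forall>x. x \<notin> cball (a i) (s / 4) \<longrightarrow> f i x = 0) \<and> (LBINT x. f i x) = 1" by blast
  have "f i x * f j x = 0" if ij: "i < k" "j < k" "j \<noteq> i" for i j x
  proof (rule ccontr)
    assume "f i x * f j x \<noteq> 0"
    then have "x \<in> cball (a i) (s / 4)" "x \<in> cball (a j) (s / 4)" using f[OF ij(1)] f[OF ij(2)] by auto
    then have "dist (a i) (a j) \<le> s / 2" using dist_triangle2[of "a i" "a j" x] by simp
    moreover have "dist (a i) (a j) = s * \<bar>real i - real j\<bar>"
    proof -
      have "a i - a j = (s * (real i - real j)) *\<^sub>R b" by (simp add: a_def algebra_simps)
      then show ?thesis using b s by (simp add: dist_norm abs_mult)
    qed
    moreover have "s * 1 \<le> s * \<bar>real i - real j\<bar>" using ij(3) s by (intro mult_left_mono) auto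
    ultimately show False using s by simp
  qed
  with f show ?thesis by blast
qed

text \<open>A single bump with positive norm \<open>N\<close> and gradient integral \<open>I\<close>
  forces every admissible constant to be at least \<open>N / I\<close>. Were the infimum 0, its
  \<open>powr\<close> would be 0 and no positive \<alpha> would satisfy the threshold.\<close>

lemma C_BV_pos:
  fixes \<Omega> :: "'a::euclidean_space set"
  assumes \<Omega>: "open \<Omega>" "bounded \<Omega>" "\<Omega> \<noteq> {}"
  shows "C_BV \<Omega> > 0"
proof -
  let ?S = "sobolev_exponent DIM('a)"
  let ?C = "{C. 0 \<le> C \<and> (\<forall>v g. W0_11 \<Omega> v g \<longrightarrow> v \<in> Lp \<Omega> ?S \<and>
     Lnorm ?S v \<le> C * (\<integral>x. norm (g x) \<partial>lebesgue_on \<Omega>))}"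
  have ne: "?C \<noteq> {}" using sobolev_W0_11[OF \<Omega>(1,2)] by blast
  obtain x0 R where R: "R > 0" "cball x0 R \<subseteq> \<Omega>" using \<Omega> by (metis ex_in_conv open_contains_cball)
  obtain f where f: "f \<in> test_functions \<Omega>" "\<And>x. f x \<ge> 0" "(LBINT x. f x) = 1"
    using test_function_bump[OF R] by blast
  let ?v = "abs_L0 f"
  note fi = integrable_test_function[OF f(1)]
  have r: "L1_rep \<Omega> ?v f" by (rule L1_rep_abs_L0[OF fi(1) test_functionsD(7)[OF f(1)]])
  have fb: "f \<in> borel_measurable borel" by (rule L1_repD(4)[OF r])
  have fL: "AE x in lebesgue. rep_L0 ?v x = f x" by (rule L1_repD(2)[OF r])
  have v1: "Lnorm 1 ?v = 1" using L1_repD(6)[OF r] f(2,3) by simp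
  have W: "W0_11 \<Omega> ?v (grad f)"
    unfolding W0_11_def
  proof (intro conjI exI[of _ "\<lambda>_. f"])
    show "?v \<in> Lp \<Omega> 1" by (rule L1_repD(5)[OF r])
    show "integrable (lebesgue_on \<Omega>) (grad f)" by (rule integrable_lebesgue_on[OF \<Omega>(1) fi(3)])
    show "weak_gradient \<Omega> ?v (grad f)" unfolding weak_gradient_def
    proof (intro ballI)
      fix \<phi> and b :: 'a assume \<phi>: "\<phi> \<in> test_functions \<Omega>" and b: "b \<in> Basis"
      have m: "partial b \<phi> \<in> borel_measurable borel" "partial b f \<in> borel_measurable borel" "\<phi> \<in> borel_measurable borel"
        using test_functionsD(3,4)[OF \<phi>] test_functionsD(4)[OF f(1)] by (auto intro: borel_measurable_continuous_onI)

      have "(\<integral>x. rep_L0 ?v x * partial b \<phi> x \<partial>lebesgue_on \<Omega>) = (LBINT x. f x * partial b \<phi> x)"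
      proof (rule integral_lebesgue_on_lborel[OF \<Omega>(1)])
        have "partial b \<phi> \<in> borel_measurable lborel" using m(1) by simp
        from measurable_completion[OF this] show "(\<lambda>x. rep_L0 ?v x * partial b \<phi> x) \<in> borel_measurable lebesgue"
          using borel_measurable_rep_L0[of ?v] by measurable
        show "AE x in lebesgue. rep_L0 ?v x * partial b \<phi> x = f x * partial b \<phi> x"
          using fL by eventually_elim simp
        show "x \<notin> \<Omega> \<Longrightarrow> f x * partial b \<phi> x = 0" for x using test_functionsD(7)[OF f(1), of x] by simp
      qed (use fb m(1) in measurable)
      moreover have "(\<integral>x. (grad f x \<bullet> b) * \<phi> x \<partial>lebesgue_on \<Omega>) = (LBINT x. partial b f x * \<phi> x)"
      proof (rule integral_lebesgue_on_lborel[OF \<Omega>(1)])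
        have eq: "(\<lambda>x. (grad f x \<bullet> b) * \<phi> x) = (\<lambda>x. partial b f x * \<phi> x)"
          using partial_grad[OF test_functionsD(2)[OF f(1)], of b] by simp
        have "(\<lambda>x. partial b f x * \<phi> x) \<in> borel_measurable lborel" using m by simp
        from measurable_completion[OF this] show "(\<lambda>x. (grad f x \<bullet> b) * \<phi> x) \<in> borel_measurable lebesgue" unfolding eq .
        show "AE x in lebesgue. (grad f x \<bullet> b) * \<phi> x = partial b f x * \<phi> x"
          using partial_grad[OF test_functionsD(2)[OF f(1)], of b] by simp
        show "x \<notin> \<Omega> \<Longrightarrow> partial b f x * \<phi> x = 0" for x using test_functionsD(7)[OF \<phi>, of x] by simp
      qed (use m in measurable)
      ultimately show "(\<integral>x. rep_L0 ?v x * partial b \<phi> x \<partial>lebesgue_on \<Omega>) = - (\<integral>x. (grad f x \<bullet> b) * \<phi> x \<partial>lebesgue_on \<Omega>)"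
        using integration_by_parts[OF f(1) \<phi> b] by simp
    qed
    show "\<forall>j::nat. f \<in> test_functions \<Omega>" using f by simp
    have "(\<integral>x. \<bar>f x - rep_L0 ?v x\<bar> \<partial>lebesgue_on \<Omega>) = (\<integral>x. (0::real) \<partial>(lborel::'a measure))"
    proof (rule integral_lebesgue_on_lborel[OF \<Omega>(1)])
      have "f \<in> borel_measurable lborel" using fb by simp
      from measurable_completion[OF this] show "(\<lambda>x. \<bar>f x - rep_L0 ?v x\<bar>) \<in> borel_measurable lebesgue"
        using borel_measurable_rep_L0[of ?v] by measurable
      show "AE x in lebesgue. \<bar>f x - rep_L0 ?v x\<bar> = 0" using fL by eventually_elim simp
    qed auto
    then show "(\<lambda>j::nat. \<integral>x. \<bar>f x - rep_L0 ?v x\<bar> \<partial>lebesgue_on \<Omega>) \<longlonglongrightarrow> 0" by simp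
    show "(\<lambda>j::nat. \<integral>x. norm (grad f x - grad f x) \<partial>lebesgue_on \<Omega>) \<longlonglongrightarrow> 0" by simp
  qed
  define I where "I = (\<integral>x. norm (grad f x) \<partial>lebesgue_on \<Omega>)"
  define N where "N = Lnorm ?S ?v"
  have vS: "?v \<in> Lp \<Omega> ?S" using ne W by blast
  \<comment> \<open>A vanishing norm would make the class zero, contradicting integral 1; the
    essential supremum in dimension 1 is treated apart from the integral norms.\<close>
  have "N > 0"
  proof (rule ccontr)
    assume "\<not> N > 0"
    have "?v = 0"
    proof (cases "DIM('a) = 1")
      case True
      have "ess_norm ?v < \<infinity>" using vS True by (auto simp: Lp_def sobolev_exponent_def)
      moreover have "real_of_ereal (ess_norm ?v) \<le> 0"
      proof -
        have "real_of_ereal (ess_norm ?v) = N" using True by (simp add: N_def Lnorm_def sobolev_exponent_def)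
        with \<open>\<not> N > 0\<close> show ?thesis by linarith
      qed
      ultimately have le: "ess_norm ?v \<le> 0" by (cases "ess_norm ?v") auto
      have "AE x in lebesgue. ereal \<bar>rep_L0 ?v x\<bar> \<le> ess_norm ?v" unfolding ess_norm_def by (rule esssup_AE)
      with rep_L0_ops(5) show ?thesis unfolding L0_eq_iff
      proof eventually_elim
        case (elim x)
        have "ereal \<bar>rep_L0 ?v x\<bar> \<le> 0" using elim(2) le by (rule order_trans)
        then show ?case using elim(1) by simp
      qed
    next
      case False
      have d: "real DIM('a) > 1" using False DIM_positive[where 'a='a] by linarith
      define q where "q = real DIM('a) / (real DIM('a) - 1)"
      have S: "?S = ereal q" using False by (simp add: sobolev_exponent_def q_def)
      have "q > 0" using d by (simp add: q_def)
      moreover have "Lnorm (ereal q) ?v = 0" using \<open>\<not> N > 0\<close> Lnorm_nonneg[of q ?v] unfolding N_def S by linarith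
      ultimately show ?thesis using Lnorm_eq_0_iff[of ?v \<Omega> q] vS unfolding S by simp
    qed
    then have "AE x in lebesgue. rep_L0 ?v x = 0" using rep_L0_ops(5) by simp
    then have "Lnorm 1 ?v = 0" unfolding Lnorm_1 by (intro integral_eq_zero_AE) (auto elim: eventually_mono)
    with v1 show False by simp
  qed
  have I0: "I \<ge> 0" unfolding I_def by simp
  have le: "N \<le> C * I" if "C \<in> ?C" for C using that W unfolding I_def N_def by blast
  obtain C where "C \<in> ?C" using ne by blast
  from le[OF this] \<open>N > 0\<close> I0 have I: "I > 0" by (cases "I = 0") auto
  have "N / I \<le> Inf ?C"
    by (rule cInf_greatest[OF ne]) (use le I in \<open>simp add: pos_divide_le_eq\<close>)
  then show ?thesis unfolding C_BV_def using \<open>N > 0\<close> I by (smt (verit) divide_pos_pos)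
qed

section \<open>Finite combinations of bumps\<close>

lemma sum_test_functions:
  assumes "\<And>i. i < k \<Longrightarrow> f i \<in> test_functions U"
  shows "(\<lambda>y. \<Sum>i<k::nat. x i * f i y) \<in> test_functions U"
  using assms
proof (induction k)
  case 0
  show ?case using test_functionsI[OF smooth_alg.const[of 0], of "{}" U] by simp
next
  case (Suc k)
  have "(\<lambda>y. f k y * x k) \<in> test_functions U" by (rule test_functions_cmult) (use Suc.prems in simp)
  with Suc have "(\<lambda>y. (\<Sum>i<k. x i * f i y) + f k y * x k) \<in> test_functions U"
    by (intro test_functions_add) auto
  then show ?case by (simp add: mult.commute)
qed

lemma tv_sum_le:
  assumes "\<And>i. i < k \<Longrightarrow> integrable lborel (f i)" "\<And>i. i < k \<Longrightarrow> tv U (f i) \<le> ereal (T i)"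
  shows "tv U (\<lambda>y. \<Sum>i<k::nat. x i * f i y) \<le> ereal (\<Sum>i<k. \<bar>x i\<bar> * T i)"
  using assms
proof (induction k)
  case 0
  have "tv U (\<lambda>y. 0 * (0::real)) \<le> ereal 0" unfolding tv_def by (intro SUP_least) auto
  then show ?case by simp
next
  case (Suc k)
  have i: "integrable lborel (\<lambda>y. \<Sum>i<k. x i * f i y)" using Suc.prems(1) by (intro Bochner_Integration.integrable_sum) auto
  have "tv U (\<lambda>y. 1 * (\<Sum>i<k. x i * f i y) + x k * f k y) \<le> ereal (\<bar>1\<bar> * (\<Sum>i<k. \<bar>x i\<bar> * T i) + \<bar>x k\<bar> * T k)"
    by (rule tv_linear[OF i]) (use Suc in auto)
  then show ?case by simp
qed

section \<open>Minimax sets\<close>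

lemma continuous_map_submetric:
  assumes M1: "Metric_space M1 d1" and M2: "Metric_space M2 d2" and S: "S \<subseteq> M1" and h: "\<And>x. x \<in> S \<Longrightarrow> h x \<in> M2"
    and c: "\<And>x \<epsilon>. x \<in> S \<Longrightarrow> \<epsilon> > 0 \<Longrightarrow> \<exists>\<delta>>0. \<forall>y\<in>S. d1 x y < \<delta> \<longrightarrow> d2 (h x) (h y) < \<epsilon>"
  shows "continuous_map (subtopology (Metric_space.mtopology M1 d1) S) (Metric_space.mtopology M2 d2) h"
  unfolding Metric_space.continuous_map_to_metric[OF M2]
proof (intro ballI allI impI)
  interpret A: Metric_space M1 d1 by (rule M1)
  interpret B: Metric_space M2 d2 by (rule M2)
  fix x and \<epsilon> :: real assume "x \<in> topspace (subtopology A.mtopology S)" and \<epsilon>: "\<epsilon> > 0"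
  then have x: "x \<in> S" by auto
  obtain \<delta> where \<delta>: "\<delta> > 0" "\<forall>y\<in>S. d1 x y < \<delta> \<longrightarrow> d2 (h x) (h y) < \<epsilon>" using c[OF x \<epsilon>] by blast
  show "\<exists>U. openin (subtopology A.mtopology S) U \<and> x \<in> U \<and> (\<forall>y\<in>U. h y \<in> B.mball (h x) \<epsilon>)"
  proof (intro exI conjI ballI)
    show "openin (subtopology A.mtopology S) (S \<inter> A.mball x \<delta>)" by (intro openin_subtopology_Int2 A.openin_mball)
    show "x \<in> S \<inter> A.mball x \<delta>" using x S \<delta>(1) by auto
    fix y assume "y \<in> S \<inter> A.mball x \<delta>"
    then show "h y \<in> B.mball (h x) \<epsilon>" using \<delta>(2) h x by auto
  qed
qed

text \<open>An odd map on the image, composed with the odd map \<open>h\<close>, is an odd map on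
  \<open>S\<close> into the same space.\<close>

lemma genus_image:
  assumes h: "continuous_map (subtopology X S) Y h" and odd: "\<And>v. v \<in> S \<Longrightarrow> h (- v) = - h v"
  shows "genus X S \<le> genus Y (h ` S)"
  unfolding genus_def
proof (rule Inf_superset_mono, safe)
  fix k f assume f: "continuous_map (subtopology Y (h ` S)) (Euclidean_space k) f"
    and nz: "\<forall>v\<in>h ` S. f v \<noteq> (\<lambda>_. 0)" and o: "\<forall>v\<in>h ` S. f (- v) = (\<lambda>i. - f v i)"
  have "continuous_map (subtopology X S) (subtopology Y (h ` S)) h"
    using h by (auto simp: continuous_map_in_subtopology)
  then have "continuous_map (subtopology X S) (Euclidean_space k) (f \<circ> h)" using f by (rule continuous_map_compose)
  moreover have "\<forall>v\<in>S. (f \<circ> h) v \<noteq> (\<lambda>_. 0)" using nz by simp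
  moreover have "\<forall>v\<in>S. (f \<circ> h) (- v) = (\<lambda>i. - (f \<circ> h) v i)" using o odd by simp
  ultimately show "\<exists>k'. enat k = enat k' \<and> (\<exists>f. continuous_map (subtopology X S) (Euclidean_space k') f \<and>
      (\<forall>v\<in>S. f v \<noteq> (\<lambda>_. 0)) \<and> (\<forall>v\<in>S. f (- v) = (\<lambda>i. - f v i)))" by blast
qed

lemma genus_empty: "genus X {} = 0"
proof -
  have "continuous_map (subtopology X {}) (Euclidean_space 0) (\<lambda>_ _. 0)"
    by (simp add: continuous_map_def)
  then have "genus X {} \<le> enat 0" unfolding genus_def by (intro Inf_lower) blast
  then show ?thesis by (simp flip: zero_enat_def)
qed

text \<open>Keeps the suprema in the minimax values from running over the empty set, where they
  would be minus infinity.\<close>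

lemma minimax_sets_nonempty: "S \<in> minimax_sets \<Omega> q \<alpha> k \<Longrightarrow> k \<ge> 1 \<Longrightarrow> S \<noteq> {}"
  by (auto simp: minimax_sets_def genus_empty zero_enat_def)

section \<open>Exchange of minimax sets between the two problems\<close>

lemma Lp1: "ereal 1 = 1" "Metric_space (Lp \<Omega> 1 :: 'a::euclidean_space L0 set) (Ldist 1)"
  using Lp_metric[of 1 \<Omega>] by (simp_all add: one_ereal_def)

lemma Ldist_scale: "q > 0 \<Longrightarrow> Ldist (ereal q) (c *\<^sub>R v) (c *\<^sub>R w) = \<bar>c\<bar> * Lnorm (ereal q) (v - w)"
  unfolding Ldist_def by (simp flip: scaleR_diff_right add: Lnorm_scale)

text \<open>Scaling is odd, so the image keeps its symmetry and the genus cannot drop; continuity of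
  the identity between the two norms on \<open>S\<close> keeps it compact.\<close>

lemma minimax_sets_scale:
  fixes \<Omega> :: "'a::euclidean_space set"
  assumes S: "S \<in> minimax_sets \<Omega> (ereal q) \<alpha> k" and q: "q \<ge> 1" "r \<ge> 1" and c: "c > 0"
    and sub: "\<And>v. v \<in> S \<Longrightarrow> v \<in> Lp \<Omega> (ereal r)"
    and cont: "\<And>\<epsilon>. \<epsilon> > 0 \<Longrightarrow> \<exists>\<delta>>0. \<forall>v\<in>S. \<forall>w\<in>S. Lnorm (ereal q) (v - w) < \<delta> \<longrightarrow> Lnorm (ereal r) (v - w) < \<epsilon>"
  shows "(\<lambda>v. c *\<^sub>R v) ` S \<in> minimax_sets \<Omega> (ereal r) (c * \<alpha>) k"
proof -
  let ?h = "\<lambda>v :: 'a L0. c *\<^sub>R v"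
  have S': "S \<subseteq> Lp \<Omega> (ereal q)" "compactin (Ltop \<Omega> (ereal q)) S" "\<forall>v\<in>S. - v \<in> S" "\<forall>v\<in>S. Lnorm 1 v = \<alpha>"
      "enat k \<le> genus (Ltop \<Omega> (ereal q)) S" using S by (auto simp: minimax_sets_def)
  have mem: "?h v \<in> Lp \<Omega> (ereal r)" if "v \<in> S" for v using Lint_scale(2)[OF sub[OF that]] .
  have ch: "continuous_map (subtopology (Ltop \<Omega> (ereal q)) S) (Ltop \<Omega> (ereal r)) ?h"
  proof (rule continuous_map_submetric[OF Lp_metric[OF q(1)] Lp_metric[OF q(2)] S'(1) mem])
    fix x :: "'a L0" and \<epsilon> :: real assume x: "x \<in> S" and \<epsilon>: "\<epsilon> > 0"
    obtain \<delta> where \<delta>: "\<delta> > 0" "\<forall>v\<in>S. \<forall>w\<in>S. Lnorm (ereal q) (v - w) < \<delta> \<longrightarrow> Lnorm (ereal r) (v - w) < \<epsilon> / c"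
      using cont[of "\<epsilon> / c"] \<epsilon> c by auto
    show "\<exists>\<delta>>0. \<forall>y\<in>S. Ldist (ereal q) x y < \<delta> \<longrightarrow> Ldist (ereal r) (?h x) (?h y) < \<epsilon>"
    proof (intro exI[of _ \<delta>] conjI \<delta>(1) ballI impI)
      fix y assume "y \<in> S" "Ldist (ereal q) x y < \<delta>"
      then have "Lnorm (ereal r) (x - y) < \<epsilon> / c" using \<delta>(2) x by (simp add: Ldist_def)
      then show "Ldist (ereal r) (?h x) (?h y) < \<epsilon>"
        using q c by (simp add: Ldist_scale pos_less_divide_eq mult.commute)
    qed
  qed
  have odd: "?h (- v) = - ?h v" for v by simp
  show ?thesis unfolding minimax_sets_def
  proof (intro CollectI conjI)
    show "?h ` S \<subseteq> Lp \<Omega> (ereal r)" using mem by auto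
    have "compactin (subtopology (Ltop \<Omega> (ereal q)) S) S" using S'(2) by (simp add: compactin_subtopology)
    from image_compactin[OF this ch] show "compactin (Ltop \<Omega> (ereal r)) (?h ` S)" .
    show "\<forall>v\<in>?h ` S. - v \<in> ?h ` S"
    proof
      fix v assume "v \<in> ?h ` S"
      then obtain u where "u \<in> S" "v = ?h u" by blast
      then have "- u \<in> S" "- v = ?h (- u)" using S'(3) by auto
      then show "- v \<in> ?h ` S" by blast
    qed
    have "Lnorm 1 (?h v) = c * \<alpha>" if "v \<in> S" for v
      using S'(4) that Lnorm_scale[of 1 c v] c by (simp add: Lp1)
    then show "\<forall>v\<in>?h ` S. Lnorm 1 v = c * \<alpha>" by blast
    show "enat k \<le> genus (Ltop \<Omega> (ereal r)) (?h ` S)"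
      using S'(5) genus_image[OF ch odd] by (rule order_trans)
  qed
qed

text \<open>Where \<open>\<bar>v\<bar> \<le> e\<close> the constant \<open>e\<close> is integrated
  over a set of finite measure; elsewhere the higher power dominates. Fit for continuity:
  \<open>e\<close> is chosen before the bound on \<open>Lint p v\<close>.\<close>

lemma Lnorm_1_le:
  fixes \<Omega> :: "'a::euclidean_space set"
  assumes \<Omega>: "open \<Omega>" "bounded \<Omega>" and v: "v \<in> Lp \<Omega> (ereal p)" and p: "p > 1" and e: "e > 0"
  shows "v \<in> Lp \<Omega> 1" "Lnorm 1 v \<le> e * measure lborel \<Omega> + e powr (1 - p) * Lint p v"
proof -
  have \<Omega>L: "\<Omega> \<in> sets lebesgue" using \<Omega>(1) by auto
  have \<Omega>b: "\<Omega> \<in> sets lborel" using \<Omega>(1) by auto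
  have i: "integrable lebesgue (indicator \<Omega> :: 'a \<Rightarrow> real)"
    using emeasure_bounded_finite[OF \<Omega>(2)] \<Omega>L \<Omega>b by (intro integrable_real_indicator) auto
  have j: "integrable lebesgue (\<lambda>x. \<bar>rep_L0 v x\<bar> powr p)" and z: "AE x in lebesgue. x \<notin> \<Omega> \<longrightarrow> rep_L0 v x = 0"
    using v by (auto simp: Lp_finite_iff)
  have ij: "integrable lebesgue (\<lambda>x. e * indicator \<Omega> x + e powr (1 - p) * \<bar>rep_L0 v x\<bar> powr p)" using i j by auto
  have le: "AE x in lebesgue. \<bar>rep_L0 v x\<bar> \<le> e * indicator \<Omega> x + e powr (1 - p) * \<bar>rep_L0 v x\<bar> powr p"
    using z
  proof eventually_elim
    case (elim x)
    show ?case
    proof (cases "x \<in> \<Omega>")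
      case True
      show ?thesis using powr_interpolation[of "\<bar>rep_L0 v x\<bar>" e 1 p] e p True
      proof (cases "\<bar>rep_L0 v x\<bar> \<le> e")
        case False
        have "\<bar>rep_L0 v x\<bar> = \<bar>rep_L0 v x\<bar> powr (1 - p) * \<bar>rep_L0 v x\<bar> powr p"
          using False e by (simp flip: powr_add)
        also have "\<dots> \<le> e powr (1 - p) * \<bar>rep_L0 v x\<bar> powr p"
          using False e p by (intro mult_right_mono powr_mono2') auto
        finally show ?thesis using True e by simp
      qed (use True in \<open>simp add: add_increasing2\<close>)
    qed (use elim in simp)
  qed
  have k: "integrable lebesgue (\<lambda>x. \<bar>rep_L0 v x\<bar>)"
    by (rule Bochner_Integration.integrable_bound[OF ij]) (use le in \<open>auto elim: eventually_mono\<close>)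
  then have "integrable lebesgue (rep_L0 v)" by (subst (asm) integrable_abs_iff) auto
  with z show "v \<in> Lp \<Omega> 1" by (simp add: Lp_1_iff)
  have "Lnorm 1 v \<le> (\<integral>x. e * indicator \<Omega> x + e powr (1 - p) * \<bar>rep_L0 v x\<bar> powr p \<partial>lebesgue)"
    unfolding Lnorm_1 by (rule integral_mono_AE[OF k ij le])
  also have "\<dots> = e * measure lebesgue \<Omega> + e powr (1 - p) * Lint p v"
    using i j \<Omega>L by (simp add: Lint_def)
  finally show "Lnorm 1 v \<le> e * measure lborel \<Omega> + e powr (1 - p) * Lint p v" using \<Omega>b by simp
qed

lemma minimax_sets_to_L1:
  fixes \<Omega> :: "'a::euclidean_space set"
  assumes \<Omega>: "open \<Omega>" "bounded \<Omega>" and p: "p > 1" and \<alpha>: "\<alpha> > 0" and S: "S \<in> minimax_sets \<Omega> (ereal p) \<alpha> k"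
  shows "(\<lambda>v. (1 / \<alpha>) *\<^sub>R v) ` S \<in> minimax_sets \<Omega> 1 1 k"
proof -
  have Sp: "v \<in> Lp \<Omega> (ereal p)" if "v \<in> S" for v using S that by (auto simp: minimax_sets_def)
  have "(\<lambda>v. (1 / \<alpha>) *\<^sub>R v) ` S \<in> minimax_sets \<Omega> (ereal 1) (1 / \<alpha> * \<alpha>) k"
  proof (rule minimax_sets_scale[OF S])
    show "v \<in> Lp \<Omega> (ereal 1)" if "v \<in> S" for v using Lnorm_1_le(1)[OF \<Omega> Sp[OF that] p, of 1] by (simp add: Lp1)
    fix \<epsilon> :: real assume \<epsilon>: "\<epsilon> > 0"
    define m where "m = measure lborel \<Omega>"
    have m: "m \<ge> 0" by (simp add: m_def)
    \<comment> \<open>Makes the first term of \<open>Lnorm_1_le\<close> less than half of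
      \<epsilon>; the 1 added to the measure avoids division by 0.\<close>
    define e where "e = \<epsilon> / (2 * (m + 1))"
    have e: "e > 0" using \<epsilon> m by (simp add: e_def)
    have em: "e * m < \<epsilon> / 2"
      using \<epsilon> m by (simp add: e_def pos_divide_less_eq)
    define D where "D = \<epsilon> / 2 * e powr (p - 1)"
    have D: "D > 0" using \<epsilon> e by (simp add: D_def)
    show "\<exists>\<delta>>0. \<forall>v\<in>S. \<forall>w\<in>S. Lnorm (ereal p) (v - w) < \<delta> \<longrightarrow> Lnorm (ereal 1) (v - w) < \<epsilon>"
    proof (intro exI[of _ "D powr (1 / p)"] conjI ballI impI)
      show "D powr (1 / p) > 0" using D by simp
      fix v w assume vw: "v \<in> S" "w \<in> S" and lt: "Lnorm (ereal p) (v - w) < D powr (1 / p)"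
      have d: "v - w \<in> Lp \<Omega> (ereal p)" using vw Sp p by (intro Lp_diff) auto
      have "Lint p (v - w) = Lnorm (ereal p) (v - w) powr p" using p by (simp add: Lint_Lnorm)
      also have "\<dots> < (D powr (1 / p)) powr p" using lt p by (intro powr_less_mono2) auto
      also have "\<dots> = D" using D p by (simp add: powr_powr)
      finally have "e powr (1 - p) * Lint p (v - w) < e powr (1 - p) * D" using e by simp
      also have "\<dots> = \<epsilon> / 2 * (e powr (1 - p) * e powr (p - 1))" by (simp add: D_def)
      also have "\<dots> = \<epsilon> / 2" using e by (simp flip: powr_add)
      finally have "e powr (1 - p) * Lint p (v - w) < \<epsilon> / 2" .
      with Lnorm_1_le(2)[OF \<Omega> d p e] em show "Lnorm (ereal 1) (v - w) < \<epsilon>" unfolding m_def Lp1 by linarith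
    qed
  qed (use p \<alpha> in auto)
  then show ?thesis using \<alpha> by (simp add: Lp1)
qed

text \<open>Bounded energy enters here: differences of elements of \<open>S\<close> are bounded in
  an exponent \<open>q > p\<close>, so by interpolation closeness in the first norm gives closeness
  in the norm of exponent \<open>p\<close>.\<close>

lemma minimax_sets_from_L1:
  fixes \<Omega> :: "'a::euclidean_space set"
  assumes \<Omega>: "open \<Omega>" "bounded \<Omega>" "lipschitz_boundary \<Omega>" and p: "1 < p" "p \<le> 1 + 1 / real DIM('a)"
    and \<alpha>: "\<alpha> > 0" and S: "S \<in> minimax_sets \<Omega> 1 1 k" and K: "\<And>v. v \<in> S \<Longrightarrow> v \<in> BV \<Omega> \<and> TV \<Omega> v \<le> K"
  shows "(\<lambda>v. \<alpha> *\<^sub>R v) ` S \<in> minimax_sets \<Omega> (ereal p) \<alpha> k"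
proof -
  obtain q C where q: "q > p" and C: "C > 0"
    and Q: "\<And>v. v \<in> BV \<Omega> \<Longrightarrow> v \<in> Lp \<Omega> (ereal q) \<and> Lint q v \<le> (C * (TV \<Omega> v + Lnorm 1 v)) powr q"
    and P: "\<And>v. v \<in> BV \<Omega> \<Longrightarrow> v \<in> Lp \<Omega> (ereal p)"
    using BV_embedding[OF \<Omega> p] by blast
  have S1: "Lnorm 1 v = 1" if "v \<in> S" for v using S that by (auto simp: minimax_sets_def)
  have "(\<lambda>v. \<alpha> *\<^sub>R v) ` S \<in> minimax_sets \<Omega> (ereal p) (\<alpha> * 1) k"
  proof (rule minimax_sets_scale[OF S[folded Lp1(1)]])
    show "v \<in> Lp \<Omega> (ereal p)" if "v \<in> S" for v using K[OF that] P by blast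
    fix \<epsilon> :: real assume \<epsilon>: "\<epsilon> > 0"
    define D where "D = (C * (2 * \<bar>K\<bar> + 2)) powr q"
    have D: "D > 0" using C by (auto simp: D_def intro!: mult_pos_pos add_nonneg_pos)
    define h where "h = \<epsilon> powr p"
    have h: "h > 0" using \<epsilon> by (simp add: h_def)
    \<comment> \<open>The interpolation level at which the part with exponent \<open>q\<close> is
      \<open>h / 4\<close>; after that \<delta> is chosen for the other part.\<close>
    define L where "L = (h / (4 * D)) powr (1 / (p - q))"
    have L: "L > 0" using h D by (simp add: L_def)
    have LD: "L powr (p - q) * D < h / 2" using h D q by (simp add: L_def powr_powr)
    define \<delta> where "\<delta> = h / (2 * L powr (p - 1))"
    show "\<exists>\<delta>>0. \<forall>v\<in>S. \<forall>w\<in>S. Lnorm (ereal 1) (v - w) < \<delta> \<longrightarrow> Lnorm (ereal p) (v - w) < \<epsilon>"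
    proof (intro exI[of _ \<delta>] conjI ballI impI)
      show "\<delta> > 0" using h L by (simp add: \<delta>_def)
      fix v w assume vw: "v \<in> S" "w \<in> S" and lt: "Lnorm (ereal 1) (v - w) < \<delta>"
      have bv: "v \<in> BV \<Omega>" "w \<in> BV \<Omega>" and t: "TV \<Omega> v \<le> K" "TV \<Omega> w \<le> K" using K vw by auto
      note d = BV_diff[OF \<Omega>(1) bv]
      have d1: "v - w \<in> Lp \<Omega> 1" using d(1) by (simp add: BV_def)
      have n0: "Lnorm 1 (v - w) \<ge> 0" by (simp add: Lnorm_1)
      have "Lint q (v - w) \<le> (C * (TV \<Omega> (v - w) + Lnorm 1 (v - w))) powr q" using Q[OF d(1)] by blast
      also have "\<dots> \<le> D" unfolding D_def
        using d(2,3) t S1[OF vw(1)] S1[OF vw(2)] C q p TV_nonneg[OF \<Omega>(1) d(1)] n0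
        by (intro powr_mono2 mult_left_mono) auto
      finally have "L powr (p - q) * Lint q (v - w) \<le> L powr (p - q) * D" by (intro mult_left_mono) auto
      then have 1: "L powr (p - q) * Lint q (v - w) < h / 2" using LD by linarith
      have "L powr (p - 1) * Lnorm 1 (v - w) < L powr (p - 1) * \<delta>" using lt L by (simp add: Lp1)
      also have "\<dots> = h / 2" using L by (simp add: \<delta>_def)
      finally have 2: "L powr (p - 1) * Lnorm 1 (v - w) < h / 2" .
      have "Lint p (v - w) < h"
        using Lint_interpolation(2)[OF d1 _ L, of q p] Q[OF d(1)] p q 1 2 by simp
      then have "Lnorm (ereal p) (v - w) < h powr (1 / p)"
        unfolding Lnorm_Lint using p by (intro powr_less_mono2) auto
      then show "Lnorm (ereal p) (v - w) < \<epsilon>" using \<epsilon> p by (simp add: h_def powr_powr)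
    qed
  qed (use p \<alpha> in auto)
  then show ?thesis by simp
qed

section \<open>Finiteness of the unperturbed minimax values\<close>

lemma compactin_cross_sphere: "compactin (powertop_real UNIV) (cross_sphere n)"
proof (rule closed_compactin)
  show "compactin (powertop_real UNIV) (\<Pi>\<^sub>E i\<in>(UNIV::nat set). {-1..1::real})"
    by (simp add: compactin_PiE)
  have "x i \<in> {-1..1}" if x: "x \<in> cross_sphere n" for x i
  proof (cases "i \<le> n")
    case True
    have "\<bar>x i\<bar> \<le> (\<Sum>i\<le>n. \<bar>x i\<bar>)" using True by (intro member_le_sum) auto
    then show ?thesis using x by (auto simp: cross_sphere_def)
  next
    case False
    then show ?thesis using x by (auto simp: cross_sphere_def)
  qed
  then show "cross_sphere n \<subseteq> (\<Pi>\<^sub>E i\<in>UNIV. {-1..1})" by auto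
  have p: "continuous_map (powertop_real UNIV) euclideanreal (\<lambda>x. x i)" for i :: nat
    by (rule continuous_map_product_projection) simp
  have "closedin (powertop_real UNIV) {x \<in> topspace (powertop_real UNIV). (\<Sum>i\<le>n. \<bar>x i\<bar>) \<in> {1}}"
    by (rule closedin_continuous_map_preimage[of _ euclideanreal])
       (auto intro!: continuous_map_sum continuous_map_real_abs p)
  moreover have "closedin (powertop_real UNIV) (\<Inter>i\<in>{n<..}. {x \<in> topspace (powertop_real UNIV). x i \<in> {0}})"
    by (intro closedin_INT closedin_continuous_map_preimage[OF p]) auto
  ultimately have "closedin (powertop_real UNIV) ({x \<in> topspace (powertop_real UNIV). (\<Sum>i\<le>n. \<bar>x i\<bar>) \<in> {1}} \<inter>
      (\<Inter>i\<in>{n<..}. {x \<in> topspace (powertop_real UNIV). x i \<in> {0}}))" by (rule closedin_Int)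
  also have "\<dots> = cross_sphere n" by (auto simp: cross_sphere_def)
  finally show "closedin (powertop_real UNIV) (cross_sphere n)" .
qed

text \<open>Combinations of \<open>k\<close> bumps with coefficients on the sum-norm sphere form a
  compact symmetric set of bounded energy. An odd map from it to \<open>j\<close> dimensions would
  pull back to the sphere of dimension \<open>k - 1\<close>, so \<open>k \<le> j\<close>.\<close>

lemma lambda1_finite:
  fixes \<Omega> :: "'a::euclidean_space set"
  assumes \<Omega>: "open \<Omega>" "lipschitz_boundary \<Omega>" "\<Omega> \<noteq> {}" and k: "k \<ge> 1"
  shows "lambda1 \<Omega> k < \<infinity>"
proof -
  obtain n where n: "k = Suc n" using k by (cases k) auto
  obtain f where f: "\<And>i. i < k \<Longrightarrow> f i \<in> test_functions \<Omega>" "\<And>i x. i < k \<Longrightarrow> f i x \<ge> 0" "\<And>i. i < k \<Longrightarrow> (LBINT x. f i x) = 1"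
    and disj: "\<And>i j x. i < k \<Longrightarrow> j < k \<Longrightarrow> j \<noteq> i \<Longrightarrow> f i x * f j x = 0"
    using disjoint_test_functions[OF \<Omega>(1,3), of k] by metis
  define T where "T i = (LBINT x. norm (grad (f i) x))" for i
  define F where "F x = (\<lambda>y. \<Sum>i<k. x i * f i y)" for x
  define g where "g x = abs_L0 (F x)" for x
  have Ft: "F x \<in> test_functions \<Omega>" for x unfolding F_def by (rule sum_test_functions[OF f(1)])
  have fi: "integrable lborel (f i)" if "i < k" for i by (rule integrable_test_function(1)[OF f(1)[OF that]])
  note E = E_TV_test_function[OF \<Omega>(1,2) Ft]
  have lin: "g x - g y = g (\<lambda>i. x i - y i)" "- g x = g (\<lambda>i. - x i)" for x y
  proof -
    have m: "F x \<in> borel_measurable lebesgue" for x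
      using L1_repD(4)[OF E(1)] by (intro measurable_completion) auto
    note r = rep_abs_L0[OF m]
    show "g x - g y = g (\<lambda>i. x i - y i)" unfolding L0_eq_iff g_def
      using r[of x] r[of y] r[of "\<lambda>i. x i - y i"] rep_L0_ops(2)[of "abs_L0 (F x)" "abs_L0 (F y)"]
      by eventually_elim (simp add: F_def left_diff_distrib sum_subtractf)
    show "- g x = g (\<lambda>i. - x i)" unfolding L0_eq_iff g_def
      using r[of x] r[of "\<lambda>i. - x i"] rep_L0_ops(3)[of "abs_L0 (F x)"]
      by eventually_elim (simp add: F_def sum_negf)
  qed
  \<comment> \<open>At each point at most one bump is nonzero, so absolute values may be taken
    inside the sum: \<open>g\<close> is an isometry for the sum norm on the first \<open>k\<close>
    coordinates.\<close>
  have norm: "Lnorm 1 (g x) = (\<Sum>i<k. \<bar>x i\<bar>)" for x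
  proof -
    have "\<bar>F x y\<bar> = (\<Sum>i<k. \<bar>x i\<bar> * f i y)" for y
    proof (cases "\<exists>j<k. f j y \<noteq> 0")
      case True
      then obtain j where j: "j < k" "f j y \<noteq> 0" by blast
      have z: "f i y = 0" if "i < k" "i \<noteq> j" for i using disj[OF j(1) that(1) that(2), of y] j by simp
      have "(\<Sum>i<k. c i * f i y) = c j * f j y" for c :: "nat \<Rightarrow> real"
        by (subst sum.remove[of _ j]) (use j z in auto)
      then show ?thesis using f(2)[OF j(1), of y] by (simp add: F_def abs_mult)
    next
      case False
      then have "\<And>i. i < k \<Longrightarrow> f i y = 0" by blast
      then show ?thesis by (simp add: F_def)
    qed
    then have "Lnorm 1 (g x) = (LBINT y. (\<Sum>i<k. \<bar>x i\<bar> * f i y))"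
      unfolding g_def using L1_repD(6)[OF E(1)[of x]] by simp
    also have "\<dots> = (\<Sum>i<k. \<bar>x i\<bar> * (LBINT y. f i y))"
      using fi by (subst Bochner_Integration.integral_sum) auto
    finally show ?thesis using f(3) by simp
  qed
  have mem: "g x \<in> Lp \<Omega> 1" for x using E(2)[of x] by (simp add: g_def BV_def)
  let ?X = "subtopology (powertop_real UNIV) (cross_sphere n)"
  have cg: "continuous_map ?X (Ltop \<Omega> 1) g"
    unfolding Metric_space.continuous_map_to_metric[OF Lp1(2)]
  proof (intro ballI allI impI)
    interpret B: Metric_space "Lp \<Omega> 1" "Ldist 1 :: 'a L0 \<Rightarrow> _" by (rule Lp1(2))
    fix x and \<epsilon> :: real assume x: "x \<in> topspace ?X" and \<epsilon>: "\<epsilon> > 0"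
    have p: "continuous_map ?X euclideanreal (\<lambda>x. x i)" for i :: nat
      by (rule continuous_map_from_subtopology) (rule continuous_map_product_projection, simp)
    have c: "continuous_map ?X euclideanreal (\<lambda>y. \<Sum>i<k. \<bar>x i - y i\<bar>)"
      by (intro continuous_map_sum continuous_map_real_abs continuous_map_diff p) auto
    show "\<exists>U. openin ?X U \<and> x \<in> U \<and> (\<forall>y\<in>U. g y \<in> B.mball (g x) \<epsilon>)"
    proof (intro exI conjI ballI)
      show "openin ?X {y \<in> topspace ?X. (\<Sum>i<k. \<bar>x i - y i\<bar>) \<in> {..<\<epsilon>}}"
        by (rule openin_continuous_map_preimage[OF c]) auto
      show "x \<in> {y \<in> topspace ?X. (\<Sum>i<k. \<bar>x i - y i\<bar>) \<in> {..<\<epsilon>}}" using x \<epsilon> by simp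
      fix y assume "y \<in> {y \<in> topspace ?X. (\<Sum>i<k. \<bar>x i - y i\<bar>) \<in> {..<\<epsilon>}}"
      then show "g y \<in> B.mball (g x) \<epsilon>" using mem by (simp add: Ldist_def lin norm)
    qed
  qed
  define S where "S = g ` cross_sphere n"
  have sumk: "(\<Sum>i<k. \<bar>x i\<bar>) = 1" if "x \<in> cross_sphere n" for x
    using that by (simp add: cross_sphere_def n lessThan_Suc_atMost)
  have "S \<in> minimax_sets \<Omega> 1 1 k"
    unfolding minimax_sets_def
  proof (intro CollectI conjI)
    show "S \<subseteq> Lp \<Omega> 1" using mem by (auto simp: S_def)
    have "compactin ?X (cross_sphere n)" using compactin_cross_sphere by (simp add: compactin_subtopology)
    from image_compactin[OF this cg] show "compactin (Ltop \<Omega> 1) S" unfolding S_def .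
    show "\<forall>v\<in>S. - v \<in> S" unfolding S_def using lin(2) by auto
    show "\<forall>v\<in>S. Lnorm 1 v = 1" unfolding S_def using norm sumk by auto
    show "enat k \<le> genus (Ltop \<Omega> 1) S"
      unfolding genus_def
    proof (rule Inf_greatest, safe)
      fix j h assume h: "continuous_map (subtopology (Ltop \<Omega> 1) S) (Euclidean_space j) h"
        and nz: "\<forall>v\<in>S. h v \<noteq> (\<lambda>_. 0)" and o: "\<forall>v\<in>S. h (- v) = (\<lambda>i. - h v i)"
      have "continuous_map ?X (subtopology (Ltop \<Omega> 1) S) g"
        using cg by (auto simp: continuous_map_in_subtopology S_def)
      then have hg: "continuous_map ?X (Euclidean_space j) (h \<circ> g)" using h by (rule continuous_map_compose)
      have "Suc n \<le> j"
      proof (rule Borsuk_Ulam_cross_sphere[of j n "h \<circ> g"])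
        fix i
        have "continuous_map ?X (powertop_real UNIV) (h \<circ> g)"
          using hg unfolding Euclidean_space_def by (rule continuous_map_into_fulltopology)
        then show "continuous_map ?X euclideanreal (\<lambda>x. (h \<circ> g) x i)"
          by (auto simp: continuous_map_componentwise_UNIV)
        fix x assume "x \<in> cross_sphere n"
        then have gx: "g x \<in> S" by (simp add: S_def)
        show "(h \<circ> g) (antipode x) i = - (h \<circ> g) x i" using o gx by (simp flip: lin(2))
      next
        fix x assume x: "x \<in> cross_sphere n"
        then have gx: "g x \<in> S" by (simp add: S_def)
        have "(h \<circ> g) x \<in> topspace (Euclidean_space j)"
          using continuous_map_image_subset_topspace[OF hg] x by auto
        then have "\<forall>i\<ge>j. h (g x) i = 0" by (simp add: topspace_Euclidean_space)
        moreover obtain i where "h (g x) i \<noteq> 0" using nz gx by blast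
        ultimately show "\<exists>i<j. (h \<circ> g) x i \<noteq> 0" by (auto simp: not_le[symmetric])
      qed
      then show "enat k \<le> enat j" by (simp add: n)
    qed
  qed
  then have "lambda1 \<Omega> k \<le> (SUP v\<in>S. E_TV \<Omega> v)" unfolding lambda1_def by (intro INF_lower)
  also have "\<dots> \<le> ereal (\<Sum>i<k. \<bar>T i\<bar>)"
  proof (rule SUP_least)
    fix v assume "v \<in> S"
    then obtain x where x: "x \<in> cross_sphere n" "v = g x" by (auto simp: S_def)
    have "E_TV \<Omega> v = tv \<Omega> (F x)" using E(3) x by (simp add: g_def)
    also have "\<dots> \<le> ereal (\<Sum>i<k. \<bar>x i\<bar> * T i)"
      unfolding F_def T_def by (rule tv_sum_le[OF fi tv_test_function[OF f(1)]])
    also have "\<dots> \<le> ereal (\<Sum>i<k. \<bar>T i\<bar>)"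
    proof -
      have "\<bar>x i\<bar> * T i \<le> \<bar>T i\<bar>" if i: "i < k" for i
      proof -
        have "\<bar>x i\<bar> \<le> (\<Sum>i<k. \<bar>x i\<bar>)" using i by (intro member_le_sum) auto
        then have "\<bar>x i\<bar> \<le> 1" using sumk[OF x(1)] by simp
        then have "\<bar>x i\<bar> * \<bar>T i\<bar> \<le> 1 * \<bar>T i\<bar>" by (intro mult_right_mono) auto
        moreover have "\<bar>x i\<bar> * T i \<le> \<bar>x i\<bar> * \<bar>T i\<bar>" by (intro mult_left_mono) auto
        ultimately show ?thesis by simp
      qed
      then show ?thesis by (simp only: ereal_less_eq) (intro sum_mono, simp)
    qed
    finally show "E_TV \<Omega> v \<le> ereal (\<Sum>i<k. \<bar>T i\<bar>)" .
  qed
  finally show ?thesis by (cases "lambda1 \<Omega> k") auto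
qed

lemma lambda1_real:
  fixes \<Omega> :: "'a::euclidean_space set"
  assumes \<Omega>: "open \<Omega>" "lipschitz_boundary \<Omega>" "\<Omega> \<noteq> {}" and k: "k \<ge> 1"
  obtains L where "lambda1 \<Omega> k = ereal L" "L \<ge> 0"
proof -
  have "0 \<le> lambda1 \<Omega> k" unfolding lambda1_def
  proof (rule INF_greatest)
    fix S :: "'a L0 set" assume "S \<in> minimax_sets \<Omega> 1 1 k"
    then obtain v where "v \<in> S" using minimax_sets_nonempty[OF _ k] by blast
    then show "0 \<le> (SUP v\<in>S. E_TV \<Omega> v)" using E_TV_nonneg[OF \<Omega>(1)] by (rule SUP_upper2)
  qed
  with lambda1_finite[OF assms] that show ?thesis by (cases "lambda1 \<Omega> k") auto
qed

section \<open>The perturbed problem\<close>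

text \<open>Apply the embedding to the normalised function. The power \<open>p\<close> from scaling
  back, against the single power of \<alpha> in the energy, is the source of the smallness.\<close>

lemma Lint_energy_bound:
  fixes \<Omega> :: "'a::euclidean_space set"
  assumes \<Omega>: "open \<Omega>" and C1: "C1 > 0" "\<And>v. v \<in> BV \<Omega> \<Longrightarrow> Lnorm 1 v = 1 \<Longrightarrow> Lint p v \<le> C1 * (TV \<Omega> v + 1)"
    and u: "u \<in> BV \<Omega>" "Lnorm 1 u = \<alpha>" "E_TV \<Omega> u \<le> ereal e" and \<alpha>: "\<alpha> > 0"
  shows "Lint p u \<le> \<alpha> powr p * (C1 * (e / \<alpha> + 1))"
proof -
  let ?v = "(1 / \<alpha>) *\<^sub>R u"
  have a: "1 / \<alpha> > 0" using \<alpha> by simp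
  note v = BV_scale[OF \<Omega> u(1) a]
  have "Lnorm 1 ?v = 1" using Lnorm_scale[of 1 "1 / \<alpha>" u] u(2) \<alpha> by (simp add: Lp1)
  note P = C1(2)[OF v(1) this]
  have "ereal (TV \<Omega> u) \<le> ereal e" using E_TV_ge[OF \<Omega> u(1)] u(3) by (rule order_trans)
  then have e: "TV \<Omega> u \<le> e" by simp
  have "TV \<Omega> ?v = TV \<Omega> u / \<alpha>"
    unfolding TV_def v(2) by simp
  then have "TV \<Omega> ?v + 1 \<le> e / \<alpha> + 1" using e \<alpha> by (simp add: divide_right_mono)
  then have "C1 * (TV \<Omega> ?v + 1) \<le> C1 * (e / \<alpha> + 1)" using C1(1) by (intro mult_left_mono) auto
  then have b: "Lint p ?v \<le> C1 * (e / \<alpha> + 1)" using P by linarith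
  have "Lint p u = Lint p (\<alpha> *\<^sub>R ?v)" using \<alpha> by simp
  also have "\<dots> = \<alpha> powr p * Lint p ?v" using Lint_scale(1)[of p \<alpha> ?v] \<alpha> by simp
  also have "\<dots> \<le> \<alpha> powr p * (C1 * (e / \<alpha> + 1))" by (intro mult_left_mono b) auto
  finally show ?thesis .
qed

lemma E_TV_finite:
  assumes "open \<Omega>" "E_TV \<Omega> v < \<infinity>"
  shows "v \<in> BV \<Omega>" "E_TV \<Omega> v = ereal (real_of_ereal (E_TV \<Omega> v))" "0 \<le> real_of_ereal (E_TV \<Omega> v)"
proof -
  show "v \<in> BV \<Omega>" using assms(2) by (auto simp: E_TV_def split: if_splits)
  show "E_TV \<Omega> v = ereal (real_of_ereal (E_TV \<Omega> v))" "0 \<le> real_of_ereal (E_TV \<Omega> v)"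
    using E_TV_nonneg[OF assms(1), of v] assms(2) by (cases "E_TV \<Omega> v"; simp)+
qed

text \<open>Adds to the hypotheses of the problem an embedding constant \<open>C1\<close>, supplied
  by \<open>BV_embedding\<close>, on which \<kappa> depends.\<close>

locale perturbed_problem =
  fixes \<Omega> :: "'a::euclidean_space set" and p CP C1 :: real and E :: "'a L0 \<Rightarrow> real"
  assumes \<Omega>: "open \<Omega>" "bounded \<Omega>" "lipschitz_boundary \<Omega>"
    and p: "1 < p" "p \<le> 1 + 1 / real DIM('a)"
    and CP: "CP > 0" "\<And>v. v \<in> Lp \<Omega> (ereal p) \<Longrightarrow> \<bar>E v\<bar> \<le> CP * Lnorm (ereal p) v powr p"
    and clarke: "\<And>v w. v \<in> Lp \<Omega> (ereal p) \<Longrightarrow> w \<in> clarke_gradient \<Omega> p E v \<Longrightarrow>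
           Lnorm (ereal (p / (p - 1))) w \<le> p * CP * Lnorm (ereal p) v powr (p - 1)"
    and C1: "C1 > 0" "\<And>v. v \<in> BV \<Omega> \<Longrightarrow> Lnorm 1 v = 1 \<Longrightarrow> Lint p v \<le> C1 * (TV \<Omega> v + 1)"
      "\<And>v. v \<in> BV \<Omega> \<Longrightarrow> v \<in> Lp \<Omega> (ereal p)"
begin

text \<open>The size of the perturbation relative to energy plus \<alpha> on functions of norm
  \<alpha>.\<close>

definition \<kappa> :: "real \<Rightarrow> real" where "\<kappa> \<alpha> = CP * C1 * \<alpha> powr (p - 1)"

lemma \<kappa>_nonneg: "\<kappa> \<alpha> \<ge> 0"
  using CP C1 by (simp add: \<kappa>_def)

lemma Lint_small:
  assumes "u \<in> BV \<Omega>" "Lnorm 1 u = \<alpha>" "E_TV \<Omega> u \<le> ereal e" "\<alpha> > 0"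
  shows "CP * Lint p u \<le> \<kappa> \<alpha> * (e + \<alpha>)"
proof -
  have "\<alpha> powr p = \<alpha> powr (p - 1) * \<alpha>" using powr_add[of \<alpha> "p - 1" 1] assms(4) by simp
  then have eq: "\<alpha> powr p * (C1 * (e / \<alpha> + 1)) = \<alpha> powr (p - 1) * C1 * (e + \<alpha>)"
    using assms(4) by (simp add: field_simps)
  have "CP * Lint p u \<le> CP * (\<alpha> powr (p - 1) * C1 * (e + \<alpha>))"
    using Lint_energy_bound[OF \<Omega>(1) C1(1,2) assms] CP(1) unfolding eq by (intro mult_left_mono) auto
  then show ?thesis by (simp add: \<kappa>_def mult_ac)
qed

lemma E_small: "u \<in> BV \<Omega> \<Longrightarrow> \<bar>E u\<bar> \<le> CP * Lint p u"
  using CP(2)[OF C1(3)] p by (simp add: Lint_Lnorm)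

text \<open>On a set where the perturbed functional is at most \<open>m\<close>, a perturbation of
  relative size below 1 can be absorbed into the energy. Normalised, the set competes in
  \<open>lambda1\<close>.\<close>

lemma minimax_lower:
  assumes S: "S \<in> minimax_sets \<Omega> (ereal p) \<alpha> k" and k: "k \<ge> 1" and L: "lambda1 \<Omega> k = ereal L" and \<alpha>: "\<alpha> > 0" "\<kappa> \<alpha> < 1"
  shows "ereal (\<alpha> * ((1 - \<kappa> \<alpha>) * L - \<kappa> \<alpha>)) \<le> (SUP v\<in>S. E_TV \<Omega> v + ereal (E v))"
proof -
  let ?M = "SUP v\<in>S. E_TV \<Omega> v + ereal (E v)"
  have Sn: "Lnorm 1 v = \<alpha>" if "v \<in> S" for v using S that by (auto simp: minimax_sets_def)
  obtain v0 where v0: "v0 \<in> S" using minimax_sets_nonempty[OF S k] by blast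
  have up: "E_TV \<Omega> v + ereal (E v) \<le> ?M" if "v \<in> S" for v by (rule SUP_upper[OF that])
  show ?thesis
  proof (cases ?M)
    case (real m)
    \<comment> \<open>The bound for the normalised energy after the term
      \<open>\<kappa> \<alpha> * e\<close> has been moved to the left.\<close>
    define B where "B = (m / \<alpha> + \<kappa> \<alpha>) / (1 - \<kappa> \<alpha>)"
    have "E_TV \<Omega> ((1 / \<alpha>) *\<^sub>R v) \<le> ereal B" if v: "v \<in> S" for v
    proof -
      have le: "E_TV \<Omega> v + ereal (E v) \<le> ereal m" using up[OF v] real by simp
      then have fin: "E_TV \<Omega> v < \<infinity>" by (cases "E_TV \<Omega> v") auto
      define e where "e = real_of_ereal (E_TV \<Omega> v)"
      note F = E_TV_finite[OF \<Omega>(1) fin, folded e_def]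
      have "\<bar>E v\<bar> \<le> \<kappa> \<alpha> * (e + \<alpha>)"
        using E_small[OF F(1)] Lint_small[OF F(1) Sn[OF v] _ \<alpha>(1), of e] F(2) by simp
      moreover have "e + E v \<le> m" using le F(2) by simp
      ultimately have "(1 - \<kappa> \<alpha>) * e \<le> m + \<kappa> \<alpha> * \<alpha>" by (simp add: algebra_simps)
      then have "(1 - \<kappa> \<alpha>) * e / \<alpha> \<le> (m + \<kappa> \<alpha> * \<alpha>) / \<alpha>" using \<alpha>(1) by (simp add: divide_right_mono)
      also have "\<dots> = m / \<alpha> + \<kappa> \<alpha>" using \<alpha>(1) by (simp add: add_divide_distrib)
      finally have "(1 - \<kappa> \<alpha>) * (e / \<alpha>) \<le> m / \<alpha> + \<kappa> \<alpha>" by simp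
      then have "e / \<alpha> \<le> B" using \<alpha>(2) by (simp add: B_def pos_le_divide_eq mult.commute)
      moreover have "E_TV \<Omega> ((1 / \<alpha>) *\<^sub>R v) = ereal (e / \<alpha>)"
        using E_TV_scale[OF \<Omega>, of "1 / \<alpha>" v] \<alpha>(1) F(2) by simp
      ultimately show ?thesis by simp
    qed
    moreover have "lambda1 \<Omega> k \<le> (SUP v\<in>(\<lambda>v. (1 / \<alpha>) *\<^sub>R v) ` S. E_TV \<Omega> v)"
      unfolding lambda1_def by (rule INF_lower[OF minimax_sets_to_L1[OF \<Omega>(1,2) p(1) \<alpha>(1) S]])
    moreover have "\<dots> \<le> ereal B" using calculation(1) by (intro SUP_least) auto
    ultimately have "ereal L \<le> ereal B" using L by (metis order_trans)
    then have "(1 - \<kappa> \<alpha>) * L \<le> m / \<alpha> + \<kappa> \<alpha>" using \<alpha>(2) by (simp add: B_def pos_le_divide_eq mult.commute)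
    then have "(1 - \<kappa> \<alpha>) * L - \<kappa> \<alpha> \<le> m / \<alpha>" by simp
    then have "\<alpha> * ((1 - \<kappa> \<alpha>) * L - \<kappa> \<alpha>) \<le> m" using \<alpha>(1) by (simp add: pos_le_divide_eq mult.commute)
    then show ?thesis using real by simp
  next
    \<comment> \<open>Excluded, since the energy is nonnegative, the perturbation is finite and
      \<open>S\<close> has an element.\<close>
    case MInf
    with up[OF v0] E_TV_nonneg[OF \<Omega>(1), of v0] show ?thesis by (cases "E_TV \<Omega> v0") auto
  qed simp
qed

text \<open>A competitor for \<open>lambda1\<close> of bounded energy is scaled by \<alpha>; the
  energy scales exactly and the perturbation adds at most its relative size.\<close>

lemma minimax_upper:
  assumes S: "S \<in> minimax_sets \<Omega> 1 1 k" and N: "\<And>v. v \<in> S \<Longrightarrow> E_TV \<Omega> v \<le> ereal N" and \<alpha>: "\<alpha> > 0"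
  shows "c_minimax \<Omega> p E k \<alpha> \<le> ereal (\<alpha> * ((1 + \<kappa> \<alpha>) * N + \<kappa> \<alpha>))"
proof -
  have Sn: "Lnorm 1 v = 1" if "v \<in> S" for v using S that by (auto simp: minimax_sets_def)
  have BV: "v \<in> BV \<Omega> \<and> TV \<Omega> v \<le> N" if v: "v \<in> S" for v
  proof -
    have "E_TV \<Omega> v < \<infinity>" using N[OF v] by (cases "E_TV \<Omega> v") auto
    note F = E_TV_finite(1)[OF \<Omega>(1) this]
    have "ereal (TV \<Omega> v) \<le> ereal N" using E_TV_ge[OF \<Omega>(1) F] N[OF v] by (rule order_trans)
    with F show ?thesis by simp
  qed
  have "c_minimax \<Omega> p E k \<alpha> \<le> (SUP v\<in>(\<lambda>v. \<alpha> *\<^sub>R v) ` S. E_TV \<Omega> v + ereal (E v))"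
    unfolding c_minimax_def by (rule INF_lower[OF minimax_sets_from_L1[OF \<Omega> p \<alpha> S BV]])
  also have "\<dots> \<le> ereal (\<alpha> * ((1 + \<kappa> \<alpha>) * N + \<kappa> \<alpha>))"
  proof (rule SUP_least, safe)
    fix v assume v: "v \<in> S"
    have fin: "E_TV \<Omega> v < \<infinity>" using N[OF v] by (cases "E_TV \<Omega> v") auto
    define e where "e = real_of_ereal (E_TV \<Omega> v)"
    note F = E_TV_finite[OF \<Omega>(1) fin, folded e_def]
    have e: "e \<le> N" using N[OF v] F(2) by simp
    have bv: "\<alpha> *\<^sub>R v \<in> BV \<Omega>" by (rule BV_scale(1)[OF \<Omega>(1) F(1) \<alpha>])
    have n: "Lnorm 1 (\<alpha> *\<^sub>R v) = \<alpha>" using Lnorm_scale[of 1 \<alpha> v] Sn[OF v] \<alpha> by (simp add: Lp1)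
    have E1: "E_TV \<Omega> (\<alpha> *\<^sub>R v) = ereal (\<alpha> * e)" using E_TV_scale[OF \<Omega> \<alpha>, of v] F(2) by simp
    have "\<bar>E (\<alpha> *\<^sub>R v)\<bar> \<le> \<kappa> \<alpha> * (\<alpha> * e + \<alpha>)"
      using E_small[OF bv] Lint_small[OF bv n _ \<alpha>, of "\<alpha> * e"] E1 by simp
    then have "\<alpha> * e + E (\<alpha> *\<^sub>R v) \<le> \<alpha> * ((1 + \<kappa> \<alpha>) * e + \<kappa> \<alpha>)" by (simp add: algebra_simps)
    also have "\<dots> \<le> \<alpha> * ((1 + \<kappa> \<alpha>) * N + \<kappa> \<alpha>)"
      using e \<kappa>_nonneg[of \<alpha>] \<alpha> by (intro mult_left_mono add_right_mono) auto
    finally show "E_TV \<Omega> (\<alpha> *\<^sub>R v) + ereal (E (\<alpha> *\<^sub>R v)) \<le> ereal (\<alpha> * ((1 + \<kappa> \<alpha>) * N + \<kappa> \<alpha>))"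
      using E1 by simp
  qed
  finally show ?thesis .
qed

lemma minimax_value:
  assumes k: "k \<ge> 1" and L: "lambda1 \<Omega> k = ereal L" and \<alpha>: "\<alpha> > 0" "\<kappa> \<alpha> < 1"
  obtains c where "c_minimax \<Omega> p E k \<alpha> = ereal c" "\<alpha> * ((1 - \<kappa> \<alpha>) * L - \<kappa> \<alpha>) \<le> c" "c \<le> \<alpha> * ((1 + \<kappa> \<alpha>) * L + \<kappa> \<alpha>)"
proof -
  have lo: "ereal (\<alpha> * ((1 - \<kappa> \<alpha>) * L - \<kappa> \<alpha>)) \<le> c_minimax \<Omega> p E k \<alpha>"
    unfolding c_minimax_def by (rule INF_greatest) (rule minimax_lower[OF _ k L \<alpha>])
  \<comment> \<open>The infimum \<open>L\<close> need not be attained, so nearly optimal sets are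
    used and \<open>e\<close> is removed afterwards.\<close>
  have up: "c_minimax \<Omega> p E k \<alpha> \<le> ereal (\<alpha> * ((1 + \<kappa> \<alpha>) * (L + e) + \<kappa> \<alpha>))" if e: "e > 0" for e
  proof -
    have "lambda1 \<Omega> k < ereal (L + e)" using L e by simp
    then obtain S where S: "S \<in> minimax_sets \<Omega> 1 1 k" "(SUP v\<in>S. E_TV \<Omega> v) < ereal (L + e)"
      unfolding lambda1_def INF_less_iff by blast
    show ?thesis
      by (rule minimax_upper[OF S(1) _ \<alpha>(1)]) (use S(2) in \<open>auto intro: order_trans[OF SUP_upper less_imp_le]\<close>)
  qed
  obtain c where c: "c_minimax \<Omega> p E k \<alpha> = ereal c" using lo up[of 1] by (cases "c_minimax \<Omega> p E k \<alpha>") auto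
  have pos: "\<alpha> * (1 + \<kappa> \<alpha>) > 0" using \<alpha> \<kappa>_nonneg[of \<alpha>] by simp
  have "c \<le> \<alpha> * ((1 + \<kappa> \<alpha>) * L + \<kappa> \<alpha>)"
  proof (rule field_le_epsilon)
    fix e :: real assume "e > 0"
    then have "c \<le> \<alpha> * ((1 + \<kappa> \<alpha>) * (L + e / (\<alpha> * (1 + \<kappa> \<alpha>))) + \<kappa> \<alpha>)"
      using up[of "e / (\<alpha> * (1 + \<kappa> \<alpha>))"] pos c by simp
    also have "\<dots> = \<alpha> * ((1 + \<kappa> \<alpha>) * L + \<kappa> \<alpha>) + (\<alpha> * (1 + \<kappa> \<alpha>)) * (e / (\<alpha> * (1 + \<kappa> \<alpha>)))"
      by (simp only: distrib_left distrib_right mult_1_left ac_simps)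
    also have "(\<alpha> * (1 + \<kappa> \<alpha>)) * (e / (\<alpha> * (1 + \<kappa> \<alpha>))) = e"
      using pos by (intro nonzero_mult_div_cancel_left[THEN trans[OF times_divide_eq_right]]) auto
    finally show "c \<le> \<alpha> * ((1 + \<kappa> \<alpha>) * L + \<kappa> \<alpha>) + e" .
  qed
  with lo c that show ?thesis by simp
qed

text \<open>Multiplying the eigenvalue equation by \<open>u\<close> and integrating gives
  \<open>\<mu> * \<alpha>\<close> as the energy plus the pairing with the generalized gradient,
  while \<open>c\<close> is the energy plus the perturbation. The two differ by at most
  \<open>(1 + p) * I\<close>, with \<open>I\<close> being \<open>CP\<close> times the integral of
  the power \<open>p\<close>.\<close>

lemma eigenvalue_estimate:
  assumes u: "eigenfunction \<Omega> p E \<alpha> u" "perturbed_functional \<Omega> E \<alpha> u = ereal c" "eigenvalue \<Omega> p E u \<mu>"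
    and \<kappa>: "\<kappa> \<alpha> \<le> 1 / 2" and c: "c \<le> \<alpha> * B"
  shows "Lnorm 1 u = \<alpha>" "\<bar>\<mu> - c / \<alpha>\<bar> \<le> (1 + p) * (\<kappa> \<alpha> * (2 * B + 2))" "Lint p u \<le> \<kappa> \<alpha> * \<alpha> * (2 * B + 2) / CP"
proof -
  have \<alpha>: "\<alpha> > 0" and up: "u \<in> Lp \<Omega> (ereal p)" using u(1) by (auto simp: eigenfunction_def critical_point_def)
  have fin: "E_TV \<Omega> u < \<infinity>" using u(2) unfolding perturbed_functional_def
    by (cases "E_TV \<Omega> u") (auto split: if_splits)
  define e where "e = real_of_ereal (E_TV \<Omega> u)"
  note F = E_TV_finite[OF \<Omega>(1) fin, folded e_def]
  show n: "Lnorm 1 u = \<alpha>" using u(2) F(2) unfolding perturbed_functional_def by (auto split: if_splits)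
  have ec: "e + E u = c" using u(2) F(2) n unfolding perturbed_functional_def by simp
  define I where "I = CP * Lint p u"
  have I0: "I \<ge> 0" using CP by (simp add: I_def)
  have Iu: "I \<le> \<kappa> \<alpha> * (e + \<alpha>)" unfolding I_def using Lint_small[OF F(1) n _ \<alpha>, of e] F(2) by simp
  \<comment> \<open>With \<kappa> at most a half, the perturbation is absorbed and the energy is
    bounded by \<open>2 * c + \<alpha>\<close>, hence by a multiple of \<alpha>.\<close>
  also have "\<dots> \<le> 1 / 2 * (e + \<alpha>)" using \<kappa> F(3) \<alpha> by (intro mult_right_mono) auto
  finally have "I \<le> e / 2 + \<alpha> / 2" by simp
  moreover have Eu: "\<bar>E u\<bar> \<le> I" using E_small[OF F(1)] by (simp add: I_def)
  ultimately have "e \<le> 2 * c + \<alpha>" using ec by linarith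
  then have "e + \<alpha> \<le> \<alpha> * (2 * B + 2)" using c by (simp add: algebra_simps)
  then have "\<kappa> \<alpha> * (e + \<alpha>) \<le> \<kappa> \<alpha> * (\<alpha> * (2 * B + 2))" using \<kappa>_nonneg by (intro mult_left_mono) auto
  then have IB: "I \<le> \<alpha> * (\<kappa> \<alpha> * (2 * B + 2))" using Iu by (simp add: mult_ac)
  then show "Lint p u \<le> \<kappa> \<alpha> * \<alpha> * (2 * B + 2) / CP"
    using CP by (simp add: I_def pos_le_divide_eq mult_ac)
  obtain s w us where s: "AE x in lebesgue_on \<Omega>. rep_L0 s x \<in> Sgn (rep_L0 u x)"
    and w: "w \<in> Lp \<Omega> (ereal (p / (p - 1)))" "E_TV \<Omega> u = ereal (- pairing u w)"
    and us: "us \<in> clarke_gradient \<Omega> p E u" and eq: "- w + us = \<mu> *\<^sub>R s"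
    using u(3) unfolding eigenvalue_def by blast
  have us': "us \<in> Lp \<Omega> (ereal (p / (p - 1)))" using us by (simp add: clarke_gradient_def)
  note Hw = pairing_Hoelder[OF w(1) up p(1) refl] and Hu = pairing_Hoelder[OF us' up p(1) refl]
  have "\<Omega> \<in> sets lebesgue" using \<Omega>(1) by auto
  with s have s': "AE x in lebesgue. x \<in> \<Omega> \<longrightarrow> rep_L0 s x \<in> Sgn (rep_L0 u x)"
    by (subst (asm) AE_restrict_space_iff) auto
  have z: "AE x in lebesgue. x \<notin> \<Omega> \<longrightarrow> rep_L0 u x = 0" using up by (simp add: Lp_finite_iff)
  \<comment> \<open>On \<Omega> the sign condition makes \<open>s\<close> times \<open>u\<close> the
    absolute value of \<open>u\<close>; outside both sides vanish with \<open>u\<close>. So the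
    integral of the right side is \<mu> times the first norm.\<close>
  have q: "AE x in lebesgue. rep_L0 us x * rep_L0 u x - rep_L0 w x * rep_L0 u x = \<mu> * \<bar>rep_L0 u x\<bar>"
    using s' z rep_L0_ops(1)[of "- w" us] rep_L0_ops(3)[of w] rep_L0_ops(4)[of \<mu> s]
  proof eventually_elim
    case (elim x)
    have 1: "rep_L0 us x - rep_L0 w x = \<mu> * rep_L0 s x" using elim(3-5) eq by simp
    have 2: "rep_L0 s x * rep_L0 u x = \<bar>rep_L0 u x\<bar>"
      using elim(1,2) by (cases "x \<in> \<Omega>") (auto simp: Sgn_def split: if_splits)
    have "rep_L0 us x * rep_L0 u x - rep_L0 w x * rep_L0 u x = (rep_L0 us x - rep_L0 w x) * rep_L0 u x"
      by (simp add: left_diff_distrib)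
    also have "\<dots> = \<mu> * (rep_L0 s x * rep_L0 u x)" unfolding 1 by simp
    finally show ?case unfolding 2 .
  qed
  have "pairing us u - pairing w u = (\<integral>x. rep_L0 us x * rep_L0 u x - rep_L0 w x * rep_L0 u x \<partial>lebesgue)"
    using Hw(1) Hu(1) by (simp add: pairing_def)
  also have "\<dots> = (\<integral>x. \<mu> * \<bar>rep_L0 u x\<bar> \<partial>lebesgue)"
    using q borel_measurable_rep_L0 by (intro integral_cong_AE) auto
  also have "\<dots> = \<mu> * \<alpha>" using n by (simp add: Lnorm_1)
  finally have "pairing us u - pairing w u = \<mu> * \<alpha>" .
  moreover have "e = - pairing w u"
    using w(2) F(2) by (simp add: pairing_def mult.commute)
  ultimately have \<mu>: "\<mu> * \<alpha> = e + pairing us u" by simp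
  have "\<bar>pairing us u\<bar> \<le> Lnorm (ereal (p / (p - 1))) us * Lnorm (ereal p) u" by (rule Hu(2))
  also have "\<dots> \<le> p * CP * Lnorm (ereal p) u powr (p - 1) * Lnorm (ereal p) u"
    by (intro mult_right_mono clarke up us) auto
  also have "\<dots> = p * I"
  proof -
    have "Lnorm (ereal p) u powr (p - 1) * Lnorm (ereal p) u = Lnorm (ereal p) u powr p"
      using powr_add[of "Lnorm (ereal p) u" "p - 1" 1] by (cases "Lnorm (ereal p) u = 0") (auto simp: less_le)
    then show ?thesis using p by (simp add: I_def Lint_Lnorm)
  qed
  finally have "\<bar>\<mu> * \<alpha> - c\<bar> \<le> (1 + p) * I" using Eu ec \<mu> by (simp add: distrib_right)
  also have "\<dots> \<le> (1 + p) * (\<alpha> * (\<kappa> \<alpha> * (2 * B + 2)))" using IB p by (intro mult_left_mono) auto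
  finally have le: "\<bar>\<mu> * \<alpha> - c\<bar> \<le> \<alpha> * ((1 + p) * (\<kappa> \<alpha> * (2 * B + 2)))" by (simp add: mult_ac)
  have "\<bar>\<mu> - c / \<alpha>\<bar> * \<alpha> = \<bar>(\<mu> - c / \<alpha>) * \<alpha>\<bar>" using \<alpha> by (simp add: abs_mult)
  also have "\<dots> = \<bar>\<mu> * \<alpha> - c\<bar>" using \<alpha> by (simp add: left_diff_distrib)
  finally have "\<bar>\<mu> - c / \<alpha>\<bar> * \<alpha> \<le> (1 + p) * (\<kappa> \<alpha> * (2 * B + 2)) * \<alpha>" using le by (simp add: mult_ac)
  then show "\<bar>\<mu> - c / \<alpha>\<bar> \<le> (1 + p) * (\<kappa> \<alpha> * (2 * B + 2))" using \<alpha> by simp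
qed

section \<open>Limits for vanishing parameter\<close>

lemma \<kappa>_tendsto_0: "(\<kappa> \<longlongrightarrow> 0) (at_right 0)"
proof -
  have "((\<lambda>\<alpha>. \<alpha> powr (p - 1)) \<longlongrightarrow> 0) (at_right 0)" using p(1) by real_asymp
  from tendsto_mult[OF tendsto_const[of "CP * C1"] this] show ?thesis unfolding \<kappa>_def by simp
qed

lemma small_parameter:
  assumes "\<epsilon> > 0"
  shows "\<forall>\<^sub>F \<alpha> in at_right 0. \<alpha> > 0 \<and> \<kappa> \<alpha> < \<epsilon>"
  using order_tendstoD(2)[OF \<kappa>_tendsto_0 assms] eventually_at_right_less[of "0::real"]
  by eventually_elim simp

definition c_real :: "nat \<Rightarrow> real \<Rightarrow> real" where
  "c_real k \<alpha> = real_of_ereal (c_minimax \<Omega> p E k \<alpha>)"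

lemma c_real:
  assumes k: "k \<ge> 1" and L: "lambda1 \<Omega> k = ereal L" and \<alpha>: "\<alpha> > 0" "\<kappa> \<alpha> < 1"
  shows "c_minimax \<Omega> p E k \<alpha> = ereal (c_real k \<alpha>)" "(1 - \<kappa> \<alpha>) * L - \<kappa> \<alpha> \<le> c_real k \<alpha> / \<alpha>"
    "c_real k \<alpha> / \<alpha> \<le> (1 + \<kappa> \<alpha>) * L + \<kappa> \<alpha>"
proof -
  obtain c where "c_minimax \<Omega> p E k \<alpha> = ereal c" "\<alpha> * ((1 - \<kappa> \<alpha>) * L - \<kappa> \<alpha>) \<le> c" "c \<le> \<alpha> * ((1 + \<kappa> \<alpha>) * L + \<kappa> \<alpha>)"
    by (rule minimax_value[OF assms])
  then show "c_minimax \<Omega> p E k \<alpha> = ereal (c_real k \<alpha>)" "(1 - \<kappa> \<alpha>) * L - \<kappa> \<alpha> \<le> c_real k \<alpha> / \<alpha>"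
    "c_real k \<alpha> / \<alpha> \<le> (1 + \<kappa> \<alpha>) * L + \<kappa> \<alpha>"
    using \<alpha>(1) by (simp_all add: c_real_def pos_le_divide_eq pos_divide_le_eq mult.commute)
qed

lemma c_real_tendsto:
  assumes k: "k \<ge> 1" and L: "lambda1 \<Omega> k = ereal L"
  shows "((\<lambda>\<alpha>. c_real k \<alpha> / \<alpha>) \<longlongrightarrow> L) (at_right 0)"
proof (rule tendsto_sandwich)
  show "\<forall>\<^sub>F \<alpha> in at_right 0. (1 - \<kappa> \<alpha>) * L - \<kappa> \<alpha> \<le> c_real k \<alpha> / \<alpha>"
    using small_parameter[OF zero_less_one] by eventually_elim (auto intro: c_real[OF k L])
  show "\<forall>\<^sub>F \<alpha> in at_right 0. c_real k \<alpha> / \<alpha> \<le> (1 + \<kappa> \<alpha>) * L + \<kappa> \<alpha>"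
    using small_parameter[OF zero_less_one] by eventually_elim (auto intro: c_real[OF k L])
  have "((\<lambda>\<alpha>. (1 - \<kappa> \<alpha>) * L - \<kappa> \<alpha>) \<longlongrightarrow> (1 - 0) * L - 0) (at_right 0)" by (intro tendsto_intros \<kappa>_tendsto_0)
  then show "((\<lambda>\<alpha>. (1 - \<kappa> \<alpha>) * L - \<kappa> \<alpha>) \<longlongrightarrow> L) (at_right 0)" by simp
  have "((\<lambda>\<alpha>. (1 + \<kappa> \<alpha>) * L + \<kappa> \<alpha>) \<longlongrightarrow> (1 + 0) * L + 0) (at_right 0)" by (intro tendsto_intros \<kappa>_tendsto_0)
  then show "((\<lambda>\<alpha>. (1 + \<kappa> \<alpha>) * L + \<kappa> \<alpha>) \<longlongrightarrow> L) (at_right 0)" by simp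
qed

lemma c_minimax_tendsto:
  assumes k: "k \<ge> 1" and L: "lambda1 \<Omega> k = ereal L"
  shows "((\<lambda>\<alpha>. c_minimax \<Omega> p E k \<alpha> / ereal \<alpha>) \<longlongrightarrow> ereal L) (at_right 0)"
proof -
  have "\<forall>\<^sub>F \<alpha> in at_right 0. ereal (c_real k \<alpha> / \<alpha>) = c_minimax \<Omega> p E k \<alpha> / ereal \<alpha>"
    using small_parameter[OF zero_less_one] by eventually_elim (simp add: c_real[OF k L])
  moreover have "((\<lambda>\<alpha>. ereal (c_real k \<alpha> / \<alpha>)) \<longlongrightarrow> ereal L) (at_right 0)"
    using c_real_tendsto[OF assms] by simp
  ultimately show ?thesis by (rule Lim_transform_eventually[rotated])
qed

text \<open>The eigenvalues stay within a multiple of \<kappa> of the quotients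
  \<open>c_real k \<alpha> / \<alpha>\<close>, and the same bound shows that the eigenfunctions
  shrink in the norm of exponent \<open>p\<close>; a sequence of parameters tending to 0 then
  exhibits the bifurcation.\<close>

lemma eigenvalue_branch:
  assumes k: "k \<ge> 1" and L: "lambda1 \<Omega> k = ereal L"
    and ev: "\<forall>\<^sub>F \<alpha> in at_right 0. eigenfunction \<Omega> p E \<alpha> (u \<alpha>) \<and>
      perturbed_functional \<Omega> E \<alpha> (u \<alpha>) = c_minimax \<Omega> p E k \<alpha> \<and> eigenvalue \<Omega> p E (u \<alpha>) (l \<alpha>)"
  shows "(l \<longlongrightarrow> L) (at_right 0)" "bifurcation_value \<Omega> p E L"
proof -
  \<comment> \<open>Bounds the quotients of minimax value and parameter once \<kappa> is below a
    half.\<close>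
  define B where "B = 2 * \<bar>L\<bar> + 1"
  have main: "\<forall>\<^sub>F \<alpha> in at_right 0. (\<alpha> > 0 \<and> eigenfunction \<Omega> p E \<alpha> (u \<alpha>) \<and> eigenvalue \<Omega> p E (u \<alpha>) (l \<alpha>)) \<and>
      Lnorm 1 (u \<alpha>) = \<alpha> \<and> \<bar>l \<alpha> - c_real k \<alpha> / \<alpha>\<bar> \<le> (1 + p) * (\<kappa> \<alpha> * (2 * B + 2)) \<and>
      Lint p (u \<alpha>) \<le> \<kappa> \<alpha> * \<alpha> * (2 * B + 2) / CP"
    using ev small_parameter[of "1 / 2", simplified]
  proof eventually_elim
    case (elim \<alpha>)
    then have \<alpha>: "\<alpha> > 0" "\<kappa> \<alpha> < 1" "\<kappa> \<alpha> \<le> 1 / 2" by auto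
    have "(1 + \<kappa> \<alpha>) * L \<le> (1 + \<kappa> \<alpha>) * \<bar>L\<bar>"
      using \<kappa>_nonneg[of \<alpha>] by (intro mult_left_mono) auto
    then have "c_real k \<alpha> / \<alpha> \<le> (1 + \<kappa> \<alpha>) * \<bar>L\<bar> + \<kappa> \<alpha>"
      using c_real(3)[OF k L \<alpha>(1,2)] by linarith
    also have "\<dots> \<le> 2 * \<bar>L\<bar> + 1" using \<alpha> by (intro add_mono mult_right_mono) auto
    finally have "c_real k \<alpha> \<le> \<alpha> * B" using \<alpha>(1) by (simp add: B_def pos_divide_le_eq mult.commute)
    from eigenvalue_estimate[OF _ _ _ \<alpha>(3) this, of "u \<alpha>" "l \<alpha>"] elim \<alpha>
    show ?case by (simp add: c_real(1)[OF k L \<alpha>(1,2)])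
  qed
  have z: "((\<lambda>\<alpha>. (1 + p) * (\<kappa> \<alpha> * (2 * B + 2))) \<longlongrightarrow> 0) (at_right 0)"
  proof -
    have "((\<lambda>\<alpha>. (1 + p) * (\<kappa> \<alpha> * (2 * B + 2))) \<longlongrightarrow> (1 + p) * (0 * (2 * B + 2))) (at_right 0)"
      by (intro tendsto_intros \<kappa>_tendsto_0)
    then show ?thesis by simp
  qed
  have "((\<lambda>\<alpha>. l \<alpha> - c_real k \<alpha> / \<alpha>) \<longlongrightarrow> 0) (at_right 0)"
    by (rule Lim_null_comparison[OF _ z]) (use main in \<open>auto elim: eventually_mono\<close>)
  from tendsto_add[OF this c_real_tendsto[OF k L]]
  show lim: "(l \<longlongrightarrow> L) (at_right 0)" by simp
  have z2: "((\<lambda>\<alpha>. \<kappa> \<alpha> * \<alpha> * (2 * B + 2) / CP) \<longlongrightarrow> 0) (at_right 0)"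
  proof -
    have "((\<lambda>\<alpha>. \<kappa> \<alpha> * \<alpha> * (2 * B + 2) / CP) \<longlongrightarrow> 0 * 0 * (2 * B + 2) / CP) (at_right 0)"
      using CP(1) by (intro tendsto_intros \<kappa>_tendsto_0 tendsto_ident_at) auto
    then show ?thesis by simp
  qed
  have "((\<lambda>\<alpha>. Lint p (u \<alpha>)) \<longlongrightarrow> 0) (at_right 0)"
    by (rule Lim_null_comparison[OF _ z2]) (use main in \<open>auto elim: eventually_mono\<close>)
  then have zero: "((\<lambda>\<alpha>. Lnorm (ereal p) (u \<alpha>)) \<longlongrightarrow> 0) (at_right 0)"
    unfolding Lnorm_Lint using p by (intro tendsto_zero_powrI[where b = "1 / p"]) auto
  obtain b where b: "b > 0" "\<And>\<alpha>. 0 < \<alpha> \<Longrightarrow> \<alpha> < b \<Longrightarrow> eigenfunction \<Omega> p E \<alpha> (u \<alpha>) \<and> eigenvalue \<Omega> p E (u \<alpha>) (l \<alpha>) \<and>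
      Lnorm 1 (u \<alpha>) = \<alpha>"
    using main unfolding eventually_at_right_field by blast
  \<comment> \<open>The shift by 2 keeps every parameter strictly inside \<open>(0, b)\<close>, also
    for \<open>j = 0\<close>.\<close>
  define a where "a j = b / (real j + 2)" for j
  have a: "0 < a j" "a j < b" for j using b(1) by (auto simp: a_def pos_divide_less_eq)
  have "a \<longlonglongrightarrow> 0" unfolding a_def by real_asymp
  then have fl: "filterlim a (at_right 0) sequentially"
    using a(1) by (auto simp: filterlim_at less_imp_neq[symmetric])
  show "bifurcation_value \<Omega> p E L"
    unfolding bifurcation_value_def
  proof (intro exI[of _ "\<lambda>j. l (a j)"] exI[of _ "\<lambda>j. u (a j)"] conjI allI)
    fix j
    note B = b(2)[OF a(1,2)[of j]]
    show "u (a j) \<noteq> 0"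
    proof
      assume "u (a j) = 0"
      then have "Lnorm 1 (u (a j)) = 0" using Lnorm_scale[of 1 0 "u (a j)"] by (simp add: Lp1)
      then show False using B a(1)[of j] by simp
    qed
    show "eigenfunction \<Omega> p E (Lnorm 1 (u (a j))) (u (a j))" "eigenvalue \<Omega> p E (u (a j)) (l (a j))"
      using B by auto
  next
    show "(\<lambda>j. l (a j)) \<longlonglongrightarrow> L" by (rule filterlim_compose[OF lim fl])
    show "(\<lambda>j. Lnorm (ereal p) (u (a j))) \<longlonglongrightarrow> 0" by (rule filterlim_compose[OF zero fl])
  qed
qed

end

text \<open>The exponent of \<alpha> is at least \<open>1 / n\<close>, because
  \<open>(n - 1) * (1 + 1 / n) = n - 1 / n\<close>; so the left side tends to 0 while the right side
  is a positive constant.\<close>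

lemma eventually_below_threshold:
  fixes n p C D :: real
  assumes "n \<ge> 1" "1 < p" "p \<le> 1 + 1 / n" "C > 0" "D > 0"
  shows "\<forall>\<^sub>F \<alpha> in at_right 0. \<alpha> > 0 \<and> \<alpha> powr (n - (n - 1) * p) < inverse C * D powr (- (p - 1) * n)"
proof -
  have "(n - 1) * p \<le> (n - 1) * (1 + 1 / n)" using assms by (intro mult_left_mono) auto
  also have "\<dots> = n - 1 / n" using assms by (simp add: field_simps)
  also have "\<dots> < n" using assms by simp
  finally have "n - (n - 1) * p > 0" by simp
  moreover define e where "e = n - (n - 1) * p"
  ultimately have "((\<lambda>\<alpha>. \<alpha> powr e) \<longlongrightarrow> 0) (at_right 0)" by simp real_asymp
  moreover have "inverse C * D powr (- (p - 1) * n) > 0" using assms by simp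
  ultimately have "\<forall>\<^sub>F \<alpha> in at_right 0. \<alpha> powr e < inverse C * D powr (- (p - 1) * n)" by (rule order_tendstoD(2))
  with eventually_at_right_less[of "0::real"] show ?thesis unfolding e_def by eventually_elim simp
qed

theorem theorem3p6:
  fixes \<Omega> :: "(real ^ 'n) set" and p C_Per :: real and E_Per :: "(real ^ 'n) L0 \<Rightarrow> real"
  assumes "open \<Omega>" and "bounded \<Omega>" and "\<Omega> \<noteq> {}" and "lipschitz_boundary \<Omega>"
    and "1 < p" and "p \<le> 1 + 1 / real CARD('n)"
    and "locally_lipschitz_Lp \<Omega> (ereal p) E_Per"
    and "\<And>v. v \<in> Lp \<Omega> (ereal p) \<Longrightarrow> E_Per (- v) = E_Per v"
    and "C_Per > 0"
    and "\<And>v. v \<in> Lp \<Omega> (ereal p) \<Longrightarrow> \<bar>E_Per v\<bar> \<le> C_Per * Lnorm (ereal p) v powr p"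
    and "\<And>v w. v \<in> Lp \<Omega> (ereal p) \<Longrightarrow> w \<in> clarke_gradient \<Omega> p E_Per v \<Longrightarrow>
           Lnorm (ereal (p / (p - 1))) w \<le> p * C_Per * Lnorm (ereal p) v powr (p - 1)"
  shows "\<forall>k\<ge>1. \<exists>\<mu>::real. lambda1 \<Omega> k = ereal \<mu> \<and>
    ((\<lambda>\<alpha>. c_minimax \<Omega> p E_Per k \<alpha> / ereal \<alpha>) \<longlongrightarrow> ereal \<mu>) (at_right 0) \<and>
    (\<forall>u l.
       (\<forall>\<alpha>>0. \<alpha> powr (real CARD('n) - (real CARD('n) - 1) * p)
                 < inverse C_Per * C_BV \<Omega> powr (- (p - 1) * real CARD('n)) \<longrightarrow>
          eigenfunction \<Omega> p E_Per \<alpha> (u \<alpha>) \<and>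
          perturbed_functional \<Omega> E_Per \<alpha> (u \<alpha>) = c_minimax \<Omega> p E_Per k \<alpha> \<and>
          eigenvalue \<Omega> p E_Per (u \<alpha>) (l \<alpha>)) \<longrightarrow>
       (l \<longlongrightarrow> \<mu>) (at_right 0) \<and> bifurcation_value \<Omega> p E_Per \<mu>)"
proof (intro allI impI)
  fix k :: nat assume k: "k \<ge> 1"
  have p: "p \<le> 1 + 1 / real DIM(real ^ 'n)" using assms(6) by simp
  obtain C1 where C1: "C1 > 0" "\<And>v. v \<in> BV \<Omega> \<Longrightarrow> Lnorm 1 v = 1 \<Longrightarrow> Lint p v \<le> C1 * (TV \<Omega> v + 1)"
      "\<And>v. v \<in> BV \<Omega> \<Longrightarrow> v \<in> Lp \<Omega> (ereal p)"
    using BV_embedding[OF assms(1,2,4,5) p] by blast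
  interpret perturbed_problem \<Omega> p C_Per C1 E_Per
    by unfold_locales (use assms p C1 in blast)+
  obtain L where L: "lambda1 \<Omega> k = ereal L" by (rule lambda1_real[OF assms(1,4,3) k])
  have "real CARD('n) \<ge> 1" using zero_less_card_finite[where 'a='n] by linarith
  \<comment> \<open>Turns the eigenfunctions, given only below the threshold, into a family defined
    for all sufficiently small \<alpha>.\<close>
  note th = eventually_below_threshold[OF this assms(5,6,9) C_BV_pos[OF assms(1-3)]]
  show "\<exists>\<mu>::real. lambda1 \<Omega> k = ereal \<mu> \<and>
    ((\<lambda>\<alpha>. c_minimax \<Omega> p E_Per k \<alpha> / ereal \<alpha>) \<longlongrightarrow> ereal \<mu>) (at_right 0) \<and>
    (\<forall>u l.
       (\<forall>\<alpha>>0. \<alpha> powr (real CARD('n) - (real CARD('n) - 1) * p)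
                 < inverse C_Per * C_BV \<Omega> powr (- (p - 1) * real CARD('n)) \<longrightarrow>
          eigenfunction \<Omega> p E_Per \<alpha> (u \<alpha>) \<and>
          perturbed_functional \<Omega> E_Per \<alpha> (u \<alpha>) = c_minimax \<Omega> p E_Per k \<alpha> \<and>
          eigenvalue \<Omega> p E_Per (u \<alpha>) (l \<alpha>)) \<longrightarrow>
       (l \<longlongrightarrow> \<mu>) (at_right 0) \<and> bifurcation_value \<Omega> p E_Per \<mu>)"
  proof (intro exI[of _ L] conjI L c_minimax_tendsto[OF k L] allI impI)
    fix u l
    assume hyp: "\<forall>\<alpha>>0. \<alpha> powr (real CARD('n) - (real CARD('n) - 1) * p)
                 < inverse C_Per * C_BV \<Omega> powr (- (p - 1) * real CARD('n)) \<longrightarrow>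
          eigenfunction \<Omega> p E_Per \<alpha> (u \<alpha>) \<and>
          perturbed_functional \<Omega> E_Per \<alpha> (u \<alpha>) = c_minimax \<Omega> p E_Per k \<alpha> \<and>
          eigenvalue \<Omega> p E_Per (u \<alpha>) (l \<alpha>)"
    have "\<forall>\<^sub>F \<alpha> in at_right 0. eigenfunction \<Omega> p E_Per \<alpha> (u \<alpha>) \<and>
      perturbed_functional \<Omega> E_Per \<alpha> (u \<alpha>) = c_minimax \<Omega> p E_Per k \<alpha> \<and> eigenvalue \<Omega> p E_Per (u \<alpha>) (l \<alpha>)"
      using th by eventually_elim (use hyp in blast)
    from eigenvalue_branch[OF k L this]
    show "(l \<longlongrightarrow> L) (at_right 0)" "bifurcation_value \<Omega> p E_Per L" by auto
  qed
qed

end
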